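(* Let $T$ be an $\omega$-stable complete theory in a countable language with quantifier elimination, and let $\mathfrak p$ be a strongly regular global type such that $\mathfrak p|_A$ is not isolated for every finite set $A$. Let $\mathcal C$ be the class of pairs $(H,\mathrm{cl}_H)$ where $H$ is a prime model over some Morley sequence in $\mathfrak p$ and $\mathrm{cl}_H(X)=\mathrm{cl}_{\mathfrak p}(X)\cap H$ for $X\subseteq H$ (together with isomorphic copies, with the transported closure operator). Then $\mathcal C$ is a quasiminimal excellent class.
   Context: $\mathfrak C$ is a monster model of $T$. A global type $\mathfrak p(x)$ in one variable is strongly regular if it is invariant under $\mathrm{Aut}(\mathfrak C)$ and for every small $D$ and $a\in\mathfrak C$, either $a$ realises $\mathfrak p|_D$ or $\mathfrak p|_D\vdash\mathfrak p|_{D\cup\{a\}}$. $\mathrm{cl}_{\mathfrak p}(D)=\{b\in\mathfrak C: b\text{ does not realise }\mathfrak p|_D\}$. A Morley sequence in $\mathfrak p$ is a sequence $(a_\alpha)$ with each $a_\alpha$ realising $\mathfrak p|_{\{a_\beta:\beta<\alpha\}}$. A partial embedding is a partial map between structures preserving all quantifier-free formulas. A quasiminimal excellent class is a class $\mathcal C$ of pairs $(H,\mathrm{cl}_H)$, $H$ a structure and $\mathrm{cl}_H$ a pregeometry on $H$, such that: (1) if $(H,\mathrm{cl}_H)\in\mathcal C$ and $f:H\to H'$ is an isomorphism then $(H',\mathrm{cl}_{H'})\in\mathcal C$ where $\mathrm{cl}_{H'}(X')=f(\mathrm{cl}_H(f^{-1}(X')))$; (2) any two members satisfy the same quantifier-free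 sentences; (3) for each member the closure of a finite set is countable; if $X\subseteq H$ then $\mathrm{cl}_H(X)$ is a substructure of $H$ which with the restricted closure is in $\mathcal C$; and if $(H,\mathrm{cl}_H),(H',\mathrm{cl}_{H'})\in\mathcal C$, $X\subseteq H$, $y\in H$ and $f$ is a partial embedding from $H$ to $H'$ defined on $X\cup\{y\}$, then $y\in\mathrm{cl}_H(X)$ iff $f(y)\in\mathrm{cl}_{H'}(f(X))$; (4) if $(H,\mathrm{cl}_H),(H',\mathrm{cl}_{H'})\in\mathcal C$, $G\subseteq H$, $G'\subseteq H'$ are each either empty or countable and closed ($\mathrm{cl}(G)=G$), $g:G\to G'$ is an isomorphism, and $x\in H\setminus\mathrm{cl}_H(G)$, $x'\in H'\setminus\mathrm{cl}_{H'}(G')$, then $g\cup\{(x,x')\}$ is a partial embedding; (5) with $H,H',G,G',g$ as in (4), if $g\cup f$ is a partial embedding from $H$ to $H'$ with $X=\mathrm{dom}(f)$ finite and $y\in\mathrm{cl}_H(X\cup G)$, then there is $y'\in H'$ such that $g\cup f\cup\{(y,y')\}$ is a partial embedding. *)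

theory Defs
  imports "HOL-Library.Countable_Set"
begin

section \<open>First-order languages, structures and satisfaction\<close>

datatype 'f tm = Var nat | Fn 'f "'f tm list"

datatype ('f, 'r) fm =
    Bot
  | Eq "'f tm" "'f tm"
  | Rel 'r "'f tm list"
  | Imp "('f, 'r) fm" "('f, 'r) fm"
  | All nat "('f, 'r) fm"

abbreviation Neg :: "('f, 'r) fm \<Rightarrow> ('f, 'r) fm" where
  "Neg \<phi> \<equiv> Imp \<phi> Bot"

record ('f, 'r) lang =
  funs :: "'f set"
  farity :: "'f \<Rightarrow> nat"
  rels :: "'r set"
  rarity :: "'r \<Rightarrow> nat"

record ('f, 'r, 'a) struc =
  universe :: "'a set"
  fint :: "'f \<Rightarrow> 'a list \<Rightarrow> 'a"
  rint :: "'r \<Rightarrow> 'a list \<Rightarrow> bool"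

fun wf_tm :: "('f, 'r) lang \<Rightarrow> 'f tm \<Rightarrow> bool" where
  "wf_tm L (Var i) \<longleftrightarrow> True"
| "wf_tm L (Fn f ts) \<longleftrightarrow> f \<in> funs L \<and> length ts = farity L f \<and> (\<forall>t\<in>set ts. wf_tm L t)"

fun wf_fm :: "('f, 'r) lang \<Rightarrow> ('f, 'r) fm \<Rightarrow> bool" where
  "wf_fm L Bot \<longleftrightarrow> True"
| "wf_fm L (Eq t u) \<longleftrightarrow> wf_tm L t \<and> wf_tm L u"
| "wf_fm L (Rel r ts) \<longleftrightarrow> r \<in> rels L \<and> length ts = rarity L r \<and> (\<forall>t\<in>set ts. wf_tm L t)"
| "wf_fm L (Imp \<phi> \<psi>) \<longleftrightarrow> wf_fm L \<phi> \<and> wf_fm L \<psi>"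
| "wf_fm L (All i \<phi>) \<longleftrightarrow> wf_fm L \<phi>"

fun fv_tm :: "'f tm \<Rightarrow> nat set" where
  "fv_tm (Var i) = {i}"
| "fv_tm (Fn f ts) = (\<Union>t\<in>set ts. fv_tm t)"

fun fv :: "('f, 'r) fm \<Rightarrow> nat set" where
  "fv Bot = {}"
| "fv (Eq t u) = fv_tm t \<union> fv_tm u"
| "fv (Rel r ts) = (\<Union>t\<in>set ts. fv_tm t)"
| "fv (Imp \<phi> \<psi>) = fv \<phi> \<union> fv \<psi>"
| "fv (All i \<phi>) = fv \<phi> - {i}"

fun qfree :: "('f, 'r) fm \<Rightarrow> bool" where
  "qfree (Imp \<phi> \<psi>) \<longleftrightarrow> qfree \<phi> \<and> qfree \<psi>"
| "qfree (All i \<phi>) \<longleftrightarrow> False"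
| "qfree _ \<longleftrightarrow> True"

fun eval_tm :: "('f, 'r, 'a) struc \<Rightarrow> (nat \<Rightarrow> 'a) \<Rightarrow> 'f tm \<Rightarrow> 'a" where
  "eval_tm M s (Var i) = s i"
| "eval_tm M s (Fn f ts) = fint M f (map (eval_tm M s) ts)"

fun sat :: "('f, 'r, 'a) struc \<Rightarrow> (nat \<Rightarrow> 'a) \<Rightarrow> ('f, 'r) fm \<Rightarrow> bool" where
  "sat M s Bot \<longleftrightarrow> False"
| "sat M s (Eq t u) \<longleftrightarrow> eval_tm M s t = eval_tm M s u"
| "sat M s (Rel r ts) \<longleftrightarrow> rint M r (map (eval_tm M s) ts)"
| "sat M s (Imp \<phi> \<psi>) \<longleftrightarrow> (sat M s \<phi> \<longrightarrow> sat M s \<psi>)"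
| "sat M s (All i \<phi>) \<longleftrightarrow> (\<forall>a\<in>universe M. sat M (s(i := a)) \<phi>)"

definition valid_in :: "('f, 'r, 'a) struc \<Rightarrow> ('f, 'r) fm \<Rightarrow> bool" where
  "valid_in M \<phi> \<longleftrightarrow> (\<forall>s. (\<forall>i. s i \<in> universe M) \<longrightarrow> sat M s \<phi>)"

text \<open>Only the interpretations of the symbols of \<^term>\<open>L\<close> on tuples of the right length from the
  universe matter; the interpretation functions are unconstrained elsewhere.\<close>

definition is_struc :: "('f, 'r) lang \<Rightarrow> ('f, 'r, 'a) struc \<Rightarrow> bool" where
  "is_struc L M \<longleftrightarrow> universe M \<noteq> {} \<and>
     (\<forall>f\<in>funs L. \<forall>as\<in>lists (universe M). length as = farity L f \<longrightarrow> fint M f as \<in> universe M)"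

definition restr :: "('f, 'r, 'a) struc \<Rightarrow> 'a set \<Rightarrow> ('f, 'r, 'a) struc" where
  "restr M B = M\<lparr>universe := B\<rparr>"

definition substruc :: "('f, 'r) lang \<Rightarrow> ('f, 'r, 'a) struc \<Rightarrow> 'a set \<Rightarrow> bool" where
  "substruc L M B \<longleftrightarrow> B \<subseteq> universe M \<and> is_struc L (restr M B)"

definition elem_submodel :: "('f, 'r) lang \<Rightarrow> ('f, 'r, 'a) struc \<Rightarrow> 'a set \<Rightarrow> bool" where
  "elem_submodel L M B \<longleftrightarrow> substruc L M B \<and>
     (\<forall>\<phi> s. wf_fm L \<phi> \<and> (\<forall>i. s i \<in> B) \<longrightarrow> (sat (restr M B) s \<phi> \<longleftrightarrow> sat M s \<phi>))"

definition isom :: "('f, 'r) lang \<Rightarrow> ('a \<Rightarrow> 'b) \<Rightarrow> ('f, 'r, 'a) struc \<Rightarrow> ('f, 'r, 'b) struc \<Rightarrow> bool" where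
  "isom L h M N \<longleftrightarrow> bij_betw h (universe M) (universe N) \<and>
     (\<forall>f\<in>funs L. \<forall>as\<in>lists (universe M). length as = farity L f \<longrightarrow>
        h (fint M f as) = fint N f (map h as)) \<and>
     (\<forall>r\<in>rels L. \<forall>as\<in>lists (universe M). length as = rarity L r \<longrightarrow>
        (rint M r as \<longleftrightarrow> rint N r (map h as)))"

text \<open>Partial maps between structures are given by their graphs, so that extending and uniting them
  is literally set union.\<close>

definition partial_map :: "('f, 'r, 'a) struc \<Rightarrow> ('f, 'r, 'b) struc \<Rightarrow> ('a \<times> 'b) set \<Rightarrow> bool" where
  "partial_map M N R \<longleftrightarrow> single_valued R \<and> Domain R \<subseteq> universe M \<and> Range R \<subseteq> universe N"

definition preserves :: "('f, 'r, 'a) struc \<Rightarrow> ('f, 'r, 'b) struc \<Rightarrow> ('a \<times> 'b) set \<Rightarrow> ('f, 'r) fm \<Rightarrow> bool" where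
  "preserves M N R \<phi> \<longleftrightarrow>
     (\<forall>s t. (\<forall>i\<in>fv \<phi>. (s i, t i) \<in> R) \<longrightarrow> (sat M s \<phi> \<longleftrightarrow> sat N t \<phi>))"

definition partial_embedding ::
  "('f, 'r) lang \<Rightarrow> ('f, 'r, 'a) struc \<Rightarrow> ('f, 'r, 'b) struc \<Rightarrow> ('a \<times> 'b) set \<Rightarrow> bool" where
  "partial_embedding L M N R \<longleftrightarrow> partial_map M N R \<and>
     (\<forall>\<phi>. wf_fm L \<phi> \<and> qfree \<phi> \<longrightarrow> preserves M N R \<phi>)"

definition partial_elementary ::
  "('f, 'r) lang \<Rightarrow> ('f, 'r, 'a) struc \<Rightarrow> ('f, 'r, 'b) struc \<Rightarrow> ('a \<times> 'b) set \<Rightarrow> bool" where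
  "partial_elementary L M N R \<longleftrightarrow> partial_map M N R \<and>
     (\<forall>\<phi>. wf_fm L \<phi> \<longrightarrow> preserves M N R \<phi>)"

definition graph_on :: "'a set \<Rightarrow> ('a \<Rightarrow> 'b) \<Rightarrow> ('a \<times> 'b) set" where
  "graph_on A g = {(a, g a) | a. a \<in> A}"


section \<open>Parameters and types\<close>

text \<open>Parameters are adjoined to the language as new constant symbols \<^term>\<open>Inr a\<close> naming
  themselves.\<close>

definition with_params :: "('f, 'r) lang \<Rightarrow> 'a set \<Rightarrow> ('f + 'a, 'r) lang" where
  "with_params L A = \<lparr>funs = Inl ` funs L \<union> Inr ` A,
     farity = case_sum (farity L) (\<lambda>_. 0), rels = rels L, rarity = rarity L\<rparr>"

definition named :: "('f, 'r, 'a) struc \<Rightarrow> ('f + 'a, 'r, 'a) struc" where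
  "named M = \<lparr>universe = universe M,
     fint = case_sum (fint M) (\<lambda>a _. a), rint = rint M\<rparr>"

text \<open>The complete \<open>n\<close>-types over \<^term>\<open>A\<close> in \<^term>\<open>M\<close>, with free variables \<open>0, \<dots>, n - 1\<close>.\<close>

definition complete_type ::
  "('f, 'r) lang \<Rightarrow> ('f, 'r, 'a) struc \<Rightarrow> 'a set \<Rightarrow> nat \<Rightarrow> ('f + 'a, 'r) fm set \<Rightarrow> bool" where
  "complete_type L M A n q \<longleftrightarrow>
     (\<forall>\<phi>\<in>q. wf_fm (with_params L A) \<phi> \<and> fv \<phi> \<subseteq> {..<n}) \<and>
     (\<forall>F\<subseteq>q. finite F \<longrightarrow> (\<exists>s. (\<forall>i. s i \<in> universe M) \<and> (\<forall>\<phi>\<in>F. sat (named M) s \<phi>))) \<and>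
     (\<forall>\<phi>. wf_fm (with_params L A) \<phi> \<and> fv \<phi> \<subseteq> {..<n} \<longrightarrow> \<phi> \<in> q \<or> Neg \<phi> \<in> q)"

text \<open>For formulas in the single free variable \<open>0\<close>, evaluation at \<^term>\<open>a\<close> is evaluation under the
  constant assignment.\<close>

definition realises :: "('f, 'r, 'a) struc \<Rightarrow> ('f + 'a, 'r) fm set \<Rightarrow> 'a \<Rightarrow> bool" where
  "realises M q a \<longleftrightarrow> a \<in> universe M \<and> (\<forall>\<phi>\<in>q. sat (named M) (\<lambda>_. a) \<phi>)"

definition isolated :: "('f, 'r, 'a) struc \<Rightarrow> ('f + 'a, 'r) fm set \<Rightarrow> bool" where
  "isolated M q \<longleftrightarrow> (\<exists>\<phi>\<in>q. \<forall>\<psi>\<in>q. valid_in (named M) (Imp \<phi> \<psi>))"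

definition type_restr ::
  "('f, 'r) lang \<Rightarrow> ('f + 'a, 'r) fm set \<Rightarrow> 'a set \<Rightarrow> ('f + 'a, 'r) fm set" where
  "type_restr L p A = {\<phi> \<in> p. wf_fm (with_params L A) \<phi>}"


section \<open>Theories\<close>

definition models :: "('f, 'r) lang \<Rightarrow> ('f, 'r) fm set \<Rightarrow> ('f, 'r, 'a) struc \<Rightarrow> bool" where
  "models L T M \<longleftrightarrow> is_struc L M \<and> (\<forall>\<phi>\<in>T. valid_in M \<phi>)"

text \<open>Semantic notions quantify over the models of \<^term>\<open>T\<close> whose universe is a subset of a given
  type. By downward Loewenheim--Skolem this is no restriction when the language is countable and
  the type is infinite.\<close>

definition entails :: "'a itself \<Rightarrow> ('f, 'r) lang \<Rightarrow> ('f, 'r) fm set \<Rightarrow> ('f, 'r) fm \<Rightarrow> bool" where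
  "entails (_ :: 'a itself) L T \<phi> \<longleftrightarrow>
     (\<forall>M :: ('f, 'r, 'a) struc. models L T M \<longrightarrow> valid_in M \<phi>)"

definition complete_theory :: "'a itself \<Rightarrow> ('f, 'r) lang \<Rightarrow> ('f, 'r) fm set \<Rightarrow> bool" where
  "complete_theory (ty :: 'a itself) L T \<longleftrightarrow>
     (\<forall>\<phi>\<in>T. wf_fm L \<phi> \<and> fv \<phi> = {}) \<and>
     (\<exists>M :: ('f, 'r, 'a) struc. models L T M) \<and>
     (\<forall>\<phi>. wf_fm L \<phi> \<and> fv \<phi> = {} \<longrightarrow> entails ty L T \<phi> \<or> entails ty L T (Neg \<phi>))"

definition quantifier_elimination :: "'a itself \<Rightarrow> ('f, 'r) lang \<Rightarrow> ('f, 'r) fm set \<Rightarrow> bool" where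
  "quantifier_elimination ty L T \<longleftrightarrow>
     (\<forall>\<phi>. wf_fm L \<phi> \<longrightarrow>
        (\<exists>\<psi>. wf_fm L \<psi> \<and> qfree \<psi> \<and> fv \<psi> \<subseteq> fv \<phi> \<and>
             entails ty L T (Imp \<phi> \<psi>) \<and> entails ty L T (Imp \<psi> \<phi>)))"

definition omega_stable :: "'a itself \<Rightarrow> ('f, 'r) lang \<Rightarrow> ('f, 'r) fm set \<Rightarrow> bool" where
  "omega_stable (_ :: 'a itself) L T \<longleftrightarrow>
     (\<forall>(M :: ('f, 'r, 'a) struc) A n. models L T M \<and> A \<subseteq> universe M \<and> countable A \<longrightarrow>
        countable {q. complete_type L M A n q})"


section \<open>The monster model\<close>

text \<open>Smallness is measured by a cardinal \<^term>\<open>\<kappa>\<close>, given as a cardinal order.\<close>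

definition small :: "'k rel \<Rightarrow> 'a set \<Rightarrow> bool" where
  "small \<kappa> A \<longleftrightarrow> (card_of A, \<kappa>) \<in> ordLess"

definition saturated :: "('f, 'r) lang \<Rightarrow> 'k rel \<Rightarrow> ('f, 'r, 'a) struc \<Rightarrow> bool" where
  "saturated L \<kappa> M \<longleftrightarrow>
     (\<forall>A q. A \<subseteq> universe M \<and> small \<kappa> A \<and> complete_type L M A 1 q \<longrightarrow> (\<exists>a. realises M q a))"

definition strongly_homogeneous :: "('f, 'r) lang \<Rightarrow> 'k rel \<Rightarrow> ('f, 'r, 'a) struc \<Rightarrow> bool" where
  "strongly_homogeneous L \<kappa> M \<longleftrightarrow>
     (\<forall>R. partial_elementary L M M R \<and> small \<kappa> (Domain R) \<longrightarrow>
        (\<exists>\<sigma>. isom L \<sigma> M M \<and> (\<forall>(a, b)\<in>R. \<sigma> a = b)))"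

definition monster :: "('f, 'r) lang \<Rightarrow> ('f, 'r) fm set \<Rightarrow> 'k rel \<Rightarrow> ('f, 'r, 'a) struc \<Rightarrow> bool" where
  "monster L T \<kappa> M \<longleftrightarrow> models L T M \<and> Card_order \<kappa> \<and> (natLeq, \<kappa>) \<in> ordLess \<and>
     saturated L \<kappa> M \<and> strongly_homogeneous L \<kappa> M"

definition global_type :: "('f, 'r) lang \<Rightarrow> ('f, 'r, 'a) struc \<Rightarrow> ('f + 'a, 'r) fm set \<Rightarrow> bool" where
  "global_type L C p \<longleftrightarrow> complete_type L C (universe C) 1 p"

definition aut_invariant :: "('f, 'r) lang \<Rightarrow> ('f, 'r, 'a) struc \<Rightarrow> ('f + 'a, 'r) fm set \<Rightarrow> bool" where
  "aut_invariant L C p \<longleftrightarrow>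
     (\<forall>\<sigma>. isom L \<sigma> C C \<longrightarrow> map_fm (map_sum id \<sigma>) id ` p = p)"

text \<open>Entailment between types over small sets, in the usual monster-model sense; by saturation it
  agrees with entailment modulo the elementary diagram.\<close>

definition type_entails ::
  "('f, 'r, 'a) struc \<Rightarrow> ('f + 'a, 'r) fm set \<Rightarrow> ('f + 'a, 'r) fm set \<Rightarrow> bool" where
  "type_entails C q q' \<longleftrightarrow> (\<forall>b. realises C q b \<longrightarrow> realises C q' b)"

definition strongly_regular ::
  "('f, 'r) lang \<Rightarrow> 'k rel \<Rightarrow> ('f, 'r, 'a) struc \<Rightarrow> ('f + 'a, 'r) fm set \<Rightarrow> bool" where
  "strongly_regular L \<kappa> C p \<longleftrightarrow> global_type L C p \<and> aut_invariant L C p \<and>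
     (\<forall>D a. D \<subseteq> universe C \<and> small \<kappa> D \<and> a \<in> universe C \<longrightarrow>
        realises C (type_restr L p D) a \<or>
        type_entails C (type_restr L p D) (type_restr L p (insert a D)))"

definition cl_p ::
  "('f, 'r) lang \<Rightarrow> ('f, 'r, 'a) struc \<Rightarrow> ('f + 'a, 'r) fm set \<Rightarrow> 'a set \<Rightarrow> 'a set" where
  "cl_p L C p D = {b \<in> universe C. \<not> realises C (type_restr L p D) b}"

text \<open>Ordinal-indexed sequences are families indexed by the field of a well-order.\<close>

definition morley_seq ::
  "('f, 'r) lang \<Rightarrow> ('f, 'r, 'a) struc \<Rightarrow> ('f + 'a, 'r) fm set \<Rightarrow> 'i rel \<Rightarrow> ('i \<Rightarrow> 'a) \<Rightarrow> bool" where
  "morley_seq L C p r a \<longleftrightarrow> Well_order r \<and>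
     (\<forall>i\<in>Field r. realises C (type_restr L p (a ` underS r i)) (a i))"

text \<open>Models of the theory containing \<^term>\<open>A\<close> are, as usual, elementary submodels of the monster.\<close>

definition prime_over :: "('f, 'r) lang \<Rightarrow> ('f, 'r, 'a) struc \<Rightarrow> 'a set \<Rightarrow> 'a set \<Rightarrow> bool" where
  "prime_over L C A B \<longleftrightarrow> elem_submodel L C B \<and> A \<subseteq> B \<and>
     (\<forall>N. elem_submodel L C N \<and> A \<subseteq> N \<longrightarrow>
        (\<exists>e. partial_elementary L (restr C B) (restr C N) e \<and> Domain e = B \<and> Id_on A \<subseteq> e))"


section \<open>Quasiminimal excellent classes\<close>

definition pregeometry :: "'a set \<Rightarrow> ('a set \<Rightarrow> 'a set) \<Rightarrow> bool" where
  "pregeometry H cl \<longleftrightarrow>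
     (\<forall>X\<subseteq>H. X \<subseteq> cl X \<and> cl X \<subseteq> H) \<and>
     (\<forall>X Y. X \<subseteq> Y \<and> Y \<subseteq> H \<longrightarrow> cl X \<subseteq> cl Y) \<and>
     (\<forall>X\<subseteq>H. cl (cl X) = cl X) \<and>
     (\<forall>X\<subseteq>H. \<forall>a\<in>cl X. \<exists>F\<subseteq>X. finite F \<and> a \<in> cl F) \<and>
     (\<forall>X\<subseteq>H. \<forall>a\<in>H. \<forall>b\<in>H. a \<in> cl (insert b X) \<and> a \<notin> cl X \<longrightarrow> b \<in> cl (insert a X))"

text \<open>A closure operator on a structure is only meaningful on subsets of the universe; so the
  restriction of an operator to a closed subset is the operator itself.\<close>

type_synonym ('f, 'r, 'a) cl_struc = "('f, 'r, 'a) struc \<times> ('a set \<Rightarrow> 'a set)"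

definition isomorphic_copy ::
  "('f, 'r) lang \<Rightarrow> ('a \<Rightarrow> 'b) \<Rightarrow> ('f, 'r, 'a) cl_struc \<Rightarrow> ('f, 'r, 'b) cl_struc \<Rightarrow> bool" where
  "isomorphic_copy L h = (\<lambda>(H, cl) (H', cl'). isom L h H H' \<and>
     (\<forall>X'\<subseteq>universe H'. cl' X' = h ` cl {a \<in> universe H. h a \<in> X'}))"

definition empty_or_countable_closed :: "('f, 'r, 'a) cl_struc \<Rightarrow> 'a set \<Rightarrow> bool" where
  "empty_or_countable_closed = (\<lambda>(H, cl) G.
     G = {} \<or> (G \<subseteq> universe H \<and> countable G \<and> cl G = G))"

text \<open>The empty set need not be a substructure (the language may contain constant symbols), so the
  empty isomorphism is treated separately.\<close>

definition isom_of_subsets ::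
  "('f, 'r) lang \<Rightarrow> ('a \<Rightarrow> 'b) \<Rightarrow> ('f, 'r, 'a) struc \<Rightarrow> 'a set \<Rightarrow> ('f, 'r, 'b) struc \<Rightarrow> 'b set \<Rightarrow> bool" where
  "isom_of_subsets L g H G H' G' \<longleftrightarrow>
     (G = {} \<and> G' = {}) \<or> (G \<noteq> {} \<and> G' \<noteq> {} \<and> isom L g (restr H G) (restr H' G'))"

text \<open>A class of structures is represented by its members with universe in a fixed but arbitrary
  type.\<close>

definition quasiminimal_excellent ::
  "('f, 'r) lang \<Rightarrow> ('f, 'r, 'a) cl_struc set \<Rightarrow> bool" where
  "quasiminimal_excellent L K \<longleftrightarrow>
     (\<forall>(H, cl)\<in>K. is_struc L H \<and> pregeometry (universe H) cl) \<and>
     (\<forall>P\<in>K. \<forall>P' h. isomorphic_copy L h P P' \<longrightarrow> P' \<in> K) \<and>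
     (\<forall>(H, cl)\<in>K. \<forall>(H', cl')\<in>K. \<forall>\<phi>. wf_fm L \<phi> \<and> qfree \<phi> \<and> fv \<phi> = {} \<longrightarrow>
        (valid_in H \<phi> \<longleftrightarrow> valid_in H' \<phi>)) \<and>
     (\<forall>(H, cl)\<in>K. \<forall>F\<subseteq>universe H. finite F \<longrightarrow> countable (cl F)) \<and>
     (\<forall>(H, cl)\<in>K. \<forall>X\<subseteq>universe H. substruc L H (cl X) \<and> (restr H (cl X), cl) \<in> K) \<and>
     (\<forall>(H, cl)\<in>K. \<forall>(H', cl')\<in>K. \<forall>X y y' f.
        X \<subseteq> universe H \<and> y \<in> universe H \<and> partial_embedding L H H' f \<and>
        Domain f = insert y X \<and> (y, y') \<in> f \<longrightarrow>
        (y \<in> cl X \<longleftrightarrow> y' \<in> cl' (f `` X))) \<and>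
     (\<forall>(H, cl)\<in>K. \<forall>(H', cl')\<in>K. \<forall>G G' g x x'.
        empty_or_countable_closed (H, cl) G \<and> empty_or_countable_closed (H', cl') G' \<and>
        isom_of_subsets L g H G H' G' \<and>
        x \<in> universe H - cl G \<and> x' \<in> universe H' - cl' G' \<longrightarrow>
        partial_embedding L H H' (graph_on G g \<union> {(x, x')})) \<and>
     (\<forall>(H, cl)\<in>K. \<forall>(H', cl')\<in>K. \<forall>G G' g f y.
        empty_or_countable_closed (H, cl) G \<and> empty_or_countable_closed (H', cl') G' \<and>
        isom_of_subsets L g H G H' G' \<and>
        partial_embedding L H H' (graph_on G g \<union> f) \<and> finite (Domain f) \<and>
        y \<in> cl (Domain f \<union> G) \<longrightarrow>
        (\<exists>y'\<in>universe H'. partial_embedding L H H' (graph_on G g \<union> f \<union> {(y, y')})))"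

text \<open>Well-orders on the type of the monster represent all small ordinals, as an infinite
  \<open>\<kappa>\<close>-saturated structure has at least \<open>\<kappa>\<close> elements.\<close>

definition prime_class ::
  "('f, 'r) lang \<Rightarrow> 'k rel \<Rightarrow> ('f, 'r, 'm) struc \<Rightarrow> ('f + 'm, 'r) fm set \<Rightarrow> ('f, 'r, 'm) cl_struc set" where
  "prime_class L \<kappa> C p =
     {(restr C B, \<lambda>X. cl_p L C p X \<inter> B) | B (r :: 'm rel) a.
        morley_seq L C p r a \<and> small \<kappa> (Field r) \<and> prime_over L C (a ` Field r) B}"

definition isomorphic_copies ::
  "('f, 'r) lang \<Rightarrow> ('f, 'r, 'a) cl_struc set \<Rightarrow> ('f, 'r, 'b) cl_struc set" where
  "isomorphic_copies L K = {P'. \<exists>P\<in>K. \<exists>h. isomorphic_copy L h P P'}"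

end

theory Submission
  imports Defs "HOL-Library.Countable_Set_Type"
begin

text \<open>Work with the definable sets of the monster model. By \<open>\<omega>\<close>-stability there is no binary tree of
  definable sets. This makes the isolated types dense, and for the strongly regular type it makes Morley
  sequences totally indiscernible with bounded alternation, so that \<open>cl\<^sub>\<pp>\<close> is a pregeometry and \<open>\<pp>\<close> is
  definable without parameters by a majority vote along a Morley sequence.

  The models prime over a Morley sequence are then described without reference to the sequence: call an
  elementary submodel \<open>B\<close> good if, for finite independent \<open>Y \<subseteq> B\<close>, every tuple from \<open>cl Y \<inter> B\<close> has isolated
  type over \<open>Y\<close>, and closures of finite sets in \<open>B\<close> are countable. Since \<open>\<pp>\<close> is isolated over no finite set,
  closed subsets of a good \<open>B\<close> are elementary, hence again good. The key point is that for independent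
  \<open>Z \<subseteq> B\<close> and any family of finite subsets \<open>Y\<close> of \<open>Z\<close>, tuples from \<open>cl Z \<inter> B\<close> have isolated type over \<open>Z\<close>
  together with all the sets \<open>cl Y \<inter> B\<close>: a formula splitting that type could be moved to parameters
  already used, because every large definable set meets the elementary submodel \<open>cl {} \<inter> B\<close>. It shows
  that a good \<open>B\<close> is prime over each of its bases, and that the type of \<open>y \<in> cl (G \<union> X)\<close> over \<open>G \<union> X\<close>
  is isolated for closed \<open>G\<close> and finite \<open>X\<close>, which is what the last axiom needs.\<close>

section \<open>Definable sets of tuples\<close>

text \<open>The axiom on closed substructures forces a description of \<open>B\<close> that is
  independent of a sequence: \<open>cl X \<inter> B\<close> has bases, but these need not be part of
  the original Morley sequence, so primeness has to be proved again over an arbitrary basis.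
  Back-and-forth reaches only countable sets, while bases may be uncountable. Hence every
  isomorphism argument takes place inside \<open>cl Y \<inter> B\<close> for a finite
  \<open>Y\<close>, and maps defined on all of \<open>B\<close> are glued from such pieces; the
  glueing asks for isolation over a union of closures rather than over a single one. That
  \<open>cl Y \<inter> B\<close> is countable for finite \<open>Y\<close> comes from primeness:
  \<open>B\<close> embeds into a model atomic over a countable elementary
  \<open>M \<subseteq> cl Y\<close> together with the rest of the basis, and in that model
  \<open>cl Y\<close> has no points outside \<open>M\<close>. The model theory is done for an
  abstract family of predicates on tuples closed under the first-order operations. Formulas,
  substitution and named parameters enter only when the monster is shown to carry such a family, and
  quantifier elimination only when partial embeddings are identified with elementary maps.\<close>

definition tuples :: "'a set \<Rightarrow> nat \<Rightarrow> 'a list set" where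
  "tuples U n = {xs. length xs = n \<and> set xs \<subseteq> U}"

lemma tuples_append_iff [simp]: 
  "length xs = n \<Longrightarrow> xs @ ys \<in> tuples U (n + m) \<longleftrightarrow> xs \<in> tuples U n \<and> ys \<in> tuples U m"
  by (auto simp: tuples_def)

lemma tuplesD: "xs \<in> tuples U n \<Longrightarrow> length xs = n" "xs \<in> tuples U n \<Longrightarrow> set xs \<subseteq> U"
  by (auto simp: tuples_def)

lemma tuples_1 [simp]: "[a] \<in> tuples U (Suc 0) \<longleftrightarrow> a \<in> U"
  by (auto simp: tuples_def)

lemma tuples_1E: 
  assumes "xs \<in> tuples U 1" obtains a where "a \<in> U" "xs = [a]"
  using assms by (auto simp: tuples_def length_Suc_conv)

lemma tuples_nth: "xs \<in> tuples U n \<Longrightarrow> i < n \<Longrightarrow> xs ! i \<in> U"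
  using nth_mem by (fastforce simp: tuples_def)

lemma tuples_take: "xs \<in> tuples U (n + m) \<Longrightarrow> take n xs \<in> tuples U n"
  by (auto simp: tuples_def dest: in_set_takeD)

lemma tuples_drop: "xs \<in> tuples U (n + m) \<Longrightarrow> drop n xs \<in> tuples U m"
  by (auto simp: tuples_def dest: in_set_dropD)

text \<open>\<open>Df n P\<close> says that \<open>P\<close> defines, on the lists of length \<open>n\<close> over \<open>U\<close>, a set that is definable without
  parameters; the values of \<open>P\<close> on other lists do not matter.\<close>

locale definable_sets =
  fixes U :: "'a set" and Df :: "nat \<Rightarrow> ('a list \<Rightarrow> bool) \<Rightarrow> bool"
  assumes U_nonempty: "U \<noteq> {}"
    and Df_cong: "Df n P \<Longrightarrow> (\<And>xs. xs \<in> tuples U n \<Longrightarrow> P xs = Q xs) \<Longrightarrow> Df n Q"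
    and Df_not: "Df n P \<Longrightarrow> Df n (\<lambda>xs. \<not> P xs)"
    and Df_conj: "Df n P \<Longrightarrow> Df n Q \<Longrightarrow> Df n (\<lambda>xs. P xs \<and> Q xs)"
    and Df_ex: "Df (Suc n) P \<Longrightarrow> Df n (\<lambda>xs. \<exists>a\<in>U. P (xs @ [a]))"
    and Df_reindex: "Df n P \<Longrightarrow> (\<And>i. i < n \<Longrightarrow> f i < m) \<Longrightarrow> 
                      Df m (\<lambda>xs. P (map (\<lambda>i. xs ! f i) [0..<n]))"
    and Df_eq: "Df 2 (\<lambda>xs. xs ! 0 = xs ! 1)"
begin

abbreviation Tp :: "nat \<Rightarrow> 'a list set" where "Tp n \<equiv> tuples U n"

text \<open>Parameters are appended as a list, so a set definable over \<open>A\<close> is a fibre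
  of a parameter-free one. The intersection with \<open>U\<close> allows \<open>A\<close> to be any
  set.\<close>

definition Def :: "'a set \<Rightarrow> nat \<Rightarrow> ('a list \<Rightarrow> bool) \<Rightarrow> bool" where
  "Def A n P \<longleftrightarrow> (\<exists>cs Q. set cs \<subseteq> A \<inter> U \<and> Df (n + length cs) Q \<and> (\<forall>xs\<in>Tp n. P xs = Q (xs @ cs)))"

lemma Def_cong: "Def A n P \<Longrightarrow> (\<And>xs. xs \<in> Tp n \<Longrightarrow> P xs = Q xs) \<Longrightarrow> Def A n Q"
  unfolding Def_def by metis

lemma Def_mono: "Def A n P \<Longrightarrow> A \<subseteq> B \<Longrightarrow> Def B n P"
  unfolding Def_def by blast

lemma Def_finite_base: "Def A n P \<Longrightarrow> \<exists>cs. set cs \<subseteq> A \<inter> U \<and> Def (set cs) n P"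
  unfolding Def_def by auto

lemma Def_of_Df: "Df n P \<Longrightarrow> Def A n P"
  unfolding Def_def by (intro exI[of _ "[]"] exI[of _ P]) auto

lemma Def_not: "Def A n P \<Longrightarrow> Def A n (\<lambda>xs. \<not> P xs)"
  unfolding Def_def using Df_not by fast

text \<open>Each parameter is read off at some position of \<open>ds\<close>, which is a reindexing.
  Two definable sets thereby get the same parameter tuple, as closure under conjunction
  requires.\<close>

lemma Def_over:
  assumes "Def (set ds) n P" "set ds \<subseteq> U"
  shows "\<exists>Q. Df (n + length ds) Q \<and> (\<forall>xs\<in>Tp n. P xs = Q (xs @ ds))"
proof -
  obtain cs Q where cs: "set cs \<subseteq> set ds" "Df (n + length cs) Q" "\<And>xs. xs \<in> Tp n \<Longrightarrow> P xs = Q (xs @ cs)"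
    using assms unfolding Def_def by auto
  have "\<exists>j<length ds. ds ! j = cs ! i" if "i < length cs" for i
    using that cs(1) by (metis in_set_conv_nth nth_mem subsetD)
  then obtain h where h: "\<And>i. i < length cs \<Longrightarrow> h i < length ds \<and> ds ! h i = cs ! i" by metis
  define f where "f i = (if i < n then i else n + h (i - n))" for i
  have 1: "f i < n + length ds" if "i < n + length cs" for i
    using that h[of "i - n"] by (auto simp: f_def)
  have "Df (n + length ds) (\<lambda>xs. Q (map (\<lambda>i. xs ! f i) [0..<n + length cs]))"
    by (rule Df_reindex[OF cs(2) 1])
  moreover have "map (\<lambda>i. (xs @ ds) ! f i) [0..<n + length cs] = xs @ cs" if "xs \<in> Tp n" for xs
    using that h by (intro nth_equalityI) (auto simp: f_def tuples_def nth_append)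
  ultimately show ?thesis using cs(3)
    by (intro exI[of _ "\<lambda>xs. Q (map (\<lambda>i. xs ! f i) [0..<n + length cs])"]) auto
qed

lemma Def_conj:
  assumes "Def A n P" "Def A n Q" shows "Def A n (\<lambda>xs. P xs \<and> Q xs)"
proof -
  obtain cs ds where cs: "set cs \<subseteq> A \<inter> U" "Def (set cs) n P" and ds: "set ds \<subseteq> A \<inter> U" "Def (set ds) n Q"
    using Def_finite_base assms by metis
  let ?es = "cs @ ds"
  have "Def (set ?es) n P" "Def (set ?es) n Q" using cs ds Def_mono[of _ n _ "set ?es"] by simp_all
  moreover have es: "set ?es \<subseteq> A \<inter> U" using cs ds by auto
  ultimately obtain P' Q' where "Df (n + length ?es) P' \<and> (\<forall>xs\<in>Tp n. P xs = P' (xs @ ?es))" 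
    "Df (n + length ?es) Q' \<and> (\<forall>xs\<in>Tp n. Q xs = Q' (xs @ ?es))"
    using Def_over[of ?es n P] Def_over[of ?es n Q] by auto
  then show ?thesis using es Df_conj unfolding Def_def
    by (intro exI[of _ ?es] exI[of _ "\<lambda>xs. P' xs \<and> Q' xs"]) auto
qed

lemma Def_disj: "Def A n P \<Longrightarrow> Def A n Q \<Longrightarrow> Def A n (\<lambda>xs. P xs \<or> Q xs)"
  using Def_not[OF Def_conj[OF Def_not Def_not]] by fastforce

lemma Def_imp: "Def A n P \<Longrightarrow> Def A n Q \<Longrightarrow> Def A n (\<lambda>xs. P xs \<longrightarrow> Q xs)"
  using Def_disj[OF Def_not] by fastforce

lemma Def_iff: "Def A n P \<Longrightarrow> Def A n Q \<Longrightarrow> Def A n (\<lambda>xs. P xs \<longleftrightarrow> Q xs)"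
  using Def_conj[OF Def_imp Def_imp, of A n P Q Q P] by (rule Def_cong) auto

text \<open>This turns the fixed elements \<open>cs\<close> into variables, so that they can be
  replaced by other elements with the same type over \<open>A\<close>.\<close>

lemma Def_params:
  assumes "Def (A \<union> set cs) n P" "set cs \<subseteq> U"
  obtains Q where "Def A (n + length cs) Q" "\<And>xs. xs \<in> Tp n \<Longrightarrow> P xs = Q (xs @ cs)"
proof -
  obtain es where es: "set es \<subseteq> (A \<union> set cs) \<inter> U" "Def (set es) n P"
    using Def_finite_base assms by metis
  define as where "as = filter (\<lambda>x. x \<in> A) es"
  have sub: "set es \<subseteq> set (cs @ as)" "set (cs @ as) \<subseteq> U" using es assms by (auto simp: as_def)
  then obtain Q where Q: "Df (n + length (cs @ as)) Q" "\<And>xs. xs \<in> Tp n \<Longrightarrow> P xs = Q (xs @ cs @ as)"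
    using Def_over[OF Def_mono[OF es(2) sub(1)] sub(2)] by auto
  have "Def A (n + length cs) (\<lambda>ys. Q (ys @ as))" unfolding Def_def
    using Q es by (intro exI[of _ as] exI[of _ Q]) (auto simp: as_def add.assoc)
  then show ?thesis using that Q by simp
qed

lemma Def_param_fiber:
  assumes "Def A (n + length cs) Q" "set cs \<subseteq> U" shows "Def (A \<union> set cs) n (\<lambda>xs. Q (xs @ cs))"
proof -
  obtain ds R where "set ds \<subseteq> A \<inter> U" "Df (n + length cs + length ds) R" 
     "\<And>xs. xs \<in> Tp (n + length cs) \<Longrightarrow> Q xs = R (xs @ ds)"
    using assms unfolding Def_def by auto
  then show ?thesis unfolding Def_def using assms(2)
    by (intro exI[of _ "cs @ ds"] exI[of _ R]) (auto simp: add.assoc tuples_def)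
qed

text \<open>A change of variables: each component of \<open>t\<close> is a coordinate or a constant from \<open>A\<close>.\<close>

definition Rix :: "'a set \<Rightarrow> nat \<Rightarrow> nat \<Rightarrow> ('a list \<Rightarrow> 'a list) \<Rightarrow> bool" where
  "Rix A m n t \<longleftrightarrow> (\<forall>xs\<in>Tp m. length (t xs) = n) \<and>
     (\<forall>i<n. (\<exists>j<m. \<forall>xs\<in>Tp m. t xs ! i = xs ! j) \<or> (\<exists>c\<in>A \<inter> U. \<forall>xs\<in>Tp m. t xs ! i = c))"

lemma Rix_id: "m = n \<Longrightarrow> Rix A m n (\<lambda>xs. xs)"
  by (auto simp: Rix_def tuples_def)

lemma Rix_take: "Rix A m n t \<Longrightarrow> k \<le> n \<Longrightarrow> Rix A m k (\<lambda>xs. take k (t xs))"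
  by (auto simp: Rix_def)

lemma Rix_drop: "Rix A m n' t \<Longrightarrow> n' = k + n \<Longrightarrow> Rix A m n (\<lambda>xs. drop k (t xs))"
  by (auto simp: Rix_def)

lemma Rix_append: "Rix A m a s \<Longrightarrow> Rix A m b t \<Longrightarrow> n = a + b \<Longrightarrow> Rix A m n (\<lambda>xs. s xs @ t xs)"
proof -
  assume s: "Rix A m a s" and t: "Rix A m b t" and n: "n = a + b"
  have len: "length (s xs) = a" "length (t xs) = b" if "xs \<in> Tp m" for xs using s t that by (auto simp: Rix_def)
  have "(\<exists>j<m. \<forall>xs\<in>Tp m. (s xs @ t xs) ! i = xs ! j) \<or> (\<exists>c\<in>A \<inter> U. \<forall>xs\<in>Tp m. (s xs @ t xs) ! i = c)"
    if "i < n" for i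
  proof (cases "i < a")
    case True
    then have "(s xs @ t xs) ! i = s xs ! i" if "xs \<in> Tp m" for xs using len that by (simp add: nth_append)
    then show ?thesis using True s unfolding Rix_def by (metis (no_types, lifting))
  next
    case False
    then have "(s xs @ t xs) ! i = t xs ! (i - a)" if "xs \<in> Tp m" for xs using len that by (simp add: nth_append)
    moreover have "i - a < b" using False that n by simp
    ultimately show ?thesis using t unfolding Rix_def by (metis (no_types, lifting))
  qed
  then show ?thesis using len n by (simp add: Rix_def)
qed

lemma Rix_const: "set cs \<subseteq> A \<Longrightarrow> set cs \<subseteq> U \<Longrightarrow> length cs = n \<Longrightarrow> Rix A m n (\<lambda>_. cs)"
  by (fastforce simp: Rix_def)

lemma Rix_nth: "Rix A m n t \<Longrightarrow> i < n \<Longrightarrow> k = 1 \<Longrightarrow> Rix A m k (\<lambda>xs. [t xs ! i])"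
  by (auto simp: Rix_def)

lemma Rix_Cons: "Rix A m 1 (\<lambda>xs. [a xs]) \<Longrightarrow> Rix A m b t \<Longrightarrow> n = Suc b \<Longrightarrow> Rix A m n (\<lambda>xs. a xs # t xs)"
  using Rix_append[of A m 1 "\<lambda>xs. [a xs]" b t n] by simp

lemma Rix_map_nth: "Rix A m n t \<Longrightarrow> (\<And>i. i < k \<Longrightarrow> f i < n) \<Longrightarrow> Rix A m k (\<lambda>xs. map (\<lambda>i. t xs ! f i) [0..<k])"
  by (auto simp: Rix_def)

lemmas Rix_intros = Rix_id Rix_take Rix_drop Rix_const Rix_nth Rix_append Rix_Cons

lemma Rix_Tp: "Rix A m n t \<Longrightarrow> xs \<in> Tp m \<Longrightarrow> t xs \<in> Tp n"
proof -
  assume t: "Rix A m n t" and xs: "xs \<in> Tp m"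
  have "t xs ! i \<in> U" if "i < n" for i
    using t xs that tuples_nth[OF xs] unfolding Rix_def by (metis IntD2)
  then show ?thesis using t xs by (auto simp: Rix_def tuples_def in_set_conv_nth)
qed

text \<open>The constant components of \<open>t\<close> become additional parameters; after that,
  composing with \<open>t\<close> is a reindexing of coordinates and parameters.\<close>

lemma Def_sub:
  assumes "Def A n P" and t: "Rix A m n t" shows "Def A m (\<lambda>xs. P (t xs))"
proof -
  obtain cs Q where cs: "set cs \<subseteq> A \<inter> U" "Df (n + length cs) Q" "\<And>xs. xs \<in> Tp n \<Longrightarrow> P xs = Q (xs @ cs)"
    using assms unfolding Def_def by auto
  define V where "V i \<longleftrightarrow> (\<exists>j<m. \<forall>xs\<in>Tp m. t xs ! i = xs ! j)" for i
  have "\<forall>i. \<exists>j. V i \<longrightarrow> j < m \<and> (\<forall>xs\<in>Tp m. t xs ! i = xs ! j)" unfolding V_def by blast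
  then obtain j where j: "\<And>i. V i \<Longrightarrow> j i < m \<and> (\<forall>xs\<in>Tp m. t xs ! i = xs ! j i)" by metis
  have "\<exists>c. i < n \<longrightarrow> \<not> V i \<longrightarrow> c \<in> A \<inter> U \<and> (\<forall>xs\<in>Tp m. t xs ! i = c)" for i
    using t unfolding Rix_def V_def by blast
  then obtain c where c: "\<And>i. i < n \<Longrightarrow> \<not> V i \<Longrightarrow> c i \<in> A \<inter> U \<and> (\<forall>xs\<in>Tp m. t xs ! i = c i)" by metis
  obtain ds where ds: "set ds = c ` {i. i < n \<and> \<not> V i}" 
    using finite_list[of "c ` {i. i < n \<and> \<not> V i}"] by auto
  have "\<exists>k<length ds. ds ! k = c i" if "i < n" "\<not> V i" for i
    using that ds in_set_conv_nth[of "c i" ds] by auto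
  then obtain k where k: "\<And>i. i < n \<Longrightarrow> \<not> V i \<Longrightarrow> k i < length ds \<and> ds ! k i = c i" by metis
  \<comment> \<open>The tuple to be read is \<open>xs @ ds @ cs\<close>: coordinates come first,
    then the constants of \<open>t\<close>, then the old parameters.\<close>
  define f where "f i = (if i < n then if V i then j i else m + k i else m + length ds + (i - n))" for i
  have f: "f i < m + length (ds @ cs)" if "i < n + length cs" for i
    using that j[of i] k[of i] by (auto simp: f_def)
  have "map (\<lambda>i. (xs @ ds @ cs) ! f i) [0..<n + length cs] = t xs @ cs" if xs: "xs \<in> Tp m" for xs
  proof (rule nth_equalityI)
    have l: "length (t xs) = n" "length xs = m" using t xs by (auto simp: Rix_def tuples_def)
    then show "length (map (\<lambda>i. (xs @ ds @ cs) ! f i) [0..<n + length cs]) = length (t xs @ cs)" by simp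
    fix i assume "i < length (map (\<lambda>i. (xs @ ds @ cs) ! f i) [0..<n + length cs])"
    then have "i < n + length cs" by simp
    then show "map (\<lambda>i. (xs @ ds @ cs) ! f i) [0..<n + length cs] ! i = (t xs @ cs) ! i"
      using l j[of i] c[of i] k[of i] xs by (auto simp: f_def nth_append)
  qed
  then have "P (t xs) = Q (map (\<lambda>i. (xs @ ds @ cs) ! f i) [0..<n + length cs])" if "xs \<in> Tp m" for xs
    using cs(3)[of "t xs"] Rix_Tp[OF t that] that by simp
  moreover have "Df (m + length (ds @ cs)) (\<lambda>zs. Q (map (\<lambda>i. zs ! f i) [0..<n + length cs]))"
    by (rule Df_reindex[OF cs(2) f])
  moreover have "set (ds @ cs) \<subseteq> A \<inter> U" using ds cs c by auto
  ultimately show ?thesis unfolding Def_def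
    by (intro exI[of _ "ds @ cs"] exI[of _ "\<lambda>zs. Q (map (\<lambda>i. zs ! f i) [0..<n + length cs])"]) auto
qed

lemma Def_eq: "Rix A m 1 (\<lambda>xs. [a xs]) \<Longrightarrow> Rix A m 1 (\<lambda>xs. [b xs]) \<Longrightarrow> Def A m (\<lambda>xs. a xs = b xs)"
  using Def_sub[OF Def_of_Df[OF Df_eq] Rix_Cons[of A m a 1 "\<lambda>xs. [b xs]" 2]] by simp

text \<open>The full set is the projection of the condition that a further coordinate equals itself.
  The further coordinate also serves \<open>n = 0\<close>, where there is nothing to
  compare.\<close>

lemma Def_True: "Def A n (\<lambda>_. True)"
proof -
  obtain u where "u \<in> U" using U_nonempty by auto
  have "Df n (\<lambda>xs. \<exists>a\<in>U. map (\<lambda>i. (xs @ [a]) ! n) [0..<2] ! 0 = map (\<lambda>i. (xs @ [a]) ! n) [0..<2] ! 1)"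
    by (intro Df_ex[where P = "\<lambda>ys. map (\<lambda>i. ys ! n) [0..<2] ! 0 = map (\<lambda>i. ys ! n) [0..<2] ! 1"] 
          Df_reindex[OF Df_eq]) auto
  from Def_of_Df[OF this] show ?thesis by (rule Def_cong) (use \<open>u \<in> U\<close> in auto)
qed

lemma Def_False: "Def A n (\<lambda>_. False)"
  using Def_not[OF Def_True] by simp

lemma Def_triv: "Def A n (\<lambda>_. b)"
  using Def_True Def_False by (cases b) auto

lemma Def_ex1:
  assumes "Def A (Suc n) P" shows "Def A n (\<lambda>xs. \<exists>a\<in>U. P (xs @ [a]))"
proof -
  obtain cs where cs: "set cs \<subseteq> A \<inter> U" "Def (set cs) (Suc n) P" using Def_finite_base assms by metis
  then have 1: "Def (set cs \<union> {}) (Suc n) P" by simp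
  obtain Q where Q: "Df (Suc n + length cs) Q" "\<And>xs. xs \<in> Tp (Suc n) \<Longrightarrow> P xs = Q (xs @ cs)"
    using Def_over[OF cs(2)] cs(1) by auto
  \<comment> \<open>\<open>Df_ex\<close> quantifies the last coordinate, but in \<open>Def\<close>
    the parameters stand last; they are moved in front of the quantified coordinate.\<close>
  let ?Q = "\<lambda>ys. Q (take n ys @ drop (n + length cs) ys @ take (length cs) (drop n ys))"
  have "Def {} (Suc (n + length cs)) ?Q"
    by (rule Def_sub[OF Def_of_Df[OF Q(1)]]) (rule refl Rix_intros | simp)+
  then have "Df (Suc (n + length cs)) ?Q" 
    using Def_over[of "[]" "Suc (n + length cs)" ?Q] Df_cong[of "Suc (n + length cs)" _ ?Q] by auto
  from Df_ex[OF this] have "Def A n (\<lambda>xs. \<exists>a\<in>U. ?Q ((xs @ cs) @ [a]))"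
    unfolding Def_def by (intro exI[of _ cs] exI[of _ "\<lambda>ys. \<exists>a\<in>U. ?Q (ys @ [a])"]) (use cs in simp)
  then show ?thesis
  proof (rule Def_cong)
    fix xs assume xs: "xs \<in> Tp n"
    have "?Q ((xs @ cs) @ [a]) = P (xs @ [a])" if "a \<in> U" for a
      using Q(2)[of "xs @ [a]"] xs that by (auto simp: tuples_def)
    then show "(\<exists>a\<in>U. ?Q ((xs @ cs) @ [a])) = (\<exists>a\<in>U. P (xs @ [a]))" by blast
  qed
qed

lemma Def_ex:
  assumes "Def A (m + k) (\<lambda>ws. P (take m ws) (drop m ws))"
  shows "Def A m (\<lambda>xs. \<exists>ys\<in>Tp k. P xs ys)"
  using assms
proof (induction k arbitrary: P)
  case 0
  have "Def A m (\<lambda>ws. P (take m ws) (drop m ws))" using 0 unfolding add_0_right .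
  then show ?case
    by (rule Def_cong) (simp add: tuples_def)
next
  case (Suc k)
  have "Def A (Suc (m + k)) (\<lambda>ws. P (take m ws) (drop m ws))" using Suc.prems unfolding add_Suc_right .
  note 1 = Def_ex1[OF this]
  have "Def A (m + k) (\<lambda>ws. \<exists>a\<in>U. P (take m ws) (drop m ws @ [a]))"
    by (rule Def_cong[OF 1]) (simp add: tuples_def)
  note 2 = Suc.IH[of "\<lambda>xs ys. \<exists>a\<in>U. P xs (ys @ [a])", OF this]
  show ?case
  proof (rule Def_cong[OF 2])
    fix xs
    show "(\<exists>ys\<in>Tp k. \<exists>a\<in>U. P xs (ys @ [a])) = (\<exists>ys\<in>Tp (Suc k). P xs ys)"
    proof safe
      fix ys a assume "ys \<in> Tp k" "a \<in> U" "P xs (ys @ [a])"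
      then show "\<exists>ys\<in>Tp (Suc k). P xs ys" by (intro bexI[of _ "ys @ [a]"]) (simp_all add: tuples_def)
    next
      fix ys assume ys: "ys \<in> Tp (Suc k)" "P xs ys"
      then obtain zs a where "ys = zs @ [a]"
        by (metis tuplesD(1) length_Suc_conv_rev)
      then show "\<exists>ys\<in>Tp k. \<exists>a\<in>U. P xs (ys @ [a])" using ys 
        by (intro bexI[of _ zs] bexI[of _ a]) (simp_all add: tuples_def)
    qed
  qed
qed

lemma Def_all:
  assumes "Def A (m + k) (\<lambda>ws. P (take m ws) (drop m ws))"
  shows "Def A m (\<lambda>xs. \<forall>ys\<in>Tp k. P xs ys)"
  using Def_not[OF Def_ex[OF Def_not[OF assms]]] by simp

lemma Def_exU:
  assumes "Def A (m + 1) (\<lambda>ws. P (take m ws) (ws ! m))"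
  shows "Def A m (\<lambda>xs. \<exists>y\<in>U. P xs y)"
proof -
  have "Def A m (\<lambda>xs. \<exists>ys\<in>Tp 1. P xs (ys ! 0))"
    by (rule Def_ex, rule Def_cong[OF assms]) (auto simp: tuples_def)
  then show ?thesis by (rule Def_cong) (auto simp: tuples_def length_Suc_conv intro: bexI[of _ "[_]"])
qed

lemma Def_Ball_finite: "finite I \<Longrightarrow> (\<And>i. i \<in> I \<Longrightarrow> Def A n (P i)) \<Longrightarrow> Def A n (\<lambda>xs. \<forall>i\<in>I. P i xs)"
  by (induction I rule: finite_induct) (auto intro: Def_True Def_conj)

lemma Def_Bex_finite: "finite I \<Longrightarrow> (\<And>i. i \<in> I \<Longrightarrow> Def A n (P i)) \<Longrightarrow> Def A n (\<lambda>xs. \<exists>i\<in>I. P i xs)"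
  by (induction I rule: finite_induct) (auto intro: Def_False Def_disj)

section \<open>Types and elementary relations\<close>

text \<open>Equality of the complete types over the empty set.\<close>

definition eqv :: "'a list \<Rightarrow> 'a list \<Rightarrow> bool" where
  "eqv xs ys \<longleftrightarrow> length xs = length ys \<and> set xs \<subseteq> U \<and> set ys \<subseteq> U \<and> 
     (\<forall>P. Def {} (length xs) P \<longrightarrow> P xs = P ys)"

lemma eqv_refl: "set xs \<subseteq> U \<Longrightarrow> eqv xs xs" by (simp add: eqv_def)
lemma eqv_sym: "eqv xs ys \<Longrightarrow> eqv ys xs" by (auto simp: eqv_def)
lemma eqv_length: "eqv xs ys \<Longrightarrow> length xs = length ys" by (simp add: eqv_def)

lemma eqv_sub:
  assumes "eqv xs ys" "Rix {} (length xs) n t" shows "eqv (t xs) (t ys)"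
proof -
  have "xs \<in> Tp (length xs)" "ys \<in> Tp (length xs)" using assms by (auto simp: eqv_def tuples_def)
  then have "t xs \<in> Tp n" "t ys \<in> Tp n" using Rix_Tp assms by blast+
  moreover have "P (t xs) = P (t ys)" if "Def {} n P" for P
    using assms(1) Def_sub[OF that assms(2)] unfolding eqv_def by blast
  ultimately show ?thesis by (auto simp: eqv_def tuples_def)
qed

text \<open>Elementary partial maps of the monster, given by their graphs and tested on finite lists
  of pairs. The domain may be of any cardinality.\<close>

definition el :: "('a \<times> 'a) set \<Rightarrow> bool" where
  "el R \<longleftrightarrow> (\<forall>zs. set zs \<subseteq> R \<longrightarrow> eqv (map fst zs) (map snd zs))"

lemma eqv_append_left: "eqv (xs @ as) (ys @ bs) \<Longrightarrow> length xs = length ys \<Longrightarrow> eqv xs ys"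
  using eqv_sub[of "xs @ as" "ys @ bs" "length xs" "take (length xs)"] 
  by (auto simp: Rix_take[OF Rix_id] eqv_length)

text \<open>Permuting, repeating and omitting corresponding coordinates of two equivalent tuples all
  pass through this lemma, since each is a choice of pairs from the zipped list.\<close>

lemma eqv_map_zip:
  assumes "eqv xs ys" "set zs \<subseteq> set (zip xs ys)" shows "eqv (map fst zs) (map snd zs)"
proof -
  have l: "length xs = length ys" using assms by (simp add: eqv_def)
  have "\<exists>j<length xs. zs ! i = (xs ! j, ys ! j)" if "i < length zs" for i
    using that assms l by (metis in_set_zip nth_mem prod.collapse subsetD)
  then obtain j where j: "\<And>i. i < length zs \<Longrightarrow> j i < length xs \<and> zs ! i = (xs ! j i, ys ! j i)" by metis
  let ?t = "\<lambda>xs. map (\<lambda>i. xs ! j i) [0..<length zs]"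
  have "eqv (?t xs) (?t ys)" 
    by (rule eqv_sub[OF assms(1)]) (use Rix_map_nth[OF Rix_id, of "length xs" "length xs"] j in auto)
  moreover have "?t xs = map fst zs" "?t ys = map snd zs" using j by (auto intro!: nth_equalityI)
  ultimately show ?thesis by simp
qed

lemma el_zip: "eqv xs ys \<Longrightarrow> el (set (zip xs ys))"
  unfolding el_def using eqv_map_zip by blast

lemma eqv_of_el:
  assumes "el R" "set (zip xs ys) \<subseteq> R" "length xs = length ys" shows "eqv xs ys"
  using assms(1)[unfolded el_def, rule_format, OF assms(2)] assms(3) by simp

lemma el_mono: "el R \<Longrightarrow> S \<subseteq> R \<Longrightarrow> el S"
  unfolding el_def by blast

lemma el_finite_char: "(\<And>F. finite F \<Longrightarrow> F \<subseteq> R \<Longrightarrow> el F) \<Longrightarrow> el R"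
  unfolding el_def by (metis List.finite_set order_refl)

lemma el_converse: "el R \<Longrightarrow> el (R\<inverse>)"
  unfolding el_def
proof (intro allI impI)
  fix zs assume *: "\<forall>zs. set zs \<subseteq> R \<longrightarrow> eqv (map fst zs) (map snd zs)" "set zs \<subseteq> R\<inverse>"
  have "eqv (map fst (map prod.swap zs)) (map snd (map prod.swap zs))"
    by (rule *(1)[rule_format]) (use *(2) in auto)
  then show "eqv (map fst zs) (map snd zs)" by (auto simp: comp_def intro: eqv_sym)
qed

lemma el_U: assumes "el R" shows "R \<subseteq> U \<times> U"
proof safe
  fix a b assume "(a, b) \<in> R"
  then have "eqv [a] [b]" using eqv_of_el[OF assms, of "[a]" "[b]"] by simp
  then show "a \<in> U" "b \<in> U" by (auto simp: eqv_def)
qed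

lemma el_eq_iff:
  assumes "el R" "(a, b) \<in> R" "(c, d) \<in> R" shows "a = c \<longleftrightarrow> b = d"
proof -
  have "eqv [a, c] [b, d]" by (rule eqv_of_el[OF assms(1)]) (use assms in auto)
  moreover have "Def {} (length [a, c]) (\<lambda>xs. xs ! 0 = xs ! 1)"
    using Def_of_Df[OF Df_eq, of "{}"] by (simp add: numeral_2_eq_2)
  ultimately have "([a, c] ! 0 = [a, c] ! 1) = ([b, d] ! 0 = [b, d] ! 1)" unfolding eqv_def by blast
  then show ?thesis by simp
qed

lemma el_single_valued: "el R \<Longrightarrow> single_valued R"
  unfolding single_valued_def using el_eq_iff by blast

lemma el_Id_on: "A \<subseteq> U \<Longrightarrow> el (Id_on A)"
  unfolding el_def
proof (intro allI impI)
  fix zs assume *: "A \<subseteq> U" "set zs \<subseteq> Id_on A"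
  then have "map fst zs = map snd zs" "set (map fst zs) \<subseteq> U" by auto
  then show "eqv (map fst zs) (map snd zs)" using eqv_refl by metis
qed

lemma el_Union_chain:
  assumes "\<And>R. R \<in> \<C> \<Longrightarrow> el R" "\<And>R S. R \<in> \<C> \<Longrightarrow> S \<in> \<C> \<Longrightarrow> R \<subseteq> S \<or> S \<subseteq> R" "\<C> \<noteq> {}"
  shows "el (\<Union>\<C>)"
proof (rule el_finite_char)
  fix F assume "finite F" "F \<subseteq> \<Union>\<C>"
  then obtain R where "R \<in> \<C>" "F \<subseteq> R"
    using finite_subset_Union_chain[of F \<C> UNIV] assms(2,3) by (metis subset_chain_def subset_UNIV)
  then show "el F" using assms el_mono by blast
qed

end

text \<open>\<omega>-stability is expressed by \<open>no_tree\<close>: a nonempty \<open>S\<close>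
  as described would be a binary tree of definable sets, presented without indexing its levels.
  Saturation is demanded over finite parameter sets, and \<open>countable_Df\<close> reflects the
  countable language.\<close>

locale stable_sets = definable_sets +
  assumes no_tree: "(\<And>P. P \<in> S \<Longrightarrow> Def U n P \<and> (\<exists>xs\<in>Tp n. P xs) \<and> 
      (\<exists>Q\<in>S. \<exists>R\<in>S. \<forall>xs\<in>Tp n. (Q xs \<longrightarrow> P xs) \<and> (R xs \<longrightarrow> P xs) \<and> \<not> (Q xs \<and> R xs))) \<Longrightarrow> S = {}"
    and sat1: "finite A \<Longrightarrow> A \<subseteq> U \<Longrightarrow> (\<And>P. P \<in> F \<Longrightarrow> Def A 1 P) \<Longrightarrow> 
      (\<And>G. finite G \<Longrightarrow> G \<subseteq> F \<Longrightarrow> \<exists>a\<in>U. \<forall>P\<in>G. P [a]) \<Longrightarrow> \<exists>a\<in>U. \<forall>P\<in>F. P [a]"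
    and countable_Df: "\<exists>F :: nat \<Rightarrow> 'a list \<Rightarrow> bool. \<forall>P. Df n P \<longrightarrow> (\<exists>k. \<forall>xs\<in>Tp n. P xs = F k xs)"
begin

lemma Def_emptyD: 
  assumes "Def (set cs) n P" "set cs \<subseteq> U"
  obtains Q where "Def {} (n + length cs) Q" "\<And>xs. xs \<in> Tp n \<Longrightarrow> P xs = Q (xs @ cs)"
  using Def_params[of "{}" cs n P] assms by auto

lemma Def_emptyE: 
  assumes "Def A n P"
  obtains cs Q where "set cs \<subseteq> A \<inter> U" "Def {} (n + length cs) Q" "\<And>xs. xs \<in> Tp n \<Longrightarrow> P xs = Q (xs @ cs)"
  using Def_finite_base[OF assms] Def_emptyD by (metis inf.boundedE)

lemma Def_param_left:
  assumes "Def A (length cs + n) Q" "set cs \<subseteq> U" shows "Def (A \<union> set cs) n (\<lambda>xs. Q (cs @ xs))"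
  by (rule Def_sub[OF Def_mono[OF assms(1)]], simp, (rule refl Rix_intros | use assms in simp)+)

lemma Def_fiber:
  assumes "Def {} (n + length cs) Q" "set cs \<subseteq> A" "A \<subseteq> U" shows "Def A n (\<lambda>xs. Q (xs @ cs))"
  using Def_mono[OF Def_param_fiber[OF assms(1)]] assms by auto

lemma eqvD: "eqv xs ys \<Longrightarrow> Def {} n P \<Longrightarrow> n = length xs \<Longrightarrow> P xs \<longleftrightarrow> P ys"
  by (simp add: eqv_def)

text \<open>Saturation yields homogeneity: the type of \<open>a\<close> over \<open>xs\<close>,
  moved to \<open>ys\<close>, is finitely satisfiable because the existential closure of a finite
  part of it is a property of the type of \<open>xs\<close>.\<close>

lemma eqv_extend:
  assumes "eqv xs ys" "a \<in> U"
  shows "\<exists>b\<in>U. eqv (xs @ [a]) (ys @ [b])"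
proof -
  let ?n = "length xs"
  let ?C = "{P. Def {} (Suc ?n) P \<and> P (xs @ [a])}"
  have ys: "set ys \<subseteq> U" "length ys = ?n" using assms by (auto simp: eqv_def)
  have "\<exists>b\<in>U. \<forall>P\<in>(\<lambda>P zs. P (ys @ zs)) ` ?C. P [b]"
  proof (rule sat1[of "set ys"])
    fix P assume "P \<in> (\<lambda>P zs. P (ys @ zs)) ` ?C"
    then show "Def (set ys) 1 P" using Def_param_left[of "{}" ys 1] ys by auto
  next
    fix G assume "finite G" "G \<subseteq> (\<lambda>P zs. P (ys @ zs)) ` ?C"
    then obtain C where C: "C \<subseteq> ?C" "finite C" "G = (\<lambda>P zs. P (ys @ zs)) ` C"
      by (metis (no_types, lifting) finite_subset_image)
    have "Def {} ?n (\<lambda>xs. \<exists>b\<in>U. \<forall>P\<in>C. P (xs @ [b]))"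
      using Def_ex1[OF Def_Ball_finite[OF C(2), of "{}" "Suc ?n" "\<lambda>P. P"]] C(1) by auto
    then show "\<exists>b\<in>U. \<forall>P\<in>G. P [b]"
      using eqvD[OF assms(1), of "length xs" "\<lambda>xs. \<exists>b\<in>U. \<forall>P\<in>C. P (xs @ [b])"] C assms(2) by auto
  qed (use ys in auto)
  then obtain b where b: "b \<in> U" "\<And>P. P \<in> ?C \<Longrightarrow> P (ys @ [b])" by auto
  have "P (xs @ [a]) \<longleftrightarrow> P (ys @ [b])" if "Def {} (Suc ?n) P" for P
    using b(2)[of P] b(2)[of "\<lambda>zs. \<not> P zs"] that Def_not[OF that] by blast
  then show ?thesis using b(1) assms ys by (intro bexI[of _ b]) (auto simp: eqv_def)
qed

lemma eqv_extend_tuple: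
  assumes "eqv xs ys" "set as \<subseteq> U"
  shows "\<exists>bs. eqv (xs @ as) (ys @ bs)"
  using assms(2)
proof (induction as rule: rev_induct)
  case Nil
  then show ?case using assms by (intro exI[of _ "[]"]) auto
next
  case (snoc a as)
  then obtain bs where "eqv (xs @ as) (ys @ bs)" by auto
  from eqv_extend[OF this, of a] snoc.prems show ?case by (metis append.assoc in_set_conv_decomp subsetD)
qed

subsection \<open>Isolated types\<close>

text \<open>The name stands for isolated: the type of \<open>xs\<close> over \<open>A\<close> is
  generated by the single definable set \<open>X\<close>.\<close>

definition iso :: "'a set \<Rightarrow> 'a list \<Rightarrow> bool" where
  "iso A xs \<longleftrightarrow> set xs \<subseteq> U \<and> (\<exists>X. Def A (length xs) X \<and> X xs \<and>
     (\<forall>Q. Def A (length xs) Q \<and> Q xs \<longrightarrow> (\<forall>ys\<in>Tp (length xs). X ys \<longrightarrow> Q ys)))"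

lemma isoE:
  assumes "iso A xs" 
  obtains X where "Def A (length xs) X" "X xs" 
    "\<And>Q ys. Def A (length xs) Q \<Longrightarrow> Q xs \<Longrightarrow> ys \<in> Tp (length xs) \<Longrightarrow> X ys \<Longrightarrow> Q ys"
  using assms unfolding iso_def by blast

lemma isoI:
  assumes "set xs \<subseteq> U" "Def A n X" "X xs" "n = length xs"
    "\<And>Q ys. Def A n Q \<Longrightarrow> Q xs \<Longrightarrow> ys \<in> Tp n \<Longrightarrow> X ys \<Longrightarrow> Q ys"
  shows "iso A xs"
  unfolding iso_def using assms by blast

lemma iso_U: "iso A xs \<Longrightarrow> set xs \<subseteq> U" by (simp add: iso_def)

text \<open>A projection of the isolating set isolates the projected tuple.\<close>

lemma iso_subset:
  assumes "iso A xs" "set bs \<subseteq> set xs" shows "iso A bs"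
proof -
  obtain X where X: "Def A (length xs) X" "X xs" 
    "\<And>Q ys. Def A (length xs) Q \<Longrightarrow> Q xs \<Longrightarrow> ys \<in> Tp (length xs) \<Longrightarrow> X ys \<Longrightarrow> Q ys"
    using isoE[OF assms(1)] by blast
  let ?k = "length xs" and ?n = "length bs"
  have xs: "set xs \<subseteq> U" using assms iso_U by auto
  have "\<exists>j<?k. xs ! j = bs ! i" if "i < ?n" for i
    using that assms(2) by (metis in_set_conv_nth nth_mem subsetD)
  then obtain f where f: "\<And>i. i < ?n \<Longrightarrow> f i < ?k \<and> xs ! f i = bs ! i" by metis
  let ?t = "\<lambda>ys. map (\<lambda>i. ys ! f i) [0..<?n]"
  have bs: "?t xs = bs" using f by (auto intro!: nth_equalityI)
  show ?thesis
  proof (rule isoI[where X = "\<lambda>zs. \<exists>ys\<in>Tp ?k. X ys \<and> (\<forall>i\<in>{..<?n}. ys ! f i = zs ! i)" and n = ?n])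
    show "set bs \<subseteq> U" using xs assms by auto
    show "Def A ?n (\<lambda>zs. \<exists>ys\<in>Tp ?k. X ys \<and> (\<forall>i\<in>{..<?n}. ys ! f i = zs ! i))"
      apply (intro Def_ex Def_conj Def_Ball_finite)
        apply (rule Def_sub[OF X(1)], (rule refl Rix_intros | simp)+)
      apply (rule Def_eq, (rule refl Rix_intros | use f in simp)+)
      done
    show "\<exists>ys\<in>Tp ?k. X ys \<and> (\<forall>i\<in>{..<?n}. ys ! f i = bs ! i)"
      using X(2) xs f by (intro bexI[of _ xs]) (auto simp: tuples_def)
    fix Q zs assume Q: "Def A ?n Q" "Q bs" "zs \<in> Tp ?n" "\<exists>ys\<in>Tp ?k. X ys \<and> (\<forall>i\<in>{..<?n}. ys ! f i = zs ! i)"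
    then obtain ys where ys: "ys \<in> Tp ?k" "X ys" "\<forall>i<?n. ys ! f i = zs ! i" by auto
    have "Def A ?k (\<lambda>ys. Q (?t ys))" by (rule Def_sub[OF Q(1) Rix_map_nth[OF Rix_id[OF refl]]]) (use f in simp)
    then have "Q (?t ys)" using X(3)[of "\<lambda>ys. Q (?t ys)" ys] ys Q(2) bs by simp
    moreover have "?t ys = zs" using ys Q(3) by (auto intro!: nth_equalityI simp: tuples_def)
    ultimately show "Q zs" by simp
  qed simp
qed

lemma Def_eq_const:
  assumes "set cs \<subseteq> A" "set cs \<subseteq> U" "Rix A m (length cs) t"
  shows "Def A m (\<lambda>xs. t xs = cs)"
proof -
  have "Def A m (\<lambda>xs. \<forall>i\<in>{..<length cs}. t xs ! i = cs ! i)"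
    by (intro Def_Ball_finite) (auto intro!: Def_eq Rix_nth[OF assms(3)] Rix_nth[OF Rix_const] assms)
  then show ?thesis 
    by (rule Def_cong) (use assms(3) in \<open>auto simp: Rix_def intro!: nth_equalityI\<close>)
qed

lemma iso_params:
  assumes "iso A xs" "set cs \<subseteq> A" "set cs \<subseteq> U" shows "iso A (xs @ cs)"
proof -
  obtain X where X: "Def A (length xs) X" "X xs" 
    "\<And>Q ys. Def A (length xs) Q \<Longrightarrow> Q xs \<Longrightarrow> ys \<in> Tp (length xs) \<Longrightarrow> X ys \<Longrightarrow> Q ys"
    using isoE[OF assms(1)] by blast
  let ?n = "length xs + length cs"
  show ?thesis
  proof (rule isoI[where X = "\<lambda>ws. X (take (length xs) ws) \<and> drop (length xs) ws = cs" and n = ?n])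
    show "set (xs @ cs) \<subseteq> U" using assms iso_U by auto
    show "Def A ?n (\<lambda>ws. X (take (length xs) ws) \<and> drop (length xs) ws = cs)"
      apply (rule Def_conj)
       apply (rule Def_sub[OF X(1)], (rule refl Rix_intros | simp)+)
      apply (rule Def_eq_const, (rule refl assms Rix_intros | simp)+)
      done
    fix Q ws assume Q: "Def A ?n Q" "Q (xs @ cs)" "ws \<in> Tp ?n" "X (take (length xs) ws) \<and> drop (length xs) ws = cs"
    have "Def A (length xs) (\<lambda>ys. Q (ys @ cs))" 
      by (rule Def_sub[OF Q(1)], (rule refl assms Rix_intros | simp)+)
    then show "Q ws" using X(3)[of "\<lambda>ys. Q (ys @ cs)" "take (length xs) ws"] Q tuples_take[OF Q(3)]
      by (metis append_take_drop_id)
  qed (use X in auto)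
qed

lemma iso_Nil: "iso A []"
  by (rule isoI[where X = "\<lambda>_. True" and n = 0]) (auto simp: Def_True tuples_def)

lemma iso_append:
  assumes "iso A (xs @ ys)" shows "iso (A \<union> set xs) ys"
proof -
  let ?k = "length xs" and ?l = "length ys"
  have U: "set xs \<subseteq> U" "set ys \<subseteq> U" using iso_U[OF assms] by auto
  obtain X where X: "Def A (?k + ?l) X" "X (xs @ ys)" 
    "\<And>Q zs. Def A (?k + ?l) Q \<Longrightarrow> Q (xs @ ys) \<Longrightarrow> zs \<in> Tp (?k + ?l) \<Longrightarrow> X zs \<Longrightarrow> Q zs"
    using isoE[OF assms] unfolding length_append by blast
  show ?thesis
  proof (rule isoI[where X = "\<lambda>zs. X (xs @ zs)" and n = ?l])
    show "Def (A \<union> set xs) ?l (\<lambda>zs. X (xs @ zs))" by (rule Def_param_left[OF X(1) U(1)])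
    fix Q zs assume Q: "Def (A \<union> set xs) ?l Q" "Q ys" "zs \<in> Tp ?l" "X (xs @ zs)"
    obtain Q' where Q': "Def A (?l + ?k) Q'" "\<And>zs. zs \<in> Tp ?l \<Longrightarrow> Q zs = Q' (zs @ xs)"
      using Def_params[OF Q(1) U(1)] by blast
    have d: "Def A (?k + ?l) (\<lambda>ws. Q' (drop ?k ws @ take ?k ws))"
      by (rule Def_sub[OF Q'(1)], (rule refl Rix_intros | simp)+)
    have "xs @ zs \<in> Tp (?k + ?l)" "ys \<in> Tp ?l" using Q U by (auto simp: tuples_def)
    then show "Q zs" using X(3)[OF d, of "xs @ zs"] Q Q'(2)[of zs] Q'(2)[of ys] by simp
  qed (use X U in auto)
qed

text \<open>Let \<open>X\<close> isolate \<open>xs\<close> and let \<open>Z\<close> be the isolating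
  set of \<open>ys\<close> with \<open>xs\<close> made variable. For each \<open>Q\<close> true of
  \<open>xs @ ys\<close>, the statement that \<open>Z\<close> implies \<open>Q\<close> is definable
  over \<open>A\<close> and true of \<open>xs\<close>, hence implied by \<open>X\<close>. So
  \<open>X\<close> together with \<open>Z\<close> isolates the joint tuple.\<close>

lemma iso_join:
  assumes "iso A xs" "iso (A \<union> set xs) ys" shows "iso A (xs @ ys)"
proof -
  let ?k = "length xs" and ?l = "length ys"
  have U: "set xs \<subseteq> U" "set ys \<subseteq> U" using iso_U assms by auto
  obtain X where X: "Def A ?k X" "X xs" 
    "\<And>Q zs. Def A ?k Q \<Longrightarrow> Q xs \<Longrightarrow> zs \<in> Tp ?k \<Longrightarrow> X zs \<Longrightarrow> Q zs"
    using isoE[OF assms(1)] by blast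
  obtain Y where Y: "Def (A \<union> set xs) ?l Y" "Y ys" 
    "\<And>Q zs. Def (A \<union> set xs) ?l Q \<Longrightarrow> Q ys \<Longrightarrow> zs \<in> Tp ?l \<Longrightarrow> Y zs \<Longrightarrow> Q zs"
    using isoE[OF assms(2)] by blast
  obtain Z where Z: "Def A (?l + ?k) Z" "\<And>zs. zs \<in> Tp ?l \<Longrightarrow> Y zs = Z (zs @ xs)"
    using Def_params[OF Y(1) U(1)] by blast
  show ?thesis
  proof (rule isoI[where X = "\<lambda>ws. X (take ?k ws) \<and> Z (drop ?k ws @ take ?k ws)" and n = "?k + ?l"])
    show "Def A (?k + ?l) (\<lambda>ws. X (take ?k ws) \<and> Z (drop ?k ws @ take ?k ws))"
      apply (rule Def_conj)
       apply (rule Def_sub[OF X(1)], (rule refl Rix_intros | simp)+)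
      apply (rule Def_sub[OF Z(1)], (rule refl Rix_intros | simp)+)
      done
    fix Q ws assume Q: "Def A (?k + ?l) Q" "Q (xs @ ys)" "ws \<in> Tp (?k + ?l)" "X (take ?k ws) \<and> Z (drop ?k ws @ take ?k ws)"
    let ?T = "\<lambda>us. \<forall>zs\<in>Tp ?l. Z (zs @ us) \<longrightarrow> Q (us @ zs)"
    have "Def A ?k ?T"
      apply (intro Def_all Def_imp)
       apply (rule Def_sub[OF Z(1)], (rule refl Rix_intros | simp)+)
      apply (rule Def_sub[OF Q(1)], (rule refl Rix_intros | simp)+)
      done
    moreover have "?T xs"
      using Y(3)[OF Def_param_left[OF Q(1) U(1)] Q(2)] Z(2) by blast
    ultimately have "?T (take ?k ws)" using X(3)[of ?T "take ?k ws"] Q tuples_take by blast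
    then have "Q (take ?k ws @ drop ?k ws)" using Q tuples_drop[OF Q(3)] by blast
    then show "Q ws" by simp
  qed (use X U Y Z in \<open>auto simp: tuples_def\<close>)
qed

text \<open>The isolating set uses finitely many parameters, and it still isolates over every
  smaller base that contains them.\<close>

lemma iso_finite_base:
  assumes "iso A xs" 
  shows "\<exists>cs. set cs \<subseteq> A \<and> set cs \<subseteq> U \<and> (\<forall>A'. set cs \<subseteq> A' \<longrightarrow> A' \<subseteq> A \<longrightarrow> iso A' xs)"
proof -
  obtain X where X: "Def A (length xs) X" "X xs" 
    "\<And>Q ys. Def A (length xs) Q \<Longrightarrow> Q xs \<Longrightarrow> ys \<in> Tp (length xs) \<Longrightarrow> X ys \<Longrightarrow> Q ys"
    using isoE[OF assms(1)] by blast
  obtain cs where cs: "set cs \<subseteq> A \<inter> U" "Def (set cs) (length xs) X" using Def_finite_base[OF X(1)] by blast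
  show ?thesis
  proof (intro exI[of _ cs] conjI allI impI)
    fix A' assume A': "set cs \<subseteq> A'" "A' \<subseteq> A"
    show "iso A' xs"
    proof (rule isoI[where X = X and n = "length xs"])
      fix Q ys assume "Def A' (length xs) Q" "Q xs" "ys \<in> Tp (length xs)" "X ys"
      then show "Q ys" using X(3) Def_mono[OF _ A'(2)] by blast
    qed (use iso_U[OF assms] Def_mono[OF cs(2) A'(1)] X in simp_all)
  qed (use cs in auto)
qed

lemma image_list:
  assumes "A \<subseteq> Domain R" "set cs \<subseteq> A"
  obtains ds where "length ds = length cs" "set (zip cs ds) \<subseteq> R" "set ds \<subseteq> R `` A"
proof -
  have "\<forall>c\<in>A. \<exists>d. (c, d) \<in> R" using assms by auto
  then obtain f where f: "\<And>c. c \<in> A \<Longrightarrow> (c, f c) \<in> R" by metis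
  then have "set (zip cs (map f cs)) \<subseteq> R" using assms(2) by (auto simp: zip_map2 zip_same_conv_map)
  moreover have "set (map f cs) \<subseteq> R `` A" using f assms by auto
  ultimately show ?thesis using that[of "map f cs"] by simp
qed

lemma preimage_list:
  assumes "set ds \<subseteq> R `` A"
  obtains cs where "length cs = length ds" "set (zip cs ds) \<subseteq> R" "set cs \<subseteq> A"
proof -
  have "\<forall>d\<in>set ds. \<exists>c. (c, d) \<in> R \<and> c \<in> A" using assms by auto
  then obtain f where f: "\<And>d. d \<in> set ds \<Longrightarrow> (f d, d) \<in> R \<and> f d \<in> A" by metis
  then have "set (zip (map f ds) ds) \<subseteq> R" "set (map f ds) \<subseteq> A" by (auto simp: set_zip)
  then show ?thesis using that[of "map f ds"] by simp
qed

lemma iso_transfer: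
  assumes R: "el R" and A: "A \<subseteq> Domain R" and xy: "set (zip xs ys) \<subseteq> R" "length xs = length ys" and "iso A xs"
  shows "iso (R `` A) ys"
proof -
  let ?n = "length xs"
  have U: "A \<subseteq> U" "R `` A \<subseteq> U" using A el_U[OF R] by auto
  obtain X where X: "Def A ?n X" "X xs" 
    "\<And>Q ys. Def A ?n Q \<Longrightarrow> Q xs \<Longrightarrow> ys \<in> Tp ?n \<Longrightarrow> X ys \<Longrightarrow> Q ys"
    using isoE[OF assms(5)] by blast
  obtain cs X0 where cs: "set cs \<subseteq> A \<inter> U" "Def {} (?n + length cs) X0" "\<And>xs. xs \<in> Tp ?n \<Longrightarrow> X xs = X0 (xs @ cs)"
    using Def_emptyE[OF X(1)] by blast
  obtain ds where ds: "length ds = length cs" "set (zip cs ds) \<subseteq> R" "set ds \<subseteq> R `` A"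
    using image_list[OF A, of cs] cs by auto
  have xy': "xs \<in> Tp ?n" "ys \<in> Tp ?n" using eqv_of_el[OF R xy] by (auto simp: eqv_def tuples_def)
  show ?thesis
  proof (rule isoI[where X = "\<lambda>zs. X0 (zs @ ds)" and n = ?n])
    show "set ys \<subseteq> U" using eqv_of_el[OF R xy] by (simp add: eqv_def)
    show "Def (R `` A) ?n (\<lambda>zs. X0 (zs @ ds))"
      by (rule Def_fiber) (use cs ds U in simp_all)
    have "eqv (xs @ cs) (ys @ ds)" by (rule eqv_of_el[OF R]) (use xy ds in auto)
    then show "X0 (ys @ ds)" using eqvD[of "xs @ cs" "ys @ ds" _ X0] X(2) cs xy' by auto
    fix Q zs assume Q: "Def (R `` A) ?n Q" "Q ys" "zs \<in> Tp ?n" "X0 (zs @ ds)"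
    obtain es Q0 where es: "set es \<subseteq> R `` A \<inter> U" "Def {} (?n + length es) Q0" 
      "\<And>xs. xs \<in> Tp ?n \<Longrightarrow> Q xs = Q0 (xs @ es)" using Def_emptyE[OF Q(1)] by blast
    obtain fs where fs: "length fs = length es" "set (zip fs es) \<subseteq> R" "set fs \<subseteq> A"
      using preimage_list[of es R A] es by auto
    \<comment> \<open>That the isolating set implies \<open>Q\<close> is a property of the
      parameters alone, so it is carried along \<open>R\<close>.\<close>
    let ?T = "\<lambda>us. \<forall>zs\<in>Tp ?n. X0 (zs @ take (length cs) us) \<longrightarrow> Q0 (zs @ drop (length cs) us)"
    have d: "Def {} (length cs + length es) ?T"
      apply (intro Def_all Def_imp)
       apply (rule Def_sub[OF cs(2)], (rule refl Rix_intros | simp)+)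
      apply (rule Def_sub[OF es(2)], (rule refl Rix_intros | simp)+)
      done
    have "eqv (cs @ fs) (ds @ es)" by (rule eqv_of_el[OF R]) (use fs ds in auto)
    from eqvD[OF this d] have "?T (cs @ fs) \<longleftrightarrow> ?T (ds @ es)" using fs by simp
    moreover have "?T (cs @ fs)"
    proof -
      have "eqv (xs @ fs) (ys @ es)" by (rule eqv_of_el[OF R]) (use fs xy in auto)
      then have q: "Q0 (xs @ fs)" using eqvD[of "xs @ fs" "ys @ es" _ Q0] es Q(2) fs xy' by auto
      have d: "Def A ?n (\<lambda>zs. Q0 (zs @ fs))"
        by (intro Def_fiber) (use es fs U in simp_all)
      have "Q0 (zs @ fs)" if "zs \<in> Tp ?n" "X0 (zs @ cs)" for zs
        using X(3)[OF d q that(1)] cs(3)[OF that(1)] that(2) by blast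
      then show ?thesis by simp
    qed
    ultimately show "Q zs" using es(3) Q ds by simp
  qed (use xy in auto)
qed

subsection \<open>Elementary submodels and atomic models\<close>

text \<open>The Tarski-Vaught test in one variable. It determines the elementary submodels without
  reference to the language; \<open>elem_iff_elem_submodel\<close> makes the connection.\<close>

definition elem :: "'a set \<Rightarrow> bool" where
  "elem E \<longleftrightarrow> E \<subseteq> U \<and> (\<forall>P. Def E 1 P \<longrightarrow> (\<exists>a\<in>U. P [a]) \<longrightarrow> (\<exists>a\<in>E. P [a]))"

lemma elem_U: "elem E \<Longrightarrow> E \<subseteq> U" by (simp add: elem_def)

lemma elem_nonempty: "elem E \<Longrightarrow> E \<noteq> {}"
  unfolding elem_def using Def_True U_nonempty by blast

lemma elem_UNIV: "elem U" by (simp add: elem_def)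

lemma elem_tuple:
  assumes "elem E" shows "Def E k P \<Longrightarrow> ys \<in> Tp k \<Longrightarrow> P ys \<Longrightarrow> \<exists>xs\<in>Tp k. set xs \<subseteq> E \<and> P xs"
proof (induction k arbitrary: P ys)
  case 0
  then show ?case by (intro bexI[of _ ys]) (auto simp: tuples_def)
next
  case (Suc k)
  have 1: "Def E 1 (\<lambda>xs. \<exists>zs\<in>Tp k. P (xs @ zs))"
    by (rule Def_ex, rule Def_sub[OF Suc.prems(1)], (rule refl Rix_intros | simp)+)
  obtain y zs where y: "ys = y # zs" "y \<in> U" "zs \<in> Tp k" 
    using Suc.prems(2) by (cases ys) (auto simp: tuples_def)
  then have "\<exists>a\<in>U. \<exists>zs\<in>Tp k. P ([a] @ zs)" using Suc.prems by auto
  then obtain a zs where a: "a \<in> E" "zs \<in> Tp k" "P ([a] @ zs)" using 1 assms unfolding elem_def by blast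
  have "Def (E \<union> set [a]) k (\<lambda>zs. P ([a] @ zs))"
    by (rule Def_param_left) (use Suc.prems a elem_U[OF assms] in auto)
  then have "Def E k (\<lambda>zs. P ([a] @ zs))" using a by (simp add: insert_absorb)
  from Suc.IH[OF this a(2,3)] obtain us where "us \<in> Tp k" "set us \<subseteq> E" "P ([a] @ us)" by blast
  then show ?case using a elem_U[OF assms] by (intro bexI[of _ "a # us"]) (auto simp: tuples_def)
qed

lemma el_empty: "el {}"
  unfolding el_def by (simp add: eqv_refl)

lemma el_insertI:
  assumes "el R" "b \<in> U" "b' \<in> U" and *: "\<And>zs. set zs \<subseteq> R \<Longrightarrow> eqv (b # map fst zs) (b' # map snd zs)"
  shows "el (insert (b, b') R)"
  unfolding el_def
proof (intro allI impI)
  fix zs assume zs: "set zs \<subseteq> insert (b, b') R"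
  let ?zs = "filter (\<lambda>z. z \<in> R) zs"
  have "eqv (b # map fst ?zs) (b' # map snd ?zs)" by (rule *) auto
  moreover have "set zs \<subseteq> set (zip (b # map fst ?zs) (b' # map snd ?zs))"
    using zs by (auto simp: zip_map_fst_snd)
  ultimately show "eqv (map fst zs) (map snd zs)" by (rule eqv_map_zip)
qed

text \<open>The isolating set, with its parameters moved along \<open>R\<close>, is nonempty and
  therefore has a point in the elementary set \<open>N\<close>. Because it isolates, that point
  realises the whole transported type.\<close>

lemma el_extend_iso:
  assumes R: "el R" and "iso (Domain R) [b]" "elem N" "Range R \<subseteq> N"
  shows "\<exists>b'\<in>N. el (insert (b, b') R)"
proof -
  have U: "Domain R \<subseteq> U" "Range R \<subseteq> U" "b \<in> U" using el_U[OF R] iso_U[OF assms(2)] by auto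
  obtain X where X: "Def (Domain R) 1 X" "X [b]" 
    "\<And>Q y. Def (Domain R) 1 Q \<Longrightarrow> Q [b] \<Longrightarrow> y \<in> U \<Longrightarrow> X [y] \<Longrightarrow> Q [y]"
    using isoE[OF assms(2)] by (metis length_Cons list.size(3) One_nat_def tuples_1)
  obtain cs X0 where cs: "set cs \<subseteq> Domain R \<inter> U" "Def {} (1 + length cs) X0" "\<And>xs. xs \<in> Tp 1 \<Longrightarrow> X xs = X0 (xs @ cs)"
    using Def_emptyE[OF X(1)] by blast
  obtain ds where ds: "length ds = length cs" "set (zip cs ds) \<subseteq> R" "set ds \<subseteq> R `` Domain R"
    using image_list[of "Domain R" R cs] cs by auto
  have cd: "eqv cs ds" by (rule eqv_of_el[OF R]) (use ds in auto)
  have "Def {} (length cs) (\<lambda>us. \<exists>ys\<in>Tp 1. X0 (ys @ us))"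
    by (rule Def_ex, rule Def_sub[OF cs(2)], (rule refl Rix_intros | simp)+)
  then have "\<exists>ys\<in>Tp 1. X0 (ys @ ds)" 
    using eqvD[OF cd, of _ "\<lambda>us. \<exists>ys\<in>Tp 1. X0 (ys @ us)"] X(2) cs(3)[of "[b]"] U(3)
    by (auto simp del: append.simps intro: bexI[of _ "[b]"])
  then have "\<exists>a\<in>U. X0 ([a] @ ds)" by (metis tuples_1E)
  moreover have "Def N 1 (\<lambda>ys. X0 (ys @ ds))"
  proof (rule Def_fiber)
    show "set ds \<subseteq> N" using ds(3) assms(4) by blast
  qed (use cs ds elem_U[OF assms(3)] in simp_all)
  ultimately obtain b' where b': "b' \<in> N" "X0 ([b'] @ ds)" using assms(3) unfolding elem_def by blast
  have b'U: "b' \<in> U" using b' elem_U assms by auto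
  have main: "P (b' # map snd zs)" if "set zs \<subseteq> R" "Def {} (Suc (length zs)) P" "P (b # map fst zs)" for zs P
  proof -
    let ?T = "\<lambda>us. \<forall>ys\<in>Tp 1. X0 (ys @ take (length cs) us) \<longrightarrow> P (ys @ drop (length cs) us)"
    have d: "Def {} (length cs + length zs) ?T"
      apply (intro Def_all Def_imp)
       apply (rule Def_sub[OF cs(2)], (rule refl Rix_intros | simp)+)
      apply (rule Def_sub[OF that(2)], (rule refl Rix_intros | simp)+)
      done
    have "eqv (cs @ map fst zs) (ds @ map snd zs)" 
      by (rule eqv_of_el[OF R]) (use ds that in \<open>auto simp: zip_map_fst_snd\<close>)
    from eqvD[OF this d] have "?T (cs @ map fst zs) \<longleftrightarrow> ?T (ds @ map snd zs)" by simp
    moreover have "?T (cs @ map fst zs)"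
    proof -
      have "set (map fst zs) \<subseteq> Domain R" using that by force
      then have "Def (Domain R) 1 (\<lambda>ys. P (ys @ map fst zs))"
        by (intro Def_fiber) (use that(2) U in simp_all)
      then have "P ([y] @ map fst zs)" if "y \<in> U" "X [y]" for y
        using X(3)[of "\<lambda>ys. P (ys @ map fst zs)"] that \<open>P (b # map fst zs)\<close> by simp
      moreover have "X [y] = X0 ([y] @ cs)" if "y \<in> U" for y using cs(3)[of "[y]"] that by simp
      ultimately show ?thesis by (auto simp: tuples_def length_Suc_conv)
    qed
    ultimately have T: "?T (ds @ map snd zs)" by blast
    show ?thesis using T[rule_format, of "[b']"] b' b'U ds by simp
  qed
  have "el (insert (b, b') R)"
  proof (rule el_insertI[OF R U(3) b'U])
    fix zs assume zs: "set zs \<subseteq> R"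
    have "set (map fst zs) \<subseteq> U" "set (map snd zs) \<subseteq> U" using zs U by force+
    moreover have "P (b # map fst zs) \<longleftrightarrow> P (b' # map snd zs)" if "Def {} (Suc (length zs)) P" for P
      using main[OF zs that] main[OF zs Def_not[OF that]] by blast
    ultimately show "eqv (b # map fst zs) (b' # map snd zs)" using U b'U by (auto simp: eqv_def)
  qed
  then show ?thesis using b' by blast
qed

text \<open>Density of isolated types. If no definable subset of \<open>X\<close> were an atom over
  \<open>A\<close>, each nonempty one could be cut into two nonempty pieces, contradicting
  \<open>no_tree\<close>.\<close>

lemma ex_atom:
  assumes "Def A n X" "xs \<in> Tp n" "X xs"
  shows "\<exists>Y. Def A n Y \<and> (\<exists>ys\<in>Tp n. Y ys) \<and> (\<forall>ys\<in>Tp n. Y ys \<longrightarrow> X ys) \<and>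
     (\<forall>Q. Def A n Q \<longrightarrow> (\<forall>ys\<in>Tp n. Y ys \<longrightarrow> Q ys) \<or> (\<forall>ys\<in>Tp n. Y ys \<longrightarrow> \<not> Q ys))"
proof (rule ccontr)
  assume *: "\<not> ?thesis"
  have DU: "Def A n Y \<Longrightarrow> Def U n Y" for Y using Def_finite_base Def_mono by (metis le_inf_iff)
  let ?S = "{Y. Def A n Y \<and> (\<exists>ys\<in>Tp n. Y ys) \<and> (\<forall>ys\<in>Tp n. Y ys \<longrightarrow> X ys)}"
  have "?S = {}"
  proof (rule no_tree[of _ n])
    fix P assume P: "P \<in> ?S"
    then obtain Q where Q: "Def A n Q" "\<not> (\<forall>ys\<in>Tp n. P ys \<longrightarrow> Q ys)" "\<not> (\<forall>ys\<in>Tp n. P ys \<longrightarrow> \<not> Q ys)"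
      using * by blast
    have S: "(\<lambda>ys. P ys \<and> Q ys) \<in> ?S" "(\<lambda>ys. P ys \<and> \<not> Q ys) \<in> ?S"
      using P Q Def_conj Def_not by auto
    then show "Def U n P \<and> (\<exists>xs\<in>Tp n. P xs) \<and> 
      (\<exists>Q\<in>?S. \<exists>R\<in>?S. \<forall>xs\<in>Tp n. (Q xs \<longrightarrow> P xs) \<and> (R xs \<longrightarrow> P xs) \<and> \<not> (Q xs \<and> R xs))"
      using P DU by (intro conjI bexI[OF _ S(1)] bexI[OF _ S(2)]) auto
  qed
  then show False using assms by blast
qed

definition atomic :: "'a set \<Rightarrow> 'a set \<Rightarrow> bool" where
  "atomic A N \<longleftrightarrow> (\<forall>xs. set xs \<subseteq> N \<longrightarrow> iso A xs)"

text \<open>A maximal subset of \<open>M\<close> that is atomic over \<open>A\<close> passes the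
  Tarski-Vaught test: a nonempty set over it contains an atom over it, and a point of that atom in
  \<open>M\<close> can be adjoined without losing atomicity.\<close>

lemma ex_atomic_model:
  assumes "A \<subseteq> M" "elem M"
  obtains N where "A \<subseteq> N" "N \<subseteq> M" "elem N" "atomic A N"
proof -
  have AU: "A \<subseteq> U" using assms elem_U by auto
  let ?P = "{N. A \<subseteq> N \<and> N \<subseteq> M \<and> atomic A N}"
  have "\<exists>N\<in>?P. \<forall>X\<in>?P. N \<subseteq> X \<longrightarrow> X = N"
  proof (rule subset_Zorn_nonempty)
    have "atomic A A" unfolding atomic_def using iso_params[OF iso_Nil] AU by auto
    then show "?P \<noteq> {}" using assms by auto
    fix \<C> assume C: "\<C> \<noteq> {}" "subset.chain ?P \<C>"
    have "iso A xs" if *: "set xs \<subseteq> \<Union>\<C>" for xs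
    proof -
      obtain N where "N \<in> \<C>" "set xs \<subseteq> N" 
        using finite_subset_Union_chain[OF finite_set * C] by blast
      then show ?thesis using C(2) by (auto simp: subset_chain_def atomic_def)
    qed
    then have "atomic A (\<Union>\<C>)" by (simp add: atomic_def)
    moreover have "\<forall>N\<in>\<C>. A \<subseteq> N \<and> N \<subseteq> M" using C by (auto simp: subset_chain_def)
    then have "A \<subseteq> \<Union>\<C>" "\<Union>\<C> \<subseteq> M" using C(1) by blast+
    ultimately show "\<Union>\<C> \<in> ?P" by simp
  qed
  then obtain N where N': "N \<in> ?P" "\<forall>X\<in>?P. N \<subseteq> X \<longrightarrow> X = N" ..
  then have N: "A \<subseteq> N" "N \<subseteq> M" "atomic A N" by simp_all
  have max: "X = N" if "N \<subseteq> X" "X \<subseteq> M" "atomic A X" for X using N' N(1) that by simp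
  have NU: "N \<subseteq> U" using N(2) elem_U[OF assms(2)] by blast
  have "elem N" unfolding elem_def
  proof (intro conjI allI impI NU)
    fix P assume P: "Def N 1 P" "\<exists>a\<in>U. P [a]"
    then obtain u where "u \<in> U" "P [u]" by blast
    then obtain Y where Y: "Def N 1 Y" "\<exists>ys\<in>Tp 1. Y ys" "\<forall>ys\<in>Tp 1. Y ys \<longrightarrow> P ys"
      "\<And>Q. Def N 1 Q \<Longrightarrow> (\<forall>ys\<in>Tp 1. Y ys \<longrightarrow> Q ys) \<or> (\<forall>ys\<in>Tp 1. Y ys \<longrightarrow> \<not> Q ys)"
      using ex_atom[OF P(1), of "[u]"] by auto
    then have "\<exists>a\<in>U. Y [a]" by (metis tuples_1E)
    then obtain a where a: "a \<in> M" "Y [a]" 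
      using assms(2) Def_mono[OF Y(1) N(2)] unfolding elem_def by blast
    have aU: "a \<in> U" using a assms elem_U by auto
    obtain cs where cs: "set cs \<subseteq> N \<inter> U" "Def (set cs) 1 Y" using Def_finite_base Y(1) by metis
    have "atomic A (insert a N)" unfolding atomic_def
    proof (intro allI impI)
      fix xs assume xs: "set xs \<subseteq> insert a N"
      \<comment> \<open>\<open>ns\<close> collects the parameters of the atom \<open>Y\<close> and
        the members of \<open>xs\<close> already in \<open>N\<close>. Since \<open>Y\<close>
        isolates \<open>a\<close> over \<open>A\<close> and \<open>ns\<close>, and \<open>ns\<close>
        is isolated over \<open>A\<close>, the joint tuple is isolated over
        \<open>A\<close>.\<close>
      define ns where "ns = cs @ filter (\<lambda>x. x \<in> N) xs"
      have ns: "set ns \<subseteq> N" using cs by (auto simp: ns_def)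
      have "iso (A \<union> set ns) [a]"
      proof (rule isoI[where X = Y and n = 1])
        show "Def (A \<union> set ns) 1 Y" by (rule Def_mono[OF cs(2)]) (auto simp: ns_def)
        fix Q ys assume Q: "Def (A \<union> set ns) 1 Q" "Q [a]" "ys \<in> Tp 1" "Y ys"
        have "Def N 1 Q" using Def_mono[OF Q(1)] ns N(1) by auto
        then show "Q ys" using Y(4) Q a aU by (metis One_nat_def tuples_1)
      qed (use a aU in auto)
      then have "iso A (ns @ [a])" using iso_join N(3) ns unfolding atomic_def by blast
      then show "iso A xs" by (rule iso_subset) (use xs in \<open>auto simp: ns_def\<close>)
    qed
    then have "insert a N = N" using max[of "insert a N"] N(2) a by auto
    then show "\<exists>a\<in>N. P [a]" using a aU Y(3) by (metis One_nat_def insertI1 tuples_1)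
  qed
  then show ?thesis using that N by auto
qed

section \<open>Countable elementary submodels and back-and-forth\<close>

lemma lowenheim_skolem:
  assumes "elem E" "X \<subseteq> E" "countable X"
  obtains M where "countable M" "X \<subseteq> M" "M \<subseteq> E" "elem M"
proof -
  have "\<forall>n. \<exists>F :: nat \<Rightarrow> 'a list \<Rightarrow> bool. \<forall>P. Df n P \<longrightarrow> (\<exists>k. \<forall>xs\<in>Tp n. P xs = F k xs)"
    using countable_Df by blast
  then obtain F :: "nat \<Rightarrow> nat \<Rightarrow> 'a list \<Rightarrow> bool" 
    where F: "\<And>n P. Df n P \<Longrightarrow> \<exists>k. \<forall>xs\<in>Tp n. P xs = F n k xs" by metis
  obtain e0 where "e0 \<in> E" using elem_nonempty assms by blast
  \<comment> \<open>Skolem functions for the countably many predicates \<open>F\<close>;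
    \<open>e0\<close> is the default value when there is no witness in \<open>E\<close>.\<close>
  then have "\<forall>k cs. \<exists>e\<in>E. (\<exists>a\<in>E. F (Suc (length cs)) k (a # cs)) \<longrightarrow> F (Suc (length cs)) k (e # cs)" by auto
  then obtain sk where sk: "\<And>k cs. sk k cs \<in> E" 
    "\<And>k cs a. a \<in> E \<Longrightarrow> F (Suc (length cs)) k (a # cs) \<Longrightarrow> F (Suc (length cs)) k (sk k cs # cs)" by metis
  define step where "step Y = Y \<union> (\<Union>k. sk k ` lists Y)" for Y
  define M where "M = (\<Union>n. (step ^^ n) X)"
  have X: "countable ((step ^^ n) X) \<and> (step ^^ n) X \<subseteq> E" for n
    by (induction n) (use assms sk in \<open>auto simp: step_def\<close>)
  have mono: "m \<le> n \<Longrightarrow> (step ^^ m) X \<subseteq> (step ^^ n) X" for m n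
    by (rule lift_Suc_mono_le[of "\<lambda>n. (step ^^ n) X"]) (auto simp: step_def)
  have fin: "\<exists>n. set cs \<subseteq> (step ^^ n) X" if "set cs \<subseteq> M" for cs
    using that
  proof (induction cs)
    case (Cons c cs)
    then obtain n m where "set cs \<subseteq> (step ^^ n) X" "c \<in> (step ^^ m) X" by (auto simp: M_def)
    then show ?case using mono[of n "max n m"] mono[of m "max n m"] by (intro exI[of _ "max n m"]) auto
  qed simp
  have skM: "sk k cs \<in> M" if *: "set cs \<subseteq> M" for k cs
  proof -
    obtain n where "set cs \<subseteq> (step ^^ n) X" using fin[OF *] by blast
    then have "sk k cs \<in> (step ^^ Suc n) X" by (auto simp: step_def)
    then show ?thesis unfolding M_def by blast
  qed
  have ME: "M \<subseteq> E" using X by (auto simp: M_def)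
  have "elem M" unfolding elem_def
  proof (intro conjI allI impI)
    show "M \<subseteq> U" using ME elem_U assms by auto
    fix P assume P: "Def M 1 P" "\<exists>a\<in>U. P [a]"
    then obtain a where a: "a \<in> E" "P [a]" using Def_mono[OF P(1) ME] assms(1) unfolding elem_def by blast
    obtain cs Q where cs: "set cs \<subseteq> M \<inter> U" "Df (1 + length cs) Q" "\<And>xs. xs \<in> Tp 1 \<Longrightarrow> P xs = Q (xs @ cs)"
      using P(1) unfolding Def_def by blast
    obtain k where k: "\<And>xs. xs \<in> Tp (Suc (length cs)) \<Longrightarrow> Q xs = F (Suc (length cs)) k xs" using F[OF cs(2)] by auto
    have *: "P [x] = F (Suc (length cs)) k (x # cs)" if "x \<in> E" for x
      using cs(1) cs(3)[of "[x]"] k[of "x # cs"] that elem_U[OF assms(1)] by (auto simp: tuples_def)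
    then have "P [sk k cs]" using a sk by auto
    then show "\<exists>a\<in>M. P [a]" using skM cs by blast
  qed
  moreover have "X \<subseteq> M" unfolding M_def by (metis UN_upper UNIV_I funpow_0)
  moreover have "countable M" using X by (auto simp: M_def)
  ultimately show ?thesis using that ME by blast
qed

lemma iso_Domain_extend:
  assumes "\<And>xs. set xs \<subseteq> E \<Longrightarrow> iso (Domain R) xs" "set (map fst zs) \<subseteq> E" "c \<in> E"
  shows "iso (Domain (R \<union> set zs)) [c]"
proof -
  have "iso (Domain R) (map fst zs @ [c])" using assms by auto
  from iso_append[OF this] show ?thesis by (simp add: Domain_fst image_Un Un_commute)
qed

text \<open>With \<open>C2\<close> empty this is the one-sided extension of \<open>R\<close> along a countable atomic set, and with
  \<open>C1 = E1\<close>, \<open>C2 = E2\<close> it is the back-and-forth construction.\<close>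

lemma back_and_forth:
  assumes R: "el R" "Range R \<subseteq> E2" and E2: "elem E2"
    and C: "countable C1" "countable C2" "C2 \<subseteq> E2"
    and forth: "\<And>xs. set xs \<subseteq> C1 \<union> E1 \<Longrightarrow> iso (Domain R) xs"
    and bk: "C2 \<noteq> {} \<Longrightarrow> elem E1 \<and> Domain R \<subseteq> E1 \<and> C1 \<subseteq> E1 \<and> (\<forall>xs. set xs \<subseteq> E2 \<longrightarrow> iso (Range R) xs)"
  shows "\<exists>R'. R \<subseteq> R' \<and> R' \<subseteq> R \<union> (C1 \<union> E1) \<times> E2 \<and> el R' \<and> C1 \<subseteq> Domain R' \<and> C2 \<subseteq> Range R'"
proof -
  let ?E = "C1 \<union> E1"
  define okl where "okl zs \<longleftrightarrow> set zs \<subseteq> ?E \<times> E2 \<and> el (R \<union> set zs)" for zs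
  have f: "\<exists>zs'. okl zs' \<and> set zs \<subseteq> set zs' \<and> c \<in> Domain (set zs')" if "okl zs" "c \<in> C1" for zs c
  proof -
    \<comment> \<open>Finitely many added pairs preserve isolation: their first components together
      with \<open>c\<close> form a tuple isolated over \<open>Domain R\<close>.\<close>
    have "iso (Domain (R \<union> set zs)) [c]"
      by (rule iso_Domain_extend[where E = ?E]) (use that forth in \<open>auto simp: okl_def\<close>)
    moreover have "el (R \<union> set zs)" "Range (R \<union> set zs) \<subseteq> E2" using that R by (auto simp: okl_def)
    ultimately obtain b where "b \<in> E2" "el (insert (c, b) (R \<union> set zs))"
      using el_extend_iso[of "R \<union> set zs" c E2] E2 by blast
    then show ?thesis using that by (intro exI[of _ "(c, b) # zs"]) (auto simp: okl_def)
  qed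
  have b: "\<exists>zs'. okl zs' \<and> set zs \<subseteq> set zs' \<and> c \<in> Range (set zs')" if "okl zs" "c \<in> C2" for zs c
  proof -
    have E1: "elem E1" "Domain R \<subseteq> E1" "C1 \<subseteq> E1" "\<And>xs. set xs \<subseteq> E2 \<Longrightarrow> iso (Domain (R\<inverse>)) xs"
      using bk that by auto
    let ?zs = "map prod.swap zs"
    have zs: "R\<inverse> \<union> set ?zs = (R \<union> set zs)\<inverse>" by auto
    then have el: "el (R\<inverse> \<union> set ?zs)" using that el_converse by (simp add: okl_def)
    have "iso (Domain (R\<inverse> \<union> set ?zs)) [c]"
    proof (rule iso_Domain_extend[OF E1(4)])
      show "set (map fst ?zs) \<subseteq> E2" "c \<in> E2" using that C by (auto simp: okl_def)
    qed
    moreover have "Range (R\<inverse> \<union> set ?zs) \<subseteq> E1" using that E1(2,3) by (auto simp: okl_def)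
    ultimately obtain b where "b \<in> E1" "el (insert (c, b) (R\<inverse> \<union> set ?zs))"
      using el_extend_iso[OF el _ E1(1)] by blast
    moreover have "(insert (c, b) (R\<inverse> \<union> set ?zs))\<inverse> = R \<union> set ((b, c) # zs)" using zs by auto
    ultimately show ?thesis using that C el_converse[of "insert (c, b) (R\<inverse> \<union> set ?zs)"]
      by (intro exI[of _ "(b, c) # zs"]) (auto simp: okl_def)
  qed
  have step: "\<exists>zs'. okl zs' \<and> set zs \<subseteq> set zs' \<and> (C1 \<noteq> {} \<longrightarrow> from_nat_into C1 n \<in> Domain (set zs')) \<and>
      (C2 \<noteq> {} \<longrightarrow> from_nat_into C2 n \<in> Range (set zs'))" if okl: "okl zs" for zs n
  proof -
    have "\<exists>zs1. okl zs1 \<and> set zs \<subseteq> set zs1 \<and> (C1 \<noteq> {} \<longrightarrow> from_nat_into C1 n \<in> Domain (set zs1))"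
      using f[OF okl from_nat_into[of C1 n]] okl by (cases "C1 = {}") auto
    then obtain zs1 where 1: "okl zs1" "set zs \<subseteq> set zs1" "C1 \<noteq> {} \<longrightarrow> from_nat_into C1 n \<in> Domain (set zs1)"
      by blast
    have "\<exists>zs2. okl zs2 \<and> set zs1 \<subseteq> set zs2 \<and> (C2 \<noteq> {} \<longrightarrow> from_nat_into C2 n \<in> Range (set zs2))"
      using b[OF 1(1) from_nat_into[of C2 n]] 1(1) by (cases "C2 = {}") auto
    then obtain zs2 where 2: "okl zs2" "set zs1 \<subseteq> set zs2" "C2 \<noteq> {} \<longrightarrow> from_nat_into C2 n \<in> Range (set zs2)"
      by blast
    show ?thesis using 1 2 by (intro exI[of _ zs2]) auto
  qed
  have "\<exists>Z. \<forall>n. okl (Z n) \<and> (set (Z n) \<subseteq> set (Z (Suc n)) \<and> 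
      (C1 \<noteq> {} \<longrightarrow> from_nat_into C1 n \<in> Domain (set (Z (Suc n)))) \<and>
      (C2 \<noteq> {} \<longrightarrow> from_nat_into C2 n \<in> Range (set (Z (Suc n)))))"
  proof (rule dependent_nat_choice)
    show "\<exists>zs. okl zs" using R by (intro exI[of _ "[]"]) (auto simp: okl_def)
  qed (use step in blast)
  then obtain Z where Z': "\<forall>n. okl (Z n) \<and> (set (Z n) \<subseteq> set (Z (Suc n)) \<and> 
      (C1 \<noteq> {} \<longrightarrow> from_nat_into C1 n \<in> Domain (set (Z (Suc n)))) \<and>
      (C2 \<noteq> {} \<longrightarrow> from_nat_into C2 n \<in> Range (set (Z (Suc n)))))" ..
  then have Z: "okl (Z n)" "set (Z n) \<subseteq> set (Z (Suc n))"
    "C1 \<noteq> {} \<Longrightarrow> from_nat_into C1 n \<in> Domain (set (Z (Suc n)))"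
    "C2 \<noteq> {} \<Longrightarrow> from_nat_into C2 n \<in> Range (set (Z (Suc n)))" for n by simp_all
  let ?R = "\<Union>(range (\<lambda>n. R \<union> set (Z n)))"
  have mono: "m \<le> n \<Longrightarrow> set (Z m) \<subseteq> set (Z n)" for m n
    by (rule lift_Suc_mono_le[of "\<lambda>n. set (Z n)"]) (use Z in auto)
  have "el ?R"
  proof (rule el_Union_chain)
    fix S T assume "S \<in> range (\<lambda>n. R \<union> set (Z n))" "T \<in> range (\<lambda>n. R \<union> set (Z n))"
    then obtain m n where "S = R \<union> set (Z m)" "T = R \<union> set (Z n)" by blast
    then show "S \<subseteq> T \<or> T \<subseteq> S" using mono[of m n] mono[of n m] by (cases "m \<le> n") auto
  qed (use Z in \<open>auto simp: okl_def\<close>)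
  moreover have "C1 \<subseteq> Domain ?R"
  proof
    fix c assume c: "c \<in> C1"
    then obtain n where "from_nat_into C1 n = c" using from_nat_into_surj C by metis
    then show "c \<in> Domain ?R" using Z(3)[of n] c by blast
  qed
  moreover have "C2 \<subseteq> Range ?R"
  proof
    fix c assume c: "c \<in> C2"
    then obtain n where "from_nat_into C2 n = c" using from_nat_into_surj C by metis
    then show "c \<in> Range ?R" using Z(4)[of n] c by blast
  qed
  moreover have "?R \<subseteq> R \<union> ?E \<times> E2" using Z(1) by (auto simp: okl_def)
  moreover have "R \<subseteq> ?R" by auto
  ultimately show ?thesis by blast
qed

text \<open>Realisation of the restriction of the type to \<open>A\<close>. The type
  \<open>lg\<close> is an argument because the assumptions of \<open>regular_type\<close> already
  use this notion.\<close>

definition generic :: "(('a list \<Rightarrow> bool) \<Rightarrow> bool) \<Rightarrow> 'a set \<Rightarrow> 'a \<Rightarrow> bool" where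
  "generic lg A a \<longleftrightarrow> a \<in> U \<and> (\<forall>P. Def A 1 P \<and> lg P \<longrightarrow> P [a])"

end

section \<open>Strongly regular types and their pregeometry\<close>

text \<open>The predicate \<open>lg\<close> says which definable sets of elements belong to the global type.\<close>

locale regular_type = stable_sets +
  fixes lg :: "('a list \<Rightarrow> bool) \<Rightarrow> bool"
  assumes lg_cong: "lg P \<Longrightarrow> (\<And>a. a \<in> U \<Longrightarrow> P [a] = Q [a]) \<Longrightarrow> lg Q"
    and lg_nonempty: "lg P \<Longrightarrow> \<exists>a\<in>U. P [a]"
    and lg_conj: "lg P \<Longrightarrow> lg Q \<Longrightarrow> lg (\<lambda>x. P x \<and> Q x)"
    and lg_compl: "Def U 1 P \<Longrightarrow> lg P \<or> lg (\<lambda>x. \<not> P x)"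
    and lg_inv: "eqv cs ds \<Longrightarrow> Def {} (1 + length cs) P \<Longrightarrow> lg (\<lambda>x. P (x @ cs)) \<Longrightarrow> lg (\<lambda>x. P (x @ ds))"
    and regular: "finite D \<Longrightarrow> D \<subseteq> U \<Longrightarrow> a \<in> U \<Longrightarrow> 
      generic lg D a \<or> (\<forall>b. generic lg D b \<longrightarrow> generic lg (insert a D) b)"
    and not_isolated: "finite A \<Longrightarrow> A \<subseteq> U \<Longrightarrow> Def A 1 P \<Longrightarrow> lg P \<Longrightarrow> 
      \<exists>Q. Def A 1 Q \<and> lg Q \<and> (\<exists>a\<in>U. P [a] \<and> \<not> Q [a])"
begin

abbreviation "gen \<equiv> generic lg"

lemma Def_U: "Def A n P \<Longrightarrow> Def U n P"
  using Def_finite_base Def_mono by (metis le_inf_iff)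

lemma lg_not: assumes "Def U 1 P" shows "lg (\<lambda>x. \<not> P x) \<longleftrightarrow> \<not> lg P"
proof
  assume "lg (\<lambda>x. \<not> P x)"
  then show "\<not> lg P" using lg_nonempty[OF lg_conj] by fastforce
qed (use lg_compl[OF assms] in auto)

lemma lg_True: "lg (\<lambda>_. True)"
  using lg_compl[OF Def_True] lg_nonempty[of "\<lambda>_. False"] by auto

lemma lg_Ball: "finite G \<Longrightarrow> (\<And>P. P \<in> G \<Longrightarrow> lg P) \<Longrightarrow> lg (\<lambda>x. \<forall>P\<in>G. P x)"
proof (induction G rule: finite_induct)
  case (insert P G)
  then have "lg P" "lg (\<lambda>x. \<forall>P\<in>G. P x)" by auto
  from lg_conj[OF this] show ?case by (rule lg_cong) auto
qed (simp add: lg_True)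

lemma lg_eqv: 
  assumes "eqv cs ds" "Def {} (1 + length cs) P" shows "lg (\<lambda>x. P (x @ cs)) \<longleftrightarrow> lg (\<lambda>x. P (x @ ds))"
  using lg_inv[OF assms] lg_inv[OF eqv_sym[OF assms(1)], of P] assms eqv_length by auto

lemma gen_iff: "gen A a \<Longrightarrow> Def A 1 P \<Longrightarrow> P [a] \<longleftrightarrow> lg P"
proof
  assume a: "gen A a" "Def A 1 P"
  { assume "lg P" then show "P [a]" using a by (auto simp: generic_def) }
  { assume p: "P [a]" show "lg P"
    proof (rule ccontr)
      assume "\<not> lg P"
      then have "lg (\<lambda>x. \<not> P x)" using lg_not Def_U a by blast
      moreover have "Def A 1 (\<lambda>x. \<not> P x)" using Def_not a by blast
      ultimately show False using p a unfolding generic_def by blast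
    qed }
qed

lemma gen_U: "gen A a \<Longrightarrow> a \<in> U" by (simp add: generic_def)

lemma gen_mono: "gen B a \<Longrightarrow> A \<subseteq> B \<Longrightarrow> gen A a"
  unfolding generic_def using Def_mono by metis

lemma gen_finite_char:
  assumes "a \<in> U" "\<not> gen A a" obtains F where "finite F" "F \<subseteq> A" "F \<subseteq> U" "\<not> gen F a"
proof -
  obtain P where P: "Def A 1 P" "lg P" "\<not> P [a]" using assms unfolding generic_def by blast
  obtain cs where "set cs \<subseteq> A \<inter> U" "Def (set cs) 1 P" using Def_finite_base P(1) by metis
  then show ?thesis using P that[of "set cs"] unfolding generic_def by blast
qed

lemma ex_gen: "finite A \<Longrightarrow> A \<subseteq> U \<Longrightarrow> \<exists>a. gen A a"
proof -
  assume A: "finite A" "A \<subseteq> U"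
  have "\<exists>a\<in>U. \<forall>P\<in>{P. Def A 1 P \<and> lg P}. P [a]"
  proof (rule sat1[OF A])
    fix G assume G: "finite G" "G \<subseteq> {P. Def A 1 P \<and> lg P}"
    show "\<exists>a\<in>U. \<forall>P\<in>G. P [a]" by (rule lg_nonempty[OF lg_Ball[OF G(1)]]) (use G(2) in auto)
  qed auto
  then show ?thesis unfolding generic_def by blast
qed

text \<open>By invariance, which instances of a formula are large depends only on the type of the
  parameters. Hence the type of \<open>cs\<close> determines that of its generic extension.\<close>

lemma gen_eqv_extend:
  assumes "eqv cs ds" "gen (set cs) x" "gen (set ds) y"
  shows "eqv (cs @ [x]) (ds @ [y])"
proof -
  let ?k = "length cs"
  have U: "set cs \<subseteq> U" "set ds \<subseteq> U" "x \<in> U" "y \<in> U" "length ds = ?k" 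
    using assms gen_U by (auto simp: eqv_def)
  have "P (cs @ [x]) \<longleftrightarrow> P (ds @ [y])" if P: "Def {} (?k + 1) P" for P
  proof -
    let ?Q = "\<lambda>ws. P (drop 1 ws @ take 1 ws)"
    have Q: "Def {} (1 + ?k) ?Q" by (rule Def_sub[OF P], (rule refl Rix_intros | simp)+)
    have 1: "Def (set cs) 1 (\<lambda>z. ?Q (z @ cs))" by (rule Def_fiber[OF Q]) (use U in auto)
    have 2: "Def (set ds) 1 (\<lambda>z. ?Q (z @ ds))" by (rule Def_fiber) (use U Q in auto)
    show ?thesis using gen_iff[OF assms(2) 1] gen_iff[OF assms(3) 2] lg_eqv[OF assms(1) Q] by simp
  qed
  then show ?thesis using U by (auto simp: eqv_def)
qed

lemma gen_eqv:
  assumes "eqv (cs @ [x]) (ds @ [y])" "length cs = length ds" "gen (set cs) x"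
  shows "gen (set ds) y"
  unfolding generic_def
proof (intro conjI allI impI)
  show "y \<in> U" using assms by (simp add: eqv_def)
  have U: "set cs \<subseteq> U" "set ds \<subseteq> U" "x \<in> U" using assms by (auto simp: eqv_def)
  fix P assume P: "Def (set ds) 1 P \<and> lg P"
  then obtain Q where Q: "Def {} (1 + length ds) Q" "\<And>xs. xs \<in> Tp 1 \<Longrightarrow> P xs = Q (xs @ ds)"
    using Def_emptyD U by metis
  have "lg (\<lambda>x. Q (x @ ds))" using P Q(2) lg_cong[of P "\<lambda>x. Q (x @ ds)"] by simp
  moreover have "eqv cs ds" using eqv_append_left assms by blast
  ultimately have "lg (\<lambda>x. Q (x @ cs))" using lg_eqv Q(1) assms(2) by metis
  moreover have "Def (set cs) 1 (\<lambda>x. Q (x @ cs))" by (rule Def_fiber) (use Q assms U in auto)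
  ultimately have "Q ([x] @ cs)" using gen_iff[OF assms(3), of "\<lambda>x. Q (x @ cs)"] by blast
  moreover have "eqv (x # cs) (y # ds)" using eqv_map_zip[OF assms(1), of "zip (x # cs) (y # ds)"] assms(2) by simp
  ultimately have "Q (y # ds)" using eqvD[of "x # cs" "y # ds" _ Q] Q(1) assms(2) by simp
  then show "P [y]" using Q(2) \<open>y \<in> U\<close> by simp
qed

section \<open>Finite Morley sequences\<close>

primrec mor :: "'a set \<Rightarrow> 'a list \<Rightarrow> bool" where
  "mor A [] \<longleftrightarrow> True"
| "mor A (x # xs) \<longleftrightarrow> gen A x \<and> mor (insert x A) xs"

lemma mor_append: "mor A (xs @ ys) \<longleftrightarrow> mor A xs \<and> mor (A \<union> set xs) ys"
  by (induction xs arbitrary: A) auto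

lemma mor_mono: "mor B xs \<Longrightarrow> A \<subseteq> B \<Longrightarrow> mor A xs"
proof (induction xs arbitrary: A B)
  case (Cons x xs)
  then show ?case using gen_mono Cons.IH[of "insert x B" "insert x A"] by auto
qed simp

lemma mor_U: "mor A xs \<Longrightarrow> set xs \<subseteq> U"
  by (induction xs arbitrary: A) (auto dest: gen_U)

lemma mor_delete: "mor A (xs @ d # ys) \<Longrightarrow> mor A (xs @ ys)"
  using mor_mono by (auto simp: mor_append)

lemma ex_mor: "finite A \<Longrightarrow> A \<subseteq> U \<Longrightarrow> \<exists>xs. length xs = n \<and> mor A xs"
proof (induction n arbitrary: A)
  case (Suc n)
  obtain a where a: "gen A a" using ex_gen[OF Suc.prems] by blast
  then obtain xs where "length xs = n" "mor (insert a A) xs" using Suc gen_U by (metis finite_insert insert_subset)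
  then show ?case using a by (intro exI[of _ "a # xs"]) auto
qed auto

lemma mor_unique:
  "eqv cs ds \<Longrightarrow> mor (set cs) xs \<Longrightarrow> mor (set ds) ys \<Longrightarrow> length xs = length ys \<Longrightarrow> eqv (cs @ xs) (ds @ ys)"
proof (induction xs arbitrary: cs ds ys)
  case (Cons x xs)
  then obtain y zs where ys: "ys = y # zs" by (cases ys) auto
  have "eqv (cs @ [x]) (ds @ [y])" using gen_eqv_extend Cons.prems ys by auto
  from Cons.IH[OF this, of zs] show ?case using Cons.prems ys by simp
qed auto

lemma mor_eqv:
  "eqv (cs @ xs) (ds @ ys) \<Longrightarrow> length cs = length ds \<Longrightarrow> mor (set cs) xs \<Longrightarrow> mor (set ds) ys"
proof (induction xs arbitrary: cs ds ys)
  case Nil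
  then show ?case using eqv_length by fastforce
next
  case (Cons x xs)
  have "length ys = Suc (length xs)" using eqv_length[OF Cons.prems(1)] Cons.prems(2) by simp
  then obtain y zs where ys: "ys = y # zs" by (cases ys) auto
  have e: "eqv ((cs @ [x]) @ xs) ((ds @ [y]) @ zs)" using Cons.prems ys by simp
  then have "eqv (cs @ [x]) (ds @ [y])" by (rule eqv_append_left) (use Cons.prems in simp)
  then have "gen (set ds) y" using gen_eqv Cons.prems by auto
  then show ?case using Cons.IH[OF e] Cons.prems ys by simp
qed

text \<open>A fresh Morley sequence longer by one becomes, after deletion of its middle element, a
  sequence of the same type as \<open>xs @ ys\<close>. Homogeneity carries the deleted element
  back.\<close>

lemma mor_insert:
  assumes "finite A" "A \<subseteq> U" "mor A (xs @ ys)" shows "\<exists>d. mor A (xs @ d # ys)"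
proof -
  obtain cs where cs: "set cs = A" using finite_list assms by blast
  obtain zs where zs: "length zs = length xs + Suc (length ys)" "mor A zs" using ex_mor assms by blast
  define xs' d' ys' where "xs' = take (length xs) zs" and "d' = zs ! length xs" and "ys' = drop (Suc (length xs)) zs"
  have z: "zs = xs' @ d' # ys'" "length xs' = length xs" "length ys' = length ys"
    using zs(1) by (auto simp: xs'_def d'_def ys'_def id_take_nth_drop[symmetric])
  have "eqv (cs @ xs' @ ys') (cs @ xs @ ys)"
    by (rule mor_unique) (use cs assms z zs(2) mor_delete[of A xs' d' ys'] in \<open>auto intro: eqv_refl\<close>)
  moreover have "d' \<in> U" using mor_U[OF zs(2)] z by auto
  ultimately obtain d where d: "eqv ((cs @ xs' @ ys') @ [d']) ((cs @ xs @ ys) @ [d])" 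
    using eqv_extend by blast
  have "set (zip (cs @ xs' @ d' # ys') (cs @ xs @ d # ys)) \<subseteq> set (zip ((cs @ xs' @ ys') @ [d']) ((cs @ xs @ ys) @ [d]))"
    using z by auto
  from eqv_map_zip[OF d this] have "eqv (cs @ xs' @ d' # ys') (cs @ xs @ d # ys)" using z by simp
  from mor_eqv[OF this] zs(2) z cs show ?thesis by blast
qed

text \<open>If symmetry failed, the failing formula would order a Morley sequence, and cutting an interval of the
  sequence in two would give a binary tree of definable sets.\<close>

lemma gen_exchange_finite:
  assumes A: "finite A" "A \<subseteq> U" and a: "gen A a" and b: "gen (insert a A) b"
  shows "gen (insert b A) a"
proof (rule ccontr)
  assume "\<not> gen (insert b A) a"
  then obtain P where P: "Def (A \<union> set [b]) 1 P" "lg P" "\<not> P [a]" using gen_U[OF a] unfolding generic_def by auto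
  have U: "a \<in> U" "b \<in> U" using a b gen_U by auto
  obtain Q where Q: "Def A (1 + length [b]) Q" "\<And>xs. xs \<in> Tp 1 \<Longrightarrow> P xs = Q (xs @ [b])"
    using Def_params[OF P(1)] U by auto
  obtain cs where cs: "set cs = A" using finite_list A by blast
  obtain Q' where Q': "Def {} (2 + length cs) Q'" "\<And>xs. xs \<in> Tp 2 \<Longrightarrow> Q xs = Q' (xs @ cs)"
    using Def_emptyD[of cs 2 Q] Q(1) cs A by (auto simp: numeral_2_eq_2)
  have cc: "eqv cs cs" using A cs eqv_refl by auto
  have pos: "Q [x, y]" if "gen A y" "gen (insert y A) x" for x y
  proof -
    have yx: "y \<in> U" "x \<in> U" using that gen_U by auto
    let ?R = "\<lambda>ws. Q' (take 1 ws @ drop (1 + length cs) ws @ take (length cs) (drop 1 ws))"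
    have R: "Def {} (1 + (length cs + 1)) ?R" by (rule Def_sub[OF Q'(1)], (rule refl Rix_intros | simp)+)
    have "eqv (cs @ [b]) (cs @ [y])"
      by (rule gen_eqv_extend[OF cc]) (use cs that b gen_mono in auto)
    then have "lg (\<lambda>z. ?R (z @ cs @ [b])) \<longleftrightarrow> lg (\<lambda>z. ?R (z @ cs @ [y]))" by (rule lg_eqv) (use R in simp)
    moreover have "lg (\<lambda>z. ?R (z @ cs @ [b]))"
      by (rule lg_cong[OF P(2)]) (use Q(2) Q'(2) U in \<open>auto simp: tuples_def\<close>)
    moreover have "Def (set (cs @ [y])) 1 (\<lambda>z. ?R (z @ cs @ [y]))"
      by (rule Def_fiber) (use R yx A cs in auto)
    ultimately have "?R ([x] @ cs @ [y])" using gen_iff[of "set (cs @ [y])" x] that cs by auto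
    then show ?thesis using Q'(2)[of "[x, y]"] yx by (auto simp: tuples_def)
  qed
  have neg: "\<not> Q [y, x]" if "gen A y" "gen (insert y A) x" for x y
  proof -
    have yx: "y \<in> U" "x \<in> U" using that gen_U by auto
    have "eqv (cs @ [a, b]) (cs @ [y, x])" 
      by (rule mor_unique[OF cc]) (use cs that a b in auto)
    then have "eqv ([a, b] @ cs) ([y, x] @ cs)"
      using eqv_sub[of "cs @ [a, b]" "cs @ [y, x]" "length cs + 2" "\<lambda>ws. drop (length cs) ws @ take (length cs) ws"]
      by (auto simp: Rix_append[OF Rix_drop[OF Rix_id] Rix_take[OF Rix_id]])
    moreover have "\<not> Q' ([a, b] @ cs)" using Q(2)[of "[a]"] Q'(2)[of "[a, b]"] P(3) U by (auto simp: tuples_def)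
    ultimately have "\<not> Q' ([y, x] @ cs)" using eqvD[of "[a, b] @ cs" "[y, x] @ cs" _ Q'] Q'(1) by simp
    then show ?thesis using Q'(2)[of "[y, x]"] yx by (auto simp: tuples_def)
  qed
  \<comment> \<open>A member of \<open>?S\<close> contains every element that fits into some gap of
    a Morley sequence. An element \<open>d\<close> of the gap splits it: later elements
    \<open>e\<close> satisfy \<open>Q [e, d]\<close> by \<open>pos\<close>, earlier ones fail it by
    \<open>neg\<close>.\<close>
  let ?S = "{X. Def U 1 X \<and> (\<exists>xs ys. mor A (xs @ ys) \<and> (\<forall>e. mor A (xs @ e # ys) \<longrightarrow> X [e]))}"
  have "?S = {}"
  proof (rule no_tree[of _ 1])
    fix X assume X: "X \<in> ?S"
    then obtain xs ys where xy: "mor A (xs @ ys)" "\<And>e. mor A (xs @ e # ys) \<Longrightarrow> X [e]" by auto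
    obtain d where d: "mor A (xs @ d # ys)" using mor_insert[OF A xy(1)] by blast
    have dU: "d \<in> U" using mor_U[OF d] by auto
    have D: "Def U 1 (\<lambda>x. Q (x @ [d]))" 
      by (rule Def_sub[OF Def_U[OF Q(1)]], (rule refl Rix_intros | use dU in simp)+)
    let ?X1 = "\<lambda>x. X x \<and> Q (x @ [d])" and ?X2 = "\<lambda>x. X x \<and> \<not> Q (x @ [d])"
    have "\<forall>e. mor A ((xs @ [d]) @ e # ys) \<longrightarrow> ?X1 [e]"
    proof (intro allI impI)
      fix e assume e: "mor A ((xs @ [d]) @ e # ys)"
      then have "mor A (xs @ e # ys)" using mor_delete[of A xs d "e # ys"] by simp
      moreover have "gen A d" "gen (insert d A) e"
        using e gen_mono[of _ d A] gen_mono[of _ e "insert d A"] by (auto simp: mor_append)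
      ultimately show "?X1 [e]" using xy(2) pos by simp
    qed
    moreover have "mor A ((xs @ [d]) @ ys)" using d by simp
    ultimately have X1: "?X1 \<in> ?S" using X Def_conj[OF _ D, of X] by blast
    have "\<forall>e. mor A (xs @ e # d # ys) \<longrightarrow> ?X2 [e]"
    proof (intro allI impI)
      fix e assume e: "mor A (xs @ e # d # ys)"
      then have "mor A (xs @ e # ys)" using mor_delete[of A "xs @ [e]" d ys] by simp
      moreover have "gen A e" "gen (insert e A) d"
        using e gen_mono[of _ e A] gen_mono[of _ d "insert e A"] by (auto simp: mor_append)
      ultimately show "?X2 [e]" using xy(2) neg by simp
    qed
    then have X2: "?X2 \<in> ?S" using X Def_conj[OF _ Def_not[OF D], of X] d by blast
    have "X [d]" "[d] \<in> Tp 1" using xy(2) d dU by auto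
    then show "Def U 1 X \<and> (\<exists>xs\<in>Tp 1. X xs) \<and> 
      (\<exists>Q\<in>?S. \<exists>R\<in>?S. \<forall>xs\<in>Tp 1. (Q xs \<longrightarrow> X xs) \<and> (R xs \<longrightarrow> X xs) \<and> \<not> (Q xs \<and> R xs))"
      using X by (intro conjI bexI[OF _ X1] bexI[OF _ X2]) auto
  qed
  moreover have "(\<lambda>_. True) \<in> ?S" using Def_True mor.simps(1) by (auto simp del: mor.simps intro!: exI[of _ "[]"])
  ultimately show False by blast
qed

lemma gen_exchange:
  assumes a: "gen A a" and b: "gen (insert a A) b" shows "gen (insert b A) a"
proof (rule ccontr)
  assume "\<not> gen (insert b A) a"
  then obtain F where F: "finite F" "F \<subseteq> insert b A" "F \<subseteq> U" "\<not> gen F a" using gen_finite_char gen_U a by metis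
  let ?G = "F - {b}"
  have "gen ?G a" by (rule gen_mono[OF a]) (use F(2) in auto)
  moreover have "gen (insert a ?G) b" by (rule gen_mono[OF b]) (use F(2) in auto)
  ultimately
  have "gen (insert b ?G) a" using gen_exchange_finite F by blast
  then show False using F gen_mono[of _ a F] by blast
qed

section \<open>The closure operator of the type\<close>

definition cl :: "'a set \<Rightarrow> 'a set" where "cl A = {b \<in> U. \<not> gen A b}"

lemma cl_U: "cl A \<subseteq> U" by (auto simp: cl_def)

lemma cl_mono: "A \<subseteq> B \<Longrightarrow> cl A \<subseteq> cl B"
  unfolding cl_def using gen_mono by blast

text \<open>Otherwise the condition \<open>x = a\<close> would belong to the type and isolate its
  restriction to \<open>{a}\<close>.\<close>

lemma gen_notin:
  assumes "gen A a" shows "a \<notin> A"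
proof
  assume "a \<in> A"
  have aU: "a \<in> U" using assms gen_U by auto
  have D: "Def {a} 1 (\<lambda>x. x ! 0 = a)"
    by (rule Def_eq, (rule refl Rix_intros | use aU in simp)+)
  have "gen {a} a" using gen_mono[OF assms] \<open>a \<in> A\<close> by auto
  then have "lg (\<lambda>x. x ! 0 = a)" using gen_iff[OF _ D, of a] by simp
  from not_isolated[OF _ _ D this] aU obtain Q where "Def {a} 1 Q" "lg Q" "\<not> Q [a]" by auto
  then show False using \<open>gen {a} a\<close> gen_iff by blast
qed

lemma cl_superset: "A \<subseteq> U \<Longrightarrow> A \<subseteq> cl A"
  unfolding cl_def using gen_notin by blast

lemma cl_finite_char:
  assumes "b \<in> cl A" obtains F where "finite F" "F \<subseteq> A" "b \<in> cl F"
proof -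
  have b: "b \<in> U" "\<not> gen A b" using assms by (simp_all add: cl_def)
  obtain F where "finite F" "F \<subseteq> A" "\<not> gen F b" by (rule gen_finite_char[OF b])
  then show ?thesis using that b(1) by (simp add: cl_def)
qed

text \<open>An element that is not generic over \<open>C\<close> is not generic over any larger set
  either, so regularity allows the elements of \<open>F\<close> to be added one at a time while
  \<open>b\<close> stays generic.\<close>

lemma gen_closure_finite: "finite F \<Longrightarrow> F \<subseteq> cl C \<Longrightarrow> finite C \<Longrightarrow> C \<subseteq> U \<Longrightarrow> gen C b \<Longrightarrow> gen (F \<union> C) b"
proof (induction F rule: finite_induct)
  case (insert f F)
  have "f \<in> U" "\<not> gen C f" using insert.prems by (auto simp: cl_def)
  then have "\<not> gen (F \<union> C) f" using gen_mono by blast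
  moreover have "F \<subseteq> U" using insert.prems cl_U by blast
  ultimately have "gen (insert f (F \<union> C)) b" using regular[of "F \<union> C" f] insert \<open>f \<in> U\<close> by auto
  then show ?case by simp
qed simp

lemma gen_closure:
  assumes "A \<subseteq> cl C" "gen C b" shows "gen (A \<union> C) b"
proof (rule ccontr)
  assume "\<not> gen (A \<union> C) b"
  then obtain F where F: "finite F" "F \<subseteq> A \<union> C" "F \<subseteq> U" "\<not> gen F b" using gen_finite_char gen_U assms by metis
  have "\<forall>f\<in>F \<inter> A. \<exists>G. finite G \<and> G \<subseteq> C \<and> f \<in> cl G" using assms(1) cl_finite_char by (metis IntD2 subsetD)
  then obtain G where G: "\<And>f. f \<in> F \<inter> A \<Longrightarrow> finite (G f) \<and> G f \<subseteq> C \<and> f \<in> cl (G f)" by metis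
  \<comment> \<open>A finite part of \<open>C\<close> whose closure contains the relevant elements
    of \<open>A\<close>. It is cut down to \<open>U\<close>, since regularity speaks of subsets of
    \<open>U\<close> while \<open>C\<close> is arbitrary.\<close>
  let ?H = "((\<Union>f\<in>F \<inter> A. G f) \<union> (F \<inter> C)) \<inter> U"
  have cI: "cl (X \<inter> U) = cl X" for X
  proof -
    have "Def (X \<inter> U) 1 P = Def X 1 P" for P unfolding Def_def by (simp add: Int_assoc)
    then show ?thesis by (simp add: cl_def generic_def)
  qed
  have "f \<in> cl ?H" if "f \<in> F \<inter> A" for f
  proof -
    have "G f \<subseteq> (\<Union>f\<in>F \<inter> A. G f) \<union> (F \<inter> C)" using that by blast
    from cl_mono[OF this] have "f \<in> cl ((\<Union>f\<in>F \<inter> A. G f) \<union> (F \<inter> C))" using G[OF that] by blast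
    then show ?thesis using cI by simp
  qed
  then have "gen ((F \<inter> A) \<union> ?H) b"
  proof (intro gen_closure_finite)
    show "gen ?H b" by (rule gen_mono[OF assms(2)]) (use G in auto)
  qed (use F G in auto)
  then have "gen F b" by (rule gen_mono) (use F in auto)
  then show False using F by blast
qed

lemma cl_subset: "A \<subseteq> cl C \<Longrightarrow> cl A \<subseteq> cl C"
  using gen_closure gen_mono unfolding cl_def by blast

lemma cl_exchange:
  assumes "a \<in> cl (insert b X)" "a \<notin> cl X" "b \<in> U" shows "b \<in> cl (insert a X)"
  using assms gen_exchange[of X a b] unfolding cl_def by blast

section \<open>Independent sets and bases\<close>

definition indep :: "'a set \<Rightarrow> bool" where
  "indep Z \<longleftrightarrow> Z \<subseteq> U \<and> (\<forall>z\<in>Z. gen (Z - {z}) z)"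

lemma indep_mono: "indep Z \<Longrightarrow> Y \<subseteq> Z \<Longrightarrow> indep Y"
  unfolding indep_def by (meson Diff_mono gen_mono order_refl order_trans subsetD)

text \<open>The order of enumeration is irrelevant. Together with \<open>mor_unique\<close> this is
  the total indiscernibility of independent sets.\<close>

lemma indep_mor:
  "indep Z \<Longrightarrow> A \<subseteq> Z \<Longrightarrow> distinct xs \<Longrightarrow> set xs \<subseteq> Z \<Longrightarrow> set xs \<inter> A = {} \<Longrightarrow> mor A xs"
proof (induction xs arbitrary: A)
  case (Cons x xs)
  have "gen A x" using Cons.prems unfolding indep_def by (auto intro: gen_mono[of "Z - {x}"])
  moreover have "mor (insert x A) xs" by (rule Cons.IH) (use Cons.prems in auto)
  ultimately show ?case by simp
qed simp

lemma indep_insert: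
  assumes "indep Z" "gen Z a" shows "indep (insert a Z)"
proof -
  have "a \<notin> Z" using assms(2) gen_notin by blast
  have "gen (insert a Z - {z}) z" if "z \<in> Z" for z
  proof -
    have "gen (Z - {z}) z" "gen (insert z (Z - {z})) a" 
      using assms that by (auto simp: indep_def insert_absorb)
    then have "gen (insert a (Z - {z})) z" using gen_exchange by blast
    then show ?thesis by (rule gen_mono) auto
  qed
  then show ?thesis using assms gen_U \<open>a \<notin> Z\<close> by (auto simp: indep_def)
qed

lemma indep_gen:
  "indep Z \<Longrightarrow> z \<in> Z \<Longrightarrow> Y \<subseteq> Z \<Longrightarrow> z \<notin> Y \<Longrightarrow> gen Y z"
  unfolding indep_def by (auto intro: gen_mono[of "Z - {z}"])

lemma mor_indep: "mor {} xs \<Longrightarrow> indep (set xs) \<and> distinct xs"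
proof (induction xs rule: rev_induct)
  case Nil
  then show ?case by (simp add: indep_def)
next
  case (snoc x xs)
  then show ?case using indep_insert gen_notin by (auto simp: mor_append)
qed

lemma indep_chain_Union:
  assumes "\<C> \<noteq> {}" "subset.chain {Z. indep Z} \<C>" shows "indep (\<Union>\<C>)"
proof -
  have i: "Z \<in> \<C> \<Longrightarrow> indep Z" for Z using assms by (auto simp: subset_chain_def)
  then have U: "\<Union>\<C> \<subseteq> U" by (auto simp: indep_def)
  have "gen (\<Union>\<C> - {z}) z" if z: "z \<in> \<Union>\<C>" for z
  proof (rule ccontr)
    assume n: "\<not> ?thesis"
    obtain F where F: "finite F" "F \<subseteq> \<Union>\<C> - {z}" "\<not> gen F z"
      by (rule gen_finite_char[OF _ n]) (use U z in auto)
    have "finite (insert z F)" "insert z F \<subseteq> \<Union>\<C>" using F z by auto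
    then obtain Z where "Z \<in> \<C>" "insert z F \<subseteq> Z"
      by (rule finite_subset_Union_chain[OF _ _ assms])
    then show False using indep_gen[of Z z F] F i by blast
  qed
  then show ?thesis using U unfolding indep_def by blast
qed

lemma ex_basis:
  assumes "indep Z0" "Z0 \<subseteq> X" "X \<subseteq> U"
  obtains Z where "Z0 \<subseteq> Z" "Z \<subseteq> X" "indep Z" "X \<subseteq> cl Z"
proof -
  let ?P = "{Z. indep Z \<and> Z0 \<subseteq> Z \<and> Z \<subseteq> X}"
  have "\<exists>Z\<in>?P. \<forall>Y\<in>?P. Z \<subseteq> Y \<longrightarrow> Y = Z"
  proof (rule subset_Zorn_nonempty)
    show "?P \<noteq> {}" using assms by auto
    fix \<C> assume C: "\<C> \<noteq> {}" "subset.chain ?P \<C>"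
    then have "indep (\<Union>\<C>)" by (intro indep_chain_Union) (auto simp: subset_chain_def)
    moreover have "\<forall>Z\<in>\<C>. Z0 \<subseteq> Z \<and> Z \<subseteq> X" using C by (auto simp: subset_chain_def)
    ultimately show "\<Union>\<C> \<in> ?P" using C(1) by blast
  qed
  then obtain Z where Z: "Z \<in> ?P" "\<forall>Y\<in>?P. Z \<subseteq> Y \<longrightarrow> Y = Z" ..
  have "x \<in> cl Z" if x: "x \<in> X" for x
  proof (rule ccontr)
    assume "x \<notin> cl Z"
    then have g: "gen Z x" using x assms by (auto simp: cl_def)
    then have "insert x Z \<in> ?P" using indep_insert Z(1) x by auto
    then have "insert x Z = Z" using Z(2) by blast
    then show False using g gen_notin by blast
  qed
  then show ?thesis using that Z(1) by blast
qed

text \<open>Generic extensions are unique up to type, so corresponding bases may be extended by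
  arbitrary generic points. This is the source of the axiom on points outside closed sets.\<close>

lemma el_insert_gen:
  assumes R: "el R" and "gen (Domain R) b" "gen (Range R) b'"
  shows "el (insert (b, b') R)"
proof (rule el_insertI[OF R])
  show "b \<in> U" "b' \<in> U" using assms gen_U by auto
  fix zs assume zs: "set zs \<subseteq> R"
  have "gen (set (map fst zs)) b" "gen (set (map snd zs)) b'"
    using zs by (force intro!: gen_mono[OF assms(2)] gen_mono[OF assms(3)])+
  then have e: "eqv (map fst zs @ [b]) (map snd zs @ [b'])"
    using gen_eqv_extend R zs unfolding el_def by blast
  have "set (zip (b # map fst zs) (b' # map snd zs)) \<subseteq> set (zip (map fst zs @ [b]) (map snd zs @ [b']))"
    by (auto simp: zip_map_fst_snd)
  from eqv_map_zip[OF e this] show "eqv (b # map fst zs) (b' # map snd zs)" by simp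
qed

lemma gen_el:
  assumes R: "el R" and A: "A \<subseteq> Domain R" and "(b, b') \<in> R" "gen A b" shows "gen (R `` A) b'"
proof (rule ccontr)
  assume "\<not> ?thesis"
  moreover have "b' \<in> U" using el_U R assms by auto
  ultimately obtain F where F: "finite F" "F \<subseteq> R `` A" "\<not> gen F b'" using gen_finite_char by metis
  then obtain ds where ds: "set ds = F" using finite_list by blast
  then obtain cs where cs: "length cs = length ds" "set (zip cs ds) \<subseteq> R" "set cs \<subseteq> A"
    using preimage_list F by metis
  have "eqv (cs @ [b]) (ds @ [b'])" by (rule eqv_of_el[OF R]) (use cs assms in auto)
  then have "gen (set ds) b'" using gen_eqv cs gen_mono[OF assms(4) cs(3)] by blast
  then show False using F ds by blast
qed

end

section \<open>Ultrafilters and saturation for tuples\<close>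

text \<open>An ultrafilter is represented as a family with the finite intersection property that
  decides every set; the usual closure properties are recovered by
  \<open>fip_Inter_mem\<close>.\<close>

definition fip :: "'a set set \<Rightarrow> bool" where
  "fip \<A> \<longleftrightarrow> (\<forall>G. finite G \<and> G \<subseteq> \<A> \<longrightarrow> \<Inter>G \<noteq> {})"

lemma fip_ultrafilter:
  assumes "fip \<A>"
  shows "\<exists>\<U>. \<A> \<subseteq> \<U> \<and> fip \<U> \<and> (\<forall>Y. Y \<in> \<U> \<or> - Y \<in> \<U>)"
proof -
  let ?P = "{\<U>. \<A> \<subseteq> \<U> \<and> fip \<U>}"
  have "\<exists>\<U>\<in>?P. \<forall>Y\<in>?P. \<U> \<subseteq> Y \<longrightarrow> Y = \<U>"
  proof (rule subset_Zorn_nonempty)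
    show "?P \<noteq> {}" using assms by auto
    fix \<C> assume C: "\<C> \<noteq> {}" "subset.chain ?P \<C>"
    have "fip (\<Union>\<C>)" unfolding fip_def
    proof (intro allI impI, elim conjE)
      fix G assume "finite G" "G \<subseteq> \<Union>\<C>"
      then obtain \<U> where "\<U> \<in> \<C>" "G \<subseteq> \<U>" using finite_subset_Union_chain[OF _ _ C] by blast
      then show "\<Inter>G \<noteq> {}" using C(2) \<open>finite G\<close> by (auto simp: subset_chain_def fip_def)
    qed
    moreover have "\<forall>\<U>\<in>\<C>. \<A> \<subseteq> \<U>" using C(2) by (auto simp: subset_chain_def)
    ultimately show "\<Union>\<C> \<in> ?P" using C(1) by blast
  qed
  then obtain \<U> where U: "\<U> \<in> ?P" "\<forall>Y\<in>?P. \<U> \<subseteq> Y \<longrightarrow> Y = \<U>" ..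
  have *: "\<exists>G. finite G \<and> G \<subseteq> \<U> \<and> \<Inter>G \<inter> Y = {}" if "Y \<notin> \<U>" for Y
  proof -
    have "\<not> fip (insert Y \<U>)" using U that by blast
    then obtain G where G: "finite G" "G \<subseteq> insert Y \<U>" "\<Inter>G = {}" unfolding fip_def by blast
    then show ?thesis by (intro exI[of _ "G - {Y}"]) auto
  qed
  have "Y \<in> \<U> \<or> - Y \<in> \<U>" for Y
  proof (rule ccontr)
    assume n: "\<not> ?thesis"
    then obtain G H where GH: "finite G" "G \<subseteq> \<U>" "\<Inter>G \<inter> Y = {}" "finite H" "H \<subseteq> \<U>" "\<Inter>H \<inter> - Y = {}"
      using *[of Y] *[of "- Y"] by blast
    then have "\<Inter>(G \<union> H) = {}" unfolding Inter_Un_distrib by blast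
    moreover have "finite (G \<union> H)" "G \<union> H \<subseteq> \<U>" using GH by auto
    ultimately show False using U(1) by (auto simp: fip_def)
  qed
  then show ?thesis using U(1) by (intro exI[of _ \<U>]) simp
qed

lemma fip_Inter_mem:
  assumes "fip \<U>" "\<And>Y. Y \<in> \<U> \<or> - Y \<in> \<U>" "finite G" "G \<subseteq> \<U>" "\<Inter>G \<subseteq> Y" shows "Y \<in> \<U>"
proof (rule ccontr)
  assume "Y \<notin> \<U>"
  then have "insert (- Y) G \<subseteq> \<U>" using assms(2)[of Y] assms(4) by blast
  then have "\<Inter>(insert (- Y) G) \<noteq> {}" 
    using assms(1)[unfolded fip_def, rule_format, of "insert (- Y) G"] assms(3) by simp
  then show False using assms(5) by auto
qed

context stable_sets
begin

text \<open>\<open>F\<close> is first enlarged to a complete type \<open>?D\<close> by an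
  ultrafilter. Its projection to the first \<open>n\<close> coordinates is realised by induction. As
  \<open>?D\<close> is closed under finite conjunction, the fibre over any such realisation is
  finitely satisfiable, and saturation in one variable supplies the last coordinate.\<close>

lemma sat_tuple:
  assumes "finite A" "A \<subseteq> U"
  shows "(\<And>P. P \<in> F \<Longrightarrow> Def A n P) \<Longrightarrow> (\<And>G. finite G \<Longrightarrow> G \<subseteq> F \<Longrightarrow> \<exists>xs\<in>Tp n. \<forall>P\<in>G. P xs) \<Longrightarrow>
    \<exists>xs\<in>Tp n. \<forall>P\<in>F. P xs"
proof (induction n arbitrary: F)
  case 0
  have "[] \<in> Tp 0" by (simp add: tuples_def)
  moreover have "P []" if "P \<in> F" for P
    using 0(2)[of "{P}"] that by (auto simp: tuples_def)
  ultimately show ?case by blast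
next
  case (Suc n)
  let ?A = "insert (Tp (Suc n)) (Collect ` F)"
  have "fip ?A" unfolding fip_def
  proof (intro allI impI, elim conjE)
    fix G assume G: "finite G" "G \<subseteq> ?A"
    have "finite (G - {Tp (Suc n)})" "G - {Tp (Suc n)} \<subseteq> Collect ` F" using G by auto
    from finite_subset_image[OF this] obtain C where C': "C \<subseteq> F \<and> finite C \<and> G - {Tp (Suc n)} = Collect ` C" ..
    note C = C'[THEN conjunct1] C'[THEN conjunct2, THEN conjunct1] C'[THEN conjunct2, THEN conjunct2]
    from Suc.prems(2)[OF C(2,1)] obtain xs where xs: "xs \<in> Tp (Suc n)" "\<forall>P\<in>C. P xs" by blast
    have "xs \<in> Y" if Y: "Y \<in> G" for Y
    proof (cases "Y = Tp (Suc n)")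
      case False
      then have "Y \<in> G - {Tp (Suc n)}" using Y by blast
      then have "Y \<in> Collect ` C" using C(3) by simp
      then show ?thesis using xs by auto
    qed (use xs in simp)
    then show "\<Inter>G \<noteq> {}" by blast
  qed
  from fip_ultrafilter[OF this] obtain \<U> where "?A \<subseteq> \<U> \<and> fip \<U> \<and> (\<forall>Y. Y \<in> \<U> \<or> - Y \<in> \<U>)" ..
  then have U: "?A \<subseteq> \<U>" "fip \<U>" "\<And>Y. Y \<in> \<U> \<or> - Y \<in> \<U>" by simp_all
  let ?D = "{P. Def A (Suc n) P \<and> Collect P \<in> \<U>}"
  have conj: "\<exists>ys\<in>Tp (Suc n). \<forall>P\<in>C. P ys" "(\<lambda>ys. \<forall>P\<in>C. P ys) \<in> ?D" if "finite C" "C \<subseteq> ?D" for C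
  proof -
    have C: "finite (insert (Tp (Suc n)) (Collect ` C))" "insert (Tp (Suc n)) (Collect ` C) \<subseteq> \<U>" using that U(1) by auto
    then have "\<Inter>(insert (Tp (Suc n)) (Collect ` C)) \<noteq> {}" using U(2) unfolding fip_def by blast
    then show "\<exists>ys\<in>Tp (Suc n). \<forall>P\<in>C. P ys" by auto
    have "Collect (\<lambda>ys. \<forall>P\<in>C. P ys) \<in> \<U>" by (rule fip_Inter_mem[OF U(2,3) C]) auto
    moreover have "Def A (Suc n) (\<lambda>ys. \<forall>P\<in>C. P ys)" using Def_Ball_finite[of C A "Suc n" "\<lambda>P. P"] that by auto
    ultimately show "(\<lambda>ys. \<forall>P\<in>C. P ys) \<in> ?D" by simp
  qed
  have "\<exists>xs\<in>Tp n. \<forall>P\<in>(\<lambda>P xs. \<exists>a\<in>U. P (xs @ [a])) ` ?D. P xs"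
  proof (rule Suc.IH)
    fix P assume "P \<in> (\<lambda>P xs. \<exists>a\<in>U. P (xs @ [a])) ` ?D"
    then show "Def A n P" using Def_ex1 by blast
  next
    fix G assume "finite G" "G \<subseteq> (\<lambda>P xs. \<exists>a\<in>U. P (xs @ [a])) ` ?D"
    from finite_subset_image[OF this] obtain C where C': "C \<subseteq> ?D \<and> finite C \<and> G = (\<lambda>P xs. \<exists>a\<in>U. P (xs @ [a])) ` C" ..
    note C = C'[THEN conjunct1] C'[THEN conjunct2, THEN conjunct1] C'[THEN conjunct2, THEN conjunct2]
    obtain ys where ys: "ys \<in> Tp (Suc n)" "\<forall>P\<in>C. P ys" using conj(1) C by blast
    then obtain zs a where "ys = zs @ [a]" by (metis tuplesD(1) length_Suc_conv_rev)
    then show "\<exists>xs\<in>Tp n. \<forall>P\<in>G. P xs" using ys C(3) by (intro bexI[of _ zs]) (auto simp: tuples_def)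
  qed
  then obtain xs where xs: "xs \<in> Tp n" "\<And>P. P \<in> ?D \<Longrightarrow> \<exists>a\<in>U. P (xs @ [a])" by auto
  have "\<exists>a\<in>U. \<forall>P\<in>(\<lambda>P z. P (xs @ z)) ` ?D. P [a]"
  proof (rule sat1)
    show "finite (A \<union> set xs)" "A \<union> set xs \<subseteq> U" using assms tuplesD[OF xs(1)] by auto
    fix P assume "P \<in> (\<lambda>P z. P (xs @ z)) ` ?D"
    then show "Def (A \<union> set xs) 1 P" using Def_param_left[of A xs 1] tuplesD[OF xs(1)] by auto
  next
    fix G assume "finite G" "G \<subseteq> (\<lambda>P z. P (xs @ z)) ` ?D"
    from finite_subset_image[OF this] obtain C where C': "C \<subseteq> ?D \<and> finite C \<and> G = (\<lambda>P z. P (xs @ z)) ` C" ..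
    note C = C'[THEN conjunct1] C'[THEN conjunct2, THEN conjunct1] C'[THEN conjunct2, THEN conjunct2]
    show "\<exists>a\<in>U. \<forall>P\<in>G. P [a]" using xs(2)[OF conj(2)[OF C(2,1)]] C(3) by auto
  qed
  then obtain a where a: "a \<in> U" "\<forall>P\<in>?D. P (xs @ [a])" by auto
  have "F \<subseteq> ?D" using Suc.prems(1) U(1) by auto
  then show ?case using a xs(1) by (intro bexI[of _ "xs @ [a]"]) (auto simp: tuples_def)
qed

text \<open>Compactness is used twice: each point of \<open>Y\<close> lies in a parameter-free
  definable subset of \<open>Y\<close>, because otherwise its type would also be realised outside
  \<open>Y\<close>; and finitely many of these subsets cover \<open>Y\<close>.\<close>

lemma Def_of_invariant:
  assumes Y: "Def U k Y" and inv: "\<And>c d. c \<in> Tp k \<Longrightarrow> eqv c d \<Longrightarrow> Y c = Y d"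
  shows "Def {} k Y"
proof -
  obtain cs where cs: "set cs \<subseteq> U" "Def (set cs) k Y" using Def_finite_base[OF Y] by auto
  have 1: "\<exists>Z. Def {} k Z \<and> Z c \<and> (\<forall>d\<in>Tp k. Z d \<longrightarrow> Y d)" if c: "c \<in> Tp k" "Y c" for c
  proof (rule ccontr)
    assume n: "\<not> ?thesis"
    let ?F = "{Z. Def {} k Z \<and> Z c}"
    have "\<exists>xs\<in>Tp k. \<forall>P\<in>insert (\<lambda>xs. \<not> Y xs) ?F. P xs"
    proof (rule sat_tuple[of "set cs"])
      fix G assume G: "finite G" "G \<subseteq> insert (\<lambda>xs. \<not> Y xs) ?F"
      let ?G = "G - {\<lambda>xs. \<not> Y xs}"
      have "Def {} k (\<lambda>xs. \<forall>Z\<in>?G. Z xs)" using Def_Ball_finite[of ?G "{}" k "\<lambda>P. P"] G by auto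
      moreover have "\<forall>Z\<in>?G. Z c" using G by auto
      ultimately obtain d where d: "d \<in> Tp k" "\<forall>Z\<in>?G. Z d" "\<not> Y d" using n by blast
      then have "\<forall>P\<in>G. P d" by blast
      then show "\<exists>xs\<in>Tp k. \<forall>P\<in>G. P xs" using d(1) by blast
    qed (use cs Def_not[OF cs(2)] Def_mono[of "{}" k _ "set cs"] in auto)
    then obtain d where d': "d \<in> Tp k" "\<forall>P\<in>insert (\<lambda>xs. \<not> Y xs) ?F. P d" ..
    then have d: "d \<in> Tp k" "\<not> Y d" "\<And>Z. Def {} k Z \<Longrightarrow> Z c \<Longrightarrow> Z d" by auto
    have "Z c = Z d" if "Def {} k Z" for Z using d(3)[OF that] d(3)[OF Def_not[OF that]] by blast
    then have "eqv c d" using c d by (auto simp: eqv_def tuples_def)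
    then show False using inv c d by blast
  qed
  let ?C = "{Z. Def {} k Z \<and> (\<forall>d\<in>Tp k. Z d \<longrightarrow> Y d)}"
  let ?N = "\<lambda>(Z :: 'a list \<Rightarrow> bool) xs. \<not> Z xs"
  have D: "Def (set cs) k P" if "P \<in> insert Y (?N ` ?C)" for P
    using that cs(2) Def_mono[OF Def_not, of "{}" k _ "set cs"] by auto
  \<comment> \<open>The members of \<open>Y\<close> outside all sets of \<open>?C\<close> form an
    inconsistent type, and a finite inconsistent part of it names a finite cover.\<close>
  have "\<exists>G. finite G \<and> G \<subseteq> insert Y (?N ` ?C) \<and> \<not> (\<exists>xs\<in>Tp k. \<forall>P\<in>G. P xs)"
  proof (rule ccontr)
    assume neg: "\<not> ?thesis"
    have "\<exists>xs\<in>Tp k. \<forall>P\<in>insert Y (?N ` ?C). P xs"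
    proof (rule sat_tuple[OF finite_set cs(1) D])
      fix G assume "finite G" "G \<subseteq> insert Y (?N ` ?C)"
      then show "\<exists>xs\<in>Tp k. \<forall>P\<in>G. P xs"
        using neg[unfolded not_ex, rule_format, of G] by metis
    qed
    then obtain xs where xs: "xs \<in> Tp k" "\<forall>P\<in>insert Y (?N ` ?C). P xs" ..
    then obtain Z where "Z \<in> ?C" "Z xs" using 1[of xs] by auto
    then have "?N Z \<in> insert Y (?N ` ?C)" by blast
    then have "?N Z xs" using xs(2) by (rule bspec[rotated])
    then show False using \<open>Z xs\<close> by simp
  qed
  then obtain G where G: "finite G" "G \<subseteq> insert Y (?N ` ?C)" "\<not> (\<exists>xs\<in>Tp k. \<forall>P\<in>G. P xs)" by blast
  have "finite (G - {Y})" "G - {Y} \<subseteq> ?N ` ?C" using G by auto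
  from finite_subset_image[OF this] obtain D where D': "D \<subseteq> ?C \<and> finite D \<and> G - {Y} = ?N ` D" ..
    note D = D'[THEN conjunct1] D'[THEN conjunct2, THEN conjunct1] D'[THEN conjunct2, THEN conjunct2]
  have "Def {} k (\<lambda>xs. \<exists>Z\<in>D. Z xs)" using Def_Bex_finite[of D "{}" k "\<lambda>P. P"] D by auto
  then show ?thesis
  proof (rule Def_cong)
    fix xs assume xs: "xs \<in> Tp k"
    then obtain P where P: "P \<in> G" "\<not> P xs" using G(3) by blast
    show "(\<exists>Z\<in>D. Z xs) = Y xs"
    proof
      assume "\<exists>Z\<in>D. Z xs" then show "Y xs" using D(1) xs by blast
    next
      assume "Y xs"
      then have "P \<in> G - {Y}" using P by blast
      then have "P \<in> ?N ` D" using D(3) by simp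
      then show "\<exists>Z\<in>D. Z xs" using P(2) by blast
    qed
  qed
qed

text \<open>The count reaches \<open>n\<close> exactly when all conditions of some index set of size
  \<open>n\<close> hold, which is a finite disjunction of finite conjunctions.\<close>

lemma Def_card_ge:
  fixes N :: nat
  assumes "\<And>i. i < N \<Longrightarrow> Def A m (R i)"
  shows "Def A m (\<lambda>ws. n \<le> card {i. i < N \<and> R i ws})"
proof -
  have "Def A m (\<lambda>ws. \<exists>I\<in>{I. I \<subseteq> {..<N} \<and> card I = n}. \<forall>i\<in>I. R i ws)"
  proof (intro Def_Bex_finite Def_Ball_finite)
    show "finite {I. I \<subseteq> {..<N} \<and> card I = n}" by (rule finite_subset[of _ "Pow {..<N}"]) auto
  qed (auto intro: assms dest: finite_subset)
  then show ?thesis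
  proof (rule Def_cong)
    fix ws
    have fin: "finite {i. i < N \<and> R i ws}" by simp
    show "(\<exists>I\<in>{I. I \<subseteq> {..<N} \<and> card I = n}. \<forall>i\<in>I. R i ws) = (n \<le> card {i. i < N \<and> R i ws})"
    proof
      assume "\<exists>I\<in>{I. I \<subseteq> {..<N} \<and> card I = n}. \<forall>i\<in>I. R i ws"
      then obtain I where "I \<subseteq> {i. i < N \<and> R i ws}" "card I = n" by blast
      then show "n \<le> card {i. i < N \<and> R i ws}" using card_mono[OF fin] by metis
    next
      assume "n \<le> card {i. i < N \<and> R i ws}"
      then obtain I where "I \<subseteq> {i. i < N \<and> R i ws}" "card I = n" by (metis obtain_subset_with_card_n)
      then show "\<exists>I\<in>{I. I \<subseteq> {..<N} \<and> card I = n}. \<forall>i\<in>I. R i ws" by (intro bexI[of _ I]) auto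
    qed
  qed
qed

end

section \<open>Definability of the regular type\<close>

context regular_type
begin

text \<open>If the alternation were unbounded then, Morley sequences being totally indiscernible, every subset of
  a finite Morley sequence would be cut out by an instance of \<open>P\<close>.\<close>

lemma bounded_alternation:
  assumes P: "Def {} (1 + k) P"
  shows "\<exists>n. \<forall>xs c. mor {} xs \<longrightarrow> c \<in> Tp k \<longrightarrow> 
    \<not> (n \<le> card {i. i < length xs \<and> P (xs ! i # c)} \<and> n \<le> card {i. i < length xs \<and> \<not> P (xs ! i # c)})"
proof (rule ccontr)
  assume neg: "\<not> ?thesis"
  have all: "\<exists>c\<in>Tp k. \<forall>i<length xs. P (xs ! i # c) \<longleftrightarrow> w i" if xs: "mor {} xs" for xs and w :: "nat \<Rightarrow> bool"
  proof -
    let ?n = "length xs"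
    obtain ys c where ys: "mor {} ys" "c \<in> Tp k" "?n \<le> card {i. i < length ys \<and> P (ys ! i # c)}"
      "?n \<le> card {i. i < length ys \<and> \<not> P (ys ! i # c)}" using neg by meson
    obtain I where I: "I \<subseteq> {i. i < length ys \<and> P (ys ! i # c)}" "card I = ?n" "finite I"
      using obtain_subset_with_card_n[OF ys(3)] by blast
    obtain J where J: "J \<subseteq> {i. i < length ys \<and> \<not> P (ys ! i # c)}" "card J = ?n" "finite J"
      using obtain_subset_with_card_n[OF ys(4)] by blast
    obtain f where f: "bij_betw f {..<?n} I" using I by (metis card_lessThan finite_lessThan finite_same_card_bij)
    obtain g where g: "bij_betw g {..<?n} J" using J by (metis card_lessThan finite_lessThan finite_same_card_bij)
    \<comment> \<open>Position \<open>h i\<close> is taken from \<open>I\<close>, where the instance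
      holds, or from \<open>J\<close>, where it fails, as the pattern \<open>w\<close>
      demands.\<close>
    define h where "h i = (if w i then f i else g i)" for i
    have fI: "f i < length ys \<and> P (ys ! f i # c)" and gJ: "g i < length ys \<and> \<not> P (ys ! g i # c)" if "i < ?n" for i
      using bij_betwE[OF f] bij_betwE[OF g] I(1) J(1) that by auto
    have h: "h i < length ys" "P (ys ! h i # c) \<longleftrightarrow> w i" if "i < ?n" for i
      using fI[OF that] gJ[OF that] by (auto simp: h_def)
    have inj: "inj_on h {..<?n}"
    proof (rule inj_onI)
      fix i j assume ij: "i \<in> {..<?n}" "j \<in> {..<?n}" "h i = h j"
      then have "w i = w j" using h(2)[of i] h(2)[of j] by auto
      then show "i = j" using ij f g by (auto simp: h_def bij_betw_def inj_on_def split: if_splits)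
    qed
    let ?zs = "map (\<lambda>i. ys ! h i) [0..<?n]"
    have ind: "indep (set ys)" "distinct ys" using mor_indep ys by auto
    have "distinct ?zs" using inj h(1) ind(2) by (auto simp: distinct_map inj_on_def nth_eq_iff_index_eq)
    moreover have "set ?zs \<subseteq> set ys" using h(1) by auto
    ultimately have "mor {} ?zs" using indep_mor[OF ind(1)] by blast
    then have "eqv ([] @ ?zs) ([] @ xs)" by (intro mor_unique) (use xs in \<open>auto intro: eqv_refl\<close>)
    then have e: "eqv ?zs xs" by simp
    from eqv_extend_tuple[OF this, of c] obtain d where d: "eqv (?zs @ c) (xs @ d)" using tuplesD[OF ys(2)] by auto
    have lk: "length c = k" "length d = k" using d tuplesD[OF ys(2)] by (auto dest: eqv_length)
    have "P (xs ! i # d) \<longleftrightarrow> w i" if i: "i < ?n" for i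
    proof -
      have "(?zs ! i, xs ! i) \<in> set (zip ?zs xs)" using i by (force simp: set_zip)
      then have "set (zip (?zs ! i # c) (xs ! i # d)) \<subseteq> set (zip (?zs @ c) (xs @ d))" by auto
      from eqv_map_zip[OF d this] have "eqv (?zs ! i # c) (xs ! i # d)" using lk by simp
      then have "P (?zs ! i # c) \<longleftrightarrow> P (xs ! i # d)" using eqvD P lk by simp
      then show ?thesis using h(2) i by simp
    qed
    moreover have "d \<in> Tp k" using d lk by (auto simp: eqv_def tuples_def)
    ultimately show ?thesis by blast
  qed
  let ?X = "\<lambda>xs (w :: nat \<Rightarrow> bool) c. \<forall>i<length xs. P (xs ! i # c) \<longleftrightarrow> w i"
  \<comment> \<open>A pattern along a Morley sequence is split by the truth value at one further
    generic element; by \<open>all\<close>, both halves are nonempty.\<close>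
  let ?S = "{X. \<exists>xs w. mor {} xs \<and> X = ?X xs w}"
  have "?S = {}"
  proof (rule no_tree[of _ k])
    fix X assume "X \<in> ?S"
    then obtain xs w where X: "mor {} xs" "X = ?X xs w" by blast
    have xsU: "set xs \<subseteq> U" using mor_U X by blast
    have "Def U k (\<lambda>c. \<forall>i\<in>{..<length xs}. P (xs ! i # c) \<longleftrightarrow> w i)"
    proof (intro Def_Ball_finite Def_iff Def_triv)
      fix i assume "i \<in> {..<length xs}"
      then have "xs ! i \<in> U" using xsU by auto
      then show "Def U k (\<lambda>c. P (xs ! i # c))"
        by (intro Def_sub[OF Def_mono[OF P]]) (rule refl Rix_intros | simp)+
    qed simp
    then have D: "Def U k X" using X(2) by (simp add: Ball_def)
    obtain a where a: "gen (set xs) a" using ex_gen[of "set xs"] xsU by auto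
    then have m: "mor {} (xs @ [a])" using X by (simp add: mor_append)
    let ?w = "\<lambda>b i. if i < length xs then w i else b"
    have sub: "?X (xs @ [a]) (?w b) c \<Longrightarrow> X c \<and> (P (a # c) \<longleftrightarrow> b)" for b c
    proof -
      assume H: "?X (xs @ [a]) (?w b) c"
      have "P (xs ! i # c) \<longleftrightarrow> w i" if "i < length xs" for i using H[rule_format, of i] that by (simp add: nth_append)
      then show ?thesis using H[rule_format, of "length xs"] X(2) by simp
    qed
    have S: "?X (xs @ [a]) (?w b) \<in> ?S" for b 
      by (intro CollectI exI[of _ "xs @ [a]"] exI[of _ "?w b"] conjI m refl)
    have "\<exists>xs\<in>Tp k. X xs" using all[OF X(1), of w] X(2) by simp
    moreover have "\<exists>Q\<in>?S. \<exists>R\<in>?S. \<forall>xs\<in>Tp k. (Q xs \<longrightarrow> X xs) \<and> (R xs \<longrightarrow> X xs) \<and> \<not> (Q xs \<and> R xs)"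
    proof (rule bexI[OF _ S[of True]], rule bexI[OF _ S[of False]], rule ballI)
      fix c
      show "(?X (xs @ [a]) (?w True) c \<longrightarrow> X c) \<and> (?X (xs @ [a]) (?w False) c \<longrightarrow> X c) \<and>
        \<not> (?X (xs @ [a]) (?w True) c \<and> ?X (xs @ [a]) (?w False) c)"
        using sub[where b = True and c = c] sub[where b = False and c = c] by satx
    qed
    ultimately show "Def U k X \<and> (\<exists>xs\<in>Tp k. X xs) \<and> 
      (\<exists>Q\<in>?S. \<exists>R\<in>?S. \<forall>xs\<in>Tp k. (Q xs \<longrightarrow> X xs) \<and> (R xs \<longrightarrow> X xs) \<and> \<not> (Q xs \<and> R xs))"
      using D by (intro conjI)
  qed
  moreover have "?X [] (\<lambda>_. True) \<in> ?S" by (intro CollectI exI[of _ "[]"]) auto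
  ultimately show False by blast
qed

text \<open>Append to \<open>xs\<close> a sequence of \<open>n\<close> elements generic over
  \<open>xs\<close> and \<open>c\<close>; on these the truth value is the one prescribed by the
  type. If the opposite value occurred at least \<open>n\<close> times on \<open>xs\<close>, the
  joint sequence would contradict \<open>bounded_alternation\<close>. Length \<open>2 * n\<close>
  ensures that some value occurs at least \<open>n\<close> times.\<close>

lemma majority:
  assumes P: "Def {} (1 + k) P"
  shows "\<exists>n>0. \<forall>xs c. mor {} xs \<longrightarrow> length xs = 2 * n \<longrightarrow> c \<in> Tp k \<longrightarrow>
     (lg (\<lambda>x. P (x @ c)) \<longleftrightarrow> n \<le> card {i. i < 2 * n \<and> P (xs ! i # c)})"
proof -
  obtain n where n: "\<And>xs c. mor {} xs \<Longrightarrow> c \<in> Tp k \<Longrightarrow> 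
    \<not> (n \<le> card {i. i < length xs \<and> P (xs ! i # c)} \<and> n \<le> card {i. i < length xs \<and> \<not> P (xs ! i # c)})"
    using bounded_alternation[OF P] by meson
  obtain u where "u \<in> U" using U_nonempty by blast
  then have "replicate k u \<in> Tp k" by (auto simp: tuples_def)
  \<comment> \<open>For \<open>n = 0\<close> already the empty sequence would satisfy both
    inequalities. Positivity later turns a majority into an actual element.\<close>
  then have "n > 0" using n[of "[]"] by auto
  moreover have "lg (\<lambda>x. P (x @ c)) \<longleftrightarrow> n \<le> card {i. i < 2 * n \<and> P (xs ! i # c)}"
    if xs: "mor {} xs" "length xs = 2 * n" and c: "c \<in> Tp k" for xs c
  proof -
    have "finite (set xs \<union> set c)" "set xs \<union> set c \<subseteq> U" using mor_U[OF xs(1)] tuplesD[OF c] by auto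
    then obtain ys where ys: "length ys = n" "mor (set xs \<union> set c) ys" using ex_mor by blast
    have m: "mor {} (xs @ ys)" using xs mor_mono[OF ys(2)] by (auto simp: mor_append)
    have ind: "indep (set (xs @ ys))" "distinct (xs @ ys)" using mor_indep[OF m] by auto
    have D: "Def (set c) 1 (\<lambda>x. P (x @ c))" by (rule Def_fiber) (use P tuplesD[OF c] in auto)
    have gy: "P (y # c) \<longleftrightarrow> lg (\<lambda>x. P (x @ c))" if y: "y \<in> set ys" for y
    proof -
      obtain y1 y2 where "ys = y1 @ y # y2" using split_list[OF y] by blast
      then have "gen (set c) y" using ys(2) gen_mono[of _ y "set c"] by (auto simp: mor_append)
      from gen_iff[OF this D] show ?thesis by simp
    qed
    let ?T = "\<lambda>zs. {i. i < length zs \<and> P (zs ! i # c)}" and ?F = "\<lambda>zs. {i. i < length zs \<and> \<not> P (zs ! i # c)}"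
    have app: "card (?T xs) \<le> card (?T (xs @ ys))" "card (?F xs) \<le> card (?F (xs @ ys))"
      by (rule card_mono; auto simp: nth_append)+
    have sh: "card {i. i < n \<and> Q (ys ! i)} \<le> card {i. i < length (xs @ ys) \<and> Q ((xs @ ys) ! i)}" for Q
      using ys(1) by (intro card_inj_on_le[of "\<lambda>i. length xs + i"]) (auto simp: inj_on_def)
    have sum: "card (?T xs) + card (?F xs) = 2 * n"
    proof -
      have "?T xs \<union> ?F xs = {..<2 * n}" "?T xs \<inter> ?F xs = {}" using xs by auto
      then show ?thesis using card_Un_disjoint[of "?T xs" "?F xs"] by simp
    qed
    show ?thesis
    proof
      assume L: "lg (\<lambda>x. P (x @ c))"
      then have "{i. i < n \<and> P (ys ! i # c)} = {..<n}" using gy ys(1) by auto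
      then have "n \<le> card (?T (xs @ ys))" using sh[of "\<lambda>y. P (y # c)"] by simp
      then have "card (?F xs) < n" using n[OF m c] app by linarith
      then show "n \<le> card {i. i < 2 * n \<and> P (xs ! i # c)}" using sum xs by simp
    next
      assume "n \<le> card {i. i < 2 * n \<and> P (xs ! i # c)}"
      then have 1: "n \<le> card (?T (xs @ ys))" using app xs by simp
      show "lg (\<lambda>x. P (x @ c))"
      proof (rule ccontr)
        assume L: "\<not> lg (\<lambda>x. P (x @ c))"
        then have "{i. i < n \<and> \<not> P (ys ! i # c)} = {..<n}" using gy ys(1) by auto
        then have "n \<le> card (?F (xs @ ys))" using sh[of "\<lambda>y. \<not> P (y # c)"] by simp
        then show False using 1 n[OF m c] by blast
      qed
    qed
  qed
  ultimately show ?thesis by blast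
qed

text \<open>The vote along one Morley sequence gives a definition with that sequence as parameters;
  invariance of the type removes them.\<close>

lemma Def_lg_empty:
  assumes P: "Def {} (1 + k) P" shows "Def {} k (\<lambda>c. lg (\<lambda>x. P (x @ c)))"
proof (rule Def_of_invariant)
  obtain n where "n > 0" and n: "\<And>xs c. mor {} xs \<Longrightarrow> length xs = 2 * n \<Longrightarrow> c \<in> Tp k \<Longrightarrow>
     lg (\<lambda>x. P (x @ c)) \<longleftrightarrow> n \<le> card {i. i < 2 * n \<and> P (xs ! i # c)}" using majority[OF P] by meson
  obtain xs where xs: "length xs = 2 * n" "mor {} xs" using ex_mor by blast
  have "Def U k (\<lambda>c. n \<le> card {i. i < 2 * n \<and> P (xs ! i # c)})"
  proof (rule Def_card_ge)
    fix i assume "i < 2 * n"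
    then have "xs ! i \<in> U" using mor_U[OF xs(2)] xs(1) by auto
    then show "Def U k (\<lambda>c. P (xs ! i # c))"
      by (intro Def_sub[OF Def_mono[OF P]]) (rule refl Rix_intros | simp)+
  qed
  then show "Def U k (\<lambda>c. lg (\<lambda>x. P (x @ c)))"
    by (rule Def_cong) (use n[OF xs(2,1)] in simp)
next
  fix c d assume "c \<in> Tp k" "eqv c d"
  then show "lg (\<lambda>x. P (x @ c)) = lg (\<lambda>x. P (x @ d))" using lg_eqv P tuplesD by metis
qed

lemma Def_lg:
  assumes P: "Def A (1 + k) P" shows "Def A k (\<lambda>c. lg (\<lambda>x. P (x @ c)))"
proof -
  obtain cs Q where cs: "set cs \<subseteq> A \<inter> U" "Def {} (1 + k + length cs) Q" "\<And>xs. xs \<in> Tp (1 + k) \<Longrightarrow> P xs = Q (xs @ cs)"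
    using Def_emptyE[OF P] by blast
  have "Def {} (k + length cs) (\<lambda>c. lg (\<lambda>x. Q (x @ c)))" by (rule Def_lg_empty) (use cs in \<open>simp add: add.assoc\<close>)
  from Def_sub[OF Def_mono[OF this], of A, OF _ Rix_append[OF Rix_id Rix_const]] 
  have "Def A k (\<lambda>c. lg (\<lambda>x. Q (x @ c @ cs)))" using cs by auto
  then show ?thesis
  proof (rule Def_cong)
    fix c assume c: "c \<in> Tp k"
    have "P ([a] @ c) = Q ([a] @ c @ cs)" if "a \<in> U" for a using cs(3)[of "[a] @ c"] that c by (simp add: tuples_def)
    then show "lg (\<lambda>x. Q (x @ c @ cs)) = lg (\<lambda>x. P (x @ c))"
      using lg_cong[of "\<lambda>x. Q (x @ c @ cs)" "\<lambda>x. P (x @ c)"] lg_cong[of "\<lambda>x. P (x @ c)" "\<lambda>x. Q (x @ c @ cs)"] by auto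
  qed
qed

text \<open>The defining scheme of the type is iterated. \<open>R\<close> expresses over
  \<open>A\<close> what \<open>P\<close> says about generic elements, so that these can be
  eliminated from a formula.\<close>

lemma Def_generic_tuple:
  "Def A (n + k) P \<Longrightarrow> \<exists>R. Def A k R \<and> 
     (\<forall>c\<in>Tp k. \<forall>xs. length xs = n \<longrightarrow> mor (A \<union> set c) xs \<longrightarrow> (R c \<longleftrightarrow> P (xs @ c)))"
proof (induction n arbitrary: k P)
  case 0
  then show ?case by (intro exI[of _ P]) auto
next
  case (Suc n)
  \<comment> \<open>The head of the list is generic first, and the later elements are generic over
    it; it is therefore moved behind them and acts as a parameter in the induction
    hypothesis.\<close>
  let ?P = "\<lambda>ws. P (take 1 (drop n ws) @ take n ws @ drop (Suc n) ws)"
  have "Def A (n + (1 + k)) ?P"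
    by (rule Def_sub[OF Suc.prems], (rule refl Rix_intros | simp)+)
  from Suc.IH[OF this] obtain R where R: "Def A (1 + k) R" 
    "\<And>c xs. c \<in> Tp (1 + k) \<Longrightarrow> length xs = n \<Longrightarrow> mor (A \<union> set c) xs \<Longrightarrow> R c \<longleftrightarrow> ?P (xs @ c)" by blast
  show ?case
  proof (intro exI[of _ "\<lambda>c. lg (\<lambda>x. R (x @ c))"] conjI Def_lg R(1) ballI allI impI)
    fix c xs assume c: "c \<in> Tp k" and xs: "length xs = Suc n" "mor (A \<union> set c) xs"
    then obtain y ys where y: "xs = y # ys" by (cases xs) auto
    have yU: "y \<in> U" using mor_U[OF xs(2)] y by auto
    have "Def (A \<union> set c) 1 (\<lambda>x. R (x @ c))" by (rule Def_param_fiber) (use R tuplesD[OF c] in auto)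
    then have "lg (\<lambda>x. R (x @ c)) \<longleftrightarrow> R ([y] @ c)" using gen_iff xs y by auto
    also have "\<dots> \<longleftrightarrow> ?P (ys @ y # c)" using R(2)[of "y # c" ys] xs y yU c by (auto simp: tuples_def)
    also have "\<dots> \<longleftrightarrow> P (xs @ c)" using xs y by simp
    finally show "lg (\<lambda>x. R (x @ c)) \<longleftrightarrow> P (xs @ c)" .
  qed
qed

text \<open>That the majority of \<open>xs\<close> decides \<open>P\<close> is a parameter-free definable property of \<open>xs\<close>, so
  it holds for some tuple of the submodel.\<close>

lemma lg_meets_elem:
  assumes E: "elem E" and X: "Def U 1 X" "lg X" shows "\<exists>e\<in>E. X [e]"
proof -
  obtain c P where c: "set c \<subseteq> U" "Def {} (1 + length c) P" "\<And>xs. xs \<in> Tp 1 \<Longrightarrow> X xs = P (xs @ c)"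
    using Def_emptyE[OF X(1)] by auto
  obtain n where n: "n > 0" "\<And>xs c'. mor {} xs \<Longrightarrow> length xs = 2 * n \<Longrightarrow> c' \<in> Tp (length c) \<Longrightarrow>
     lg (\<lambda>x. P (x @ c')) \<longleftrightarrow> n \<le> card {i. i < 2 * n \<and> P (xs ! i # c')}" using majority[OF c(2)] by meson
  let ?T = "\<lambda>xs. \<forall>c'\<in>Tp (length c). lg (\<lambda>x. P (x @ c')) \<longleftrightarrow> n \<le> card {i. i < 2 * n \<and> P (xs ! i # c')}"
  have "Def E (2 * n) ?T"
  proof (intro Def_all Def_iff Def_card_ge)
    show "Def E (2 * n + length c) (\<lambda>ws. lg (\<lambda>x. P (x @ drop (2 * n) ws)))"
      by (rule Def_sub[OF Def_mono[OF Def_lg_empty[OF c(2)]]], simp, (rule refl Rix_intros | simp)+)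
    fix i assume "i < 2 * n"
    then show "Def E (2 * n + length c) (\<lambda>ws. P (take (2 * n) ws ! i # drop (2 * n) ws))"
      by (intro Def_sub[OF Def_mono[OF c(2)]]) (rule refl Rix_intros | simp)+
  qed
  moreover obtain xs where xs: "length xs = 2 * n" "mor {} xs" using ex_mor by blast
  moreover have "?T xs" using n(2)[OF xs(2,1)] by blast
  moreover have "xs \<in> Tp (2 * n)" using mor_U xs by (auto simp: tuples_def)
  ultimately obtain es where es: "es \<in> Tp (2 * n)" "set es \<subseteq> E" "?T es" using elem_tuple[OF E] by blast
  have "lg (\<lambda>x. P (x @ c))" by (rule lg_cong[OF X(2)]) (use c in auto)
  moreover have cT: "c \<in> Tp (length c)" using c by (simp add: tuples_def)
  ultimately have "n \<le> card {i. i < 2 * n \<and> P (es ! i # c)}" using es(3) by blast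
  then have "{i. i < 2 * n \<and> P (es ! i # c)} \<noteq> {}" using n(1) by (metis card.empty not_less)
  then obtain i where i: "i < 2 * n" "P (es ! i # c)" by blast
  have "es ! i \<in> E" using i es tuplesD by (metis nth_mem subsetD)
  then show ?thesis using i c(3)[of "[es ! i]"] elem_U[OF E] by auto
qed

text \<open>A generic \<open>b\<close> with isolated type over \<open>A\<close> would have isolated
  type over a finite part of \<open>A\<close>, and the restriction of the global type to that part
  would then be isolated.\<close>

lemma iso_imp_cl:
  assumes "iso A [b]" shows "b \<in> cl A"
proof (rule ccontr)
  assume "b \<notin> cl A"
  then have g: "gen A b" using iso_U[OF assms] by (auto simp: cl_def)
  obtain cs where cs: "set cs \<subseteq> A" "set cs \<subseteq> U" "iso (set cs) [b]"
    using iso_finite_base[OF assms] by blast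
  obtain X where X': "Def (set cs) (length [b]) X" "X [b]" 
    "\<And>Q ys. Def (set cs) (length [b]) Q \<Longrightarrow> Q [b] \<Longrightarrow> ys \<in> Tp (length [b]) \<Longrightarrow> X ys \<Longrightarrow> Q ys"
    using isoE[OF cs(3)] by blast
  have one: "length [b] = 1" by simp
  note X = X'[unfolded one]
  have gb: "gen (set cs) b" using gen_mono[OF g] cs by blast
  then have "lg X" using gen_iff X by blast
  then obtain Q a where Q: "Def (set cs) 1 Q" "lg Q" "a \<in> U" "X [a]" "\<not> Q [a]"
    using not_isolated[OF finite_set cs(2) X(1)] by blast
  have "Q [b]" using gen_iff[OF gb] Q by blast
  then show False using X(3)[OF Q(1), of "[a]"] Q by simp
qed

text \<open>Let \<open>b\<close> in \<open>B\<close> witness a formula \<open>P\<close> over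
  \<open>cs\<close> without lying in \<open>cl X\<close>. Then \<open>P\<close> is large; as it does
  not isolate the type over \<open>cs\<close>, some large \<open>Q\<close> over \<open>cs\<close>
  fails somewhere on \<open>P\<close>. A witness in \<open>B\<close> of \<open>P\<close> and not
  \<open>Q\<close> is non-generic over \<open>cs\<close>, hence lies in \<open>cl X\<close>.\<close>

lemma elem_cl_Int:
  assumes B: "elem B" shows "elem (cl X \<inter> B)"
  unfolding elem_def
proof (intro conjI allI impI)
  show "cl X \<inter> B \<subseteq> U" using cl_U by blast
  fix P assume P: "Def (cl X \<inter> B) 1 P" "\<exists>a\<in>U. P [a]"
  obtain cs where cs: "set cs \<subseteq> cl X \<inter> B \<inter> U" "Def (set cs) 1 P" using Def_finite_base[OF P(1)] by blast
  have meet: "\<exists>b\<in>B. Q [b]" if "Def (set cs) 1 Q" "\<exists>a\<in>U. Q [a]" for Q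
  proof -
    have "Def B 1 Q" by (rule Def_mono[OF that(1)]) (use cs in auto)
    then show ?thesis using B that(2) unfolding elem_def by blast
  qed
  obtain b where b: "b \<in> B" "P [b]" using meet[OF cs(2) P(2)] by blast
  show "\<exists>a\<in>cl X \<inter> B. P [a]"
  proof (cases "b \<in> cl X")
    case False
    then have "gen X b" using b elem_U[OF B] by (auto simp: cl_def)
    then have "gen (cl X \<union> X) b" using gen_closure by blast
    then have "gen (set cs) b" using gen_mono cs by blast
    then have "lg P" using gen_iff cs b by blast
    then obtain Q where Q: "Def (set cs) 1 Q" "lg Q" "\<exists>a\<in>U. P [a] \<and> \<not> Q [a]"
      using not_isolated[OF finite_set _ cs(2)] cs(1) by auto
    have "Def (set cs) 1 (\<lambda>x. P x \<and> \<not> Q x)" using Def_conj Def_not cs Q by blast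
    from meet[OF this] Q(3) obtain b' where b': "b' \<in> B" "P [b']" "\<not> Q [b']" by blast
    have "\<not> gen (set cs) b'" using gen_iff Q b' by blast
    then have "b' \<in> cl (set cs)" using b' elem_U[OF B] by (auto simp: cl_def)
    then have "b' \<in> cl X" using cl_subset[of "set cs" X] cs by blast
    then show ?thesis using b' by blast
  qed (use b in blast)
qed

end

section \<open>Prime models over Morley sequences\<close>

context regular_type
begin

lemma cl_finite_set:
  assumes "finite S" "S \<subseteq> cl X" shows "\<exists>F. finite F \<and> F \<subseteq> X \<and> S \<subseteq> cl F"
  using assms
proof (induction S rule: finite_induct)
  case (insert s S)
  then obtain F where F: "finite F" "F \<subseteq> X" "S \<subseteq> cl F" by auto
  obtain G where G: "finite G" "G \<subseteq> X" "s \<in> cl G"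
    by (rule cl_finite_char[of s X]) (use insert.prems in auto)
  have "insert s S \<subseteq> cl (F \<union> G)" using F G cl_mono[of F "F \<union> G"] cl_mono[of G "F \<union> G"] by blast
  then show ?case using F G by (intro exI[of _ "F \<union> G"]) auto
qed auto

lemma mor_closure: "mor C js \<Longrightarrow> A \<subseteq> cl C \<Longrightarrow> mor (A \<union> C) js"
proof (induction js arbitrary: C)
  case (Cons j js)
  have "gen (A \<union> C) j" using Cons.prems gen_closure by auto
  moreover have "A \<subseteq> cl (insert j C)" using Cons.prems cl_mono[of C "insert j C"] by blast
  then have "mor (A \<union> insert j C) js" using Cons.IH[of "insert j C"] Cons.prems(1) by simp
  ultimately show ?case by simp
qed simp

lemma mor_Def_iff:
  assumes "Def A m T" "mor A js" "mor A js'" "length js = m" "length js' = m"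
  shows "T js \<longleftrightarrow> T js'"
proof -
  obtain cs Q where cs: "set cs \<subseteq> A \<inter> U" "Def {} (m + length cs) Q" "\<And>xs. xs \<in> Tp m \<Longrightarrow> T xs = Q (xs @ cs)"
    using Def_emptyE[OF assms(1)] by blast
  have "eqv (cs @ js) (cs @ js')"
    by (rule mor_unique) (use cs mor_mono[OF assms(2)] mor_mono[OF assms(3)] assms(4,5) in \<open>auto intro: eqv_refl\<close>)
  from eqv_map_zip[OF this, of "zip (js @ cs) (js' @ cs)"] have "eqv (js @ cs) (js' @ cs)"
    using assms(4,5) by auto
  then have "Q (js @ cs) \<longleftrightarrow> Q (js' @ cs)" using eqvD cs(2) assms(4) by simp
  then show ?thesis using cs(3) mor_U[OF assms(2)] mor_U[OF assms(3)] assms(4,5) by (simp add: tuples_def)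
qed

lemma Def_params_iso:
  assumes "iso (A \<union> set js) bs" "set js \<subseteq> U" "n = length bs"
  shows "\<exists>Z. Def A (n + length js) Z \<and> Z (bs @ js) \<and>
     (\<forall>Q. Def (A \<union> set js) n Q \<longrightarrow> Q bs \<longrightarrow> (\<forall>ys\<in>Tp n. Z (ys @ js) \<longrightarrow> Q ys))"
proof -
  have bs: "bs \<in> Tp n" using iso_U assms by (auto simp: tuples_def)
  obtain X where X: "Def (A \<union> set js) n X" "X bs" 
    "\<And>Q ys. Def (A \<union> set js) n Q \<Longrightarrow> Q bs \<Longrightarrow> ys \<in> Tp n \<Longrightarrow> X ys \<Longrightarrow> Q ys"
    using isoE[OF assms(1)] unfolding assms(3) by blast
  obtain Z where Z: "Def A (n + length js) Z" "\<And>xs. xs \<in> Tp n \<Longrightarrow> X xs = Z (xs @ js)"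
    using Def_params[OF X(1) assms(2)] by blast
  show ?thesis by (intro exI[of _ Z] conjI allI impI ballI) (use X Z bs in auto)
qed

text \<open>The generic specialisation \<open>R\<close> of the formula \<open>Z\<close> isolating \<open>bs\<close> over \<open>A\<close> and \<open>js\<close> isolates \<open>bs\<close> over \<open>A\<close>.\<close>

lemma iso_mor_cancel:
  assumes A: "finite A" "A \<subseteq> U" and "iso (A \<union> set js) bs" and mor: "mor (A \<union> set bs) js"
  shows "iso A bs"
proof -
  let ?n = "length bs" and ?m = "length js"
  have U: "set bs \<subseteq> U" "set js \<subseteq> U" using iso_U[OF assms(3)] mor_U[OF mor] by auto
  have bs: "bs \<in> Tp ?n" using U by (auto simp: tuples_def)
  obtain Z where Z: "Def A (?n + ?m) Z" "Z (bs @ js)"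
     "\<And>Q ys. Def (A \<union> set js) ?n Q \<Longrightarrow> Q bs \<Longrightarrow> ys \<in> Tp ?n \<Longrightarrow> Z (ys @ js) \<Longrightarrow> Q ys"
    using Def_params_iso[OF assms(3) U(2) refl] by metis
  have "Def A (?m + ?n) (\<lambda>ws. Z (drop ?m ws @ take ?m ws))"
    by (rule Def_sub[OF Z(1)], (rule refl Rix_intros | simp)+)
  from Def_generic_tuple[OF this] obtain R where R: "Def A ?n R" 
     "\<And>c xs. c \<in> Tp ?n \<Longrightarrow> length xs = ?m \<Longrightarrow> mor (A \<union> set c) xs \<Longrightarrow> R c \<longleftrightarrow> Z (c @ xs)" by auto
  show ?thesis
  proof (rule isoI[OF U(1) R(1)])
    show "R bs" using R(2)[OF bs refl mor] Z(2) by simp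
    fix Q ys assume Q: "Def A ?n Q" "Q bs" "ys \<in> Tp ?n" "R ys"
    have "finite (A \<union> set ys)" "A \<union> set ys \<subseteq> U" using A tuplesD[OF Q(3)] by auto
    then obtain js' where js': "length js' = ?m" "mor (A \<union> set ys) js'" using ex_mor by blast
    \<comment> \<open>\<open>js'\<close> is generic over \<open>ys\<close>, so \<open>R ys\<close>
      becomes \<open>Z (ys @ js')\<close>. As \<open>js\<close> and \<open>js'\<close> have the same
      type over \<open>A\<close>, the implication from \<open>Z\<close> to \<open>Q\<close> passes
      from \<open>js\<close> to \<open>js'\<close>.\<close>
    let ?T = "\<lambda>us. \<forall>zs\<in>Tp ?n. Z (zs @ us) \<longrightarrow> Q zs"
    have "Def A ?m ?T"
      apply (intro Def_all Def_imp)
       apply (rule Def_sub[OF Z(1)], (rule refl Rix_intros | simp)+)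
      apply (rule Def_sub[OF Q(1)], (rule refl Rix_intros | simp)+)
      done
    then have "?T js \<longleftrightarrow> ?T js'"
      by (rule mor_Def_iff) (use mor_mono[OF mor] mor_mono[OF js'(2)] js'(1) in auto)
    moreover have "?T js" using Z(3)[of Q] Def_mono[OF Q(1)] Q(2) by blast
    moreover have "Z (ys @ js')" using R(2)[OF Q(3) js'] Q(4) by simp
    ultimately show "Q ys" using Q(3) by blast
  qed simp
qed

text \<open>The isolating set is \<open>?W\<close>: \<open>x\<close> satisfies the formula
  \<open>Z\<close> isolating \<open>y\<close>, read backwards, and the instance of \<open>Z\<close>
  at \<open>x\<close> is small. Smallness puts \<open>y\<close> into \<open>cl (insert x A)\<close>,
  which forces \<open>x\<close> to be generic over \<open>A\<close>, for otherwise \<open>y\<close>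
  would stay generic. Hence \<open>x\<close> and \<open>e\<close> have the same type over
  \<open>A\<close>, and the implications of \<open>Z\<close> carry over.\<close>

lemma iso_exchange:
  assumes iso: "iso (insert e A) [y]" and y: "y \<in> cl (insert e A)" "gen A y" and e: "e \<in> U"
  shows "iso (insert y A) [e]"
proof -
  have yU: "y \<in> U" using y gen_U by auto
  have "iso (A \<union> set [e]) [y]" using iso by simp
  then obtain Z where Z: "Def A 2 Z" "Z [y, e]"
     "\<And>Q z. Def (insert e A) 1 Q \<Longrightarrow> Q [y] \<Longrightarrow> z \<in> U \<Longrightarrow> Z [z, e] \<Longrightarrow> Q [z]"
    using Def_params_iso[of A "[e]" "[y]" 1] e by (fastforce simp: numeral_2_eq_2)
  have fib: "Def (insert x A) 1 (\<lambda>z. Z (z @ [x]))" if "x \<in> U" for x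
    using Def_param_fiber[of A 1 "[x]" Z] Z(1) that by (simp add: numeral_2_eq_2)
  have nl: "\<not> lg (\<lambda>z. Z (z @ [e]))"
  proof
    assume L: "lg (\<lambda>z. Z (z @ [e]))"
    obtain P where P: "Def (insert e A) 1 P" "lg P" "\<not> P [y]" using y(1) yU by (auto simp: cl_def generic_def)
    obtain z where "z \<in> U" "Z [z, e]" "P [z]" using lg_nonempty[OF lg_conj[OF L P(2)]] by auto
    then show False using Z(3)[OF Def_not[OF P(1)]] P(3) by blast
  qed
  let ?W = "\<lambda>x. Z (y # x) \<and> \<not> lg (\<lambda>z. Z (z @ x))"
  show ?thesis
  proof (rule isoI[where X = ?W and n = 1])
    show "set [e] \<subseteq> U" using e by simp
    have "Def (A \<union> set [y]) 1 (\<lambda>x. Z ([y] @ x))" by (rule Def_param_left) (use Z(1) yU in \<open>simp_all add: numeral_2_eq_2\<close>)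
    moreover have "Def (A \<union> set [y]) 1 (\<lambda>x. \<not> lg (\<lambda>z. Z (z @ x)))" 
      by (rule Def_not, rule Def_mono[OF Def_lg]) (use Z(1) in \<open>auto simp: numeral_2_eq_2\<close>)
    ultimately show "Def (insert y A) 1 ?W" using Def_conj by simp
    show "?W [e]" using Z(2) nl by simp
    have gen_of: "gen A x" if "x \<in> U" "y \<in> cl (insert x A)" for x
    proof (rule ccontr)
      assume "\<not> gen A x"
      then have "{x} \<subseteq> cl A" using that by (auto simp: cl_def)
      from gen_closure[OF this y(2)] show False using that(2) by (simp add: cl_def)
    qed
    fix Q ys assume Q: "Def (insert y A) 1 Q" "Q [e]" "ys \<in> Tp 1" "?W ys"
    then obtain x where x: "x \<in> U" "ys = [x]" using tuples_1E by blast
    have "y \<in> cl (insert x A)" using gen_iff[OF _ fib[OF x(1)], of y] Q(4) x yU by (auto simp: cl_def)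
    then have m: "mor A [e]" "mor A [x]" using gen_of e x y by auto
    obtain Q' where Q': "Def A (1 + length [y]) Q'" "\<And>xs. xs \<in> Tp 1 \<Longrightarrow> Q xs = Q' (xs @ [y])"
      using Def_params[of A "[y]" 1 Q] Q(1) yU by auto
    let ?T = "\<lambda>x. \<forall>z\<in>Tp 1. Z (z @ x) \<longrightarrow> Q' (x @ z)"
    have "Def A 1 ?T"
      apply (intro Def_all Def_imp)
       apply (rule Def_sub[OF Z(1)], (rule refl Rix_intros | simp add: numeral_2_eq_2)+)
      apply (rule Def_sub[OF Q'(1)], (rule refl Rix_intros | simp)+)
      done
    then have "?T [e] \<longleftrightarrow> ?T [x]" by (rule mor_Def_iff) (use m in auto)
    moreover have "?T [e]"
    proof
      fix zs assume "zs \<in> Tp 1"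
      then obtain z where z: "z \<in> U" "zs = [z]" using tuples_1E by blast
      have D: "Def (insert e A) 1 (\<lambda>z. Q' ([e] @ z))" 
        using Def_param_left[of A "[e]" 1 Q'] Q'(1) e by simp
      have "Q' ([e] @ [y])" using Q'(2)[of "[e]"] Q(2) e by simp
      then show "Z (zs @ [e]) \<longrightarrow> Q' ([e] @ zs)" using Z(3)[OF D _ z(1)] z(2) by simp
    qed
    ultimately have "Q' ([x] @ [y])" using Q(4) x yU by (auto simp: tuples_1)
    then show "Q ys" using Q'(2)[of "[x]"] x by simp
  qed simp
qed

text \<open>The Steinitz exchange, performed so that \<open>ts\<close> remains isolated over the
  current basis: \<open>iso_exchange\<close> keeps the discarded element isolated over the new
  basis, and \<open>iso_join\<close> restores the rest.\<close>

lemma iso_basis_exchange: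
  assumes "finite Z" "indep Z" "iso Z ts" "set ts \<subseteq> cl Z" "Z \<subseteq> set ts" "indep Y" "Y \<subseteq> set ts"
  shows "\<exists>Z'. finite Z' \<and> indep Z' \<and> Y \<subseteq> Z' \<and> iso Z' ts"
  using assms(1-5)
proof (induction "card (Y - Z)" arbitrary: Z rule: less_induct)
  case less
  have finY: "finite Y" using assms(7) finite_subset by auto
  show ?case
  proof (cases "Y \<subseteq> Z")
    case False
    then obtain y where y: "y \<in> Y" "y \<notin> Z" by blast
    have yU: "y \<in> U" using y assms(6) by (auto simp: indep_def)
    have ycl: "y \<in> cl Z" using y assms(7) less.prems by blast
    have "gen (Y \<inter> Z) y" using indep_gen[OF assms(6) y(1)] y by auto
    \<comment> \<open>Otherwise the elements of \<open>Z - Y\<close> could be removed one by one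
      with \<open>y\<close> staying in the closure, until \<open>y\<close> lies in the closure of
      \<open>Y \<inter> Z\<close>, over which it is generic.\<close>
    have "\<exists>e\<in>Z - Y. gen (Z - {e}) y"
    proof (rule ccontr)
      assume n: "\<not> ?thesis"
      have "F \<subseteq> Z - Y \<Longrightarrow> y \<in> cl (Z - F)" if "finite F" for F
        using that
      proof (induction F rule: finite_induct)
        case (insert e F)
        show ?case
        proof (rule ccontr)
          assume a: "y \<notin> cl (Z - insert e F)"
          have "insert e (Z - insert e F) = Z - F" using insert by auto
          then have "y \<in> cl (insert e (Z - insert e F))" using insert by simp
          then have "e \<in> cl (insert y (Z - insert e F))" 
            using cl_exchange[of y e "Z - insert e F"] a insert.prems less.prems(2) by (auto simp: indep_def)
          then have "e \<in> cl (insert y (Z - {e}))" using cl_mono[of "insert y (Z - insert e F)" "insert y (Z - {e})"] by blast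
          moreover have "insert y (Z - {e}) \<subseteq> cl (Z - {e})"
            using n insert.prems yU less.prems(2) cl_superset[of "Z - {e}"] by (auto simp: indep_def cl_def)
          ultimately have "e \<in> cl (Z - {e})" using cl_subset by blast
          then show False using less.prems(2) insert.prems by (auto simp: indep_def cl_def)
        qed
      qed (use ycl in simp)
      from this[of "Z - Y"] have "y \<in> cl (Z - (Z - Y))" using less.prems(1) by auto
      moreover have "Z - (Z - Y) = Y \<inter> Z" by auto
      ultimately show False using \<open>gen (Y \<inter> Z) y\<close> by (auto simp: cl_def)
    qed
    then obtain e where e: "e \<in> Z" "e \<notin> Y" "gen (Z - {e}) y" by blast
    let ?A = "Z - {e}" and ?Z = "insert y (Z - {e})"
    have Z: "insert e ?A = Z" using e by auto
    have eU: "e \<in> U" using e less.prems by (auto simp: indep_def)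
    have tsZ: "iso Z ([y] @ ts)" using iso_subset[OF less.prems(3)] y assms(7) by auto
    have "iso Z [y]" using iso_subset[OF tsZ] by auto
    then have "iso ?Z [e]" using iso_exchange[of e ?A y] Z ycl e eU by simp
    moreover have "?Z \<union> set [e] = Z \<union> set [y]" using e by auto
    then have "iso (?Z \<union> set [e]) ts" using iso_append[OF tsZ] by simp
    ultimately have "iso ?Z ([e] @ ts)" by (rule iso_join)
    then have ts: "iso ?Z ts" by (rule iso_subset) auto
    have "e \<in> cl ?Z" using cl_exchange[of y e ?A] Z ycl e eU by (auto simp: cl_def)
    moreover have "?Z \<subseteq> cl ?Z" by (rule cl_superset) (use less.prems(2) yU in \<open>auto simp: indep_def\<close>)
    ultimately have "Z \<subseteq> cl ?Z" using Z by blast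
    then have "set ts \<subseteq> cl ?Z" using less.prems(4) cl_subset by blast
    moreover have "indep ?Z" using indep_insert[OF indep_mono[OF less.prems(2)] e(3)] by blast
    moreover have "card (Y - ?Z) < card (Y - Z)" using y e finY by (intro psubset_card_mono) auto
    moreover have "?Z \<subseteq> set ts" using less.prems(5) y assms(7) by blast
    ultimately show ?thesis using less.hyps[of ?Z] ts less.prems(1) by blast
  qed (use less.prems in blast)
qed

section \<open>Good submodels and their relation to primeness\<close>

definition good :: "'a set \<Rightarrow> bool" where
  "good B \<longleftrightarrow> elem B \<and> 
     (\<forall>Y bs. finite Y \<longrightarrow> Y \<subseteq> B \<longrightarrow> indep Y \<longrightarrow> set bs \<subseteq> cl Y \<inter> B \<longrightarrow> iso Y bs) \<and>
     (\<forall>Y. finite Y \<longrightarrow> Y \<subseteq> B \<longrightarrow> countable (cl Y \<inter> B))"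

lemma good_elem: "good B \<Longrightarrow> elem B" by (simp add: good_def)
lemma good_iso: "good B \<Longrightarrow> finite Y \<Longrightarrow> Y \<subseteq> B \<Longrightarrow> indep Y \<Longrightarrow> set bs \<subseteq> cl Y \<inter> B \<Longrightarrow> iso Y bs"
  by (simp add: good_def)
lemma good_countable: "good B \<Longrightarrow> finite Y \<Longrightarrow> Y \<subseteq> B \<Longrightarrow> countable (cl Y \<inter> B)"
  by (simp add: good_def)

lemma good_cl_Int: "good B \<Longrightarrow> good (cl X \<inter> B)"
proof -
  assume B: "good B"
  have "countable (cl Y \<inter> (cl X \<inter> B))" if "finite Y" "Y \<subseteq> cl X \<inter> B" for Y
    by (rule countable_subset[OF _ good_countable[OF B that(1)]]) (use that in auto)
  then show ?thesis using elem_cl_Int[OF good_elem[OF B]] good_iso[OF B] unfolding good_def by auto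
qed

text \<open>\<open>Y\<close> need not be part of \<open>I\<close>. A finite
  \<open>?J \<subseteq> I\<close> spans and isolates \<open>ys @ bs\<close>, and \<open>?J\<close>
  can be exchanged for a basis containing \<open>Y\<close>. The members of that basis outside
  \<open>Y\<close> are generic over \<open>Y\<close> and \<open>bs\<close>, so they can be
  cancelled.\<close>

lemma atomic_imp_iso_over_indep:
  assumes B: "B \<subseteq> U" "atomic I B" "indep I" and Y: "finite Y" "Y \<subseteq> B" "indep Y" "set bs \<subseteq> cl Y \<inter> B"
  shows "iso Y bs"
proof -
  obtain ys where ys: "set ys = Y" using finite_list Y(1) by blast
  have "b \<in> cl I" if "b \<in> B" for b
  proof -
    have "iso I [b]" using that B(2) unfolding atomic_def by auto
    then show ?thesis by (rule iso_imp_cl)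
  qed
  then have "set (ys @ bs) \<subseteq> cl I" using ys Y by auto
  from cl_finite_set[OF finite_set this] 
  obtain J where J: "finite J" "J \<subseteq> I" "set (ys @ bs) \<subseteq> cl J" by (elim exE conjE) (rule that)
  have "iso I (ys @ bs)" using B(2) ys Y unfolding atomic_def by auto
  then obtain cs where cs': "set cs \<subseteq> I" "\<forall>A'. set cs \<subseteq> A' \<longrightarrow> A' \<subseteq> I \<longrightarrow> iso A' (ys @ bs)"
    using iso_finite_base by blast
  have cs: "set cs \<subseteq> I" "iso (J \<union> set cs) (ys @ bs)" using cs'(2)[rule_format, of "J \<union> set cs"] cs'(1) J(2) by auto
  let ?J = "J \<union> set cs"
  obtain js where js: "set js = ?J" using finite_list J by (metis finite_UnI finite_set)
  have JU: "?J \<subseteq> U" using J cs assms(3) by (auto simp: indep_def)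
  let ?ts = "(ys @ bs) @ js"
  have "iso ?J ?ts" by (rule iso_params[OF cs(2)]) (use js JU in auto)
  moreover have "set ?ts \<subseteq> cl ?J" using J(3) cl_mono[of J ?J] cl_superset[OF JU] js by auto
  moreover have "indep ?J" using indep_mono[OF assms(3)] J cs by auto
  ultimately obtain Z where Z: "finite Z" "indep Z" "Y \<subseteq> Z" "iso Z ?ts"
    using iso_basis_exchange[of ?J ?ts Y] Y js ys J by auto
  obtain zs where zs: "set zs = Z - Y" "distinct zs" using finite_distinct_list[of "Z - Y"] Z by auto
  have "mor Y zs" by (rule indep_mor[OF Z(2) Z(3) zs(2)]) (use zs in auto)
  then have "mor (set bs \<union> Y) zs" by (rule mor_closure) (use Y in auto)
  moreover have "iso (Y \<union> set zs) bs" using iso_subset[OF Z(4)] zs Z(3) by (auto simp: Un_absorb1)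
  moreover have "Y \<subseteq> U" using Y(3) by (simp add: indep_def)
  ultimately show ?thesis using iso_mor_cancel[OF Y(1)] by (simp add: Un_commute)
qed

text \<open>The elements \<open>js\<close> of \<open>I - Y\<close> used to isolate \<open>b\<close>
  over \<open>M\<close> are generic over \<open>M\<close> and \<open>b\<close>. The generic
  specialisation of the isolating formula therefore holds at \<open>b\<close> and has a solution
  \<open>b'\<close> in \<open>M\<close>, over which \<open>js\<close> is generic as well. So
  \<open>b'\<close> satisfies the isolating formula, and since that formula decides equality with
  \<open>b'\<close>, the two points coincide.\<close>

lemma closure_in_atomic_model:
  assumes I: "indep I" "Y \<subseteq> I" and M: "elem M" "Y \<subseteq> M" "M \<subseteq> cl Y" and b: "iso (M \<union> (I - Y)) [b]" "b \<in> cl Y"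
  shows "b \<in> M"
proof -
  have bU: "b \<in> U" using b cl_U by auto
  obtain cs where cs': "set cs \<subseteq> M \<union> (I - Y)" "\<forall>A'. set cs \<subseteq> A' \<longrightarrow> A' \<subseteq> M \<union> (I - Y) \<longrightarrow> iso A' [b]"
    using iso_finite_base[OF b(1)] by blast
  have cs: "set cs \<subseteq> M \<union> (I - Y)" "iso (M \<union> (set cs \<inter> (I - Y))) [b]"
    using cs'(2)[rule_format, of "M \<union> (set cs \<inter> (I - Y))"] cs'(1) by auto
  obtain js where js: "set js = set cs \<inter> (I - Y)" "distinct js" using finite_distinct_list[of "set cs \<inter> (I - Y)"] by auto
  have "mor Y js" by (rule indep_mor[OF I js(2)]) (use js in auto)
  then have "mor (insert b M \<union> Y) js" by (rule mor_closure) (use M b in auto)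
  then have mor: "mor (M \<union> set [b]) js" by (rule mor_mono) auto
  have mor': "mor (M \<union> set [b']) js" if "b' \<in> M" for b' by (rule mor_mono[OF mor]) (use that in auto)
  have "iso (M \<union> set js) [b]" using cs js by simp
  then obtain Z where Z: "Def M (1 + length js) Z" "Z ([b] @ js)"
     "\<And>Q ys. Def (M \<union> set js) 1 Q \<Longrightarrow> Q [b] \<Longrightarrow> ys \<in> Tp 1 \<Longrightarrow> Z (ys @ js) \<Longrightarrow> Q ys"
    using Def_params_iso[of M js "[b]" 1] mor_U[OF mor] by auto
  have "Def M (length js + 1) (\<lambda>ws. Z (drop (length js) ws @ take (length js) ws))"
    by (rule Def_sub[OF Z(1)], (rule refl Rix_intros | simp)+)
  from Def_generic_tuple[OF this] obtain R where R: "Def M 1 R" 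
     "\<And>c xs. c \<in> Tp 1 \<Longrightarrow> length xs = length js \<Longrightarrow> mor (M \<union> set c) xs \<Longrightarrow> R c \<longleftrightarrow> Z (c @ xs)" by auto
  have "R [b]" using R(2)[of "[b]" js] mor Z(2) bU by simp
  then obtain b' where b': "b' \<in> M" "R [b']" using M(1) R(1) bU unfolding elem_def by blast
  have b'U: "b' \<in> U" using b' elem_U[OF M(1)] by auto
  have Zb': "Z ([b'] @ js)" using R(2)[of "[b']" js] mor'[OF b'(1)] b' b'U by simp
  have D: "Def (M \<union> set js) 1 (\<lambda>x. \<not> x ! 0 = b')"
    by (rule Def_not, rule Def_eq, (rule refl Rix_intros | use b' b'U in simp)+)
  have "b = b'" using Z(3)[OF D, of "[b']"] Zb' b'U by auto
  then show ?thesis using b' by simp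
qed

lemma el_gen_iff:
  assumes "el R" "Id_on Y \<subseteq> R" "W \<subseteq> Y" "(a, b) \<in> R" shows "gen W a \<longleftrightarrow> gen W b"
proof -
  have W: "W \<subseteq> R `` W" "W \<subseteq> R\<inverse> `` W" "W \<subseteq> Domain R" "W \<subseteq> Domain (R\<inverse>)" using assms(2,3) by auto
  show ?thesis
    using gen_mono[OF gen_el[OF assms(1) W(3) assms(4)] W(1)]
      gen_mono[OF gen_el[OF el_converse[OF assms(1)] W(4), of b a] W(2)] assms(4) by blast
qed

definition prime_model :: "'a set \<Rightarrow> 'a set \<Rightarrow> bool" where
  "prime_model I B \<longleftrightarrow> elem B \<and> I \<subseteq> B \<and> 
     (\<forall>N. elem N \<and> I \<subseteq> N \<longrightarrow> (\<exists>e. el e \<and> Domain e = B \<and> Range e \<subseteq> N \<and> Id_on I \<subseteq> e))"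

text \<open>Primeness embeds \<open>B\<close> over \<open>I\<close> into an atomic model, and
  isolation is pulled back along the embedding.\<close>

lemma prime_atomic:
  assumes "prime_model I B" shows "atomic I B"
  unfolding atomic_def
proof (intro allI impI)
  fix bs assume bs: "set bs \<subseteq> B"
  have "I \<subseteq> U" using assms elem_U unfolding prime_model_def by blast
  then obtain N where N: "I \<subseteq> N" "elem N" "atomic I N" using ex_atomic_model[OF _ elem_UNIV] by metis
  then obtain e where e: "el e" "Domain e = B" "Range e \<subseteq> N" "Id_on I \<subseteq> e"
    using assms unfolding prime_model_def by blast
  obtain ns where ns: "length ns = length bs" "set (zip bs ns) \<subseteq> e" "set ns \<subseteq> e `` B"
    by (rule image_list[of B e bs]) (use e bs in auto)
  have "set ns \<subseteq> N" using ns(3) e(3) by blast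
  then have "iso I ns" using N(3) by (simp add: atomic_def)
  moreover have "set (zip ns bs) \<subseteq> e\<inverse>" using ns(2) by (auto simp: set_zip)
  ultimately have "iso (e\<inverse> `` I) bs" 
    using iso_transfer[OF el_converse[OF e(1)], of I ns bs] e(4) ns(1) by auto
  moreover have "e\<inverse> `` I = I" using e(4) el_eq_iff[OF e(1)] by fastforce
  ultimately show "iso I bs" by simp
qed

lemma prime_subset_cl:
  assumes "prime_model I B" shows "B \<subseteq> cl I"
proof
  fix b assume "b \<in> B"
  then have "iso I [b]" using prime_atomic[OF assms] unfolding atomic_def by auto
  then show "b \<in> cl I" by (rule iso_imp_cl)
qed

text \<open>Take a countable elementary \<open>M\<close> between \<open>Y\<close> and
  \<open>cl Y\<close>, and \<open>N\<close> atomic over \<open>M\<close> and \<open>I - Y\<close>.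
  An embedding of \<open>B\<close> into \<open>N\<close> over \<open>I\<close> preserves
  \<open>cl Y\<close>, and \<open>closure_in_atomic_model\<close> places the image of
  \<open>cl Y \<inter> B\<close> inside \<open>M\<close>.\<close>

lemma prime_countable_cl:
  assumes B: "prime_model I B" and I: "indep I" and Y: "finite Y" "Y \<subseteq> I"
  shows "countable (cl Y \<inter> B)"
proof -
  have YU: "Y \<subseteq> U" "I \<subseteq> U" using I Y by (auto simp: indep_def)
  have E: "elem (cl Y)" using elem_cl_Int[OF elem_UNIV, of Y] cl_U by (metis Int_absorb2)
  obtain M where M: "countable M" "Y \<subseteq> M" "M \<subseteq> cl Y" "elem M"
    by (rule lowenheim_skolem[OF E cl_superset[OF YU(1)] countable_finite[OF Y(1)]])
  have "M \<union> (I - Y) \<subseteq> U" using M(3) cl_U YU by blast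
  then obtain N where N: "M \<union> (I - Y) \<subseteq> N" "elem N" "atomic (M \<union> (I - Y)) N" 
    using ex_atomic_model[OF _ elem_UNIV] by metis
  then have "I \<subseteq> N" using M(2) by blast
  then obtain e where e: "el e" "Domain e = B" "Range e \<subseteq> N" "Id_on I \<subseteq> e"
    using B N(2) unfolding prime_model_def by blast
  have im: "\<forall>b\<in>cl Y \<inter> B. \<exists>n. (b, n) \<in> e \<and> n \<in> M"
  proof
    fix b assume b: "b \<in> cl Y \<inter> B"
    then obtain n where n: "(b, n) \<in> e" using e(2) by blast
    have nN: "n \<in> N" using n e(3) by blast
    have "n \<in> cl Y" using el_gen_iff[OF e(1,4) Y(2) n] b el_U[OF e(1)] n by (auto simp: cl_def)
    moreover have "iso (M \<union> (I - Y)) [n]" using N(3) nN unfolding atomic_def by auto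
    ultimately have "n \<in> M" using closure_in_atomic_model[OF I Y(2) M(4,2,3)] by blast
    then show "\<exists>n. (b, n) \<in> e \<and> n \<in> M" using n by blast
  qed
  from bchoice[OF im] obtain f where f: "\<forall>b\<in>cl Y \<inter> B. (b, f b) \<in> e \<and> f b \<in> M" ..
  then have "inj_on f (cl Y \<inter> B)" using el_eq_iff[OF e(1)] by (intro inj_onI) metis
  moreover have "countable (f ` (cl Y \<inter> B))" by (rule countable_subset[OF _ M(1)]) (use f in auto)
  ultimately show ?thesis by (rule countable_image_inj_on[rotated])
qed

lemma prime_good:
  assumes B: "prime_model I B" and I: "indep I" shows "good B"
  unfolding good_def
proof (intro conjI allI impI)
  show E: "elem B" using B by (simp add: prime_model_def)
  fix Y
  show "iso Y bs" if "finite Y" "Y \<subseteq> B" "indep Y" "set bs \<subseteq> cl Y \<inter> B" for bs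
    using atomic_imp_iso_over_indep[OF elem_U[OF E] prime_atomic[OF B] I that] .
  assume Y: "finite Y" "Y \<subseteq> B"
  have "Y \<subseteq> cl I" using Y prime_subset_cl[OF B] by blast
  from cl_finite_set[OF Y(1) this] obtain J where J: "finite J" "J \<subseteq> I" "Y \<subseteq> cl J" by (elim exE conjE) (rule that)
  have "cl Y \<inter> B \<subseteq> cl J \<inter> B" using cl_subset[OF J(3)] by blast
  then show "countable (cl Y \<inter> B)" using prime_countable_cl[OF B I J(1,2)] countable_subset by blast
qed

end

section \<open>Atomicity over unions of closed sets\<close>

context regular_type
begin

text \<open>Two countable models atomic over \<open>Y\<close> are isomorphic over \<open>Y\<close>, and such an isomorphism respects the
  closures of subsets of \<open>Y\<close>.\<close>

lemma iso_over_closures_finite: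
  assumes B: "good B" and Y: "finite Y" "Y \<subseteq> B" "indep Y" and W: "\<And>W. W \<in> \<W> \<Longrightarrow> W \<subseteq> Y"
    and bs: "set bs \<subseteq> cl Y \<inter> B"
  shows "iso (Y \<union> (\<Union>W\<in>\<W>. cl W \<inter> B)) bs"
proof -
  let ?E = "cl Y \<inter> B" and ?D = "\<Union>W\<in>\<W>. cl W \<inter> B"
  have YU: "Y \<subseteq> U" using Y(3) by (simp add: indep_def)
  have E: "elem ?E" by (rule elem_cl_Int[OF good_elem[OF B]])
  have YE: "Y \<subseteq> ?E" using cl_superset[OF YU] Y(2) by blast
  have DE: "?D \<subseteq> ?E" using cl_mono[OF W] by blast
  have "Y \<union> ?D \<subseteq> ?E" using YE DE by blast
  \<comment> \<open>\<open>N\<close> is taken inside \<open>?E\<close>, hence is itself countable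
    and atomic over \<open>Y\<close>. An isomorphism from \<open>N\<close> onto \<open>?E\<close>
    over \<open>Y\<close> carries atomicity over \<open>Y \<union> ?D\<close> to \<open>?E\<close>,
    provided it preserves \<open>?D\<close>.\<close>
  from ex_atomic_model[OF this E] obtain N where 
    N: "Y \<union> ?D \<subseteq> N" "N \<subseteq> ?E" "elem N" "atomic (Y \<union> ?D) N" by metis
  have at: "iso Y xs" if "set xs \<subseteq> ?E" for xs using good_iso[OF B Y that] .
  have cE: "countable ?E" by (rule good_countable[OF B Y(1,2)])
  have "\<exists>R'. Id_on Y \<subseteq> R' \<and> R' \<subseteq> Id_on Y \<union> (N \<union> N) \<times> ?E \<and> el R' \<and> N \<subseteq> Domain R' \<and> ?E \<subseteq> Range R'"
  proof (rule back_and_forth[OF el_Id_on[OF YU]])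
    show "Range (Id_on Y) \<subseteq> ?E" "elem ?E" "countable ?E" "?E \<subseteq> ?E" using YE E cE by auto
    show "countable N" using cE N(2) countable_subset by blast
    show "iso (Domain (Id_on Y)) xs" if "set xs \<subseteq> N \<union> N" for xs using at N(2) that by auto
    show "elem N \<and> Domain (Id_on Y) \<subseteq> N \<and> N \<subseteq> N \<and> (\<forall>xs. set xs \<subseteq> ?E \<longrightarrow> iso (Range (Id_on Y)) xs)"
      using N at by auto
  qed
  then obtain R where R: "Id_on Y \<subseteq> R" "R \<subseteq> Id_on Y \<union> N \<times> ?E" "el R" "N \<subseteq> Domain R" "?E \<subseteq> Range R" by auto
  have RN: "R \<subseteq> N \<times> ?E" using R(2) YE N(1) by auto
  have clW: "a \<in> cl W \<longleftrightarrow> b \<in> cl W" if "(a, b) \<in> R" "W \<in> \<W>" for a b W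
    using el_gen_iff[OF R(3,1) W[OF that(2)] that(1)] el_U[OF R(3)] that(1) by (auto simp: cl_def)
  have YR: "R `` Y = Y" using R(1) el_eq_iff[OF R(3)] by fastforce
  have DR: "R `` ?D = ?D"
  proof (intro equalityI subsetI)
    fix b assume "b \<in> R `` ?D"
    then obtain a W where a: "(a, b) \<in> R" "W \<in> \<W>" "a \<in> cl W" by blast
    then show "b \<in> ?D" using clW[OF a(1,2)] RN by blast
  next
    fix b assume "b \<in> ?D"
    then obtain W where w: "W \<in> \<W>" "b \<in> cl W" "b \<in> B" by blast
    then have "b \<in> ?E" using DE by blast
    then obtain a where a: "(a, b) \<in> R" using R(5) by blast
    then have "a \<in> cl W \<inter> B" using clW[OF a w(1)] w RN N(2) by blast
    then show "b \<in> R `` ?D" using a w(1) by blast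
  qed
  have "set bs \<subseteq> R `` N" using bs R(5) RN by blast
  then obtain ns where ns: "length ns = length bs" "set (zip ns bs) \<subseteq> R" "set ns \<subseteq> N"
    by (rule preimage_list)
  have "iso (Y \<union> ?D) ns" using N(4) ns(3) by (simp add: atomic_def)
  moreover have "Y \<union> ?D \<subseteq> Domain R" using N(1) R(4) by blast
  ultimately have "iso (R `` (Y \<union> ?D)) bs" using iso_transfer[OF R(3) _ ns(2,1)] by blast
  then show ?thesis using YR DR by (simp add: Image_Un)
qed

text \<open>The last generic element is specialised first: its formula is large, so it has a
  solution in \<open>E\<close>. The earlier elements remain generic over that solution because it
  lies in \<open>cl {}\<close>.\<close>

lemma mor_meets_elem:
  assumes E: "elem E" "E \<subseteq> cl {}"
  shows "mor A ws \<Longrightarrow> Def A (length ws) P \<Longrightarrow> P ws \<Longrightarrow> \<exists>us. length us = length ws \<and> set us \<subseteq> E \<and> P us"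
proof (induction ws arbitrary: A P rule: rev_induct)
  case Nil
  then show ?case by (intro exI[of _ "[]"]) auto
next
  case (snoc w ws)
  have m: "mor A ws" "gen (A \<union> set ws) w" using snoc.prems by (auto simp: mor_append)
  have D: "Def (A \<union> set ws) 1 (\<lambda>x. P (ws @ x))"
    by (rule Def_param_left) (use snoc.prems mor_U[OF m(1)] in simp_all)
  have "P (ws @ [w])" using snoc.prems by simp
  then have "lg (\<lambda>x. P (ws @ x))" using gen_iff[OF m(2) D] by blast
  then obtain e where e: "e \<in> E" "P (ws @ [e])" using lg_meets_elem[OF E(1) Def_U[OF D]] by blast
  have eU: "e \<in> U" using e elem_U[OF E(1)] by blast
  have "{e} \<subseteq> cl A" using e E(2) cl_mono[of "{}" A] by blast
  then have m': "mor (A \<union> set [e]) ws" using mor_closure[OF m(1), of "{e}"] by (simp add: Un_commute)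
  have "Def (A \<union> set [e]) (length ws) (\<lambda>x. P (x @ [e]))"
    by (rule Def_param_fiber) (use snoc.prems eU in simp_all)
  from snoc.IH[OF m' this e(2)] obtain us where "length us = length ws" "set us \<subseteq> E" "P (us @ [e])" by blast
  then show ?case using e by (intro exI[of _ "us @ [e]"]) auto
qed

lemma cl_witness:
  assumes "b \<in> cl W" obtains P where "Def W 1 P" "lg P" "\<not> P [b]"
  using assms unfolding cl_def generic_def by blast

lemma cl_witnessI:
  assumes "Def W 1 P" "lg P" "\<not> P [b]" "b \<in> U" shows "b \<in> cl W"
  using assms unfolding cl_def generic_def by blast

text \<open>The set \<open>X\<close> isolating \<open>bs\<close> over a finite
  \<open>W \<subseteq> Z\<close> also isolates over \<open>Z\<close>. Its solutions lie in
  \<open>cl W\<close>, so the remaining elements of \<open>Z\<close> are generic over each of them,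
  and a formula over \<open>Z\<close> specialises to one over \<open>W\<close>.\<close>

lemma iso_over_indep:
  assumes B: "good B" and Z: "indep Z" "Z \<subseteq> B" and bs: "set bs \<subseteq> cl Z \<inter> B"
  shows "iso Z bs"
proof -
  have "set bs \<subseteq> cl Z" using bs by blast
  from cl_finite_set[OF finite_set this] obtain W where W: "finite W" "W \<subseteq> Z" "set bs \<subseteq> cl W" by (elim exE conjE) (rule that)
  let ?n = "length bs"
  have bsU: "set bs \<subseteq> U" using W(3) cl_U by blast
  have "iso W bs" by (rule good_iso[OF B W(1)]) (use W Z bs indep_mono[OF Z(1) W(2)] in auto)
  then obtain X where X: "Def W ?n X" "X bs" 
    "\<And>Q ys. Def W ?n Q \<Longrightarrow> Q bs \<Longrightarrow> ys \<in> Tp ?n \<Longrightarrow> X ys \<Longrightarrow> Q ys"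
    using isoE by blast
  \<comment> \<open>Non-genericity of a coordinate of \<open>bs\<close> over \<open>W\<close> is
    witnessed by one formula over \<open>W\<close>, which \<open>X\<close> decides.\<close>
  have Xcl: "set ys \<subseteq> cl W" if ys: "ys \<in> Tp ?n" "X ys" for ys
  proof
    fix y assume "y \<in> set ys"
    then obtain i where i: "i < ?n" "y = ys ! i" using ys by (metis in_set_conv_nth tuplesD(1))
    have "bs ! i \<in> cl W" using W(3) i by auto
    then obtain P where P: "Def W 1 P" "lg P" "\<not> P [bs ! i]" by (rule cl_witness)
    have D: "Def W ?n (\<lambda>zs. \<not> P [zs ! i])"
      by (rule Def_not, rule Def_sub[OF P(1)], (rule refl Rix_intros | use i in simp)+)
    have "\<not> P [ys ! i]" using X(3)[OF D P(3) ys] .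
    then show "y \<in> cl W" using cl_witnessI[OF P(1,2)] tuples_nth[OF ys(1) i(1)] i(2) by simp
  qed
  show ?thesis
  proof (rule isoI[OF bsU Def_mono[OF X(1) W(2)] X(2) refl])
    fix Q ys assume Q: "Def Z ?n Q" "Q bs" "ys \<in> Tp ?n" "X ys"
    obtain cs where cs: "set cs \<subseteq> Z \<inter> U" "Def (set cs) ?n Q" using Def_finite_base[OF Q(1)] by blast
    obtain ws where ws: "set ws = set cs - W" "distinct ws" using finite_distinct_list[of "set cs - W"] by auto
    have mW: "mor W ws" by (rule indep_mor[OF Z(1) W(2) ws(2)]) (use ws cs in auto)
    have mor: "mor (W \<union> set c) ws" if "set c \<subseteq> cl W" for c
      using mor_closure[OF mW that] by (simp add: Un_commute)
    have "Def (W \<union> set ws) ?n Q" by (rule Def_mono[OF cs(2)]) (use ws in auto)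
    from Def_params[OF this mor_U[OF mW]] obtain Q' where 
      Q': "Def W (?n + length ws) Q'" "\<And>xs. xs \<in> Tp ?n \<Longrightarrow> Q xs = Q' (xs @ ws)" by metis
    have "Def W (length ws + ?n) (\<lambda>us. Q' (drop (length ws) us @ take (length ws) us))"
      by (rule Def_sub[OF Q'(1)], (rule refl Rix_intros | simp)+)
    from Def_generic_tuple[OF this] obtain R where R: "Def W ?n R" 
       "\<And>c xs. c \<in> Tp ?n \<Longrightarrow> length xs = length ws \<Longrightarrow> mor (W \<union> set c) xs \<Longrightarrow> R c \<longleftrightarrow> Q' (c @ xs)" by auto
    have bsT: "bs \<in> Tp ?n" using bsU by (simp add: tuples_def)
    have "R bs" using R(2)[OF bsT refl mor[OF W(3)]] Q'(2)[OF bsT] Q(2) by simp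
    then have "R ys" using X(3)[OF R(1) _ Q(3,4)] by blast
    then show "Q ys" using R(2)[OF Q(3) refl mor[OF Xcl[OF Q(3,4)]]] Q'(2)[OF Q(3)] by simp
  qed
qed

text \<open>A formula over \<open>Z\<close> and the closures that split the type isolated over a finite part \<open>W\<close> of \<open>Z\<close>
  could be moved, by specialising the elements of \<open>Z\<close> outside \<open>W\<close> to \<open>cl {}\<close>, into one over the parameters
  already used.\<close>

lemma iso_over_closures:
  assumes B: "good B" and Z: "indep Z" "Z \<subseteq> B" and Y: "\<And>Y. Y \<in> \<Y> \<Longrightarrow> finite Y \<and> Y \<subseteq> Z" 
    and bs: "set bs \<subseteq> cl Z \<inter> B"
  shows "iso (Z \<union> (\<Union>Y\<in>\<Y>. cl Y \<inter> B)) bs"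
\<comment> \<open>In the main case a member of \<open>\<Y>\<close> is required to place
  \<open>cl {} \<inter> B\<close> inside the parameter set \<open>?DW\<close>, from which the
  specialised parameters are taken.\<close>
proof (cases "\<Y> = {}")
  case True
  then show ?thesis using iso_over_indep[OF B Z bs] by simp
next
  case False
  let ?n = "length bs"
  let ?D = "\<Union>Y\<in>\<Y>. cl Y \<inter> B"
  have BU: "B \<subseteq> U" by (rule elem_U[OF good_elem[OF B]])
  have "set bs \<subseteq> cl Z" using bs by blast
  from cl_finite_set[OF finite_set this] obtain W where W: "finite W" "W \<subseteq> Z" "set bs \<subseteq> cl W" by (elim exE conjE) (rule that)
  \<comment> \<open>Each member of \<open>\<Y>\<close> is replaced by its trace on the finite set
    \<open>W\<close>. The formula isolating \<open>bs\<close> over \<open>W\<close> and these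
    smaller closures turns out to isolate over the full set.\<close>
  let ?DW = "\<Union>V\<in>(\<lambda>Y. Y \<inter> W) ` \<Y>. cl V \<inter> B"
  have WB: "W \<subseteq> B" using W Z by blast
  have bsU: "set bs \<subseteq> U" using bs BU by blast
  have "iso (W \<union> ?DW) bs"
    by (rule iso_over_closures_finite[OF B W(1) WB indep_mono[OF Z(1) W(2)]]) (use W bs in auto)
  then obtain X where X: "Def (W \<union> ?DW) ?n X" "X bs" 
    "\<And>Q ys. Def (W \<union> ?DW) ?n Q \<Longrightarrow> Q bs \<Longrightarrow> ys \<in> Tp ?n \<Longrightarrow> X ys \<Longrightarrow> Q ys"
    using isoE by blast
  have DWD: "?DW \<subseteq> ?D" using cl_mono[of "_ \<inter> W"] by (fastforce dest: subsetD)
  have DWB: "?DW \<subseteq> B" by blast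
  have clW: "?DW \<subseteq> cl W" using cl_mono[of "_ \<inter> W" W] by blast
  let ?E = "cl {} \<inter> B"
  have E: "elem ?E" by (rule elem_cl_Int[OF good_elem[OF B]])
  have EDW: "?E \<subseteq> ?DW" using False cl_mono[of "{}" "_ \<inter> W"] by blast
  have sub: "W \<union> ?DW \<subseteq> Z \<union> ?D" using W(2) DWD by blast
  show ?thesis
  proof (rule isoI[OF bsU Def_mono[OF X(1) sub] X(2) refl])
    fix Q ys assume Q: "Def (Z \<union> ?D) ?n Q" "Q bs" "ys \<in> Tp ?n" "X ys"
    show "Q ys"
    proof (rule ccontr)
      assume nQ: "\<not> Q ys"
      obtain cs where cs: "set cs \<subseteq> (Z \<union> ?D) \<inter> U" "Def (set cs) ?n Q" using Def_finite_base[OF Q(1)] by blast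
      obtain ds where ds: "set ds = set cs - W" using finite_list[of "set cs - W"] by auto
      let ?l = "length ds"
      have dsB: "set ds \<subseteq> B" using ds cs Z by auto
      have dsU: "ds \<in> Tp ?l" using dsB BU by (auto simp: tuples_def)
      have "Def (W \<union> set ds) ?n Q" by (rule Def_mono[OF cs(2)]) (use ds in auto)
      moreover have "set ds \<subseteq> U" using dsB BU by blast
      ultimately obtain Q' where Q': "Def W (?n + ?l) Q'" "\<And>xs. xs \<in> Tp ?n \<Longrightarrow> Q xs = Q' (xs @ ds)"
        using Def_params by metis
      \<comment> \<open>An element of \<open>Z\<close> outside \<open>W\<close> is treated as an
        element of the closure of a singleton, whose trace on \<open>W\<close> is empty.\<close>
      have "\<exists>V. finite V \<and> V \<subseteq> Z \<and> ds ! i \<in> cl V \<and> cl (V \<inter> W) \<inter> B \<subseteq> ?DW" if i: "i < ?l" for i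
      proof -
        have d: "ds ! i \<in> set cs" "ds ! i \<notin> W" using ds nth_mem[OF i] by auto
        show ?thesis
        proof (cases "ds ! i \<in> Z")
          case True
          have "cl ({ds ! i} \<inter> W) \<inter> B \<subseteq> ?DW" using EDW d by simp
          moreover have "ds ! i \<in> cl {ds ! i}" using cl_superset[of "{ds ! i}"] dsB BU nth_mem[OF i] by blast
          ultimately show ?thesis using True by (intro exI[of _ "{ds ! i}"]) simp
        next
          case False
          then obtain V where V: "V \<in> \<Y>" "ds ! i \<in> cl V" using d cs by blast
          then show ?thesis using Y by (intro exI[of _ V]) blast
        qed
      qed
      then obtain V where V: "\<And>i. i < ?l \<Longrightarrow> finite (V i) \<and> V i \<subseteq> Z \<and> ds ! i \<in> cl (V i) \<and> cl (V i \<inter> W) \<inter> B \<subseteq> ?DW"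
        by metis
      have "finite ((\<Union>i<?l. V i) - W)" using V by auto
      then obtain ws where ws: "set ws = (\<Union>i<?l. V i) - W" "distinct ws" using finite_distinct_list by metis
      let ?m = "length ws"
      have "set ws \<subseteq> Z" using ws V by auto
      then have "mor W ws" using indep_mor[OF Z(1) W(2) ws(2)] ws(1) by auto
      then have "mor (?DW \<union> W) ws" by (rule mor_closure[OF _ clW])
      then have mor: "mor (W \<union> ?DW) ws" by (simp add: Un_commute)
      have wsU: "set ws \<subseteq> U" using mor_U[OF mor] .
      \<comment> \<open>Membership of \<open>ds ! i\<close> in \<open>cl (V i)\<close> is certified
        by a large formula that it fails. The parameters of that formula outside \<open>W\<close>
        are displayed as \<open>ws\<close>; once they lie in \<open>cl {}\<close>, failing the
        formula means belonging to \<open>cl (V i \<inter> W)\<close>.\<close>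
      have "\<exists>P. Def (V i \<inter> W) (1 + ?m) P \<and> lg (\<lambda>x. P (x @ ws)) \<and> \<not> P ([ds ! i] @ ws)" if i: "i < ?l" for i
      proof -
        obtain P where P: "Def (V i) 1 P" "lg P" "\<not> P [ds ! i]" using cl_witness V[OF i] by metis
        have "Def ((V i \<inter> W) \<union> set ws) 1 P" by (rule Def_mono[OF P(1)]) (use ws i in auto)
        from Def_params[OF this wsU] obtain P' where 
          P': "Def (V i \<inter> W) (1 + ?m) P'" "\<And>xs. xs \<in> Tp 1 \<Longrightarrow> P xs = P' (xs @ ws)" by metis
        have "lg (\<lambda>x. P' (x @ ws))" by (rule lg_cong[OF P(2)]) (use P'(2) in simp)
        moreover have "ds ! i \<in> U" using dsB BU nth_mem[OF i] by blast
        ultimately show ?thesis using P' P(3) by (metis One_nat_def tuples_1)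
      qed
      then obtain P where P: "\<And>i. i < ?l \<Longrightarrow> Def (V i \<inter> W) (1 + ?m) (P i) \<and> lg (\<lambda>x. P i (x @ ws)) \<and> \<not> P i ([ds ! i] @ ws)"
        by metis
      have PW: "Def (W \<union> ?DW) (1 + ?m) (P i)" if "i \<in> {..<?l}" for i
        by (rule Def_mono[of "V i \<inter> W"]) (use P that in auto)
      \<comment> \<open>With \<open>vs\<close> in place of \<open>ws\<close> and \<open>us\<close>
        in place of \<open>ds\<close>: every \<open>us ! i\<close> still fails a large formula, and
        \<open>Q'\<close> with parameters \<open>us\<close> still splits \<open>X\<close>. By
        definability of the type this is a definable condition.\<close>
      let ?K = "\<lambda>vs us. (\<forall>i\<in>{..<?l}. lg (\<lambda>x. P i (x @ vs)) \<and> \<not> P i ([us ! i] @ vs)) \<and>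
         (\<exists>zs\<in>Tp ?n. X zs \<and> Q' (zs @ us)) \<and> (\<exists>zs\<in>Tp ?n. X zs \<and> \<not> Q' (zs @ us))"
      have Q'W: "Def (W \<union> ?DW) (?n + ?l) Q'" by (rule Def_mono[OF Q'(1)]) simp
      have K: "Def (W \<union> ?DW) (?m + ?l) (\<lambda>ts. ?K (take ?m ts) (drop ?m ts))"
      proof (intro Def_conj Def_Ball_finite)
        fix i assume i: "i \<in> {..<?l}"
        show "Def (W \<union> ?DW) (?m + ?l) (\<lambda>ts. lg (\<lambda>x. P i (x @ take ?m ts)))"
          by (rule Def_sub[OF Def_lg[OF PW[OF i]]], (rule refl Rix_intros | simp)+)
        show "Def (W \<union> ?DW) (?m + ?l) (\<lambda>ts. \<not> P i ([drop ?m ts ! i] @ take ?m ts))"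
          by (rule Def_not, rule Def_sub[OF PW[OF i]], (rule refl Rix_intros | use i in simp)+)
      next
        show "Def (W \<union> ?DW) (?m + ?l) (\<lambda>ts. \<exists>zs\<in>Tp ?n. X zs \<and> Q' (zs @ drop ?m ts))"
          apply (rule Def_ex, rule Def_conj)
          subgoal by (rule Def_sub[OF X(1)], (rule refl Rix_intros | simp)+)
          subgoal by (rule Def_sub[OF Q'W], (rule refl Rix_intros | simp)+)
          done
        show "Def (W \<union> ?DW) (?m + ?l) (\<lambda>ts. \<exists>zs\<in>Tp ?n. X zs \<and> \<not> Q' (zs @ drop ?m ts))"
          apply (rule Def_ex, rule Def_conj)
          subgoal by (rule Def_sub[OF X(1)], (rule refl Rix_intros | simp)+)
          subgoal by (rule Def_not, rule Def_sub[OF Q'W], (rule refl Rix_intros | simp)+)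
          done
      qed simp
      have Kds: "?K ws ds"
      proof (intro conjI ballI)
        have "bs \<in> Tp ?n" using bsU by (simp add: tuples_def)
        then show "\<exists>zs\<in>Tp ?n. X zs \<and> Q' (zs @ ds)" using Q'(2) Q(2) X(2) by blast
        show "\<exists>zs\<in>Tp ?n. X zs \<and> \<not> Q' (zs @ ds)" using Q'(2)[OF Q(3)] nQ Q by blast
      qed (use P in auto)
      have "Def (W \<union> ?DW) ?m (\<lambda>vs. \<exists>us\<in>Tp ?l. ?K vs us)" by (rule Def_ex[OF K])
      moreover have "\<exists>us\<in>Tp ?l. ?K ws us" using Kds dsU by blast
      ultimately obtain vs where vs: "length vs = ?m" "set vs \<subseteq> ?E" "\<exists>us\<in>Tp ?l. ?K vs us"
        using mor_meets_elem[OF E Int_lower1 mor] by blast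
      have vsU: "set vs \<subseteq> U" using vs(2) BU by blast
      have "Def ((W \<union> ?DW) \<union> set vs) ?l (\<lambda>us. ?K (take ?m (vs @ us)) (drop ?m (vs @ us)))"
        by (rule Def_param_left[OF _ vsU]) (use K vs(1) in \<open>simp only:\<close>)
      then have "Def B ?l (\<lambda>us. ?K (take ?m (vs @ us)) (drop ?m (vs @ us)))"
        by (rule Def_mono) (use WB DWB vs(2) in blast)
      then have "Def B ?l (?K vs)" using vs(1) by simp
      then obtain us where us: "us \<in> Tp ?l" "set us \<subseteq> B" "?K vs us" 
        using elem_tuple[OF good_elem[OF B]] vs(3) by blast
      have "set us \<subseteq> ?DW"
      proof
        fix u assume u: "u \<in> set us"
        then obtain i where i: "i < ?l" "u = us ! i" using tuplesD(1)[OF us(1)] by (metis in_set_conv_nth)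
        have uU: "u \<in> U" using u us(2) BU by blast
        have D: "Def ((V i \<inter> W) \<union> set vs) 1 (\<lambda>x. P i (x @ vs))"
          by (rule Def_param_fiber) (use P[OF i(1)] vs(1) vsU in auto)
        have "lg (\<lambda>x. P i (x @ vs))" "\<not> P i ([u] @ vs)" using us(3) i by auto
        from cl_witnessI[OF D this uU] have "u \<in> cl ((V i \<inter> W) \<union> set vs)" .
        moreover have "V i \<inter> W \<subseteq> U" using WB BU by blast
        then have "(V i \<inter> W) \<union> set vs \<subseteq> cl (V i \<inter> W)" 
          using cl_superset vs(2) cl_mono[of "{}" "V i \<inter> W"] by blast
        ultimately have "u \<in> cl (V i \<inter> W)" using cl_subset by blast
        then show "u \<in> ?DW" using V[OF i(1)] u us(2) by blast
      qed
      \<comment> \<open>So \<open>Q'\<close> with parameters \<open>us\<close> is a formula over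
        \<open>W \<union> ?DW\<close> which splits \<open>X\<close>, although \<open>X\<close>
        isolates a type over that set.\<close>
      then have "(W \<union> ?DW) \<union> set us = W \<union> ?DW" by blast
      then have D: "Def (W \<union> ?DW) ?n (\<lambda>zs. Q' (zs @ us))"
        using Def_param_fiber[of "W \<union> ?DW" ?n us Q'] Q'W tuplesD[OF us(1)] by simp
      obtain z1 z2 where z: "z1 \<in> Tp ?n" "X z1" "Q' (z1 @ us)" "z2 \<in> Tp ?n" "X z2" "\<not> Q' (z2 @ us)" 
        using us(3) by blast
      show False using X(3)[OF D _ z(4,5)] X(3)[OF Def_not[OF D] _ z(1,2)] z(3,6) by blast
    qed
  qed
qed

text \<open>Zorn's lemma is applied only to maps whose domain is \<open>Z\<close> together with some
  closures of finite subsets, since \<open>iso_over_closures\<close> gives isolation over domains of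
  this shape. Such a map extends over any further countable piece \<open>cl Y \<inter> B\<close>,
  and the extended domain has the same shape, so a maximal map is defined on all of
  \<open>B\<close>.\<close>

lemma good_prime:
  assumes B: "good B" and Z: "indep Z" "Z \<subseteq> B" "B \<subseteq> cl Z"
  shows "prime_model Z B"
  unfolding prime_model_def
proof (intro conjI allI impI)
  show "elem B" "Z \<subseteq> B" using good_elem B Z by auto
  fix N assume N: "elem N \<and> Z \<subseteq> N"
  have ZU: "Z \<subseteq> U" using Z(1) by (simp add: indep_def)
  define dom where "dom \<Y> = Z \<union> (\<Union>Y\<in>\<Y>. cl Y \<inter> B)" for \<Y>
  let ?F = "{Y. finite Y \<and> Y \<subseteq> Z}"
  let ?P = "{R. el R \<and> Id_on Z \<subseteq> R \<and> Range R \<subseteq> N \<and> (\<exists>\<Y>\<subseteq>?F. Domain R = dom \<Y>)}"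
  have "\<exists>R\<in>?P. \<forall>S\<in>?P. R \<subseteq> S \<longrightarrow> S = R"
  proof (rule subset_Zorn_nonempty)
    have "Id_on Z \<in> ?P" using el_Id_on[OF ZU] N by (auto simp: dom_def intro!: exI[of _ "{}"])
    then show "?P \<noteq> {}" by blast
    fix \<C> assume C: "\<C> \<noteq> {}" "subset.chain ?P \<C>"
    note ch' = C(2)[unfolded subset_chain_def]
    have CP: "R \<in> ?P" if "R \<in> \<C>" for R by (rule subsetD[OF conjunct1[OF ch'] that])
    have ch: "R \<subseteq> S \<or> S \<subseteq> R" if "R \<in> \<C>" "S \<in> \<C>" for R S
      by (rule bspec[OF bspec[OF conjunct2[OF ch'] that(1)] that(2)])
    have "el (\<Union>\<C>)" by (rule el_Union_chain[OF _ ch C(1)]) (use CP in auto)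
    moreover have "\<forall>R\<in>\<C>. Id_on Z \<subseteq> R \<and> Range R \<subseteq> N" using CP by simp
    then have "Id_on Z \<subseteq> \<Union>\<C>" "Range (\<Union>\<C>) \<subseteq> N" using C(1) by blast+
    moreover have "\<forall>R\<in>\<C>. \<exists>\<Y>\<subseteq>?F. Domain R = dom \<Y>" using CP by simp
    then obtain f where f: "\<And>R. R \<in> \<C> \<Longrightarrow> f R \<subseteq> ?F \<and> Domain R = dom (f R)" by metis
    then have "Domain (\<Union>\<C>) = dom (\<Union>R\<in>\<C>. f R)"
    proof -
      have "Domain (\<Union>\<C>) = (\<Union>R\<in>\<C>. dom (f R))" using f by (simp add: Domain_Union)
      also have "\<dots> = dom (\<Union>R\<in>\<C>. f R)" using C(1) by (auto simp: dom_def)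
      finally show ?thesis .
    qed
    moreover have "(\<Union>R\<in>\<C>. f R) \<subseteq> ?F" using f by blast
    ultimately show "\<Union>\<C> \<in> ?P" by blast
  qed
  then obtain R where R: "R \<in> ?P" "\<forall>S\<in>?P. R \<subseteq> S \<longrightarrow> S = R" ..
  then obtain \<Y> where Y: "\<Y> \<subseteq> ?F" "Domain R = dom \<Y>" by blast
  have all: "cl Y \<inter> B \<subseteq> Domain R" if YF: "Y \<in> ?F" for Y
  proof -
    have "\<exists>R'. R \<subseteq> R' \<and> R' \<subseteq> R \<union> ((cl Y \<inter> B) \<union> {}) \<times> N \<and> el R' \<and> cl Y \<inter> B \<subseteq> Domain R' \<and> {} \<subseteq> Range R'"
    proof (rule back_and_forth)
      show "el R" "Range R \<subseteq> N" "elem N" "countable {}" "{} \<subseteq> N" using R N by auto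
      show "countable (cl Y \<inter> B)" by (rule good_countable[OF B]) (use YF Z in auto)
      fix xs assume "set xs \<subseteq> (cl Y \<inter> B) \<union> {}"
      then have "set xs \<subseteq> cl Z \<inter> B" using Z(3) by blast
      from iso_over_closures[OF B Z(1,2) _ this, of \<Y>] show "iso (Domain R) xs"
        using Y unfolding dom_def by auto
    qed simp
    then obtain R' where R': "R \<subseteq> R'" "R' \<subseteq> R \<union> (cl Y \<inter> B) \<times> N" "el R'" "cl Y \<inter> B \<subseteq> Domain R'" by auto
    have "Domain R' = Domain R \<union> (cl Y \<inter> B)" using R' by blast
    then have "Domain R' = dom (insert Y \<Y>)" using Y(2) by (auto simp: dom_def)
    moreover have "insert Y \<Y> \<subseteq> ?F" using Y YF by blast
    moreover have RP: "Id_on Z \<subseteq> R" "Range R \<subseteq> N" using R(1) by simp_all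
    then have "Id_on Z \<subseteq> R'" "Range R' \<subseteq> N" using R'(1,2) by blast+
    ultimately have "R' \<in> ?P" using R'(3) by blast
    then have "R' = R" using R(2) R'(1) by blast
    then show ?thesis using R'(4) by simp
  qed
  have "Domain R \<subseteq> B" using Y(2) Z by (auto simp: dom_def)
  moreover have "B \<subseteq> Domain R"
  proof
    fix b assume b: "b \<in> B"
    then have "b \<in> cl Z" using Z by blast
    then obtain F where "finite F" "F \<subseteq> Z" "b \<in> cl F" by (rule cl_finite_char)
    then show "b \<in> Domain R" using all[of F] b by blast
  qed
  ultimately show "\<exists>e. el e \<and> Domain e = B \<and> Range e \<subseteq> N \<and> Id_on Z \<subseteq> e" using R(1) by blast
qed

text \<open>A basis \<open>Z0\<close> of \<open>G\<close> extends to a basis \<open>Z\<close> of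
  \<open>Z0 \<union> X\<close>. A closed \<open>G\<close> is the union of the closures in
  \<open>B\<close> of the finite subsets of \<open>Z0\<close>, so the tuple of \<open>X\<close> and
  \<open>y\<close> is isolated over \<open>Z \<union> G\<close>; the members of \<open>X\<close> can
  then be moved into the base.\<close>

lemma iso_over_closed:
  assumes B: "good B" and G: "G \<subseteq> B" "G = {} \<or> cl G \<inter> B = G" and X: "finite X" "X \<subseteq> B" 
    and y: "y \<in> cl (X \<union> G) \<inter> B"
  shows "iso (G \<union> X) [y]"
proof -
  have U: "B \<subseteq> U" using elem_U good_elem B by blast
  obtain Z0 where Z0: "Z0 \<subseteq> G" "indep Z0" "G \<subseteq> cl Z0"
    using ex_basis[of "{}" G] G(1) U by (metis indep_def empty_iff empty_subsetI subset_trans)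
  obtain Z where Z: "Z0 \<subseteq> Z" "Z \<subseteq> Z0 \<union> X" "indep Z" "Z0 \<union> X \<subseteq> cl Z"
    by (rule ex_basis[OF Z0(2), of "Z0 \<union> X"]) (use Z0 G X U in auto)
  have ZB: "Z \<subseteq> B" using Z Z0 G X by blast
  \<comment> \<open>The empty \<open>G\<close> gets no closures at all: it need not be closed, and
    already the closure of the empty set would give more than \<open>G\<close>.\<close>
  let ?\<Y> = "if G = {} then {} else {Y. finite Y \<and> Y \<subseteq> Z0}"
  have D: "(\<Union>Y\<in>?\<Y>. cl Y \<inter> B) = G"
  proof (cases "G = {}")
    case False
    then have GB: "cl G \<inter> B = G" using G(2) by blast
    have "cl Y \<inter> B \<subseteq> G" if "Y \<subseteq> Z0" for Y using cl_mono[of Y G] that Z0(1) GB by blast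
    moreover have "g \<in> (\<Union>Y\<in>{Y. finite Y \<and> Y \<subseteq> Z0}. cl Y \<inter> B)" if "g \<in> G" for g
    proof -
      have "g \<in> cl Z0" using Z0(3) that by blast
      then obtain F where "finite F" "F \<subseteq> Z0" "g \<in> cl F" by (rule cl_finite_char)
      then show ?thesis using that G(1) by blast
    qed
    ultimately show ?thesis using False by auto
  qed simp
  obtain xs where xs: "set xs = X" using finite_list X by blast
  have "G \<subseteq> cl Z" using Z0(3) cl_mono[OF Z(1)] by blast
  then have "X \<union> G \<subseteq> cl Z" using Z(4) by blast
  then have "set (xs @ [y]) \<subseteq> cl Z \<inter> B" using cl_subset[of "X \<union> G" Z] y xs X(2) by auto
  from iso_over_closures[OF B Z(3) ZB _ this, of ?\<Y>] D Z(1) have "iso (Z \<union> G) (xs @ [y])" 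
    by (auto split: if_splits)
  from iso_append[OF this] have "iso (Z \<union> G \<union> X) [y]" using xs by simp
  moreover have "Z \<union> G \<union> X = G \<union> X" using Z(2) Z0(1) by blast
  ultimately show ?thesis by simp
qed

end

section \<open>Formulas, substitution and parameters\<close>

abbreviation Conj :: "('f, 'r) fm \<Rightarrow> ('f, 'r) fm \<Rightarrow> ('f, 'r) fm" where
  "Conj \<phi> \<psi> \<equiv> Neg (Imp \<phi> (Neg \<psi>))"

abbreviation Ex :: "nat \<Rightarrow> ('f, 'r) fm \<Rightarrow> ('f, 'r) fm" where
  "Ex i \<phi> \<equiv> Neg (All i (Neg \<phi>))"

lemma finite_fv_tm: "finite (fv_tm t)"
  by (induction t) auto

lemma finite_fv: "finite (fv \<phi>)"
  by (induction \<phi>) (auto simp: finite_fv_tm)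

lemma eval_tm_cong: "(\<And>i. i \<in> fv_tm t \<Longrightarrow> s i = s' i) \<Longrightarrow> eval_tm M s t = eval_tm M s' t"
proof (induction t)
  case (Fn f ts)
  then have "map (eval_tm M s) ts = map (eval_tm M s') ts" by (intro map_cong) auto
  then show ?case unfolding eval_tm.simps by (rule arg_cong)
qed simp

lemma sat_cong: "(\<And>i. i \<in> fv \<phi> \<Longrightarrow> s i = s' i) \<Longrightarrow> sat M s \<phi> \<longleftrightarrow> sat M s' \<phi>"
proof (induction \<phi> arbitrary: s s')
  case (Eq t u)
  then show ?case using eval_tm_cong[of t s s' M] eval_tm_cong[of u s s' M] by simp
next
  case (Rel r ts)
  then have "map (eval_tm M s) ts = map (eval_tm M s') ts" by (intro map_cong eval_tm_cong) auto
  then show ?case unfolding sat.simps by (rule arg_cong)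
next
  case (Imp \<phi> \<psi>)
  have "sat M s \<phi> = sat M s' \<phi>" by (rule Imp.IH(1)) (use Imp.prems in simp)
  moreover have "sat M s \<psi> = sat M s' \<psi>" by (rule Imp.IH(2)) (use Imp.prems in simp)
  ultimately show ?case by simp
next
  case (All i \<phi>)
  have "sat M (s(i := a)) \<phi> = sat M (s'(i := a)) \<phi>" for a
    by (rule All.IH) (use All.prems in auto)
  then show ?case by simp
qed simp

fun subst_tm :: "(nat \<Rightarrow> 'f tm) \<Rightarrow> 'f tm \<Rightarrow> 'f tm" where
  "subst_tm f (Var i) = f i"
| "subst_tm f (Fn g ts) = Fn g (map (subst_tm f) ts)"

lemma eval_subst_tm: "eval_tm M s (subst_tm f t) = eval_tm M (\<lambda>i. eval_tm M s (f i)) t"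
proof (induction t)
  case (Fn g ts)
  then have "map (eval_tm M s) (map (subst_tm f) ts) = map (eval_tm M (\<lambda>i. eval_tm M s (f i))) ts" by simp
  then show ?case unfolding eval_tm.simps subst_tm.simps by (rule arg_cong)
qed simp

lemma fv_subst_tm: "fv_tm (subst_tm f t) = (\<Union>i\<in>fv_tm t. fv_tm (f i))"
  by (induction t) auto

lemma wf_subst_tm: "wf_tm L t \<Longrightarrow> (\<And>i. i \<in> fv_tm t \<Longrightarrow> wf_tm L (f i)) \<Longrightarrow> wf_tm L (subst_tm f t)"
  by (induction t) auto

text \<open>Simultaneous substitution, up to the renaming of bound variables.\<close>

lemma ex_subst:
  assumes "wf_fm L \<phi>" "\<And>i. i \<in> fv \<phi> \<Longrightarrow> wf_tm L (f i)"
  shows "\<exists>\<psi>. wf_fm L \<psi> \<and> fv \<psi> \<subseteq> (\<Union>i\<in>fv \<phi>. fv_tm (f i)) \<and> 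
    (\<forall>s. sat M s \<psi> \<longleftrightarrow> sat M (\<lambda>i. eval_tm M s (f i)) \<phi>)"
  using assms
proof (induction \<phi> arbitrary: f)
  case Bot
  then show ?case by (intro exI[of _ Bot]) auto
next
  case (Eq t u)
  then show ?case
    by (intro exI[of _ "Eq (subst_tm f t) (subst_tm f u)"]) (auto simp: eval_subst_tm fv_subst_tm intro: wf_subst_tm)
next
  case (Rel r ts)
  have "map (eval_tm M s) (map (subst_tm f) ts) = map (eval_tm M (\<lambda>i. eval_tm M s (f i))) ts" for s 
    by (simp add: eval_subst_tm)
  then have "sat M s (Rel r (map (subst_tm f) ts)) = sat M (\<lambda>i. eval_tm M s (f i)) (Rel r ts)" for s
    unfolding sat.simps by (rule arg_cong)
  moreover have "\<forall>t\<in>set (map (subst_tm f) ts). wf_tm L t" using Rel by (auto intro: wf_subst_tm)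
  moreover have "fv (Rel r (map (subst_tm f) ts)) \<subseteq> (\<Union>i\<in>fv (Rel r ts). fv_tm (f i))" by (auto simp: fv_subst_tm)
  ultimately show ?case using Rel.prems(1) 
    by (intro exI[of _ "Rel r (map (subst_tm f) ts)"]) (simp del: sat.simps map_map)
next
  case (Imp \<phi>1 \<phi>2)
  have w: "wf_fm L \<phi>1" "wf_fm L \<phi>2" "\<And>i. i \<in> fv \<phi>1 \<Longrightarrow> wf_tm L (f i)" "\<And>i. i \<in> fv \<phi>2 \<Longrightarrow> wf_tm L (f i)"
    using Imp.prems by auto
  have "\<exists>\<psi>1. wf_fm L \<psi>1 \<and> fv \<psi>1 \<subseteq> (\<Union>i\<in>fv \<phi>1. fv_tm (f i)) \<and> 
    (\<forall>s. sat M s \<psi>1 \<longleftrightarrow> sat M (\<lambda>i. eval_tm M s (f i)) \<phi>1)" by (rule Imp.IH(1)) (use w in auto)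
  then obtain \<psi>1 where "wf_fm L \<psi>1 \<and> fv \<psi>1 \<subseteq> (\<Union>i\<in>fv \<phi>1. fv_tm (f i)) \<and> 
    (\<forall>s. sat M s \<psi>1 \<longleftrightarrow> sat M (\<lambda>i. eval_tm M s (f i)) \<phi>1)" ..
  moreover have "\<exists>\<psi>2. wf_fm L \<psi>2 \<and> fv \<psi>2 \<subseteq> (\<Union>i\<in>fv \<phi>2. fv_tm (f i)) \<and> 
    (\<forall>s. sat M s \<psi>2 \<longleftrightarrow> sat M (\<lambda>i. eval_tm M s (f i)) \<phi>2)" by (rule Imp.IH(2)) (use w in auto)
  then obtain \<psi>2 where "wf_fm L \<psi>2 \<and> fv \<psi>2 \<subseteq> (\<Union>i\<in>fv \<phi>2. fv_tm (f i)) \<and> 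
    (\<forall>s. sat M s \<psi>2 \<longleftrightarrow> sat M (\<lambda>i. eval_tm M s (f i)) \<phi>2)" ..
  ultimately show ?case by (intro exI[of _ "Imp \<psi>1 \<psi>2"]) auto
next
  case (All i \<phi>)
  have "finite (\<Union>j\<in>fv \<phi>. fv_tm (f j))" by (simp add: finite_fv finite_fv_tm)
  then obtain k where k: "k \<notin> (\<Union>j\<in>fv \<phi>. fv_tm (f j))" using ex_new_if_finite infinite_UNIV_nat by blast
  let ?f = "f(i := Var k)"
  have "wf_tm L (?f j)" if "j \<in> fv \<phi>" for j using All.prems that by auto
  then obtain \<psi> where \<psi>: "wf_fm L \<psi>" "fv \<psi> \<subseteq> (\<Union>j\<in>fv \<phi>. fv_tm (?f j))" 
    "\<forall>s. sat M s \<psi> \<longleftrightarrow> sat M (\<lambda>j. eval_tm M s (?f j)) \<phi>" using All.IH[of ?f] All.prems by auto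
  have "sat M (s(k := a)) \<psi> \<longleftrightarrow> sat M ((\<lambda>j. eval_tm M s (f j))(i := a)) \<phi>" for s a
  proof -
    have "sat M (\<lambda>j. eval_tm M (s(k := a)) (?f j)) \<phi> = sat M ((\<lambda>j. eval_tm M s (f j))(i := a)) \<phi>"
      by (rule sat_cong) (use k in \<open>auto intro!: eval_tm_cong\<close>)
    then show ?thesis using \<psi>(3) by blast
  qed
  moreover have "fv (All k \<psi>) \<subseteq> (\<Union>j\<in>fv (All i \<phi>). fv_tm (f j))"
  proof
    fix x assume x: "x \<in> fv (All k \<psi>)"
    then have xk: "x \<noteq> k" "x \<in> fv \<psi>" by auto
    then obtain j where j: "j \<in> fv \<phi>" "x \<in> fv_tm (?f j)" using \<psi>(2) by blast
    then have "j \<noteq> i" using xk by auto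
    then show "x \<in> (\<Union>j\<in>fv (All i \<phi>). fv_tm (f j))" using j by auto
  qed
  ultimately show ?case using \<psi>(1) by (intro exI[of _ "All k \<psi>"]) auto
qed

section \<open>Named parameters as constants and as variables\<close>

lemma with_params_simps [simp]:
  "rels (with_params L A) = rels L" "rarity (with_params L A) = rarity L"
  "Inl f \<in> funs (with_params L A) \<longleftrightarrow> f \<in> funs L" "Inr a \<in> funs (with_params L A) \<longleftrightarrow> a \<in> A"
  "farity (with_params L A) (Inl f) = farity L f" "farity (with_params L A) (Inr a) = 0"
  by (auto simp: with_params_def)

lemma named_simps [simp]:
  "universe (named M) = universe M" "rint (named M) = rint M"
  "fint (named M) (Inl f) = fint M f" "fint (named M) (Inr a) as = a"
  by (auto simp: named_def)

lemma wf_tm_params_mono: "wf_tm (with_params L A) t \<Longrightarrow> A \<subseteq> B \<Longrightarrow> wf_tm (with_params L B) t"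
  by (induction t) (auto simp: with_params_def)

lemma wf_fm_params_mono: "wf_fm (with_params L A) \<phi> \<Longrightarrow> A \<subseteq> B \<Longrightarrow> wf_fm (with_params L B) \<phi>"
  by (induction \<phi>) (auto simp: wf_tm_params_mono)

lemma wf_tm_finite_params:
  "wf_tm (with_params L A) t \<Longrightarrow> \<exists>F. finite F \<and> F \<subseteq> A \<and> wf_tm (with_params L F) t"
proof (induction t)
  case (Fn f ts)
  have "\<forall>t\<in>set ts. \<exists>F. finite F \<and> F \<subseteq> A \<and> wf_tm (with_params L F) t" using Fn by auto
  then obtain F where F: "\<forall>t\<in>set ts. finite (F t) \<and> F t \<subseteq> A \<and> wf_tm (with_params L (F t)) t" by metis
  let ?G = "(\<Union>t\<in>set ts. F t) \<union> {a \<in> A. f = Inr a}"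
  have "finite {a \<in> A. f = Inr a}" by (rule finite_subset[of _ "case f of Inr a \<Rightarrow> {a} | Inl _ \<Rightarrow> {}"]) (auto split: sum.splits)
  moreover have "wf_tm (with_params L ?G) t" if "t \<in> set ts" for t
    by (rule wf_tm_params_mono[of L "F t"]) (use F that in auto)
  ultimately show ?case using Fn.prems F by (intro exI[of _ ?G]) (auto simp: with_params_def)
qed auto

lemma wf_fm_finite_params:
  "wf_fm (with_params L A) \<phi> \<Longrightarrow> \<exists>F. finite F \<and> F \<subseteq> A \<and> wf_fm (with_params L F) \<phi>"
proof (induction \<phi>)
  case (Eq t u)
  obtain F G where "finite F \<and> F \<subseteq> A \<and> wf_tm (with_params L F) t" "finite G \<and> G \<subseteq> A \<and> wf_tm (with_params L G) u" 
    using Eq wf_tm_finite_params by (metis wf_fm.simps(2))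
  then show ?case using wf_tm_params_mono[of L F _ "F \<union> G"] wf_tm_params_mono[of L G _ "F \<union> G"]
    by (intro exI[of _ "F \<union> G"]) auto
next
  case (Rel r ts)
  have "\<forall>t\<in>set ts. wf_tm (with_params L A) t" using Rel by simp
  then have "\<forall>t\<in>set ts. \<exists>F. finite F \<and> F \<subseteq> A \<and> wf_tm (with_params L F) t" using wf_tm_finite_params by blast
  then obtain F where F: "\<forall>t\<in>set ts. finite (F t) \<and> F t \<subseteq> A \<and> wf_tm (with_params L (F t)) t" by metis
  let ?G = "\<Union>t\<in>set ts. F t"
  have "wf_tm (with_params L ?G) t" if "t \<in> set ts" for t
    by (rule wf_tm_params_mono[of L "F t"]) (use F that in auto)
  then show ?case using Rel F by (intro exI[of _ ?G]) (auto simp: with_params_def)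
next
  case (Imp \<phi> \<psi>)
  then obtain F G where "finite F \<and> F \<subseteq> A \<and> wf_fm (with_params L F) \<phi>" "finite G \<and> G \<subseteq> A \<and> wf_fm (with_params L G) \<psi>" 
    by auto
  then show ?case using wf_fm_params_mono[of L F _ "F \<union> G"] wf_fm_params_mono[of L G _ "F \<union> G"]
    by (intro exI[of _ "F \<union> G"]) auto
qed auto

text \<open>Replacing each parameter \<open>a\<close> by the variable \<open>g a\<close>; this is only meaningful when no \<open>g a\<close> is bound.\<close>

fun unpar_tm :: "('a \<Rightarrow> nat) \<Rightarrow> ('f + 'a) tm \<Rightarrow> 'f tm" where
  "unpar_tm g (Var i) = Var i"
| "unpar_tm g (Fn (Inl f) ts) = Fn f (map (unpar_tm g) ts)"
| "unpar_tm g (Fn (Inr a) ts) = Var (g a)"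

fun unpar :: "('a \<Rightarrow> nat) \<Rightarrow> ('f + 'a, 'r) fm \<Rightarrow> ('f, 'r) fm" where
  "unpar g Bot = Bot"
| "unpar g (Eq t u) = Eq (unpar_tm g t) (unpar_tm g u)"
| "unpar g (Rel r ts) = Rel r (map (unpar_tm g) ts)"
| "unpar g (Imp \<phi> \<psi>) = Imp (unpar g \<phi>) (unpar g \<psi>)"
| "unpar g (All i \<phi>) = All i (unpar g \<phi>)"

fun bound_vars :: "('f, 'r) fm \<Rightarrow> nat set" where
  "bound_vars (Imp \<phi> \<psi>) = bound_vars \<phi> \<union> bound_vars \<psi>"
| "bound_vars (All i \<phi>) = insert i (bound_vars \<phi>)"
| "bound_vars _ = {}"

lemma finite_bound_vars: "finite (bound_vars \<phi>)"
  by (induction \<phi>) auto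

lemma wf_unpar_tm: "wf_tm (with_params L A) t \<Longrightarrow> wf_tm L (unpar_tm g t) \<and> fv_tm (unpar_tm g t) \<subseteq> fv_tm t \<union> g ` A"
  by (induction g t rule: unpar_tm.induct) (fastforce simp: with_params_def)+

lemma wf_unpar: "wf_fm (with_params L A) \<phi> \<Longrightarrow> wf_fm L (unpar g \<phi>) \<and> fv (unpar g \<phi>) \<subseteq> fv \<phi> \<union> g ` A"
proof (induction \<phi>)
  case (Rel r ts)
  then have "\<forall>t\<in>set ts. wf_tm (with_params L A) t" by simp
  then have "\<forall>t\<in>set ts. wf_tm L (unpar_tm g t) \<and> fv_tm (unpar_tm g t) \<subseteq> fv_tm t \<union> g ` A" using wf_unpar_tm by blast
  then show ?case using Rel by auto
next
  case (Eq t u)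
  then show ?case using wf_unpar_tm[of L A t g] wf_unpar_tm[of L A u g] by auto
qed auto

lemma eval_unpar_tm:
  "wf_tm (with_params L A) t \<Longrightarrow> (\<And>a. a \<in> A \<Longrightarrow> s (g a) = a) \<Longrightarrow> 
    eval_tm M s (unpar_tm g t) = eval_tm (named M) s t"
proof (induction g t rule: unpar_tm.induct)
  case (2 g f ts)
  then have "map (eval_tm M s) (map (unpar_tm g) ts) = map (eval_tm (named M) s) ts" by auto
  then show ?case by (simp del: map_map)
qed auto

lemma sat_unpar:
  "wf_fm (with_params L A) \<phi> \<Longrightarrow> (\<And>a. a \<in> A \<Longrightarrow> s (g a) = a \<and> g a \<notin> bound_vars \<phi>) \<Longrightarrow> 
    sat M s (unpar g \<phi>) \<longleftrightarrow> sat (named M) s \<phi>"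
proof (induction \<phi> arbitrary: s)
  case (Eq t u)
  then show ?case using eval_unpar_tm[of L A t s g M] eval_unpar_tm[of L A u s g M] by simp
next
  case (Rel r ts)
  then have "\<forall>t\<in>set ts. eval_tm M s (unpar_tm g t) = eval_tm (named M) s t" using eval_unpar_tm[of L A _ s g M] by simp
  then have "map (eval_tm M s) (map (unpar_tm g) ts) = map (eval_tm (named M) s) ts" by simp
  then show ?case by (simp del: map_map)
next
  case (Imp \<phi> \<psi>)
  then show ?case using Imp.IH(1)[of s] Imp.IH(2)[of s] by simp
next
  case (All i \<phi>)
  have "sat M (s(i := a)) (unpar g \<phi>) = sat (named M) (s(i := a)) \<phi>" for a
    by (rule All.IH) (use All.prems in auto)
  then show ?case by simp
qed simp

lemma ex_params_to_vars:
  fixes \<phi> :: "('f + 'a, 'r) fm" and M :: "('f, 'r, 'a) struc"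
  assumes \<phi>: "wf_fm (with_params L A) \<phi>" "fv \<phi> \<subseteq> {..<n}"
  shows "\<exists>cs \<psi>. set cs \<subseteq> A \<and> wf_fm L \<psi> \<and> fv \<psi> \<subseteq> {..<n + length cs} \<and>
     (\<forall>s. sat (named M) s \<phi> \<longleftrightarrow> sat M (\<lambda>i. if i < n then s i else cs ! (i - n)) \<psi>)"
proof -
  obtain F where F: "finite F" "F \<subseteq> A" "wf_fm (with_params L F) \<phi>" using wf_fm_finite_params[OF \<phi>(1)] by blast
  obtain cs where cs: "set cs = F" using finite_list[OF F(1)] ..
  have "\<forall>a\<in>F. \<exists>j. j < length cs \<and> cs ! j = a" using cs by (auto simp: in_set_conv_nth)
  from bchoice[OF this] obtain j where "\<forall>a\<in>F. j a < length cs \<and> cs ! j a = a" ..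
  then have j: "j a < length cs \<and> cs ! j a = a" if "a \<in> F" for a using that by blast
  obtain k where k: "bound_vars \<phi> \<subseteq> {..<k}" using finite_bound_vars[of \<phi>] finite_nat_iff_bounded by blast
  \<comment> \<open>Parameters become variables from \<open>N\<close> on, beyond the free and the
    bound variables, so that none is captured; the substitution \<open>?f\<close> then moves them
    down to start at \<open>n\<close>.\<close>
  define N where "N = max n k"
  have N: "bound_vars \<phi> \<subseteq> {..<N}" "n \<le> N" using k by (auto simp: N_def)
  let ?g = "\<lambda>a. N + j a"
  let ?f = "\<lambda>i. Var (if i < n then i else n + (i - N)) :: 'f tm"
  have w: "wf_fm L (unpar ?g \<phi>)" "fv (unpar ?g \<phi>) \<subseteq> fv \<phi> \<union> ?g ` F" using wf_unpar[OF F(3), of ?g] by auto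
  obtain \<psi> where \<psi>: "wf_fm L \<psi>" "fv \<psi> \<subseteq> (\<Union>i\<in>fv (unpar ?g \<phi>). fv_tm (?f i))" 
    "\<And>s. sat M s \<psi> \<longleftrightarrow> sat M (\<lambda>i. eval_tm M s (?f i)) (unpar ?g \<phi>)"
    using ex_subst[OF w(1), of ?f M] by auto
  have "fv \<psi> \<subseteq> {..<n + length cs}"
  proof
    fix x assume "x \<in> fv \<psi>"
    from subsetD[OF \<psi>(2) this] obtain i where "i \<in> fv (unpar ?g \<phi>)" "x \<in> fv_tm (?f i)" by (elim UN_E) (rule that)
    then have i: "i \<in> fv \<phi> \<union> ?g ` F" "x = (if i < n then i else n + (i - N))" using w(2) by auto
    then show "x \<in> {..<n + length cs}" using \<phi>(2) j by (auto split: if_splits)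
  qed
  moreover have "sat (named M) s \<phi> \<longleftrightarrow> sat M (\<lambda>i. if i < n then s i else cs ! (i - n)) \<psi>" for s
  proof -
    let ?s = "\<lambda>i. if i < n then s i else cs ! (i - n)"
    let ?t = "\<lambda>i. eval_tm M ?s (?f i)"
    have "sat M ?t (unpar ?g \<phi>) \<longleftrightarrow> sat (named M) ?t \<phi>"
    proof (rule sat_unpar[OF F(3)])
      fix a assume "a \<in> F"
      then show "?t (?g a) = a \<and> ?g a \<notin> bound_vars \<phi>" using j N by auto
    qed
    also have "\<dots> \<longleftrightarrow> sat (named M) s \<phi>" by (rule sat_cong) (use \<phi>(2) in auto)
    finally show ?thesis using \<psi>(3) by blast
  qed
  ultimately show ?thesis using \<psi>(1) F(2) cs by blast
qed

lemma map_Inl: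
  "wf_tm L t \<Longrightarrow> wf_tm (with_params L A) (map_tm Inl t)" "fv_tm (map_tm Inl t) = fv_tm t"
  "eval_tm (named M) s (map_tm Inl t) = eval_tm M s t"
proof -
  show "wf_tm L t \<Longrightarrow> wf_tm (with_params L A) (map_tm Inl t)" by (induction t) (auto simp: with_params_def)
  show "fv_tm (map_tm Inl t) = fv_tm t" by (induction t) auto
  show "eval_tm (named M) s (map_tm Inl t) = eval_tm M s t"
  proof (induction t)
    case (Fn f ts)
    then have "map (eval_tm (named M) s) (map (map_tm Inl) ts) = map (eval_tm M s) ts" by simp
    then show ?case by (simp del: map_map)
  qed simp
qed

lemma map_fm_Inl:
  "wf_fm L \<phi> \<Longrightarrow> wf_fm (with_params L A) (map_fm Inl id \<phi>)" "fv (map_fm Inl id \<phi>) = fv \<phi>"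
  "sat (named M) s (map_fm Inl id \<phi>) = sat M s \<phi>"
proof -
  show "wf_fm L \<phi> \<Longrightarrow> wf_fm (with_params L A) (map_fm Inl id \<phi>)" 
    by (induction \<phi>) (auto simp: map_Inl)
  show "fv (map_fm Inl id \<phi>) = fv \<phi>" by (induction \<phi>) (auto simp: map_Inl)
  show "sat (named M) s (map_fm Inl id \<phi>) = sat M s \<phi>"
  proof (induction \<phi> arbitrary: s)
    case (Rel r ts)
    have "map (eval_tm (named M) s) (map (map_tm Inl) ts) = map (eval_tm M s) ts" by (simp add: map_Inl)
    then show ?case by (simp del: map_map)
  qed (auto simp: map_Inl)
qed

text \<open>The formula is read in the larger language along \<open>Inl\<close>, and the constants
  naming \<open>cs\<close> are substituted for the variables from \<open>n\<close> on.\<close>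

lemma ex_vars_to_params:
  fixes \<psi> :: "('f, 'r) fm" and M :: "('f, 'r, 'a) struc"
  assumes "wf_fm L \<psi>" "fv \<psi> \<subseteq> {..<n + length cs}" "set cs \<subseteq> A"
  shows "\<exists>\<phi>. wf_fm (with_params L A) \<phi> \<and> fv \<phi> \<subseteq> {..<n} \<and> 
     (\<forall>s. sat (named M) s \<phi> \<longleftrightarrow> sat M (\<lambda>i. if i < n then s i else cs ! (i - n)) \<psi>)"
proof -
  let ?f = "\<lambda>i. if i < n then Var i else Fn (Inr (cs ! (i - n))) [] :: ('f + 'a) tm"
  let ?\<psi> = "map_fm Inl id \<psi> :: ('f + 'a, 'r) fm"
  have w: "wf_fm (with_params L A) ?\<psi>" using map_fm_Inl(1) assms by blast
  have "wf_tm (with_params L A) (?f i)" if "i \<in> fv ?\<psi>" for i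
  proof (cases "i < n")
    case False
    then have "i - n < length cs" using that assms(2) by (auto simp: map_fm_Inl)
    then have "cs ! (i - n) \<in> A" using assms(3) nth_mem by blast
    then show ?thesis using False by (simp add: with_params_def)
  qed simp
  then have "\<exists>\<phi>. wf_fm (with_params L A) \<phi> \<and> fv \<phi> \<subseteq> (\<Union>i\<in>fv ?\<psi>. fv_tm (?f i)) \<and>
    (\<forall>s. sat (named M) s \<phi> \<longleftrightarrow> sat (named M) (\<lambda>i. eval_tm (named M) s (?f i)) ?\<psi>)"
    by (rule ex_subst[OF w])
  then obtain \<phi> where \<phi>': "wf_fm (with_params L A) \<phi> \<and> fv \<phi> \<subseteq> (\<Union>i\<in>fv ?\<psi>. fv_tm (?f i)) \<and>
    (\<forall>s. sat (named M) s \<phi> \<longleftrightarrow> sat (named M) (\<lambda>i. eval_tm (named M) s (?f i)) ?\<psi>)" ..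
  then have \<phi>: "wf_fm (with_params L A) \<phi>" "fv \<phi> \<subseteq> (\<Union>i\<in>fv ?\<psi>. fv_tm (?f i))"
    "\<And>s. sat (named M) s \<phi> \<longleftrightarrow> sat (named M) (\<lambda>i. eval_tm (named M) s (?f i)) ?\<psi>"
    by blast+
  have "fv \<phi> \<subseteq> {..<n}" using \<phi>(2) by (auto split: if_splits)
  moreover have "(\<lambda>i. eval_tm (named M) s (?f i)) = (\<lambda>i. if i < n then s i else cs ! (i - n))" for s
    by auto
  ultimately show ?thesis using \<phi> by (auto simp: map_fm_Inl)
qed

lemma eval_in_universe:
  assumes "is_struc L M" shows "wf_tm L t \<Longrightarrow> (\<And>i. i \<in> fv_tm t \<Longrightarrow> s i \<in> universe M) \<Longrightarrow> eval_tm M s t \<in> universe M"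
proof (induction t)
  case (Fn f ts)
  have "eval_tm M s t \<in> universe M" if "t \<in> set ts" for t using Fn.IH[OF that] Fn.prems that by auto
  then have "map (eval_tm M s) ts \<in> lists (universe M)" by auto
  then show ?case using Fn.prems assms by (auto simp: is_struc_def)
qed simp

lemma isom_eval:
  assumes "is_struc L M" "isom L h M N"
  shows "wf_tm L t \<Longrightarrow> (\<And>i. i \<in> fv_tm t \<Longrightarrow> s i \<in> universe M) \<Longrightarrow> h (eval_tm M s t) = eval_tm N (h \<circ> s) t"
proof (induction t)
  case (Fn f ts)
  have "eval_tm M s t \<in> universe M" if "t \<in> set ts" for t 
    using eval_in_universe[OF assms(1), of t s] Fn.prems that by auto
  then have "map (eval_tm M s) ts \<in> lists (universe M)" by auto
  then have "h (fint M f (map (eval_tm M s) ts)) = fint N f (map h (map (eval_tm M s) ts))"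
    using assms(2) Fn.prems unfolding isom_def by auto
  moreover have "h (eval_tm M s t) = eval_tm N (h \<circ> s) t" if "t \<in> set ts" for t 
    by (rule Fn.IH[OF that]) (use Fn.prems that in auto)
  then have "map h (map (eval_tm M s) ts) = map (eval_tm N (h \<circ> s)) ts"
    unfolding map_map by (intro map_cong[OF refl]) (unfold o_apply, blast)
  ultimately show ?case unfolding eval_tm.simps by (simp only:)
qed simp

lemma isom_sat:
  assumes "is_struc L M" "isom L h M N"
  shows "wf_fm L \<phi> \<Longrightarrow> (\<And>i. i \<in> fv \<phi> \<Longrightarrow> s i \<in> universe M) \<Longrightarrow> sat M s \<phi> \<longleftrightarrow> sat N (h \<circ> s) \<phi>"
proof (induction \<phi> arbitrary: s)
  case (Eq t u)
  have "eval_tm M s t \<in> universe M" "eval_tm M s u \<in> universe M" 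
    using eval_in_universe[OF assms(1), of _ s] Eq.prems by simp_all
  then have "eval_tm M s t = eval_tm M s u \<longleftrightarrow> h (eval_tm M s t) = h (eval_tm M s u)"
    using assms(2) by (auto simp: isom_def bij_betw_def dest: inj_onD)
  moreover have "h (eval_tm M s t) = eval_tm N (h \<circ> s) t" "h (eval_tm M s u) = eval_tm N (h \<circ> s) u"
    using isom_eval[OF assms, of _ s] Eq.prems by simp_all
  ultimately show ?case unfolding sat.simps by (simp only:)
next
  case (Rel r ts)
  have "eval_tm M s t \<in> universe M" if "t \<in> set ts" for t 
    using eval_in_universe[OF assms(1), of t s] Rel.prems that by auto
  then have "map (eval_tm M s) ts \<in> lists (universe M)" by auto
  then have "rint M r (map (eval_tm M s) ts) = rint N r (map h (map (eval_tm M s) ts))"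
    using assms(2) Rel.prems unfolding isom_def by auto
  moreover have "h (eval_tm M s t) = eval_tm N (h \<circ> s) t" if "t \<in> set ts" for t 
    by (rule isom_eval[OF assms]) (use Rel.prems that in auto)
  then have "map h (map (eval_tm M s) ts) = map (eval_tm N (h \<circ> s)) ts" 
    unfolding map_map by (intro map_cong[OF refl]) (unfold o_apply, blast)
  ultimately show ?case unfolding sat.simps by (simp only:)
next
  case (Imp \<phi> \<psi>)
  then show ?case using Imp.IH(1)[of s] Imp.IH(2)[of s] by simp
next
  case (All i \<phi>)
  have h: "h ` universe M = universe N" using assms(2) by (auto simp: isom_def bij_betw_def)
  have "sat M (s(i := a)) \<phi> = sat N ((h \<circ> s)(i := h a)) \<phi>" if "a \<in> universe M" for a
  proof -
    have "sat M (s(i := a)) \<phi> = sat N (h \<circ> s(i := a)) \<phi>" by (rule All.IH) (use All.prems that in auto)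
    moreover have "h \<circ> s(i := a) = (h \<circ> s)(i := h a)" by auto
    ultimately show ?thesis by simp
  qed
  moreover have "(\<forall>b\<in>universe N. sat N ((h \<circ> s)(i := b)) \<phi>) \<longleftrightarrow> (\<forall>a\<in>universe M. sat N ((h \<circ> s)(i := h a)) \<phi>)"
    using h by (metis imageE imageI)
  ultimately show ?case unfolding sat.simps by blast
qed simp

lemma eval_automorphism:
  assumes "is_struc L M" "isom L h M M"
  shows "wf_tm (with_params L (universe M)) t \<Longrightarrow> (\<And>i. s i \<in> universe M) \<Longrightarrow> 
    eval_tm (named M) s t \<in> universe M \<and> eval_tm (named M) (h \<circ> s) (map_tm (map_sum id h) t) = h (eval_tm (named M) s t)"
proof (induction t)
  case (Fn f ts)
  have IH: "\<forall>t\<in>set ts. eval_tm (named M) s t \<in> universe M \<and> 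
    eval_tm (named M) (h \<circ> s) (map_tm (map_sum id h) t) = h (eval_tm (named M) s t)"
    using Fn.IH Fn.prems unfolding wf_tm.simps by blast
  show ?case
  proof (cases f)
    case (Inr a)
    then show ?thesis using Fn.prems by auto
  next
    case (Inl g)
    have l: "map (eval_tm (named M) s) ts \<in> lists (universe M)" using IH by auto
    have g: "g \<in> funs L" "length ts = farity L g" using Fn.prems Inl by auto
    have "map (eval_tm (named M) (h \<circ> s)) (map (map_tm (map_sum id h)) ts) = map h (map (eval_tm (named M) s) ts)" 
      unfolding map_map by (rule map_cong[OF refl]) (use IH in \<open>unfold o_apply, blast\<close>)
    moreover have "h (fint M g (map (eval_tm (named M) s) ts)) = fint M g (map h (map (eval_tm (named M) s) ts))"
      using assms(2) l g unfolding isom_def by auto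
    moreover have "fint M g (map (eval_tm (named M) s) ts) \<in> universe M" using assms(1) l g by (auto simp: is_struc_def)
    ultimately show ?thesis unfolding Inl tm.map eval_tm.simps map_sum.simps named_simps id_apply by (simp only:)
  qed
qed auto

text \<open>The automorphism acts on the assignment and on the named parameters simultaneously. This
  is the action in which the invariance of the global type is expressed.\<close>

lemma sat_automorphism:
  assumes "is_struc L M" "isom L h M M"
  shows "wf_fm (with_params L (universe M)) \<phi> \<Longrightarrow> (\<And>i. s i \<in> universe M) \<Longrightarrow> 
    sat (named M) (h \<circ> s) (map_fm (map_sum id h) id \<phi>) \<longleftrightarrow> sat (named M) s \<phi>"
proof (induction \<phi> arbitrary: s)
  case (Eq t u)
  have e: "eval_tm (named M) s v \<in> universe M \<and> eval_tm (named M) (h \<circ> s) (map_tm (map_sum id h) v) = h (eval_tm (named M) s v)"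
    if "v = t \<or> v = u" for v by (rule eval_automorphism[OF assms]) (use Eq.prems that in auto)
  then have "eval_tm (named M) s t \<in> universe M" "eval_tm (named M) s u \<in> universe M" by blast+
  then have "eval_tm (named M) s t = eval_tm (named M) s u \<longleftrightarrow> h (eval_tm (named M) s t) = h (eval_tm (named M) s u)"
    using assms(2) by (auto simp: isom_def bij_betw_def dest: inj_onD)
  then show ?case using e[of t] e[of u] unfolding sat.simps fm.map by simp
next
  case (Rel r ts)
  have "\<forall>t\<in>set ts. eval_tm (named M) s t \<in> universe M \<and> 
    eval_tm (named M) (h \<circ> s) (map_tm (map_sum id h) t) = h (eval_tm (named M) s t)"
    using Rel.prems eval_automorphism[OF assms] unfolding wf_fm.simps by blast
  then have l: "map (eval_tm (named M) s) ts \<in> lists (universe M)" 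
    "map (eval_tm (named M) (h \<circ> s)) (map (map_tm (map_sum id h)) ts) = map h (map (eval_tm (named M) s) ts)" 
    unfolding map_map by (force, intro map_cong[OF refl]) (unfold o_apply, blast)
  from l(1) have "rint M r (map (eval_tm (named M) s) ts) = rint M r (map h (map (eval_tm (named M) s) ts))"
    using assms(2) Rel.prems unfolding isom_def by auto
  then show ?case using l(2) unfolding sat.simps fm.map named_simps id_apply by (simp only: list.map_id)
next
  case (Imp \<phi> \<psi>)
  then show ?case using Imp.IH(1)[of s] Imp.IH(2)[of s] by simp
next
  case (All i \<phi>)
  have h: "h ` universe M = universe M" using assms(2) by (auto simp: isom_def bij_betw_def)
  have *: "sat (named M) ((h \<circ> s)(i := h a)) (map_fm (map_sum id h) id \<phi>) = sat (named M) (s(i := a)) \<phi>" if "a \<in> universe M" for a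
  proof -
    have "sat (named M) (h \<circ> s(i := a)) (map_fm (map_sum id h) id \<phi>) = sat (named M) (s(i := a)) \<phi>" 
      by (rule All.IH) (use All.prems that in auto)
    moreover have "h \<circ> s(i := a) = (h \<circ> s)(i := h a)" by auto
    ultimately show ?thesis by simp
  qed
  have "(\<forall>b\<in>universe M. sat (named M) ((h \<circ> s)(i := b)) (map_fm (map_sum id h) id \<phi>)) \<longleftrightarrow>
     (\<forall>a\<in>universe M. sat (named M) ((h \<circ> s)(i := h a)) (map_fm (map_sum id h) id \<phi>))" 
    using h by (metis imageE imageI)
  then show ?case using * unfolding sat.simps fm.map named_simps by blast
qed simp

lemma eval_tm_restr [simp]: "eval_tm (restr M B) s t = eval_tm M s t"
proof (induction t)
  case (Fn f ts)
  then have "map (eval_tm (restr M B) s) ts = map (eval_tm M s) ts" by simp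
  then have "fint M f (map (eval_tm (restr M B) s) ts) = fint M f (map (eval_tm M s) ts)" by (rule arg_cong)
  then show ?case by (simp add: restr_def)
qed simp

lemma restr_simps [simp]: "universe (restr M B) = B" "rint (restr M B) = rint M" "fint (restr M B) = fint M"
  by (simp_all add: restr_def)

lemma sat_restr_qfree: "qfree \<phi> \<Longrightarrow> sat (restr M B) s \<phi> \<longleftrightarrow> sat M s \<phi>"
proof (induction \<phi>)
  case (Rel r ts)
  have "map (eval_tm (restr M B) s) ts = map (eval_tm M s) ts" by simp
  then have "rint M r (map (eval_tm (restr M B) s) ts) = rint M r (map (eval_tm M s) ts)" by (rule arg_cong)
  then show ?case by simp
qed auto

section \<open>Countability\<close>

instance tm :: (countable) countable by countable_datatype
instance fm :: (countable, countable) countable by countable_datatype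

lemma wf_tm_set: "wf_tm L t \<Longrightarrow> set_tm t \<subseteq> funs L"
  by (induction t) auto

lemma wf_fm_set: "wf_fm L \<phi> \<Longrightarrow> set1_fm \<phi> \<subseteq> funs L \<and> set2_fm \<phi> \<subseteq> rels L"
proof (induction \<phi>)
  case (Rel r ts)
  then show ?case using wf_tm_set by fastforce
next
  case (Eq t u)
  then show ?case using wf_tm_set by fastforce
qed auto

text \<open>The symbol types themselves may be uncountable, but a well-formed formula contains only
  symbols of \<open>L\<close>, so numbering these is injective on well-formed formulas.\<close>

lemma countable_wf_fm:
  assumes "countable (funs L)" "countable (rels L)" shows "countable {\<phi>. wf_fm L \<phi>}"
proof -
  let ?h = "map_fm (to_nat_on (funs L)) (to_nat_on (rels L))"
  have "inj_on ?h {\<phi>. wf_fm L \<phi>}"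
  proof (rule inj_onI)
    fix \<phi> \<psi> assume "\<phi> \<in> {\<phi>. wf_fm L \<phi>}" "\<psi> \<in> {\<phi>. wf_fm L \<phi>}" and eq: "?h \<phi> = ?h \<psi>"
    then have w: "set1_fm \<phi> \<subseteq> funs L" "set1_fm \<psi> \<subseteq> funs L" "set2_fm \<phi> \<subseteq> rels L" "set2_fm \<psi> \<subseteq> rels L" 
      using wf_fm_set by auto
    show "\<phi> = \<psi>"
      by (rule fm.inj_map_strong[OF _ _ eq]) 
        (use w assms in \<open>auto dest: inj_onD[OF inj_on_to_nat_on]\<close>)
  qed
  then show ?thesis using countableI'[of "to_nat \<circ> ?h"] by (simp add: comp_inj_on)
qed

lemma uncountable_bool_sequences: "\<not> countable (UNIV :: (nat \<Rightarrow> bool) set)"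
proof
  assume c: "countable (UNIV :: (nat \<Rightarrow> bool) set)"
  let ?f = "\<lambda>n. \<not> from_nat_into UNIV n n"
  obtain n where "from_nat_into UNIV n = ?f" using from_nat_into_surj[OF c] by blast
  then show False by (metis (full_types))
qed

section \<open>The monster model as a structure of definable sets\<close>

locale monster_regular =
  fixes L :: "('f, 'r) lang" and T :: "('f, 'r) fm set" and \<kappa> :: "'k rel"
    and C :: "('f, 'r, 'm) struc" and p :: "('f + 'm, 'r) fm set"
  assumes countable_funs: "countable (funs L)" and countable_rels: "countable (rels L)"
    and QE: "quantifier_elimination TYPE('m) L T"
    and stable: "omega_stable TYPE('m) L T"
    and monster: "monster L T \<kappa> C"
    and sreg: "strongly_regular L \<kappa> C p"
    and nonisolated: "\<And>A. A \<subseteq> universe C \<Longrightarrow> finite A \<Longrightarrow> \<not> isolated C (type_restr L p A)"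
begin

abbreviation "U \<equiv> universe C"

definition Df :: "nat \<Rightarrow> ('m list \<Rightarrow> bool) \<Rightarrow> bool" where
  "Df n P \<longleftrightarrow> (\<exists>\<phi>. wf_fm L \<phi> \<and> fv \<phi> \<subseteq> {..<n} \<and> (\<forall>xs\<in>tuples U n. P xs = sat C (\<lambda>i. xs ! i) \<phi>))"

lemma DfI: "wf_fm L \<phi> \<Longrightarrow> fv \<phi> \<subseteq> {..<n} \<Longrightarrow> (\<And>xs. xs \<in> tuples U n \<Longrightarrow> P xs = sat C (\<lambda>i. xs ! i) \<phi>) \<Longrightarrow> Df n P"
  unfolding Df_def by blast

lemma struc: "is_struc L C"
  using monster by (simp add: monster_def models_def)

sublocale definable_sets U Df
proof
  show "U \<noteq> {}" using struc by (simp add: is_struc_def)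
  show "Df n Q" if "Df n P" "\<And>xs. xs \<in> tuples U n \<Longrightarrow> P xs = Q xs" for n P Q
    using that unfolding Df_def by auto
  show "Df n (\<lambda>xs. \<not> P xs)" if D: "Df n P" for n P
  proof -
    obtain \<phi> where "wf_fm L \<phi>" "fv \<phi> \<subseteq> {..<n}" "\<forall>xs\<in>tuples U n. P xs = sat C (\<lambda>i. xs ! i) \<phi>" using D unfolding Df_def by blast
    then show ?thesis by (intro DfI[of "Neg \<phi>"]) auto
  qed
  show "Df n (\<lambda>xs. P xs \<and> Q xs)" if D: "Df n P" "Df n Q" for n P Q
  proof -
    obtain \<phi> where "wf_fm L \<phi>" "fv \<phi> \<subseteq> {..<n}" "\<forall>xs\<in>tuples U n. P xs = sat C (\<lambda>i. xs ! i) \<phi>" using D unfolding Df_def by blast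
    moreover obtain \<psi> where "wf_fm L \<psi>" "fv \<psi> \<subseteq> {..<n}" "\<forall>xs\<in>tuples U n. Q xs = sat C (\<lambda>i. xs ! i) \<psi>" using D unfolding Df_def by blast
    ultimately show ?thesis by (intro DfI[of "Conj \<phi> \<psi>"]) auto
  qed
  show "Df n (\<lambda>xs. \<exists>a\<in>U. P (xs @ [a]))" if D: "Df (Suc n) P" for n P
  proof -
    obtain \<phi> where \<phi>: "wf_fm L \<phi>" "fv \<phi> \<subseteq> {..<Suc n}" "\<forall>xs\<in>tuples U (Suc n). P xs = sat C (\<lambda>i. xs ! i) \<phi>" using D unfolding Df_def by blast
    show ?thesis
    proof (rule DfI[of "Ex n \<phi>"])
      show "wf_fm L (Ex n \<phi>)" "fv (Ex n \<phi>) \<subseteq> {..<n}" using \<phi> by auto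
      fix xs assume xs: "xs \<in> tuples U n"
      have "P (xs @ [a]) = sat C ((\<lambda>i. xs ! i)(n := a)) \<phi>" if "a \<in> U" for a
      proof -
        have "xs @ [a] \<in> tuples U (Suc n)" using xs that by (simp add: tuples_def)
        moreover have "sat C (\<lambda>i. (xs @ [a]) ! i) \<phi> = sat C ((\<lambda>i. xs ! i)(n := a)) \<phi>"
          by (rule sat_cong) (use \<phi>(2) tuplesD[OF xs] in \<open>auto simp: nth_append\<close>)
        ultimately show ?thesis using \<phi>(3) by blast
      qed
      then show "(\<exists>a\<in>U. P (xs @ [a])) = sat C (\<lambda>i. xs ! i) (Ex n \<phi>)" by auto
    qed
  qed
  show "Df m (\<lambda>xs. P (map (\<lambda>i. xs ! f i) [0..<n]))" if P: "Df n P" and f: "\<And>i. i < n \<Longrightarrow> f i < m" for n P f m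
  proof -
    obtain \<phi> where \<phi>: "wf_fm L \<phi>" "fv \<phi> \<subseteq> {..<n}" "\<forall>xs\<in>tuples U n. P xs = sat C (\<lambda>i. xs ! i) \<phi>" using P unfolding Df_def by blast
    obtain \<psi> where \<psi>: "wf_fm L \<psi>" "fv \<psi> \<subseteq> (\<Union>i\<in>fv \<phi>. fv_tm (Var (f i) :: 'f tm))" 
      "\<forall>s. sat C s \<psi> \<longleftrightarrow> sat C (\<lambda>i. eval_tm C s (Var (f i))) \<phi>" using ex_subst[OF \<phi>(1), of "\<lambda>i. Var (f i)" C] by auto
    show ?thesis
    proof (rule DfI[OF \<psi>(1)])
      show "fv \<psi> \<subseteq> {..<m}" using \<psi>(2) \<phi>(2) f by fastforce
      fix xs assume xs: "xs \<in> tuples U m"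
      have "map (\<lambda>i. xs ! f i) [0..<n] \<in> tuples U n" using tuples_nth[OF xs] f by (auto simp: tuples_def)
      moreover have "sat C (\<lambda>i. map (\<lambda>i. xs ! f i) [0..<n] ! i) \<phi> = sat C (\<lambda>i. xs ! f i) \<phi>"
        by (rule sat_cong) (use \<phi>(2) in auto)
      ultimately show "P (map (\<lambda>i. xs ! f i) [0..<n]) = sat C (\<lambda>i. xs ! i) \<psi>" using \<phi>(3) \<psi>(3) by simp
    qed
  qed
  show "Df 2 (\<lambda>xs. xs ! 0 = xs ! 1)" by (rule DfI[of "Eq (Var 0) (Var 1)"]) auto
qed

lemma Def_iff_fm:
  assumes "A \<subseteq> U"
  shows "Def A n P \<longleftrightarrow> (\<exists>\<phi>. wf_fm (with_params L A) \<phi> \<and> fv \<phi> \<subseteq> {..<n} \<and> 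
    (\<forall>xs\<in>Tp n. P xs = sat (named C) (\<lambda>i. xs ! i) \<phi>))"
proof
  assume "Def A n P"
  then obtain cs Q where cs: "set cs \<subseteq> A \<inter> U" "Df (n + length cs) Q" "\<And>xs. xs \<in> Tp n \<Longrightarrow> P xs = Q (xs @ cs)"
    unfolding Def_def by blast
  obtain \<psi> where \<psi>: "wf_fm L \<psi>" "fv \<psi> \<subseteq> {..<n + length cs}" "\<forall>xs\<in>Tp (n + length cs). Q xs = sat C (\<lambda>i. xs ! i) \<psi>"
    using cs(2) unfolding Df_def by blast
  have "set cs \<subseteq> A" using cs(1) by blast
  from ex_vars_to_params[OF \<psi>(1,2) this, of C] obtain \<phi> where \<phi>: "wf_fm (with_params L A) \<phi> \<and> fv \<phi> \<subseteq> {..<n} \<and> 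
     (\<forall>s. sat (named C) s \<phi> \<longleftrightarrow> sat C (\<lambda>i. if i < n then s i else cs ! (i - n)) \<psi>)" ..
  have "P xs = sat (named C) (\<lambda>i. xs ! i) \<phi>" if xs: "xs \<in> Tp n" for xs
  proof -
    have "xs @ cs \<in> Tp (n + length cs)" using xs cs(1) by (auto simp: tuples_def)
    moreover have "(\<lambda>i. (xs @ cs) ! i) = (\<lambda>i. if i < n then xs ! i else cs ! (i - n))" 
      using tuplesD(1)[OF xs] by (auto simp: nth_append)
    ultimately show ?thesis using \<phi> cs(3)[OF xs] \<psi>(3) by metis
  qed
  then show "\<exists>\<phi>. wf_fm (with_params L A) \<phi> \<and> fv \<phi> \<subseteq> {..<n} \<and> 
    (\<forall>xs\<in>Tp n. P xs = sat (named C) (\<lambda>i. xs ! i) \<phi>)" using \<phi> by blast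
next
  assume "\<exists>\<phi>. wf_fm (with_params L A) \<phi> \<and> fv \<phi> \<subseteq> {..<n} \<and> 
    (\<forall>xs\<in>Tp n. P xs = sat (named C) (\<lambda>i. xs ! i) \<phi>)"
  then obtain \<phi> where \<phi>: "wf_fm (with_params L A) \<phi>" "fv \<phi> \<subseteq> {..<n}" "\<forall>xs\<in>Tp n. P xs = sat (named C) (\<lambda>i. xs ! i) \<phi>" by blast
  from ex_params_to_vars[OF \<phi>(1,2), of C] obtain cs \<psi> where \<psi>: "set cs \<subseteq> A" "wf_fm L \<psi>" "fv \<psi> \<subseteq> {..<n + length cs}"
     "\<forall>s. sat (named C) s \<phi> \<longleftrightarrow> sat C (\<lambda>i. if i < n then s i else cs ! (i - n)) \<psi>" 
    by (elim exE conjE) (rule that)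
  let ?Q = "\<lambda>zs. sat C (\<lambda>i. zs ! i) \<psi>"
  have "P xs = ?Q (xs @ cs)" if xs: "xs \<in> Tp n" for xs
  proof -
    have "(\<lambda>i. (xs @ cs) ! i) = (\<lambda>i. if i < n then xs ! i else cs ! (i - n))" 
      using tuplesD(1)[OF xs] by (auto simp: nth_append)
    then show ?thesis using \<phi>(3) xs \<psi>(4) by metis
  qed
  moreover have "Df (n + length cs) ?Q" by (rule DfI[OF \<psi>(2,3)]) simp
  moreover have "set cs \<subseteq> A \<inter> U" using \<psi>(1) assms by blast
  ultimately show "Def A n P" unfolding Def_def by blast
qed

lemma sat_nth_1: "fv \<phi> \<subseteq> {..<1} \<Longrightarrow> sat M (\<lambda>i. [a] ! i) \<phi> \<longleftrightarrow> sat M (\<lambda>_. a) \<phi>"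
  by (rule sat_cong) auto

lemma small_finite: "finite A \<Longrightarrow> small \<kappa> A"
  unfolding small_def using monster finite_iff_ordLess_natLeq ordLess_transitive
  by (metis monster_def)

lemma small_countable: "countable A \<Longrightarrow> small \<kappa> A"
  unfolding small_def using monster ordLeq_ordLess_trans countable_card_le_natLeq
  by (metis monster_def)

text \<open>The formulas over \<open>A\<close> whose solution sets are large for the ultrafilter.
  This replaces Lindenbaum's lemma as the source of complete types.\<close>

definition ultra_type :: "'m list set set \<Rightarrow> 'm set \<Rightarrow> nat \<Rightarrow> ('f + 'm, 'r) fm set" where
  "ultra_type \<U> A n = {\<phi>. wf_fm (with_params L A) \<phi> \<and> fv \<phi> \<subseteq> {..<n} \<and> {xs. sat (named C) (\<lambda>i. xs ! i) \<phi>} \<in> \<U>}"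

lemma complete_ultra_type:
  assumes "fip \<U>" "\<And>Y. Y \<in> \<U> \<or> - Y \<in> \<U>" "Tp n \<in> \<U>"
  shows "complete_type L C A n (ultra_type \<U> A n)"
  unfolding complete_type_def
proof (intro conjI allI impI ballI)
  fix F assume F: "F \<subseteq> ultra_type \<U> A n" "finite F"
  let ?G = "insert (Tp n) ((\<lambda>\<phi>. {xs. sat (named C) (\<lambda>i. xs ! i) \<phi>}) ` F)"
  have "finite ?G" "?G \<subseteq> \<U>" using F assms(3) by (auto simp: ultra_type_def)
  then have "\<Inter>?G \<noteq> {}" using assms(1) unfolding fip_def by blast
  then obtain xs where xs: "xs \<in> Tp n" "\<And>\<phi>. \<phi> \<in> F \<Longrightarrow> sat (named C) (\<lambda>i. xs ! i) \<phi>" by auto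
  obtain u where u: "u \<in> U" using U_nonempty by blast
  let ?s = "\<lambda>i. if i < n then xs ! i else u"
  have "sat (named C) ?s \<phi>" if "\<phi> \<in> F" for \<phi>
  proof -
    have "fv \<phi> \<subseteq> {..<n}" using F(1) that by (auto simp: ultra_type_def)
    then have "sat (named C) ?s \<phi> = sat (named C) (\<lambda>i. xs ! i) \<phi>" by (intro sat_cong) auto
    then show ?thesis using xs(2)[OF that] by simp
  qed
  moreover have "\<forall>i. ?s i \<in> U" using u tuples_nth[OF xs(1)] by auto
  ultimately show "\<exists>s. (\<forall>i. s i \<in> U) \<and> (\<forall>\<phi>\<in>F. sat (named C) s \<phi>)" 
    by (intro exI[of _ ?s] conjI ballI)
next
  fix \<phi> :: "('f + 'm, 'r) fm" assume \<phi>: "wf_fm (with_params L A) \<phi> \<and> fv \<phi> \<subseteq> {..<n}"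
  have "{xs. sat (named C) (\<lambda>i. xs ! i) (Neg \<phi>)} = - {xs. sat (named C) (\<lambda>i. xs ! i) \<phi>}" by auto
  then show "\<phi> \<in> ultra_type \<U> A n \<or> Neg \<phi> \<in> ultra_type \<U> A n"
    using assms(2)[of "{xs. sat (named C) (\<lambda>i. xs ! i) \<phi>}"] \<phi> unfolding ultra_type_def by auto
qed (auto simp: ultra_type_def)

lemma mem_ultra_type:
  assumes "fip \<U>" "\<And>Y. Y \<in> \<U> \<or> - Y \<in> \<U>" "Tp n \<in> \<U>" "Collect P \<in> \<U>"
    and "wf_fm (with_params L A) \<phi>" "fv \<phi> \<subseteq> {..<n}" "\<And>xs. xs \<in> Tp n \<Longrightarrow> P xs = sat (named C) (\<lambda>i. xs ! i) \<phi>"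
  shows "\<phi> \<in> ultra_type \<U> A n"
proof -
  have "{xs. sat (named C) (\<lambda>i. xs ! i) \<phi>} \<in> \<U>"
    by (rule fip_Inter_mem[OF assms(1,2), of "{Tp n, Collect P}"]) (use assms(3,4,7) in auto)
  then show ?thesis using assms(5,6) by (simp add: ultra_type_def)
qed

text \<open>Choosing two disjoint subsets in \<open>S\<close> again and again gives a binary tree.
  Each of its branches has the finite intersection property and extends to a complete type; distinct
  branches give distinct types, so there are uncountably many over the countable set of parameters
  of the tree.\<close>

lemma no_tree:
  assumes S: "\<And>P. P \<in> S \<Longrightarrow> Def U n P \<and> (\<exists>xs\<in>Tp n. P xs) \<and> 
      (\<exists>Q\<in>S. \<exists>R\<in>S. \<forall>xs\<in>Tp n. (Q xs \<longrightarrow> P xs) \<and> (R xs \<longrightarrow> P xs) \<and> \<not> (Q xs \<and> R xs))"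
  shows "S = {}"
proof (rule ccontr)
  assume "S \<noteq> {}"
  then obtain P0 where P0: "P0 \<in> S" by blast
  have "\<forall>P\<in>S. \<exists>h :: bool \<Rightarrow> 'm list \<Rightarrow> bool. (\<forall>b. h b \<in> S) \<and> 
    (\<forall>xs\<in>Tp n. (h True xs \<longrightarrow> P xs) \<and> (h False xs \<longrightarrow> P xs) \<and> \<not> (h True xs \<and> h False xs))"
  proof
    fix P assume "P \<in> S"
    from S[OF this, THEN conjunct2, THEN conjunct2]
    obtain Q R where "Q \<in> S" "R \<in> S" "\<forall>xs\<in>Tp n. (Q xs \<longrightarrow> P xs) \<and> (R xs \<longrightarrow> P xs) \<and> \<not> (Q xs \<and> R xs)"
      by (elim bexE) (rule that)
    then show "\<exists>h :: bool \<Rightarrow> 'm list \<Rightarrow> bool. (\<forall>b. h b \<in> S) \<and> 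
      (\<forall>xs\<in>Tp n. (h True xs \<longrightarrow> P xs) \<and> (h False xs \<longrightarrow> P xs) \<and> \<not> (h True xs \<and> h False xs))"
      by (intro exI[of _ "\<lambda>b. if b then Q else R"]) simp
  qed
  from bchoice[OF this] obtain h :: "('m list \<Rightarrow> bool) \<Rightarrow> bool \<Rightarrow> 'm list \<Rightarrow> bool" where 
    h: "\<forall>P\<in>S. (\<forall>b. h P b \<in> S) \<and> 
    (\<forall>xs\<in>Tp n. (h P True xs \<longrightarrow> P xs) \<and> (h P False xs \<longrightarrow> P xs) \<and> \<not> (h P True xs \<and> h P False xs))" ..
  define tree where "tree bs = foldl h P0 bs" for bs
  have snoc: "tree (bs @ [b]) = h (tree bs) b" for bs b by (simp add: tree_def)
  have tS: "tree bs \<in> S" for bs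
    by (induction bs rule: rev_induct) (use P0 h in \<open>auto simp: tree_def\<close>)
  have sub: "tree (bs @ [b]) xs \<Longrightarrow> tree bs xs" if "xs \<in> Tp n" for bs b xs
    using h tS[of bs] that snoc[of bs b] by (cases b) auto
  have dis: "\<not> (tree (bs @ [b]) xs \<and> tree (bs @ [c]) xs)" if "xs \<in> Tp n" "b \<noteq> c" for bs b c xs
    using h tS[of bs] that snoc[of bs b] snoc[of bs c] by (cases b; cases c) auto
  have subs: "tree (bs @ cs) xs \<Longrightarrow> tree bs xs" if "xs \<in> Tp n" for bs cs xs
    by (induction cs rule: rev_induct) (use sub[OF that] in \<open>auto simp flip: append_assoc\<close>)
  have "\<forall>bs. \<exists>\<phi>. wf_fm (with_params L U) \<phi> \<and> fv \<phi> \<subseteq> {..<n} \<and> (\<forall>xs\<in>Tp n. tree bs xs = sat (named C) (\<lambda>i. xs ! i) \<phi>)"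
    using S[OF tS, THEN conjunct1] unfolding Def_iff_fm[OF order_refl] by blast
  from choice[OF this] obtain \<phi> where \<phi>': "\<forall>bs. wf_fm (with_params L U) (\<phi> bs) \<and> fv (\<phi> bs) \<subseteq> {..<n} \<and> 
    (\<forall>xs\<in>Tp n. tree bs xs = sat (named C) (\<lambda>i. xs ! i) (\<phi> bs))" ..
  have "\<forall>bs. \<exists>F. finite F \<and> F \<subseteq> U \<and> wf_fm (with_params L F) (\<phi> bs)"
    by (intro allI wf_fm_finite_params) (use \<phi>' in blast)
  from choice[OF this] obtain F where F: "\<forall>bs. finite (F bs) \<and> F bs \<subseteq> U \<and> wf_fm (with_params L (F bs)) (\<phi> bs)" ..
  \<comment> \<open>The nodes are finite sequences of truth values, hence countably many, and each
    formula has finitely many parameters.\<close>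
  define A where "A = (\<Union>bs. F bs)"
  have A: "countable A" "A \<subseteq> U" using F by (auto simp: A_def intro: countable_finite)
  have \<phi>: "wf_fm (with_params L A) (\<phi> bs)" "fv (\<phi> bs) \<subseteq> {..<n}" 
    "xs \<in> Tp n \<Longrightarrow> tree bs xs = sat (named C) (\<lambda>i. xs ! i) (\<phi> bs)" for bs xs
    subgoal by (rule wf_fm_params_mono[of L "F bs"]) (use F in \<open>auto simp: A_def\<close>)
    using \<phi>' by blast+
  let ?br = "\<lambda>f k. tree (map f [0..<k])"
  have br_mono: "?br f (k + j) xs \<Longrightarrow> ?br f k xs" if "xs \<in> Tp n" for f k j xs
  proof -
    have e: "map f [0..<k + j] = map f [0..<k] @ map f [k..<k + j]" unfolding upt_add_eq_append[OF le0] map_append ..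
    show "?br f (k + j) xs \<Longrightarrow> ?br f k xs" unfolding e by (rule subs[OF that])
  qed
  have "\<exists>\<U>. (Tp n \<in> \<U> \<and> (\<forall>k. Collect (?br f k) \<in> \<U>)) \<and> fip \<U> \<and> (\<forall>Y. Y \<in> \<U> \<or> - Y \<in> \<U>)" for f :: "nat \<Rightarrow> bool"
  proof -
    let ?A = "insert (Tp n) (range (\<lambda>k. Collect (?br f k)))"
    have "fip ?A" unfolding fip_def
    proof (intro allI impI, elim conjE)
      fix G assume G: "finite G" "G \<subseteq> ?A"
      have "\<exists>K. \<forall>Y\<in>G. Y = Tp n \<or> (\<exists>k\<le>K. Y = Collect (?br f k))"
        using G
      proof (induction G rule: finite_induct)
        case (insert Y G)
        then obtain K where K: "\<forall>Y\<in>G. Y = Tp n \<or> (\<exists>k\<le>K. Y = Collect (?br f k))" by auto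
        show ?case
        proof (cases "Y = Tp n")
          case False
          then obtain k where "Y = Collect (?br f k)" using insert.prems by auto
          then show ?thesis using K by (intro exI[of _ "max k K"]) (auto intro: le_max_iff_disj[THEN iffD2])
        qed (use K in auto)
      qed simp
      then obtain K where K: "\<forall>Y\<in>G. Y = Tp n \<or> (\<exists>k\<le>K. Y = Collect (?br f k))" ..
      obtain xs where xs: "xs \<in> Tp n" "?br f K xs" using S[OF tS] by blast
      have "xs \<in> Y" if "Y \<in> G" for Y
        using K that xs br_mono[OF xs(1), of f] by (metis le_Suc_ex mem_Collect_eq)
      then show "\<Inter>G \<noteq> {}" by blast
    qed
    from fip_ultrafilter[OF this] show ?thesis by auto
  qed
  from choice[OF allI[OF this]] obtain \<U> where 
    "\<forall>f. (Tp n \<in> \<U> f \<and> (\<forall>k. Collect (?br f k) \<in> \<U> f)) \<and> fip (\<U> f) \<and> (\<forall>Y. Y \<in> \<U> f \<or> - Y \<in> \<U> f)" ..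
  then have V: "Tp n \<in> \<U> f" "Collect (?br f k) \<in> \<U> f" "fip (\<U> f)" "Y \<in> \<U> f \<or> - Y \<in> \<U> f" for f k Y by simp_all
  let ?q = "\<lambda>f. ultra_type (\<U> f) A n"
  have ct: "complete_type L C A n (?q f)" for f by (rule complete_ultra_type[OF V(3,4,1)])
  have "inj ?q"
  proof (rule injI, rule ccontr)
    fix f g assume eq: "?q f = ?q g" and "f \<noteq> g"
    then obtain k0 where "f k0 \<noteq> g k0" by auto
    \<comment> \<open>At the first difference the two branches pass to disjoint children of the same
      node.\<close>
    define k where "k = (LEAST k. f k \<noteq> g k)"
    have k: "f k \<noteq> g k" "\<And>j. j < k \<Longrightarrow> f j = g j" unfolding k_def
      using LeastI[of "\<lambda>k. f k \<noteq> g k", OF \<open>f k0 \<noteq> g k0\<close>] not_less_Least by blast+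
    then have m: "map f [0..<k] = map g [0..<k]" by simp
    let ?bs = "map f [0..<k]"
    have "\<phi> (map f [0..<Suc k]) \<in> ?q f" by (rule mem_ultra_type[OF V(3,4,1) V(2)[of f "Suc k"]]) (use \<phi> in auto)
    then have "\<phi> (?bs @ [f k]) \<in> ?q g" using eq by simp
    then have "{xs. sat (named C) (\<lambda>i. xs ! i) (\<phi> (?bs @ [f k]))} \<in> \<U> g" by (simp add: ultra_type_def)
    moreover have "Collect (tree (?bs @ [g k])) \<in> \<U> g" unfolding m using V(2)[of g "Suc k"] by simp
    moreover note V(1)[of g]
    ultimately have "{Tp n, {xs. sat (named C) (\<lambda>i. xs ! i) (\<phi> (?bs @ [f k]))}, Collect (tree (?bs @ [g k]))} \<subseteq> \<U> g" 
      by (intro insert_subsetI empty_subsetI)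
    then have "\<Inter>{Tp n, {xs. sat (named C) (\<lambda>i. xs ! i) (\<phi> (?bs @ [f k]))}, Collect (tree (?bs @ [g k]))} \<noteq> {}"
      by (intro V(3)[of g, unfolded fip_def, rule_format] conjI) simp_all
    then obtain xs where xs: "xs \<in> Tp n" "sat (named C) (\<lambda>i. xs ! i) (\<phi> (?bs @ [f k]))" "tree (?bs @ [g k]) xs" by auto
    then have "tree (?bs @ [f k]) xs" using \<phi>(3) by blast
    then show False using dis[OF xs(1) k(1), of ?bs] xs(3) by blast
  qed
  moreover have "countable {q. complete_type L C A n q}" 
    using stable monster A by (auto simp: omega_stable_def monster_def)
  then have "countable (range ?q)" by (rule countable_subset[rotated]) (use ct in auto)
  ultimately have "countable (UNIV :: (nat \<Rightarrow> bool) set)" using countable_image_inj_on by blast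
  then show False using uncountable_bool_sequences by blast
qed

sublocale stable_sets U Df
proof
  show "S = {}" if "\<And>P. P \<in> S \<Longrightarrow> Def U n P \<and> (\<exists>xs\<in>Tp n. P xs) \<and> 
      (\<exists>Q\<in>S. \<exists>R\<in>S. \<forall>xs\<in>Tp n. (Q xs \<longrightarrow> P xs) \<and> (R xs \<longrightarrow> P xs) \<and> \<not> (Q xs \<and> R xs))" for S n
    by (rule no_tree[OF that])
  show "\<exists>a\<in>U. \<forall>P\<in>F. P [a]" if A: "finite A" "A \<subseteq> U" and F: "\<And>P. P \<in> F \<Longrightarrow> Def A 1 P"
    "\<And>G. finite G \<Longrightarrow> G \<subseteq> F \<Longrightarrow> \<exists>a\<in>U. \<forall>P\<in>G. P [a]" for A F
  proof -
    \<comment> \<open>Saturation speaks of complete types, so the given family is first enlarged to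
      one by an ultrafilter.\<close>
    have "fip (insert (Tp 1) (Collect ` F))" unfolding fip_def
    proof (intro allI impI, elim conjE)
      fix G assume G: "finite G" "G \<subseteq> insert (Tp 1) (Collect ` F)"
      have "finite (G - {Tp 1})" "G - {Tp 1} \<subseteq> Collect ` F" using G by auto
      from finite_subset_image[OF this] obtain D where D: "D \<subseteq> F \<and> finite D \<and> G - {Tp 1} = Collect ` D" ..
      then have "finite D" "D \<subseteq> F" by blast+
      from F(2)[OF this] obtain a where a: "a \<in> U" "\<forall>P\<in>D. P [a]" ..
      have "[a] \<in> Y" if Y: "Y \<in> G" for Y
      proof (cases "Y = Tp 1")
        case False
        then have "Y \<in> G - {Tp 1}" using Y by blast
        then have "Y \<in> Collect ` D" using D[THEN conjunct2, THEN conjunct2] by (simp only:)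
        then show ?thesis using a by auto
      qed (use a in simp)
      then show "\<Inter>G \<noteq> {}" by blast
    qed
    from fip_ultrafilter[OF this] obtain \<U> where 
      "insert (Tp 1) (Collect ` F) \<subseteq> \<U> \<and> fip \<U> \<and> (\<forall>Y. Y \<in> \<U> \<or> - Y \<in> \<U>)" ..
    then have V: "Tp 1 \<in> \<U>" "P \<in> F \<Longrightarrow> Collect P \<in> \<U>" "fip \<U>" "Y \<in> \<U> \<or> - Y \<in> \<U>" for P Y by auto
    have "complete_type L C A 1 (ultra_type \<U> A 1)" by (rule complete_ultra_type[OF V(3,4,1)])
    then obtain a where a: "realises C (ultra_type \<U> A 1) a"
      using monster A small_finite[OF A(1)] unfolding monster_def saturated_def by blast
    have "P [a]" if P: "P \<in> F" for P
    proof -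
      obtain \<phi> where \<phi>: "wf_fm (with_params L A) \<phi>" "fv \<phi> \<subseteq> {..<1}" "\<forall>xs\<in>Tp 1. P xs = sat (named C) (\<lambda>i. xs ! i) \<phi>"
        using Def_iff_fm[OF A(2)] F(1)[OF P] by blast
      have "\<phi> \<in> ultra_type \<U> A 1" by (rule mem_ultra_type[OF V(3,4,1) V(2)[OF P] \<phi>(1,2)]) (use \<phi>(3) in blast)
      then have "sat (named C) (\<lambda>_. a) \<phi>" using a by (simp add: realises_def)
      then have "sat (named C) (\<lambda>i. [a] ! i) \<phi>" using sat_nth_1[OF \<phi>(2), of "named C" a] by blast
      moreover have "[a] \<in> Tp 1" using a by (simp add: realises_def)
      ultimately show ?thesis using \<phi>(3) by blast
    qed
    then show ?thesis using a by (auto simp: realises_def)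
  qed
  show "\<exists>F :: nat \<Rightarrow> 'm list \<Rightarrow> bool. \<forall>P. Df n P \<longrightarrow> (\<exists>k. \<forall>xs\<in>Tp n. P xs = F k xs)" for n
  proof -
    let ?F = "\<lambda>k xs. sat C (\<lambda>i. xs ! i) (from_nat_into {\<phi>. wf_fm L \<phi>} k)"
    have "\<exists>k. \<forall>xs\<in>Tp n. P xs = ?F k xs" if P: "Df n P" for P
    proof -
      obtain \<phi> where \<phi>: "wf_fm L \<phi>" "\<forall>xs\<in>Tp n. P xs = sat C (\<lambda>i. xs ! i) \<phi>" using P unfolding Df_def by blast
      obtain k where "from_nat_into {\<phi>. wf_fm L \<phi>} k = \<phi>"
        using from_nat_into_surj[OF countable_wf_fm[OF countable_funs countable_rels], of \<phi>] \<phi>(1) by auto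
      then show ?thesis using \<phi>(2) by blast
    qed
    then show ?thesis by (intro exI[of _ ?F]) blast
  qed
qed

section \<open>Elementary maps and submodels\<close>

lemma el_iff_preserves:
  "el R \<longleftrightarrow> R \<subseteq> U \<times> U \<and> (\<forall>\<phi>. wf_fm L \<phi> \<longrightarrow> preserves C C R \<phi>)"
proof
  assume R: "el R"
  have "preserves C C R \<phi>" if \<phi>: "wf_fm L \<phi>" for \<phi> unfolding preserves_def
  proof (intro allI impI)
    fix s t assume st: "\<forall>i\<in>fv \<phi>. (s i, t i) \<in> R"
    obtain vs where vs: "set vs = fv \<phi>" using finite_list[OF finite_fv] by blast
    have "\<forall>i\<in>fv \<phi>. \<exists>j. j < length vs \<and> vs ! j = i" using vs by (metis in_set_conv_nth)
    from bchoice[OF this] obtain f where f: "\<forall>i\<in>fv \<phi>. f i < length vs \<and> vs ! f i = i" ..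
    obtain \<psi> where \<psi>: "wf_fm L \<psi>" "fv \<psi> \<subseteq> (\<Union>i\<in>fv \<phi>. fv_tm (Var (f i) :: 'f tm))" 
      "\<forall>s. sat C s \<psi> \<longleftrightarrow> sat C (\<lambda>i. eval_tm C s (Var (f i))) \<phi>" using ex_subst[OF \<phi>, of "\<lambda>i. Var (f i)" C] by auto
    have fv: "fv \<psi> \<subseteq> {..<length vs}" using \<psi>(2) f by fastforce
    have D: "Def {} (length vs) (\<lambda>xs. sat C (\<lambda>i. xs ! i) \<psi>)" by (rule Def_of_Df, rule DfI[OF \<psi>(1) fv]) simp
    have "eqv (map s vs) (map t vs)"
    proof (rule eqv_of_el[OF R])
      show "set (zip (map s vs) (map t vs)) \<subseteq> R"
      proof
        fix z assume "z \<in> set (zip (map s vs) (map t vs))"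
        then obtain i where "i < length vs" "z = (s (vs ! i), t (vs ! i))" by (auto simp: set_zip)
        then show "z \<in> R" using st vs nth_mem[of i vs] by blast
      qed
    qed simp
    then have "sat C (\<lambda>i. map s vs ! i) \<psi> = sat C (\<lambda>i. map t vs ! i) \<psi>" using eqvD[OF _ D] by simp
    moreover have "sat C (\<lambda>i. map s vs ! f i) \<phi> = sat C s \<phi>" by (rule sat_cong) (use f in auto)
    moreover have "sat C (\<lambda>i. map t vs ! f i) \<phi> = sat C t \<phi>" by (rule sat_cong) (use f in auto)
    ultimately show "sat C s \<phi> \<longleftrightarrow> sat C t \<phi>" using \<psi>(3) by simp
  qed
  then show "R \<subseteq> U \<times> U \<and> (\<forall>\<phi>. wf_fm L \<phi> \<longrightarrow> preserves C C R \<phi>)" using el_U[OF R] by blast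
next
  assume R: "R \<subseteq> U \<times> U \<and> (\<forall>\<phi>. wf_fm L \<phi> \<longrightarrow> preserves C C R \<phi>)"
  show "el R" unfolding el_def
  proof (intro allI impI)
    fix zs assume zs: "set zs \<subseteq> R"
    have U: "set (map fst zs) \<subseteq> U" "set (map snd zs) \<subseteq> U" using zs R by auto
    then have T: "map fst zs \<in> Tp (length zs)" "map snd zs \<in> Tp (length zs)" by (auto simp: tuples_def)
    have "P (map fst zs) = P (map snd zs)" if D: "Def {} (length zs) P" for P
    proof -
      obtain Q where "Df (length zs) Q" "\<forall>xs\<in>Tp (length zs). P xs = Q xs" using D unfolding Def_def by fastforce
      then obtain \<phi> where \<phi>: "wf_fm L \<phi>" "fv \<phi> \<subseteq> {..<length zs}" "\<forall>xs\<in>Tp (length zs). P xs = sat C (\<lambda>i. xs ! i) \<phi>"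
        unfolding Df_def by auto
      have "sat C (\<lambda>i. map fst zs ! i) \<phi> \<longleftrightarrow> sat C (\<lambda>i. map snd zs ! i) \<phi>"
        using R \<phi>(1) unfolding preserves_def
      proof (elim conjE allE[of _ \<phi>] impE, intro \<phi>(1))
        assume *: "\<forall>s t. (\<forall>i\<in>fv \<phi>. (s i, t i) \<in> R) \<longrightarrow> sat C s \<phi> = sat C t \<phi>"
        have "\<forall>i\<in>fv \<phi>. (map fst zs ! i, map snd zs ! i) \<in> R"
        proof
          fix i assume "i \<in> fv \<phi>"
          then have i: "i < length zs" using \<phi>(2) by blast
          then have "zs ! i \<in> R" using zs nth_mem by blast
          then show "(map fst zs ! i, map snd zs ! i) \<in> R" using i by simp
        qed
        then show ?thesis using * by blast
      qed
      then show ?thesis using \<phi>(3) T by simp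
    qed
    then show "eqv (map fst zs) (map snd zs)" using U by (simp add: eqv_def)
  qed
qed

text \<open>The Tarski-Vaught theorem, including closure under the functions of the language, which
  follows because the graph of a function is definable.\<close>

lemma elem_iff_elem_submodel: "elem B \<longleftrightarrow> elem_submodel L C B"
proof
  assume B: "elem B"
  have BU: "B \<subseteq> U" by (rule elem_U[OF B])
  have fib: "Def B 1 (\<lambda>x. sat C (s(i := x ! 0)) \<phi>)" if "wf_fm L \<phi>" "\<forall>j. s j \<in> B" for s i \<phi>
  proof -
    obtain m where m: "fv \<phi> \<subseteq> {..<m}" using finite_fv finite_nat_iff_bounded by blast
    have D: "Def B m (\<lambda>xs. sat C (\<lambda>i. xs ! i) \<phi>)" by (rule Def_of_Df, rule DfI[OF that(1) m]) simp
    have "Rix B 1 m (\<lambda>x. map (\<lambda>j. if j = i then x ! 0 else s j) [0..<m])"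
      using that(2) BU by (auto simp: Rix_def)
    from Def_sub[OF D this] show ?thesis
    proof (rule Def_cong)
      fix x
      show "sat C (\<lambda>j. map (\<lambda>j. if j = i then x ! 0 else s j) [0..<m] ! j) \<phi> = sat C (s(i := x ! 0)) \<phi>"
        by (rule sat_cong) (use m in auto)
    qed
  qed
  have sat: "sat (restr C B) s \<phi> \<longleftrightarrow> sat C s \<phi>" if "wf_fm L \<phi>" "\<forall>i. s i \<in> B" for s \<phi>
    using that
  proof (induction \<phi> arbitrary: s)
    case (Rel r ts)
    have "map (eval_tm (restr C B) s) ts = map (eval_tm C s) ts" by simp
    then have "rint C r (map (eval_tm (restr C B) s) ts) = rint C r (map (eval_tm C s) ts)" by (rule arg_cong)
    then show ?case by simp
  next
    case (All i \<phi>)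
    have IH: "sat (restr C B) (s(i := a)) \<phi> = sat C (s(i := a)) \<phi>" if "a \<in> B" for a
      by (rule All.IH) (use All.prems that in auto)
    have "(\<forall>a\<in>B. sat C (s(i := a)) \<phi>) \<longleftrightarrow> (\<forall>a\<in>U. sat C (s(i := a)) \<phi>)"
    proof
      assume *: "\<forall>a\<in>B. sat C (s(i := a)) \<phi>"
      show "\<forall>a\<in>U. sat C (s(i := a)) \<phi>"
      proof (rule ccontr)
        assume "\<not> ?thesis"
        then have "\<exists>a\<in>U. (\<lambda>x. \<not> sat C (s(i := x ! 0)) \<phi>) [a]" by simp
        moreover have "Def B 1 (\<lambda>x. \<not> sat C (s(i := x ! 0)) \<phi>)" 
          by (rule Def_not, rule fib) (use All.prems in auto)
        ultimately have "\<exists>a\<in>B. (\<lambda>x. \<not> sat C (s(i := x ! 0)) \<phi>) [a]" using B unfolding elem_def by blast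
        then show False using * by simp
      qed
    qed (use BU in blast)
    then show ?case using IH by simp
  qed auto
  have "fint C f as \<in> B" if f: "f \<in> funs L" "as \<in> lists B" "length as = farity L f" for f as
  proof -
    let ?n = "length as"
    obtain b where b: "b \<in> B" using elem_nonempty[OF B] by blast
    let ?s = "\<lambda>i. if i < ?n then as ! i else b"
    \<comment> \<open>The only solution of this formula is the value of \<open>f\<close> at
      \<open>as\<close>; the test therefore places that value in \<open>B\<close>.\<close>
    let ?\<phi> = "Eq (Var ?n) (Fn f (map Var [0..<?n])) :: ('f, 'r) fm"
    have s: "\<forall>j. ?s j \<in> B" using f(2) b by (auto simp: in_lists_conv_set)
    have sm: "map (eval_tm C (?s(?n := x))) (map Var [0..<?n]) = as" for x by (auto intro!: nth_equalityI)
    have sat: "sat C (?s(?n := x)) ?\<phi> \<longleftrightarrow> x = fint C f as" for x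
      unfolding sat.simps eval_tm.simps sm by simp
    have "as \<in> lists U" using f(2) BU by (auto simp: in_lists_conv_set)
    then have "fint C f as \<in> U" using struc f by (auto simp: is_struc_def)
    then have "\<exists>a\<in>U. (\<lambda>x. sat C (?s(?n := x ! 0)) ?\<phi>) [a]" unfolding sat by auto
    moreover have "Def B 1 (\<lambda>x. sat C (?s(?n := x ! 0)) ?\<phi>)" by (rule fib[OF _ s]) (use f in auto)
    ultimately have "\<exists>a\<in>B. (\<lambda>x. sat C (?s(?n := x ! 0)) ?\<phi>) [a]" using B unfolding elem_def by blast
    then show ?thesis unfolding sat by auto
  qed
  then show "elem_submodel L C B" using sat BU elem_nonempty[OF B]
    by (auto simp: elem_submodel_def substruc_def is_struc_def)
next
  assume B: "elem_submodel L C B"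
  have BU: "B \<subseteq> U" "B \<noteq> {}" using B by (auto simp: elem_submodel_def substruc_def is_struc_def)
  have sub: "sat (restr C B) s \<phi> \<longleftrightarrow> sat C s \<phi>" if "wf_fm L \<phi>" "\<forall>i. s i \<in> B" for \<phi> s
    using B that unfolding elem_submodel_def by simp
  obtain b where b: "b \<in> B" using BU by blast
  show "elem B" unfolding elem_def
  proof (intro conjI allI impI BU(1))
    fix P assume P: "Def B 1 P" "\<exists>a\<in>U. P [a]"
    obtain cs Q where cs: "set cs \<subseteq> B \<inter> U" "Df (1 + length cs) Q" "\<And>xs. xs \<in> Tp 1 \<Longrightarrow> P xs = Q (xs @ cs)"
      using P(1) unfolding Def_def by blast
    obtain \<psi> where \<psi>: "wf_fm L \<psi>" "fv \<psi> \<subseteq> {..<1 + length cs}" "\<forall>xs\<in>Tp (1 + length cs). Q xs = sat C (\<lambda>i. xs ! i) \<psi>"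
      using cs(2) unfolding Df_def by blast
    let ?s = "\<lambda>i. if 0 < i \<and> i \<le> length cs then cs ! (i - 1) else b"
    have s: "\<forall>i. ?s i \<in> B" using cs(1) b by (auto simp: subset_iff)
    have P': "P [a] \<longleftrightarrow> sat C (?s(0 := a)) \<psi>" if "a \<in> U" for a
    proof -
      have "[a] @ cs \<in> Tp (1 + length cs)" using that cs(1) by (auto simp: tuples_def)
      then have "P [a] \<longleftrightarrow> sat C (\<lambda>i. ([a] @ cs) ! i) \<psi>" using cs(3)[of "[a]"] \<psi>(3) that by simp
      also have "\<dots> \<longleftrightarrow> sat C (?s(0 := a)) \<psi>" by (rule sat_cong) (use \<psi>(2) in \<open>auto simp: nth_Cons split: nat.splits\<close>)
      finally show ?thesis .
    qed
    have "sat C ?s (Ex 0 \<psi>)" using P(2) P' by auto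
    moreover have "wf_fm L (Ex 0 \<psi>)" using \<psi>(1) by simp
    ultimately have "sat (restr C B) ?s (Ex 0 \<psi>)" using sub[OF _ s, of "Ex 0 \<psi>"] by blast
    then obtain a where a: "a \<in> B" "sat (restr C B) (?s(0 := a)) \<psi>" by auto
    have upd: "\<forall>i. (f(0 := x)) i \<in> B" if "\<forall>i. f i \<in> B" "x \<in> B" for f :: "nat \<Rightarrow> 'm" and x using that by simp
    have "\<forall>i. (?s(0 := a)) i \<in> B" by (rule upd[OF s a(1)])
    then have "sat C (?s(0 := a)) \<psi>" using sub[OF \<psi>(1)] a(2) by blast
    then show "\<exists>a\<in>B. P [a]" using P'[of a] a(1) BU(1) by blast
  qed
qed

end

context monster_regular
begin

lemma sat_restr:
  assumes B: "elem B" and "wf_fm L \<phi>" "\<And>i. i \<in> fv \<phi> \<Longrightarrow> s i \<in> B"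
  shows "sat (restr C B) s \<phi> \<longleftrightarrow> sat C s \<phi>"
proof -
  obtain b where b: "b \<in> B" using elem_nonempty[OF B] by blast
  let ?s = "\<lambda>i. if i \<in> fv \<phi> then s i else b"
  have "\<forall>i. ?s i \<in> B" using assms(3) b by simp
  then have "sat (restr C B) ?s \<phi> \<longleftrightarrow> sat C ?s \<phi>" 
    using B assms(2) unfolding elem_iff_elem_submodel elem_submodel_def by simp
  moreover have "sat M ?s \<phi> \<longleftrightarrow> sat M s \<phi>" for M :: "('f, 'r, 'm) struc" by (rule sat_cong) simp
  ultimately show ?thesis by blast
qed

lemma preserves_restr:
  assumes "elem B" "elem N" "R \<subseteq> B \<times> N" "wf_fm L \<phi>"
  shows "preserves (restr C B) (restr C N) R \<phi> \<longleftrightarrow> preserves C C R \<phi>"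
proof -
  have "sat (restr C B) s \<phi> \<longleftrightarrow> sat C s \<phi>" "sat (restr C N) t \<phi> \<longleftrightarrow> sat C t \<phi>"
    if "\<forall>i\<in>fv \<phi>. (s i, t i) \<in> R" for s t
    using that assms(3) by (auto intro!: sat_restr[OF assms(1,4)] sat_restr[OF assms(2,4)])
  then show ?thesis unfolding preserves_def by simp
qed

lemma partial_elementary_iff:
  assumes "elem B" "elem N"
  shows "partial_elementary L (restr C B) (restr C N) e \<longleftrightarrow> el e \<and> e \<subseteq> B \<times> N"
proof
  assume e: "partial_elementary L (restr C B) (restr C N) e"
  then have sub: "e \<subseteq> B \<times> N" by (auto simp: partial_elementary_def partial_map_def)
  then have "\<forall>\<phi>. wf_fm L \<phi> \<longrightarrow> preserves C C e \<phi>" 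
    using e preserves_restr[OF assms sub] by (simp add: partial_elementary_def)
  moreover have "e \<subseteq> U \<times> U" using sub elem_U[OF assms(1)] elem_U[OF assms(2)] by blast
  ultimately show "el e \<and> e \<subseteq> B \<times> N" using sub el_iff_preserves by simp
next
  assume e: "el e \<and> e \<subseteq> B \<times> N"
  then have "\<forall>\<phi>. wf_fm L \<phi> \<longrightarrow> preserves (restr C B) (restr C N) e \<phi>"
    using preserves_restr[OF assms] el_iff_preserves by simp
  moreover have "Domain e \<subseteq> B" "Range e \<subseteq> N" using e by auto
  ultimately show "partial_elementary L (restr C B) (restr C N) e"
    using e el_single_valued by (simp add: partial_elementary_def partial_map_def)
qed

lemma qfree_equivalent:
  assumes "wf_fm L \<phi>"
  shows "\<exists>\<psi>. wf_fm L \<psi> \<and> qfree \<psi> \<and> fv \<psi> \<subseteq> fv \<phi> \<and> (\<forall>s. (\<forall>i\<in>fv \<phi>. s i \<in> U) \<longrightarrow> (sat C s \<phi> \<longleftrightarrow> sat C s \<psi>))"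
proof -
  obtain \<psi> where \<psi>: "wf_fm L \<psi>" "qfree \<psi>" "fv \<psi> \<subseteq> fv \<phi>" 
     "entails TYPE('m) L T (Imp \<phi> \<psi>)" "entails TYPE('m) L T (Imp \<psi> \<phi>)"
    using QE assms unfolding quantifier_elimination_def by blast
  have "models L T C" using monster by (simp add: monster_def)
  then have v: "valid_in C (Imp \<phi> \<psi>)" "valid_in C (Imp \<psi> \<phi>)" using \<psi>(4,5) by (auto simp: entails_def)
  obtain u where u: "u \<in> U" using U_nonempty by blast
  have "sat C s \<phi> \<longleftrightarrow> sat C s \<psi>" if s: "\<forall>i\<in>fv \<phi>. s i \<in> U" for s
  proof -
    let ?s = "\<lambda>i. if i \<in> fv \<phi> then s i else u"
    have "\<forall>i. ?s i \<in> U" using s u by simp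
    then have "sat C ?s \<phi> \<longleftrightarrow> sat C ?s \<psi>" using v[unfolded valid_in_def, rule_format, of ?s] by auto
    moreover have "sat C ?s \<phi> \<longleftrightarrow> sat C s \<phi>" by (rule sat_cong) simp
    moreover have "sat C ?s \<psi> \<longleftrightarrow> sat C s \<psi>" by (rule sat_cong) (use \<psi>(3) in auto)
    ultimately show ?thesis by blast
  qed
  then show ?thesis using \<psi>(1-3) by blast
qed

text \<open>By quantifier elimination the quantifier-free formulas determine types, and truth in an
  elementary submodel is truth in the monster. Hence embeddings between such submodels may be
  treated as elementary maps of the monster.\<close>

lemma partial_embedding_iff:
  assumes "elem B" "elem N"
  shows "partial_embedding L (restr C B) (restr C N) e \<longleftrightarrow> el e \<and> e \<subseteq> B \<times> N"
proof
  assume e: "partial_embedding L (restr C B) (restr C N) e"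
  then have sub: "e \<subseteq> B \<times> N" by (auto simp: partial_embedding_def partial_map_def)
  have U: "e \<subseteq> U \<times> U" using sub elem_U[OF assms(1)] elem_U[OF assms(2)] by blast
  have "preserves C C e \<phi>" if \<phi>: "wf_fm L \<phi>" for \<phi>
  proof -
    obtain \<psi> where \<psi>: "wf_fm L \<psi>" "qfree \<psi>" "fv \<psi> \<subseteq> fv \<phi>" 
      "\<forall>s. (\<forall>i\<in>fv \<phi>. s i \<in> U) \<longrightarrow> (sat C s \<phi> \<longleftrightarrow> sat C s \<psi>)" using qfree_equivalent[OF \<phi>] by blast
    have "preserves C C e \<psi>" 
      using e \<psi>(1,2) preserves_restr[OF assms sub \<psi>(1)] by (simp add: partial_embedding_def)
    then show ?thesis using \<psi>(3,4) U unfolding preserves_def by (metis SigmaD1 SigmaD2 subsetD)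
  qed
  then show "el e \<and> e \<subseteq> B \<times> N" using sub U el_iff_preserves by simp
next
  assume "el e \<and> e \<subseteq> B \<times> N"
  then have "partial_elementary L (restr C B) (restr C N) e" using partial_elementary_iff[OF assms] by simp
  then show "partial_embedding L (restr C B) (restr C N) e" 
    by (simp add: partial_elementary_def partial_embedding_def)
qed

section \<open>The strongly regular type\<close>

text \<open>Only the values on singletons matter: a predicate is large when it agrees there with
  some formula of \<open>p\<close>. By \<open>p_mono\<close> the choice of the defining formula does
  not affect membership in \<open>p\<close>.\<close>

definition lg :: "('m list \<Rightarrow> bool) \<Rightarrow> bool" where
  "lg P \<longleftrightarrow> (\<exists>\<phi>\<in>p. \<forall>a\<in>U. P [a] \<longleftrightarrow> sat (named C) (\<lambda>_. a) \<phi>)"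

lemma p_complete: "complete_type L C U 1 p"
  using sreg by (simp add: strongly_regular_def global_type_def)

lemma p_wf: "\<phi> \<in> p \<Longrightarrow> wf_fm (with_params L U) \<phi> \<and> fv \<phi> \<subseteq> {..<1}"
  using p_complete[unfolded complete_type_def, THEN conjunct1, rule_format, of \<phi>] by blast

lemma sat_const:
  fixes M :: "('g, 's, 'b) struc"
  shows "fv \<phi> \<subseteq> {..<1} \<Longrightarrow> sat M s \<phi> \<longleftrightarrow> sat M (\<lambda>_. s 0) \<phi>"
  by (rule sat_cong) auto

lemma p_consistent: 
  assumes "finite F" "F \<subseteq> p" shows "\<exists>a\<in>U. \<forall>\<phi>\<in>F. sat (named C) (\<lambda>_. a) \<phi>"
proof -
  obtain s where s: "\<forall>i. s i \<in> U" "\<forall>\<phi>\<in>F. sat (named C) s \<phi>"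
    using p_complete[unfolded complete_type_def, THEN conjunct2, THEN conjunct1, rule_format, OF assms(2,1)] by blast
  have "sat (named C) (\<lambda>_. s 0) \<phi>" if "\<phi> \<in> F" for \<phi>
    using sat_const[of \<phi> "named C" s] p_wf[of \<phi>] assms(2) s(2) that by blast
  then show ?thesis using s(1) by blast
qed

lemma p_cases: "wf_fm (with_params L U) \<phi> \<Longrightarrow> fv \<phi> \<subseteq> {..<1} \<Longrightarrow> \<phi> \<in> p \<or> Neg \<phi> \<in> p"
  using p_complete[unfolded complete_type_def, THEN conjunct2, THEN conjunct2, rule_format, of \<phi>] by blast

lemma p_mono:
  assumes "\<phi> \<in> p" "wf_fm (with_params L U) \<psi>" "fv \<psi> \<subseteq> {..<1}"
    "\<And>a. a \<in> U \<Longrightarrow> sat (named C) (\<lambda>_. a) \<phi> \<Longrightarrow> sat (named C) (\<lambda>_. a) \<psi>"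
  shows "\<psi> \<in> p"
proof (rule ccontr)
  assume "\<psi> \<notin> p"
  then have "{\<phi>, Neg \<psi>} \<subseteq> p" using assms(1) p_cases[OF assms(2,3)] by simp
  then obtain a where "a \<in> U" "sat (named C) (\<lambda>_. a) \<phi>" "sat (named C) (\<lambda>_. a) (Neg \<psi>)" 
    using p_consistent[of "{\<phi>, Neg \<psi>}"] by auto
  then show False using assms(4) by simp
qed

lemma Def1_fm:
  assumes "A \<subseteq> U" "Def A 1 P"
  obtains \<phi> where "wf_fm (with_params L A) \<phi>" "fv \<phi> \<subseteq> {..<1}" "\<forall>a\<in>U. P [a] \<longleftrightarrow> sat (named C) (\<lambda>_. a) \<phi>"
proof -
  obtain \<phi> where \<phi>: "wf_fm (with_params L A) \<phi>" "fv \<phi> \<subseteq> {..<1}" "\<forall>xs\<in>Tp 1. P xs = sat (named C) (\<lambda>i. xs ! i) \<phi>"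
    using assms Def_iff_fm by blast
  have "P [a] \<longleftrightarrow> sat (named C) (\<lambda>_. a) \<phi>" if "a \<in> U" for a
  proof -
    have "[a] \<in> Tp 1" using that by simp
    then have "P [a] = sat (named C) (\<lambda>i. [a] ! i) \<phi>" using \<phi>(3) by blast
    then show ?thesis using sat_nth_1[OF \<phi>(2), of "named C" a] by blast
  qed
  then show ?thesis using that \<phi>(1,2) by blast
qed

lemma Def1_of_fm:
  assumes "A \<subseteq> U" "wf_fm (with_params L A) \<phi>" "fv \<phi> \<subseteq> {..<1}"
  shows "Def A 1 (\<lambda>x. sat (named C) (\<lambda>_. x ! 0) \<phi>)"
proof -
  have "sat (named C) (\<lambda>_. x ! 0) \<phi> = sat (named C) (\<lambda>i. x ! i) \<phi>" for x
    using sat_const[OF assms(3), of "named C" "\<lambda>i. x ! i"] by simp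
  then show ?thesis using Def_iff_fm[OF assms(1)] assms(2,3) by blast
qed

lemma lg_iff_mem:
  assumes "wf_fm (with_params L U) \<phi>" "fv \<phi> \<subseteq> {..<1}" "\<forall>a\<in>U. P [a] \<longleftrightarrow> sat (named C) (\<lambda>_. a) \<phi>"
  shows "lg P \<longleftrightarrow> \<phi> \<in> p"
proof
  assume "lg P"
  then obtain \<psi> where \<psi>: "\<psi> \<in> p" "\<forall>a\<in>U. P [a] \<longleftrightarrow> sat (named C) (\<lambda>_. a) \<psi>" unfolding lg_def by blast
  show "\<phi> \<in> p" by (rule p_mono[OF \<psi>(1) assms(1,2)]) (use \<psi>(2) assms(3) in blast)
qed (use assms(3) in \<open>auto simp: lg_def\<close>)

lemma realises_iff_generic:
  assumes D: "D \<subseteq> U" shows "realises C (type_restr L p D) a \<longleftrightarrow> generic lg D a"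
proof
  assume r: "realises C (type_restr L p D) a"
  show "generic lg D a" unfolding generic_def
  proof (intro conjI allI impI)
    show aU: "a \<in> U" using r by (simp add: realises_def)
    fix P assume P: "Def D 1 P \<and> lg P"
    then obtain \<phi> where \<phi>: "wf_fm (with_params L D) \<phi>" "fv \<phi> \<subseteq> {..<1}" "\<forall>a\<in>U. P [a] \<longleftrightarrow> sat (named C) (\<lambda>_. a) \<phi>"
      using Def1_fm[OF D] by metis
    have "\<phi> \<in> p" using lg_iff_mem[OF wf_fm_params_mono[OF \<phi>(1) D] \<phi>(2,3)] P by blast
    then have "sat (named C) (\<lambda>_. a) \<phi>" using r \<phi>(1) by (simp add: realises_def type_restr_def)
    then show "P [a]" using \<phi>(3) aU by blast
  qed
next
  assume g: "generic lg D a"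
  then have aU: "a \<in> U" by (simp add: generic_def)
  have "sat (named C) (\<lambda>_. a) \<phi>" if "\<phi> \<in> p" "wf_fm (with_params L D) \<phi>" for \<phi>
  proof -
    have "Def D 1 (\<lambda>x. sat (named C) (\<lambda>_. x ! 0) \<phi>)" using Def1_of_fm[OF D that(2)] p_wf[OF that(1)] by blast
    moreover have "lg (\<lambda>x. sat (named C) (\<lambda>_. x ! 0) \<phi>)" unfolding lg_def using that(1) by (intro bexI[of _ \<phi>]) auto
    ultimately have "(\<lambda>x. sat (named C) (\<lambda>_. x ! 0) \<phi>) [a]" using g unfolding generic_def by blast
    then show ?thesis by simp
  qed
  then show "realises C (type_restr L p D) a" using aU by (simp add: realises_def type_restr_def)
qed

lemma ex_automorphism:
  assumes "eqv cs ds" shows "\<exists>\<sigma>. isom L \<sigma> C C \<and> map \<sigma> cs = ds"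
proof -
  let ?R = "set (zip cs ds)"
  have R: "el ?R" by (rule el_zip[OF assms])
  have "partial_elementary L C C ?R"
    using R el_iff_preserves el_U[OF R] el_single_valued[OF R] 
    by (auto simp: partial_elementary_def partial_map_def)
  moreover have "small \<kappa> (Domain ?R)" by (intro small_finite finite_Domain) simp
  ultimately obtain \<sigma> where \<sigma>: "isom L \<sigma> C C" "\<forall>(a, b)\<in>?R. \<sigma> a = b"
    using monster unfolding monster_def strongly_homogeneous_def by blast
  have "length cs = length ds" using assms eqv_length by blast
  then have "map \<sigma> cs = ds" using \<sigma>(2) by (intro nth_equalityI) (auto simp: set_zip)
  then show ?thesis using \<sigma>(1) by blast
qed

text \<open>Applying the automorphism to a formula of \<open>p\<close> defining \<open>P\<close>
  gives a formula that is again in \<open>p\<close> by invariance, and it holds at the image of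
  \<open>a\<close> exactly when \<open>P\<close> holds at \<open>a\<close>.\<close>

lemma lg_automorphism:
  assumes \<sigma>: "isom L \<sigma> C C" and "lg P"
  shows "\<exists>\<phi>\<in>p. \<forall>a\<in>U. P [a] \<longleftrightarrow> sat (named C) (\<lambda>_. \<sigma> a) \<phi>"
proof -
  obtain \<psi> where \<psi>: "\<psi> \<in> p" "\<forall>a\<in>U. P [a] \<longleftrightarrow> sat (named C) (\<lambda>_. a) \<psi>" using assms(2) unfolding lg_def by blast
  have "map_fm (map_sum id \<sigma>) id \<psi> \<in> map_fm (map_sum id \<sigma>) id ` p" using \<psi>(1) by blast
  then have m: "map_fm (map_sum id \<sigma>) id \<psi> \<in> p" 
    using sreg \<sigma> unfolding strongly_regular_def aut_invariant_def by blast
  have "P [a] \<longleftrightarrow> sat (named C) (\<lambda>_. \<sigma> a) (map_fm (map_sum id \<sigma>) id \<psi>)" if a: "a \<in> U" for a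
  proof -
    have "sat (named C) (\<sigma> \<circ> (\<lambda>_. a)) (map_fm (map_sum id \<sigma>) id \<psi>) \<longleftrightarrow> sat (named C) (\<lambda>_. a) \<psi>"
      by (rule sat_automorphism[OF struc \<sigma>]) (use p_wf[OF \<psi>(1)] a in auto)
    moreover have "\<sigma> \<circ> (\<lambda>_. a) = (\<lambda>_ :: nat. \<sigma> a)" by auto
    ultimately show ?thesis using \<psi>(2) a by metis
  qed
  then show ?thesis using m by blast
qed

lemma el_automorphism:
  assumes "isom L \<sigma> C C" shows "el {(a, \<sigma> a) | a. a \<in> U}"
proof -
  have b: "\<sigma> ` U = U" using assms by (auto simp: isom_def bij_betw_def)
  have "preserves C C {(a, \<sigma> a) | a. a \<in> U} \<phi>" if \<phi>: "wf_fm L \<phi>" for \<phi> unfolding preserves_def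
  proof (intro allI impI)
    fix s t assume st: "\<forall>i\<in>fv \<phi>. (s i, t i) \<in> {(a, \<sigma> a) | a. a \<in> U}"
    have "sat C s \<phi> \<longleftrightarrow> sat C (\<sigma> \<circ> s) \<phi>" by (rule isom_sat[OF struc assms \<phi>]) (use st in auto)
    also have "\<dots> \<longleftrightarrow> sat C t \<phi>" by (rule sat_cong) (use st in auto)
    finally show "sat C s \<phi> \<longleftrightarrow> sat C t \<phi>" .
  qed
  then show ?thesis using b el_iff_preserves by auto
qed

sublocale regular_type U Df lg
proof
  show "lg Q" if "lg P" "\<And>a. a \<in> U \<Longrightarrow> P [a] = Q [a]" for P Q using that unfolding lg_def by auto
  show "\<exists>a\<in>U. P [a]" if P: "lg P" for P
  proof -
    obtain \<psi> where \<psi>: "\<psi> \<in> p" "\<forall>a\<in>U. P [a] \<longleftrightarrow> sat (named C) (\<lambda>_. a) \<psi>" using P unfolding lg_def by blast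
    then show ?thesis using p_consistent[of "{\<psi>}"] by auto
  qed
  show "lg (\<lambda>x. P x \<and> Q x)" if PQ: "lg P" "lg Q" for P Q
  proof -
    obtain \<phi> where \<phi>: "\<phi> \<in> p" "\<forall>a\<in>U. P [a] \<longleftrightarrow> sat (named C) (\<lambda>_. a) \<phi>" using PQ(1) unfolding lg_def by blast
    obtain \<psi> where \<psi>: "\<psi> \<in> p" "\<forall>a\<in>U. Q [a] \<longleftrightarrow> sat (named C) (\<lambda>_. a) \<psi>" using PQ(2) unfolding lg_def by blast
    have w: "wf_fm (with_params L U) (Conj \<phi> \<psi>)" "fv (Conj \<phi> \<psi>) \<subseteq> {..<1}" using p_wf[OF \<phi>(1)] p_wf[OF \<psi>(1)] by auto
    have "Conj \<phi> \<psi> \<in> p"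
    proof (rule ccontr)
      assume "Conj \<phi> \<psi> \<notin> p"
      then have "{\<phi>, \<psi>, Neg (Conj \<phi> \<psi>)} \<subseteq> p" using p_cases[OF w] \<phi>(1) \<psi>(1) by blast
      then obtain a where "\<forall>\<chi>\<in>{\<phi>, \<psi>, Neg (Conj \<phi> \<psi>)}. sat (named C) (\<lambda>_. a) \<chi>"
        using p_consistent[of "{\<phi>, \<psi>, Neg (Conj \<phi> \<psi>)}"] by auto
      then show False by auto
    qed
    then show ?thesis using \<phi>(2) \<psi>(2) unfolding lg_def by (intro bexI[of _ "Conj \<phi> \<psi>"]) auto
  qed
  show "lg P \<or> lg (\<lambda>x. \<not> P x)" if P: "Def U 1 P" for P
  proof -
    obtain \<phi> where \<phi>: "wf_fm (with_params L U) \<phi>" "fv \<phi> \<subseteq> {..<1}" "\<forall>a\<in>U. P [a] \<longleftrightarrow> sat (named C) (\<lambda>_. a) \<phi>"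
      using Def1_fm[OF order_refl P] by metis
    have "lg P" if "\<phi> \<in> p" using that \<phi>(3) unfolding lg_def by blast
    moreover have "lg (\<lambda>x. \<not> P x)" if "Neg \<phi> \<in> p" using that \<phi>(3) unfolding lg_def by (intro bexI[of _ "Neg \<phi>"]) auto
    ultimately show ?thesis using p_cases[OF \<phi>(1,2)] by blast
  qed
  show "lg (\<lambda>x. P (x @ ds))" if cd: "eqv cs ds" and P: "Def {} (1 + length cs) P" and l: "lg (\<lambda>x. P (x @ cs))" for cs ds P
  proof -
    obtain \<sigma> where \<sigma>: "isom L \<sigma> C C" "map \<sigma> cs = ds" using ex_automorphism[OF cd] by blast
    obtain \<phi> where \<phi>: "\<phi> \<in> p" "\<forall>a\<in>U. P ([a] @ cs) \<longleftrightarrow> sat (named C) (\<lambda>_. \<sigma> a) \<phi>" 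
      using lg_automorphism[OF \<sigma>(1) l] by blast
    have b: "\<sigma> ` U = U" using \<sigma>(1) by (auto simp: isom_def bij_betw_def)
    have cU: "set cs \<subseteq> U" using cd by (simp add: eqv_def)
    have "P ([b] @ ds) \<longleftrightarrow> sat (named C) (\<lambda>_. b) \<phi>" if bU: "b \<in> U" for b
    proof -
      obtain a where a: "a \<in> U" "b = \<sigma> a" using bU b by blast
      have "eqv ([a] @ cs) ([b] @ ds)"
      proof (rule eqv_of_el[OF el_automorphism[OF \<sigma>(1)]])
        show "set (zip ([a] @ cs) ([b] @ ds)) \<subseteq> {(a, \<sigma> a) | a. a \<in> U}"
          using a cU nth_mem[of _ cs] \<sigma>(2) by (auto simp: set_zip subset_iff simp del: nth_mem)
      qed (use \<sigma>(2) in auto)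
      then have "P ([a] @ cs) \<longleftrightarrow> P ([b] @ ds)" by (rule eqvD[OF _ P]) simp
      then show ?thesis using \<phi>(2) a by blast
    qed
    then show ?thesis using \<phi>(1) unfolding lg_def by blast
  qed
  show "generic lg D a \<or> (\<forall>b. generic lg D b \<longrightarrow> generic lg (insert a D) b)" if D: "finite D" "D \<subseteq> U" "a \<in> U" for D a
  proof -
    have "realises C (type_restr L p D) a \<or> type_entails C (type_restr L p D) (type_restr L p (insert a D))"
      using sreg D small_finite[OF D(1)] unfolding strongly_regular_def by blast
    then show ?thesis using realises_iff_generic D unfolding type_entails_def by simp
  qed
  show "\<exists>Q. Def A 1 Q \<and> lg Q \<and> (\<exists>a\<in>U. P [a] \<and> \<not> Q [a])" if A: "finite A" "A \<subseteq> U" and P: "Def A 1 P" "lg P" for A P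
  proof -
    obtain \<phi> where \<phi>: "wf_fm (with_params L A) \<phi>" "fv \<phi> \<subseteq> {..<1}" "\<forall>a\<in>U. P [a] \<longleftrightarrow> sat (named C) (\<lambda>_. a) \<phi>"
      using Def1_fm[OF A(2) P(1)] by metis
    have "\<phi> \<in> p" using lg_iff_mem[OF wf_fm_params_mono[OF \<phi>(1) A(2)] \<phi>(2,3)] P by blast
    then have "\<phi> \<in> type_restr L p A" using \<phi>(1) by (simp add: type_restr_def)
    then obtain \<psi> where \<psi>: "\<psi> \<in> type_restr L p A" "\<not> valid_in (named C) (Imp \<phi> \<psi>)"
      using nonisolated[OF A(2,1)] unfolding isolated_def by blast
    then obtain s where s: "\<forall>i. s i \<in> U" "sat (named C) s \<phi>" "\<not> sat (named C) s \<psi>" by (auto simp: valid_in_def)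
    have \<psi>p: "\<psi> \<in> p" "wf_fm (with_params L A) \<psi>" "fv \<psi> \<subseteq> {..<1}" using \<psi>(1) p_wf by (auto simp: type_restr_def)
    let ?Q = "\<lambda>x. sat (named C) (\<lambda>_. x ! 0) \<psi>"
    have "Def A 1 ?Q" by (rule Def1_of_fm[OF A(2) \<psi>p(2,3)])
    moreover have "lg ?Q" unfolding lg_def using \<psi>p(1) by (intro bexI[of _ \<psi>]) auto
    moreover have "P [s 0]" using \<phi>(3) s(1,2) sat_const[OF \<phi>(2), of "named C" s] by blast
    moreover have "\<not> ?Q [s 0]" using s(3) sat_const[OF \<psi>p(3), of "named C" s] by simp
    ultimately show ?thesis using s(1) by blast
  qed
qed

lemma cl_p_eq: "D \<subseteq> U \<Longrightarrow> cl_p L C p D = cl D"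
  using realises_iff_generic by (auto simp: cl_p_def cl_def)

lemma prime_over_iff: "prime_over L C A B \<longleftrightarrow> prime_model A B"
proof -
  have *: "(\<exists>e. partial_elementary L (restr C B) (restr C N) e \<and> Domain e = B \<and> Id_on A \<subseteq> e) \<longleftrightarrow>
     (\<exists>e. el e \<and> Domain e = B \<and> Range e \<subseteq> N \<and> Id_on A \<subseteq> e)" if "elem B" "elem N" for N
  proof -
    have "partial_elementary L (restr C B) (restr C N) e \<and> Domain e = B \<and> Id_on A \<subseteq> e \<longleftrightarrow>
      el e \<and> Domain e = B \<and> Range e \<subseteq> N \<and> Id_on A \<subseteq> e" for e
      unfolding partial_elementary_iff[OF that] by auto
    then show ?thesis by simp
  qed
  show ?thesis unfolding prime_over_def prime_model_def elem_iff_elem_submodel[symmetric]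
    using * by blast
qed

lemma gen_el_iff:
  assumes R: "el R" and A: "A \<subseteq> Domain R" and b: "(b, b') \<in> R" shows "gen A b \<longleftrightarrow> gen (R `` A) b'"
proof
  show "gen A b \<Longrightarrow> gen (R `` A) b'" by (rule gen_el[OF R A b])
  assume g: "gen (R `` A) b'"
  have "gen (R\<inverse> `` (R `` A)) b" by (rule gen_el[OF el_converse[OF R] _ _ g]) (use b in auto)
  then show "gen A b" by (rule gen_mono) (use A in blast)
qed

section \<open>Prime models over small independent sets\<close>

definition nice :: "'m set \<Rightarrow> bool" where
  "nice B \<longleftrightarrow> (\<exists>Z. indep Z \<and> prime_model Z B \<and> small \<kappa> Z)"

lemma card_finite_subsets:
  assumes Z: "infinite Z" shows "ordLeq3 (card_of {F. F \<subseteq> Z \<and> finite F}) (card_of Z)"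
proof -
  \<comment> \<open>\<open>P n\<close> consists of the sets listed by \<open>n\<close> elements of
    \<open>Z\<close>, with repetitions; each \<open>P n\<close> has at most the size of
    \<open>Z\<close> by induction.\<close>
  define P where "P = rec_nat {{}} (\<lambda>_ Q. (\<lambda>(z, F). insert z F) ` (Z \<times> Q))"
  have P: "P 0 = {{}}" "P (Suc n) = (\<lambda>(z, F). insert z F) ` (Z \<times> P n)" for n by (simp_all add: P_def)
  have le: "ordLeq3 (card_of (P n)) (card_of Z)" for n
  proof (induction n)
    case 0
    have "Z \<noteq> {}" using Z by auto
    then show ?case unfolding P(1) by (rule card_of_singl_ordLeq)
  next
    case (Suc n)
    have "ordLeq3 (card_of (Z \<times> P n)) (card_of Z)"
      by (rule card_of_Sigma_ordLeq_infinite[OF Z card_of_mono1[OF order_refl]]) (use Suc in blast)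
    then show ?case unfolding P(2) using card_of_image ordLeq_transitive by blast
  qed
  have mem: "\<exists>n. F \<in> P n" if "finite F" "F \<subseteq> Z" for F
    using that
  proof (induction F rule: finite_induct)
    case empty
    show ?case using P(1) by blast
  next
    case (insert z F)
    then obtain n where "F \<in> P n" by blast
    then have "insert z F \<in> P (Suc n)" unfolding P(2) using insert.prems by force
    then show ?case by blast
  qed
  have sub: "{F. F \<subseteq> Z \<and> finite F} \<subseteq> (\<Union>n\<in>UNIV. P n)" using mem by blast
  have "ordLeq3 (card_of (UNIV :: nat set)) (card_of Z)" using Z infinite_iff_card_of_nat by blast
  then have "ordLeq3 (card_of (\<Union>n\<in>UNIV. P n)) (card_of Z)"
    by (rule card_of_UNION_ordLeq_infinite[OF Z]) (use le in blast)
  then show ?thesis by (rule ordLeq_transitive[OF card_of_mono1[OF sub]])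
qed

lemma small_subset: "small \<kappa> A \<Longrightarrow> B \<subseteq> A \<Longrightarrow> small \<kappa> B"
  unfolding small_def using card_of_mono1 ordLeq_ordLess_trans by blast

text \<open>A finite set of indices has a last one, whose value is generic over the other values, so
  \<open>indep_insert\<close> builds independence of finite parts by exchange. Finite character of
  genericity extends it to the whole sequence.\<close>

lemma indep_morley:
  assumes "morley_seq L C p r a"
  shows "indep (a ` Field r)"
proof -
  have wo: "Well_order r" and real: "\<And>i. i \<in> Field r \<Longrightarrow> realises C (type_restr L p (a ` underS r i)) (a i)"
    using assms by (auto simp: morley_seq_def)
  have aU: "a ` Field r \<subseteq> U" using real by (auto simp: realises_def)
  have uS: "underS r i \<subseteq> Field r" for i by (rule Order_Relation.underS_Field)
  have g: "gen (a ` underS r i) (a i)" if "i \<in> Field r" for i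
    using real[OF that] realises_iff_generic[of "a ` underS r i"] aU uS[of i] by blast
  have tot: "i = j \<or> i \<in> underS r j \<or> j \<in> underS r i" if "i \<in> Field r" "j \<in> Field r" for i j
    using wo that by (auto simp: underS_def well_order_on_def linear_order_on_def total_on_def partial_order_on_def)
  have tr: "i \<in> underS r k" if "i \<in> underS r j" "j \<in> underS r k" for i j k
    using wo that unfolding underS_def well_order_on_def linear_order_on_def partial_order_on_def preorder_on_def 
    by (auto dest: transD antisymD)
  have main: "indep (a ` F) \<and> (\<forall>i\<in>F. \<forall>j\<in>F. a i = a j \<longrightarrow> i = j)" if "finite F" "F \<subseteq> Field r" for F
    using that
  proof (induction "card F" arbitrary: F)
    case 0
    then show ?case by (simp add: indep_def)
  next
    case (Suc n)
    have "\<exists>m\<in>G. \<forall>i\<in>G. i = m \<or> i \<in> underS r m" if "finite G" "G \<noteq> {}" "G \<subseteq> Field r" for G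
      using that
    proof (induction G rule: finite_ne_induct)
      case (insert x G)
      then obtain m where m: "m \<in> G" "\<forall>i\<in>G. i = m \<or> i \<in> underS r m" by auto
      have "x = m \<or> x \<in> underS r m \<or> m \<in> underS r x" using tot[of x m] m insert.prems by auto
      then show ?case
      proof (elim disjE)
        assume "m \<in> underS r x"
        then have "\<forall>i\<in>insert x G. i = x \<or> i \<in> underS r x" using m(2) tr by auto
        then show ?case by (rule bexI) simp
      next
        assume "x = m"
        then show ?case using m by (intro bexI[of _ m]) auto
      next
        assume "x \<in> underS r m"
        then show ?case using m by (intro bexI[of _ m]) auto
      qed
    qed simp
    then obtain m where m: "m \<in> F" "\<forall>i\<in>F. i = m \<or> i \<in> underS r m" using Suc.hyps(2) Suc.prems by (metis card.empty nat.distinct(1))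
    let ?F = "F - {m}"
    have "n = card ?F" using Suc.hyps(2) Suc.prems m(1) by simp
    then have IH: "indep (a ` ?F) \<and> (\<forall>i\<in>?F. \<forall>j\<in>?F. a i = a j \<longrightarrow> i = j)" using Suc.hyps(1)[of ?F] Suc.prems by blast
    have gm: "gen (a ` ?F) (a m)" by (rule gen_mono[OF g]) (use m Suc.prems in auto)
    then have "a m \<notin> a ` ?F" by (rule gen_notin)
    moreover have "indep (insert (a m) (a ` ?F))" using indep_insert IH gm by blast
    moreover have "insert (a m) (a ` ?F) = a ` F" using m(1) by auto
    ultimately show ?case using IH by (metis Diff_iff empty_iff imageI insert_iff)
  qed
  have "gen (a ` Field r - {z}) z" if z: "z \<in> a ` Field r" for z
  proof (rule ccontr)
    assume n: "\<not> ?thesis"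
    obtain F where F: "finite F" "F \<subseteq> a ` Field r - {z}" "\<not> gen F z" 
      by (rule gen_finite_char[OF _ n]) (use aU z in auto)
    then have "finite (insert z F)" "insert z F \<subseteq> a ` Field r" using z by auto
    from finite_subset_image[OF this] obtain G where "G \<subseteq> Field r \<and> finite G \<and> insert z F = a ` G" ..
    then have "indep (insert z F)" using main[of G] by simp
    then have "gen F z" by (rule indep_gen) (use F in auto)
    then show False using F by blast
  qed
  then show ?thesis using aU by (simp add: indep_def)
qed

lemma prime_class_iff:
  "P \<in> prime_class L \<kappa> C p \<longleftrightarrow> (\<exists>B. nice B \<and> P = (restr C B, \<lambda>X. cl_p L C p X \<inter> B))"
proof
  assume "P \<in> prime_class L \<kappa> C p"
  then obtain B r and a :: "'m \<Rightarrow> 'm" where P: "P = (restr C B, \<lambda>X. cl_p L C p X \<inter> B)" "morley_seq L C p r a" 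
    "small \<kappa> (Field r)" "prime_over L C (a ` Field r) B" unfolding prime_class_def by blast
  have "small \<kappa> (a ` Field r)" using P(3) card_of_image ordLeq_ordLess_trans unfolding small_def by blast
  then have "nice B" using indep_morley[OF P(2)] P(4) prime_over_iff unfolding nice_def by blast
  then show "\<exists>B. nice B \<and> P = (restr C B, \<lambda>X. cl_p L C p X \<inter> B)" using P(1) by blast
next
  assume "\<exists>B. nice B \<and> P = (restr C B, \<lambda>X. cl_p L C p X \<inter> B)"
  then obtain B Z where P: "P = (restr C B, \<lambda>X. cl_p L C p X \<inter> B)" "indep Z" "prime_model Z B" "small \<kappa> Z"
    unfolding nice_def by blast
  obtain r where r: "well_order_on Z r" using well_order_on by blast
  have Zr: "Field r = Z" "Well_order r" using well_order_on_Well_order[OF r] by auto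
  have "realises C (type_restr L p (id ` underS r i)) (id i)" if "i \<in> Field r" for i
  proof -
    have "underS r i \<subseteq> Z - {i}" using Zr(1) Order_Relation.underS_Field[of r i] by (auto simp: underS_def)
    moreover have "gen (Z - {i}) i" "Z \<subseteq> U" using P(2) that Zr(1) by (auto simp: indep_def)
    ultimately have "gen (underS r i) i" "underS r i \<subseteq> U" using gen_mono by blast+
    then show ?thesis using realises_iff_generic[of "underS r i"] by simp
  qed
  then have "morley_seq L C p r id" using Zr(2) by (simp add: morley_seq_def)
  moreover have "prime_over L C (id ` Field r) B" using P(3) Zr(1) prime_over_iff by simp
  ultimately show "P \<in> prime_class L \<kappa> C p" unfolding prime_class_def using P(1,4) Zr(1) by blast
qed

lemma nice_good: "nice B \<Longrightarrow> good B"
  unfolding nice_def using prime_good by blast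

text \<open>\<open>B\<close> is covered by the countable sets \<open>cl F \<inter> B\<close> for
  finite \<open>F \<subseteq> Z\<close>, and \<kappa> is uncountable. The bound is needed because a
  basis of a closed subset of \<open>B\<close> need not lie in \<open>Z\<close>, so its smallness
  has to come from the size of \<open>B\<close>.\<close>

lemma nice_small: assumes "nice B" shows "small \<kappa> B"
proof -
  obtain Z where Z: "indep Z" "prime_model Z B" "small \<kappa> Z" using assms unfolding nice_def by blast
  have g: "good B" by (rule nice_good[OF assms])
  have ZB: "Z \<subseteq> B" using Z(2) by (simp add: prime_model_def)
  have BZ: "B \<subseteq> cl Z" by (rule prime_subset_cl[OF Z(2)])
  show ?thesis
  proof (cases "finite Z")
    case True
    have "B = cl Z \<inter> B" using BZ by blast
    then have "countable B" using good_countable[OF g True ZB] by simp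
    then show ?thesis by (rule small_countable)
  next
    case False
    have sub: "B \<subseteq> (\<Union>F\<in>{F. F \<subseteq> Z \<and> finite F}. cl F \<inter> B)"
    proof
      fix b assume b: "b \<in> B"
      then have "b \<in> cl Z" using BZ by blast
      then obtain F where "finite F" "F \<subseteq> Z" "b \<in> cl F" by (rule cl_finite_char)
      then show "b \<in> (\<Union>F\<in>{F. F \<subseteq> Z \<and> finite F}. cl F \<inter> B)" using b by blast
    qed
    have "ordLeq3 (card_of (\<Union>F\<in>{F. F \<subseteq> Z \<and> finite F}. cl F \<inter> B)) (card_of Z)"
    proof (rule card_of_UNION_ordLeq_infinite[OF False])
      show "ordLeq3 (card_of {F. F \<subseteq> Z \<and> finite F}) (card_of Z)"
        by (rule card_finite_subsets[OF False])
      show "\<forall>F\<in>{F. F \<subseteq> Z \<and> finite F}. ordLeq3 (card_of (cl F \<inter> B)) (card_of Z)"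
      proof
        fix F assume "F \<in> {F. F \<subseteq> Z \<and> finite F}"
        then have "countable (cl F \<inter> B)" using good_countable[OF g, of F] ZB by blast
        then have "ordLeq3 (card_of (cl F \<inter> B)) natLeq" using countable_card_le_natLeq by blast
        then show "ordLeq3 (card_of (cl F \<inter> B)) (card_of Z)" 
          by (rule ordLeq_transitive) (use infinite_iff_natLeq_ordLeq False in blast)
      qed
    qed
    then show ?thesis unfolding small_def 
      by (rule ordLeq_ordLess_trans[OF ordLeq_transitive[OF card_of_mono1[OF sub]] Z(3)[unfolded small_def]])
  qed
qed

text \<open>Goodness passes to closed subsets, and a good submodel is prime over any of its bases;
  this yields a new small independent set for the closed subset.\<close>

lemma nice_cl_Int: assumes "nice B" "X \<subseteq> B" shows "nice (cl X \<inter> B)"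
proof -
  let ?B = "cl X \<inter> B"
  have g: "good ?B" by (rule good_cl_Int[OF nice_good[OF assms(1)]])
  have "indep {}" by (simp add: indep_def)
  then obtain Z where Z: "{} \<subseteq> Z" "Z \<subseteq> ?B" "indep Z" "?B \<subseteq> cl Z"
    by (rule ex_basis[of _ ?B]) (use cl_U in auto)
  have "prime_model Z ?B" by (rule good_prime[OF g Z(3,2,4)])
  moreover have "small \<kappa> Z" by (rule small_subset[OF nice_small[OF assms(1)]]) (use Z in blast)
  ultimately show ?thesis using Z(3) unfolding nice_def by blast
qed

lemma cl_Int_closed: "cl (cl X \<inter> B) \<inter> B = cl X \<inter> B" if "B \<subseteq> U"
proof
  show "cl (cl X \<inter> B) \<inter> B \<subseteq> cl X \<inter> B" using cl_subset[of "cl X \<inter> B" X] by blast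
  show "cl X \<inter> B \<subseteq> cl (cl X \<inter> B) \<inter> B" using cl_superset[of "cl X \<inter> B"] cl_U by blast
qed

lemma pregeometry_cl_Int:
  assumes B: "B \<subseteq> U" shows "pregeometry B (\<lambda>X. cl X \<inter> B)"
  unfolding pregeometry_def
proof (intro conjI allI impI ballI; (elim conjE)?)
  fix X assume X: "X \<subseteq> B"
  show "X \<subseteq> cl X \<inter> B" "cl X \<inter> B \<subseteq> B" using cl_superset[of X] X B by auto
next
  fix X Y :: "'m set" assume "X \<subseteq> Y" then show "cl X \<inter> B \<subseteq> cl Y \<inter> B" using cl_mono[of X Y] by blast
next
  fix X :: "'m set" show "cl (cl X \<inter> B) \<inter> B = cl X \<inter> B" by (rule cl_Int_closed[OF B])
next
  fix X a assume X: "X \<subseteq> B" "a \<in> cl X \<inter> B"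
  then have "a \<in> cl X" by blast
  then obtain F where "finite F" "F \<subseteq> X" "a \<in> cl F" by (rule cl_finite_char)
  then show "\<exists>F\<subseteq>X. finite F \<and> a \<in> cl F \<inter> B" using X by blast
next
  fix X a b assume "X \<subseteq> B" "a \<in> B" "b \<in> B" "a \<in> cl (insert b X) \<inter> B" "a \<notin> cl X \<inter> B"
  then show "b \<in> cl (insert a X) \<inter> B" using cl_exchange[of a b X] B by blast
qed

end

section \<open>Isomorphic copies\<close>

lemma pregeometry_transport:
  assumes P: "pregeometry B k" and h: "bij_betw h B N" and c: "\<And>X. X \<subseteq> N \<Longrightarrow> c X = h ` k {a \<in> B. h a \<in> X}"
  shows "pregeometry N c"
proof -
  let ?G = "\<lambda>X. {a \<in> B. h a \<in> X}"
  have inj: "inj_on h B" and im: "h ` B = N" using h by (auto simp: bij_betw_def)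
  have hG: "h ` ?G X = X" if "X \<subseteq> N" for X using that im by auto
  have Gh: "?G (h ` Y) = Y" if "Y \<subseteq> B" for Y using that inj by (auto dest: inj_onD)
  have GB: "?G X \<subseteq> B" for X by blast
  have k1: "Y \<subseteq> k Y" "k Y \<subseteq> B" if "Y \<subseteq> B" for Y using P that by (simp_all add: pregeometry_def)
  have k2: "k X \<subseteq> k Y" if "X \<subseteq> Y" "Y \<subseteq> B" for X Y using P that by (simp add: pregeometry_def)
  have k3: "k (k Y) = k Y" if "Y \<subseteq> B" for Y using P that by (simp add: pregeometry_def)
  have k4: "\<exists>F\<subseteq>Y. finite F \<and> a \<in> k F" if "Y \<subseteq> B" "a \<in> k Y" for Y a 
    using P[unfolded pregeometry_def, THEN conjunct2, THEN conjunct2, THEN conjunct2, THEN conjunct1] that by simp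
  have k5: "b \<in> k (insert a Y)" if "Y \<subseteq> B" "a \<in> B" "b \<in> B" "a \<in> k (insert b Y)" "a \<notin> k Y" for Y a b 
    using P[unfolded pregeometry_def, THEN conjunct2, THEN conjunct2, THEN conjunct2, THEN conjunct2] that by simp
  have ch: "c (h ` Y) = h ` k Y" if "Y \<subseteq> B" for Y using c[of "h ` Y"] Gh[OF that] im that by auto
  have ex: "\<exists>Y\<subseteq>B. X = h ` Y" if "X \<subseteq> N" for X using hG[OF that] GB[of X] by metis
  show ?thesis unfolding pregeometry_def
  proof (intro conjI allI impI ballI; (elim conjE)?)
    fix X assume "X \<subseteq> N"
    then obtain Y where Y: "Y \<subseteq> B" "X = h ` Y" using ex by blast
    show "X \<subseteq> c X" "c X \<subseteq> N" using Y ch[OF Y(1)] k1[OF Y(1)] im by auto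
  next
    fix X X' assume X: "X \<subseteq> X'" "X' \<subseteq> N"
    then have "?G X \<subseteq> ?G X'" by blast
    from image_mono[OF k2[OF this GB]] show "c X \<subseteq> c X'" using c[OF X(2)] c[of X] X by simp
  next
    fix X assume "X \<subseteq> N"
    then obtain Y where Y: "Y \<subseteq> B" "X = h ` Y" using ex by blast
    then show "c (c X) = c X" using ch[OF Y(1)] ch[OF k1(2)[OF Y(1)]] k3[OF Y(1)] by simp
  next
    fix X a assume "X \<subseteq> N" "a \<in> c X"
    then obtain Y where Y: "Y \<subseteq> B" "X = h ` Y" using ex by blast
    then obtain b where b: "b \<in> k Y" "a = h b" using \<open>a \<in> c X\<close> ch[OF Y(1)] by auto
    obtain F where F: "F \<subseteq> Y" "finite F" "b \<in> k F" using k4[OF Y(1) b(1)] by blast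
    then have "a \<in> c (h ` F)" using ch[of F] b(2) Y(1) by auto
    then show "\<exists>F\<subseteq>X. finite F \<and> a \<in> c F" using F Y(2) by (intro exI[of _ "h ` F"]) auto
  next
    fix X a b assume X: "X \<subseteq> N" "a \<in> N" "b \<in> N" "a \<in> c (insert b X)" "a \<notin> c X"
    then obtain Y where Y: "Y \<subseteq> B" "X = h ` Y" using ex by blast
    obtain a' b' where ab: "a' \<in> B" "a = h a'" "b' \<in> B" "b = h b'" using X im by blast
    have i: "c (insert b X) = h ` k (insert b' Y)" "c (insert a X) = h ` k (insert a' Y)"
      using ch[of "insert b' Y"] ch[of "insert a' Y"] Y ab by auto
    have "insert b' Y \<subseteq> B" using Y ab by blast
    from k1(2)[OF this] have "a' \<in> k (insert b' Y)" using X(4) i(1) ab inj by (auto dest: inj_onD)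
    moreover have "a' \<notin> k Y" using X(5) ch[OF Y(1)] Y(2) ab(2) by auto
    ultimately have "b' \<in> k (insert a' Y)" using k5[OF Y(1) ab(1,3)] by blast
    then show "b \<in> c (insert a X)" using i ab by auto
  qed
qed

lemma isom_comp:
  assumes h: "isom L h M N" and k: "isom L k N N'"
  shows "isom L (k \<circ> h) M N'"
proof -
  have hN: "map h as \<in> lists (universe N)" if "as \<in> lists (universe M)" for as
  proof -
    have "universe N = h ` universe M" using h by (auto simp: isom_def bij_betw_def)
    then show ?thesis using that by auto
  qed
  have "(k \<circ> h) (fint M f as) = fint N' f (map (k \<circ> h) as)" 
    if "f \<in> funs L" "as \<in> lists (universe M)" "length as = farity L f" for f as
  proof -
    have "h (fint M f as) = fint N f (map h as)" using h that unfolding isom_def by blast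
    moreover have "k (fint N f (map h as)) = fint N' f (map k (map h as))" 
      using k that(1,3) hN[OF that(2)] unfolding isom_def by simp
    ultimately show ?thesis by simp
  qed
  moreover have "rint M r as \<longleftrightarrow> rint N' r (map (k \<circ> h) as)" 
    if "r \<in> rels L" "as \<in> lists (universe M)" "length as = rarity L r" for r as
  proof -
    have "rint M r as \<longleftrightarrow> rint N r (map h as)" using h that unfolding isom_def by blast
    moreover have "rint N r (map h as) \<longleftrightarrow> rint N' r (map k (map h as))" 
      using k that(1,3) hN[OF that(2)] unfolding isom_def by simp
    ultimately show ?thesis by simp
  qed
  moreover have "bij_betw (k \<circ> h) (universe M) (universe N')" 
    using h k bij_betw_trans unfolding isom_def by blast
  ultimately show ?thesis unfolding isom_def by blast
qed

lemma isomorphic_copy_trans: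
  assumes "isomorphic_copy L h P P'" "isomorphic_copy L k P' P''"
  shows "isomorphic_copy L (k \<circ> h) P P''"
proof -
  obtain H c H' c' H'' c'' where P: "P = (H, c)" "P' = (H', c')" "P'' = (H'', c'')" by (metis prod.collapse)
  have h: "isom L h H H'" "\<And>X. X \<subseteq> universe H' \<Longrightarrow> c' X = h ` c {a \<in> universe H. h a \<in> X}"
    and k: "isom L k H' H''" "\<And>X. X \<subseteq> universe H'' \<Longrightarrow> c'' X = k ` c' {a \<in> universe H'. k a \<in> X}"
    using assms P by (auto simp: isomorphic_copy_def)
  have im: "h a \<in> universe H'" if "a \<in> universe H" for a using h(1) that by (auto simp: isom_def bij_betw_def)
  have "c'' X = (k \<circ> h) ` c {a \<in> universe H. (k \<circ> h) a \<in> X}" if "X \<subseteq> universe H''" for X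
  proof -
    have "{a \<in> universe H. h a \<in> {b \<in> universe H'. k b \<in> X}} = {a \<in> universe H. (k \<circ> h) a \<in> X}" using im by auto
    then have "c' {b \<in> universe H'. k b \<in> X} = h ` c {a \<in> universe H. (k \<circ> h) a \<in> X}" 
      using h(2)[of "{b \<in> universe H'. k b \<in> X}"] by auto
    then show ?thesis using k(2)[OF that] by (simp add: image_comp)
  qed
  then show ?thesis using isom_comp[OF h(1) k(1)] P by (simp add: isomorphic_copy_def)
qed

lemma isom_struc:
  assumes M: "is_struc L M" and h: "isom L h M N" shows "is_struc L N"
proof -
  have im: "h ` universe M = universe N" using h by (auto simp: isom_def bij_betw_def)
  have "fint N f bs \<in> universe N" if f: "f \<in> funs L" "bs \<in> lists (universe N)" "length bs = farity L f" for f bs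
  proof -
    have "bs \<in> map h ` lists (universe M)" using f(2) im by (metis lists_image)
    then obtain as where as: "as \<in> lists (universe M)" "bs = map h as" by blast
    then have "h (fint M f as) = fint N f bs" using h f unfolding isom_def by simp
    moreover have "fint M f as \<in> universe M" using M as f by (auto simp: is_struc_def)
    ultimately show ?thesis using im by (metis imageI)
  qed
  moreover have "universe N \<noteq> {}" using M im by (auto simp: is_struc_def)
  ultimately show ?thesis by (simp add: is_struc_def)
qed

lemma isom_restr:
  assumes h: "isom L h M N" and B: "B \<subseteq> universe M" shows "isom L h (restr M B) (restr N (h ` B))"
proof -
  have sub: "as \<in> lists (universe M)" if "as \<in> lists B" for as using lists_mono[OF B] that by blast
  have "bij_betw h B (h ` B)" using h B by (auto simp: isom_def intro: bij_betw_subset)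
  moreover have "h (fint M f as) = fint N f (map h as)" 
    if "f \<in> funs L" "as \<in> lists B" "length as = farity L f" for f as
    using h that(1,3) sub[OF that(2)] unfolding isom_def by blast
  moreover have "rint M r as \<longleftrightarrow> rint N r (map h as)" 
    if "r \<in> rels L" "as \<in> lists B" "length as = rarity L r" for r as
    using h that(1,3) sub[OF that(2)] unfolding isom_def by blast
  ultimately show ?thesis by (simp add: isom_def restr_def del: in_lists_conv_set lists_eq_set)
qed

section \<open>Members of the class as copies of submodels of the monster\<close>

context monster_regular
begin

abbreviation "preim B h X \<equiv> {a \<in> B. h a \<in> X}"

text \<open>Membership in the class with its witnesses displayed. The operator is written with
  \<open>cl\<close>, which agrees with \<open>cl_p\<close> on subsets of the monster.\<close>

definition copy_of :: "'m set \<Rightarrow> ('m \<Rightarrow> 'u) \<Rightarrow> ('f, 'r, 'u) struc \<Rightarrow> ('u set \<Rightarrow> 'u set) \<Rightarrow> bool" where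
  "copy_of B h H c \<longleftrightarrow> nice B \<and> isom L h (restr C B) H \<and> (\<forall>X\<subseteq>universe H. c X = h ` (cl (preim B h X) \<inter> B))"

lemma nice_U: "nice B \<Longrightarrow> B \<subseteq> U"
  using elem_U good_elem nice_good by blast

lemma mem_copies_iff:
  fixes H :: "('f, 'r, 'u) struc"
  shows
  "(H, c) \<in> isomorphic_copies L (prime_class L \<kappa> C p) \<longleftrightarrow> (\<exists>B h. copy_of B h H c)"
proof -
  have "isomorphic_copy L h (restr C B, \<lambda>X. cl_p L C p X \<inter> B) (H, c) \<longleftrightarrow> copy_of B h H c" if B: "nice B" for B and h :: "'m \<Rightarrow> 'u"
  proof -
    have "cl_p L C p (preim B h X) = cl (preim B h X)" for X by (rule cl_p_eq) (use nice_U[OF B] in auto)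
    then show ?thesis using B by (simp add: isomorphic_copy_def copy_of_def)
  qed
  moreover have "nice B" if "copy_of B h H c" for B and h :: "'m \<Rightarrow> 'u" using that by (simp add: copy_of_def)
  ultimately show ?thesis unfolding isomorphic_copies_def mem_Collect_eq Bex_def prime_class_iff by blast
qed

context
  fixes B h H c assumes copy: "copy_of B h H c"
begin

lemma copy_nice: "nice B" and copy_isom: "isom L h (restr C B) H"
  and copy_cl: "X \<subseteq> universe H \<Longrightarrow> c X = h ` (cl (preim B h X) \<inter> B)"
  using copy by (simp_all add: copy_of_def)

lemma copy_good: "good B" by (rule nice_good[OF copy_nice])
lemma copy_elem: "elem B" by (rule good_elem[OF copy_good])
lemma copy_U: "B \<subseteq> U" by (rule elem_U[OF copy_elem])

lemma copy_inj: "inj_on h B" and copy_image: "h ` B = universe H"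
  using copy_isom by (auto simp: isom_def bij_betw_def)

lemma copy_struc_restr: "is_struc L (restr C B)"
  using copy_elem unfolding elem_iff_elem_submodel elem_submodel_def substruc_def by blast

lemma copy_struc: "is_struc L H"
  by (rule isom_struc[OF copy_struc_restr copy_isom])

lemma copy_mem_cl: "X \<subseteq> universe H \<Longrightarrow> b \<in> B \<Longrightarrow> h b \<in> c X \<longleftrightarrow> b \<in> cl (preim B h X)"
  using copy_cl copy_inj by (auto dest: inj_onD)

lemma copy_preim_cl: "X \<subseteq> universe H \<Longrightarrow> preim B h (c X) = cl (preim B h X) \<inter> B"
  using copy_mem_cl by auto

lemma copy_cl_subset: "X \<subseteq> universe H \<Longrightarrow> c X \<subseteq> universe H"
  using copy_cl copy_image by auto

lemma copy_pregeometry: "pregeometry (universe H) c"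
  by (rule pregeometry_transport[OF pregeometry_cl_Int[OF copy_U]]) 
     (use copy_inj copy_image copy_cl in \<open>auto simp: bij_betw_def\<close>)

lemma copy_sat_sentence:
  assumes "wf_fm L \<phi>" "fv \<phi> = {}" shows "valid_in H \<phi> \<longleftrightarrow> sat C s \<phi>"
proof -
  obtain b where b: "b \<in> B" using elem_nonempty[OF copy_elem] by blast
  have "sat H t \<phi> \<longleftrightarrow> sat C s \<phi>" for t
  proof -
    have "sat H t \<phi> \<longleftrightarrow> sat H (h \<circ> (\<lambda>_. b)) \<phi>" by (rule sat_cong) (use assms(2) in simp)
    also have "\<dots> \<longleftrightarrow> sat (restr C B) (\<lambda>_. b) \<phi>" 
      using isom_sat[OF copy_struc_restr copy_isom assms(1), of "\<lambda>_. b"] b by simp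
    also have "\<dots> \<longleftrightarrow> sat C (\<lambda>_. b) \<phi>" by (rule sat_restr[OF copy_elem assms(1)]) (rule b)
    also have "\<dots> \<longleftrightarrow> sat C s \<phi>" by (rule sat_cong) (use assms(2) in simp)
    finally show ?thesis .
  qed
  moreover have "\<exists>t :: nat \<Rightarrow> _. \<forall>i. t i \<in> universe H" using b copy_image by (intro exI[of _ "\<lambda>_. h b"]) auto
  ultimately show ?thesis unfolding valid_in_def by blast
qed

lemma copy_countable_cl: 
  assumes "F \<subseteq> universe H" "finite F" shows "countable (c F)"
proof -
  have "finite (preim B h F)" by (rule finite_vimage_IntI[OF assms(2) copy_inj, unfolded vimage_def, simplified Int_def, 
      THEN finite_subset[rotated]]) auto
  then have "countable (cl (preim B h F) \<inter> B)" by (rule good_countable[OF copy_good]) auto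
  then show ?thesis using copy_cl[OF assms(1)] by simp
qed

text \<open>The isomorphism stays the same: the closed set is the image under \<open>h\<close> of
  \<open>cl (preim B h X) \<inter> B\<close>, and there the closures computed in the smaller and in
  the larger submodel agree.\<close>

lemma copy_of_closed:
  assumes X: "X \<subseteq> universe H"
  shows "copy_of (cl (preim B h X) \<inter> B) h (restr H (c X)) c"
proof -
  let ?B = "cl (preim B h X) \<inter> B"
  have cX: "c X = h ` ?B" by (rule copy_cl[OF X])
  have "isom L h (restr (restr C B) ?B) (restr H (h ` ?B))" by (rule isom_restr[OF copy_isom]) auto
  moreover have "restr (restr C B) ?B = restr C ?B" by (simp add: restr_def)
  moreover have "nice ?B" by (rule nice_cl_Int[OF copy_nice]) auto
  moreover have "c Y = h ` (cl (preim ?B h Y) \<inter> ?B)" if Y: "Y \<subseteq> h ` ?B" for Y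
  proof -
    have eq: "preim ?B h Y = preim B h Y" using Y copy_inj by (auto dest: inj_onD)
    then have "preim B h Y \<subseteq> cl (preim B h X)" by blast
    then have "cl (preim B h Y) \<subseteq> cl (preim B h X)" by (rule cl_subset)
    then have "cl (preim B h Y) \<inter> ?B = cl (preim B h Y) \<inter> B" by blast
    moreover have "Y \<subseteq> universe H" using Y copy_image by blast
    then have "c Y = h ` (cl (preim B h Y) \<inter> B)" by (rule copy_cl)
    ultimately show ?thesis unfolding eq by simp
  qed
  ultimately show ?thesis unfolding copy_of_def cX by simp
qed

lemma copy_substruc: 
  assumes X: "X \<subseteq> universe H" shows "substruc L H (c X)"
proof -
  let ?B = "cl (preim B h X) \<inter> B"
  have c: "copy_of ?B h (restr H (c X)) c" by (rule copy_of_closed[OF X])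
  then have "elem ?B" "isom L h (restr C ?B) (restr H (c X))" using nice_good good_elem by (auto simp: copy_of_def)
  then have "is_struc L (restr H (c X))" 
    using isom_struc unfolding elem_iff_elem_submodel elem_submodel_def substruc_def by blast
  then show ?thesis using copy_cl_subset[OF X] by (simp add: substruc_def)
qed

end

text \<open>A partial map between two copies, transported to the monster. All axioms on partial
  embeddings are checked for the transported map, where elementary maps and types are
  available.\<close>

definition pull :: "'m set \<Rightarrow> ('m \<Rightarrow> 'u) \<Rightarrow> 'm set \<Rightarrow> ('m \<Rightarrow> 'v) \<Rightarrow> ('u \<times> 'v) set \<Rightarrow> ('m \<times> 'm) set" where
  "pull B h B' h' f = {(a, a'). a \<in> B \<and> a' \<in> B' \<and> (h a, h' a') \<in> f}"

context
  fixes B :: "'m set" and h :: "'m \<Rightarrow> 'u" and H c and B' :: "'m set" and h' :: "'m \<Rightarrow> 'u" and H' c'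
  assumes copy: "copy_of B h H c" and copy': "copy_of B' h' H' c'"
begin

lemma pull_subset: "pull B h B' h' f \<subseteq> B \<times> B'"
  by (auto simp: pull_def)

lemma Domain_pull: 
  assumes "f \<subseteq> universe H \<times> universe H'" shows "Domain (pull B h B' h' f) = preim B h (Domain f)"
proof (intro equalityI subsetI)
  fix a assume "a \<in> preim B h (Domain f)"
  then obtain y where y: "a \<in> B" "(h a, y) \<in> f" by blast
  then have "y \<in> h' ` B'" using assms copy_image[OF copy'] by blast
  then obtain a' where "a' \<in> B'" "y = h' a'" by blast
  then have "(a, a') \<in> pull B h B' h' f" using y by (simp add: pull_def)
  then show "a \<in> Domain (pull B h B' h' f)" by blast
qed (auto simp: pull_def)

lemma Image_pull: 
  assumes "X \<subseteq> universe H" shows "pull B h B' h' f `` preim B h X = preim B' h' (f `` X)"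
proof (intro equalityI subsetI)
  fix a' assume "a' \<in> preim B' h' (f `` X)"
  then obtain x where x: "a' \<in> B'" "(x, h' a') \<in> f" "x \<in> X" by blast
  then have "x \<in> h ` B" using assms copy_image[OF copy] by blast
  then obtain a where "a \<in> B" "x = h a" by blast
  then have "(a, a') \<in> pull B h B' h' f" "a \<in> preim B h X" using x by (simp_all add: pull_def)
  then show "a' \<in> pull B h B' h' f `` preim B h X" by blast
qed (auto simp: pull_def)

lemma Range_pull: 
  assumes f: "f \<subseteq> universe H \<times> universe H'" shows "Range (pull B h B' h' f) = preim B' h' (Range f)"
proof -
  have "pull B h B' h' f `` preim B h (Domain f) = preim B' h' (f `` Domain f)" by (rule Image_pull) (use f in auto)
  moreover have "f `` Domain f = Range f" by blast
  moreover have "pull B h B' h' f `` preim B h (Domain f) = Range (pull B h B' h' f)"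
    using Domain_pull[OF f] by blast
  ultimately show ?thesis by simp
qed

lemma pull_insert: "b \<in> B \<Longrightarrow> b' \<in> B' \<Longrightarrow> pull B h B' h' (insert (h b, h' b') f) = insert (b, b') (pull B h B' h' f)"
  using copy_inj[OF copy] copy_inj[OF copy'] by (auto simp: pull_def dest: inj_onD)

text \<open>The isomorphisms preserve quantifier-free truth, and between elementary submodels
  embeddings are elementary maps by \<open>partial_embedding_iff\<close>.\<close>

lemma partial_embedding_pull_iff:
  "partial_embedding L H H' f \<longleftrightarrow> f \<subseteq> universe H \<times> universe H' \<and> el (pull B h B' h' f)"
proof
  let ?e = "pull B h B' h' f"
  assume f: "partial_embedding L H H' f"
  have sub: "f \<subseteq> universe H \<times> universe H'" using f by (auto simp: partial_embedding_def partial_map_def)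
  have "preserves (restr C B) (restr C B') ?e \<phi>" if \<phi>: "wf_fm L \<phi>" "qfree \<phi>" for \<phi> unfolding preserves_def
  proof (intro allI impI)
    fix s t assume st: "\<forall>i\<in>fv \<phi>. (s i, t i) \<in> ?e"
    have "sat (restr C B) s \<phi> \<longleftrightarrow> sat H (h \<circ> s) \<phi>"
      by (rule isom_sat[OF copy_struc_restr[OF copy] copy_isom[OF copy] \<phi>(1)]) (use st in \<open>auto simp: pull_def\<close>)
    also have "\<dots> \<longleftrightarrow> sat H' (h' \<circ> t) \<phi>"
      using f \<phi> st unfolding partial_embedding_def preserves_def by (auto simp: pull_def)
    also have "\<dots> \<longleftrightarrow> sat (restr C B') t \<phi>"
      by (rule isom_sat[OF copy_struc_restr[OF copy'] copy_isom[OF copy'] \<phi>(1), symmetric]) (use st in \<open>auto simp: pull_def\<close>)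
    finally show "sat (restr C B) s \<phi> \<longleftrightarrow> sat (restr C B') t \<phi>" .
  qed
  moreover have "single_valued ?e"
    using f copy_inj[OF copy'] unfolding partial_embedding_def partial_map_def single_valued_def pull_def
    by (auto dest: inj_onD)
  ultimately have "partial_embedding L (restr C B) (restr C B') ?e"
    using pull_subset[of f] by (auto simp: partial_embedding_def partial_map_def)
  then show "f \<subseteq> universe H \<times> universe H' \<and> el ?e"
    using sub partial_embedding_iff[OF copy_elem[OF copy] copy_elem[OF copy']] by blast
next
  let ?e = "pull B h B' h' f"
  assume "f \<subseteq> universe H \<times> universe H' \<and> el ?e"
  then have sub: "f \<subseteq> universe H \<times> universe H'" and e: "el ?e" by auto
  have emb: "partial_embedding L (restr C B) (restr C B') ?e"
    using e pull_subset partial_embedding_iff[OF copy_elem[OF copy] copy_elem[OF copy']] by blast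
  let ?i = "inv_into B h" and ?i' = "inv_into B' h'"
  have i: "(?i x, ?i' y) \<in> ?e" "h (?i x) = x" "h' (?i' y) = y" if "(x, y) \<in> f" for x y
  proof -
    have xy: "x \<in> h ` B" "y \<in> h' ` B'" using that sub copy_image[OF copy] copy_image[OF copy'] by auto
    then show "h (?i x) = x" "h' (?i' y) = y" by (auto intro: f_inv_into_f)
    then show "(?i x, ?i' y) \<in> ?e" using that xy by (simp add: pull_def inv_into_into)
  qed
  have "preserves H H' f \<phi>" if \<phi>: "wf_fm L \<phi>" "qfree \<phi>" for \<phi> unfolding preserves_def
  proof (intro allI impI)
    fix s t assume st: "\<forall>i\<in>fv \<phi>. (s i, t i) \<in> f"
    have e': "\<forall>j\<in>fv \<phi>. ((?i \<circ> s) j, (?i' \<circ> t) j) \<in> ?e" using st i by simp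
    have "sat H s \<phi> \<longleftrightarrow> sat H (h \<circ> (?i \<circ> s)) \<phi>" by (rule sat_cong) (use st i in auto)
    also have "\<dots> \<longleftrightarrow> sat (restr C B) (?i \<circ> s) \<phi>"
      by (rule isom_sat[OF copy_struc_restr[OF copy] copy_isom[OF copy] \<phi>(1), symmetric]) (use e' in \<open>auto simp: pull_def\<close>)
    also have "\<dots> \<longleftrightarrow> sat (restr C B') (?i' \<circ> t) \<phi>"
      using emb \<phi> e' unfolding partial_embedding_def preserves_def by blast
    also have "\<dots> \<longleftrightarrow> sat H' (h' \<circ> (?i' \<circ> t)) \<phi>"
      by (rule isom_sat[OF copy_struc_restr[OF copy'] copy_isom[OF copy'] \<phi>(1)]) (use e' in \<open>auto simp: pull_def\<close>)
    also have "\<dots> \<longleftrightarrow> sat H' t \<phi>" by (rule sat_cong) (use st i in auto)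
    finally show "sat H s \<phi> \<longleftrightarrow> sat H' t \<phi>" .
  qed
  moreover have "single_valued f"
  proof (rule single_valuedI)
    fix x y z assume xy: "(x, y) \<in> f" "(x, z) \<in> f"
    have "?i' y = ?i' z" using i(1)[OF xy(1)] i(1)[OF xy(2)] el_single_valued[OF e] by (rule single_valuedD[rotated])
    then show "y = z" using i(3)[OF xy(1)] i(3)[OF xy(2)] by metis
  qed
  ultimately show "partial_embedding L H H' f" using sub by (auto simp: partial_embedding_def partial_map_def)
qed

text \<open>Being outside the closure means being generic over the set, and elementary maps preserve
  genericity in both directions.\<close>

lemma cl_invariant:
  assumes f: "partial_embedding L H H' f" and X: "X \<subseteq> universe H" "Domain f = insert y X" and y: "(y, y') \<in> f"
  shows "y \<in> c X \<longleftrightarrow> y' \<in> c' (f `` X)"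
proof -
  let ?e = "pull B h B' h' f"
  have sub: "f \<subseteq> universe H \<times> universe H'" and e: "el ?e" using f partial_embedding_pull_iff by auto
  obtain b b' where b: "b \<in> B" "y = h b" "b' \<in> B'" "y' = h' b'"
    using y sub copy_image[OF copy] copy_image[OF copy'] by blast
  have "(b, b') \<in> ?e" using b y by (simp add: pull_def)
  moreover have "preim B h X \<subseteq> Domain ?e" using Domain_pull[OF sub] X(2) by auto
  ultimately have "gen (preim B h X) b \<longleftrightarrow> gen (?e `` preim B h X) b'" by (intro gen_el_iff[OF e])
  then have "b \<in> cl (preim B h X) \<longleftrightarrow> b' \<in> cl (preim B' h' (f `` X))"
    using b copy_U[OF copy] copy_U[OF copy'] unfolding Image_pull[OF X(1)] cl_def by auto
  moreover have "f `` X \<subseteq> universe H'" using sub by auto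
  ultimately show ?thesis using copy_mem_cl[OF copy X(1) b(1)] copy_mem_cl[OF copy' _ b(3), of "f `` X"] b by simp
qed

context
  fixes G G' g
  assumes G: "empty_or_countable_closed (H, c) G" "empty_or_countable_closed (H', c') G'"
    and g: "isom_of_subsets L g H G H' G'"
begin

lemma closed_subset: "G \<subseteq> universe H" "G' \<subseteq> universe H'"
  using G by (auto simp: empty_or_countable_closed_def)

lemma Range_graph_on: "Range (graph_on G g) = G'"
  using g by (auto simp: isom_of_subsets_def isom_def bij_betw_def graph_on_def restr_def)

lemma Domain_graph_on: "Domain (graph_on G g) = G"
  by (auto simp: graph_on_def)

lemma graph_on_subset: "graph_on G g \<subseteq> universe H \<times> universe H'"
proof (rule subrelI)
  fix x y assume "(x, y) \<in> graph_on G g"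
  then have "x \<in> Domain (graph_on G g)" "y \<in> Range (graph_on G g)" by blast+
  then show "(x, y) \<in> universe H \<times> universe H'" using closed_subset unfolding Domain_graph_on Range_graph_on by blast
qed

text \<open>Quantifier-free formulas have the same truth value in a substructure, so an isomorphism
  of closed subsets is a partial embedding of the ambient structures. Closedness makes
  \<open>restr H G\<close> a structure, and the empty case is trivial.\<close>

lemma el_pull_graph: "el (pull B h B' h' (graph_on G g))"
proof (cases "G = {}")
  case True
  then show ?thesis using el_empty by (simp add: graph_on_def pull_def)
next
  case False
  then have iso: "isom L g (restr H G) (restr H' G')" using g by (auto simp: isom_of_subsets_def)
  have "substruc L H (c G)" by (rule copy_substruc[OF copy closed_subset(1)])
  moreover have "c G = G" using G(1) False by (auto simp: empty_or_countable_closed_def)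
  ultimately have st: "is_struc L (restr H G)" by (simp add: substruc_def)
  have "preserves H H' (graph_on G g) \<phi>" if \<phi>: "wf_fm L \<phi>" "qfree \<phi>" for \<phi> unfolding preserves_def
  proof (intro allI impI)
    fix s t assume *: "\<forall>i\<in>fv \<phi>. (s i, t i) \<in> graph_on G g"
    have "sat H s \<phi> \<longleftrightarrow> sat (restr H G) s \<phi>" using sat_restr_qfree[OF \<phi>(2)] by blast
    also have "\<dots> \<longleftrightarrow> sat (restr H' G') (g \<circ> s) \<phi>"
      by (rule isom_sat[OF st iso \<phi>(1)]) (use * in \<open>auto simp: graph_on_def\<close>)
    also have "\<dots> \<longleftrightarrow> sat H' (g \<circ> s) \<phi>" using sat_restr_qfree[OF \<phi>(2)] by blast
    also have "\<dots> \<longleftrightarrow> sat H' t \<phi>" by (rule sat_cong) (use * in \<open>auto simp: graph_on_def\<close>)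
    finally show "sat H s \<phi> \<longleftrightarrow> sat H' t \<phi>" .
  qed
  moreover have "single_valued (graph_on G g)" by (auto simp: single_valued_def graph_on_def)
  ultimately have "partial_embedding L H H' (graph_on G g)"
    using closed_subset Domain_graph_on Range_graph_on by (simp add: partial_embedding_def partial_map_def)
  then show ?thesis using partial_embedding_pull_iff by blast
qed

text \<open>The two new points are generic over the corresponding preimages of \<open>G\<close> and
  \<open>G'\<close>, and generic extensions of an elementary map are elementary.\<close>

lemma extend_generic:
  assumes x: "x \<in> universe H - c G" "x' \<in> universe H' - c' G'"
  shows "partial_embedding L H H' (graph_on G g \<union> {(x, x')})"
proof -
  obtain b b' where b: "b \<in> B" "x = h b" "b' \<in> B'" "x' = h' b'"
    using x copy_image[OF copy] copy_image[OF copy'] by blast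
  have "b \<notin> cl (preim B h G)" "b' \<notin> cl (preim B' h' G')"
    using x b copy_mem_cl[OF copy closed_subset(1) b(1)] copy_mem_cl[OF copy' closed_subset(2) b(3)] by auto
  then have gg: "gen (preim B h G) b" "gen (preim B' h' G') b'"
    using b copy_U[OF copy] copy_U[OF copy'] by (auto simp: cl_def)
  have "el (insert (b, b') (pull B h B' h' (graph_on G g)))"
    by (rule el_insert_gen[OF el_pull_graph]) 
       (use gg in \<open>simp_all add: Domain_pull[OF graph_on_subset] Range_pull[OF graph_on_subset] Domain_graph_on Range_graph_on\<close>)
  then have "el (pull B h B' h' (insert (x, x') (graph_on G g)))" using pull_insert b by simp
  moreover have "insert (x, x') (graph_on G g) \<subseteq> universe H \<times> universe H'" using graph_on_subset x by blast
  ultimately show ?thesis using partial_embedding_pull_iff by simp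
qed

text \<open>By \<open>iso_over_closed\<close> the type of the preimage of \<open>y\<close> over the
  domain of the pulled-back map is isolated, so its image is realised in the elementary submodel
  \<open>B'\<close>.\<close>

lemma extend_closed:
  assumes f: "partial_embedding L H H' (graph_on G g \<union> f)" "finite (Domain f)" and y: "y \<in> c (Domain f \<union> G)"
  shows "\<exists>y'\<in>universe H'. partial_embedding L H H' (graph_on G g \<union> f \<union> {(y, y')})"
proof -
  let ?f = "graph_on G g \<union> f" and ?X = "preim B h (Domain f)" and ?G = "preim B h G"
  let ?e = "pull B h B' h' ?f"
  have sub: "?f \<subseteq> universe H \<times> universe H'" and e: "el ?e" using f(1) partial_embedding_pull_iff by auto
  have fX: "Domain f \<union> G \<subseteq> universe H" using sub closed_subset by auto
  have "y \<in> universe H" using copy_cl_subset[OF copy fX] y by blast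
  then obtain b where b: "b \<in> B" "y = h b" using copy_image[OF copy] by blast
  have pu: "preim B h (Domain f \<union> G) = ?X \<union> ?G" by auto
  have "b \<in> cl (?X \<union> ?G) \<inter> B" using y b copy_mem_cl[OF copy fX b(1)] pu by simp
  moreover have "finite ?X"
    by (rule inj_on_finite[of h _ "Domain f"]) (use f(2) inj_on_subset[OF copy_inj[OF copy]] in auto)
  moreover have "?G = {} \<or> cl ?G \<inter> B = ?G"
  proof (cases "G = {}")
    case False
    then have "c G = G" using G(1) by (auto simp: empty_or_countable_closed_def)
    then show ?thesis using copy_preim_cl[OF copy closed_subset(1)] by simp
  qed simp
  ultimately have "iso (?G \<union> ?X) [b]" by (intro iso_over_closed[OF copy_good[OF copy]]) auto
  moreover have "Domain ?e = ?G \<union> ?X" using Domain_pull[OF sub] Domain_graph_on by (auto simp: Domain_Un_eq)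
  ultimately obtain b' where b': "b' \<in> B'" "el (insert (b, b') ?e)"
    using el_extend_iso[OF e _ copy_elem[OF copy'], of b] pull_subset[of ?f] by auto
  then have "el (pull B h B' h' (insert (y, h' b') ?f))" using pull_insert b by simp
  moreover have y': "h' b' \<in> universe H'" using b' copy_image[OF copy'] by blast
  moreover have "insert (y, h' b') ?f \<subseteq> universe H \<times> universe H'" using sub \<open>y \<in> universe H\<close> y' by blast
  ultimately have "partial_embedding L H H' (insert (y, h' b') ?f)" using partial_embedding_pull_iff by blast
  then show ?thesis using y' by auto
qed

end

end

section \<open>Verification of the axioms\<close>

lemma quasiminimal_excellent_copies:
  "quasiminimal_excellent L (isomorphic_copies L (prime_class L \<kappa> C p) :: ('f, 'r, 'u) cl_struc set)"
proof -
  let ?K = "isomorphic_copies L (prime_class L \<kappa> C p) :: ('f, 'r, 'u) cl_struc set"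
  have K: "\<exists>B h. copy_of B h H c" if "(H, c) \<in> ?K" for H c using that mem_copies_iff by blast
  have all: "(\<And>H c. (H, c) \<in> ?K \<Longrightarrow> Q H c) \<Longrightarrow> \<forall>(H, c)\<in>?K. Q H c" for Q by auto
  show ?thesis unfolding quasiminimal_excellent_def
  proof (intro conjI)
    show "\<forall>P\<in>?K. \<forall>P' h. isomorphic_copy L h P P' \<longrightarrow> P' \<in> ?K"
    proof (intro ballI allI impI)
      fix P P' :: "('f, 'r, 'u) cl_struc" and h assume "P \<in> ?K" "isomorphic_copy L h P P'"
      then obtain P0 k where "P0 \<in> prime_class L \<kappa> C p" "isomorphic_copy L k P0 P" unfolding isomorphic_copies_def by blast
      then show "P' \<in> ?K" using isomorphic_copy_trans[OF _ \<open>isomorphic_copy L h P P'\<close>] 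
        unfolding isomorphic_copies_def by blast
    qed
  next
    show "\<forall>(H, c)\<in>?K. is_struc L H \<and> pregeometry (universe H) c"
    proof (rule all)
      fix H c assume "(H, c) \<in> ?K"
      then obtain B h where "copy_of B h H c" using K by blast
      then show "is_struc L H \<and> pregeometry (universe H) c" using copy_struc copy_pregeometry by blast
    qed
  next
    show "\<forall>(H, c)\<in>?K. \<forall>F\<subseteq>universe H. finite F \<longrightarrow> countable (c F)"
    proof (rule all, intro allI impI)
      fix H c F assume "(H, c) \<in> ?K" "F \<subseteq> universe H" "finite F"
      then obtain B h where "copy_of B h H c" using K by blast
      then show "countable (c F)" by (rule copy_countable_cl) fact+
    qed
  next
    show "\<forall>(H, c)\<in>?K. \<forall>X\<subseteq>universe H. substruc L H (c X) \<and> (restr H (c X), c) \<in> ?K"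
    proof (rule all, intro allI impI)
      fix H c X assume "(H, c) \<in> ?K" and X: "X \<subseteq> universe H"
      then obtain B h where B: "copy_of B h H c" using K by blast
      show "substruc L H (c X) \<and> (restr H (c X), c) \<in> ?K"
        using copy_substruc[OF B X] copy_of_closed[OF B X] mem_copies_iff by blast
    qed
  next
    show "\<forall>(H, c)\<in>?K. \<forall>(H', c')\<in>?K. \<forall>\<phi>. wf_fm L \<phi> \<and> qfree \<phi> \<and> fv \<phi> = {} \<longrightarrow> (valid_in H \<phi> \<longleftrightarrow> valid_in H' \<phi>)"
    proof (rule all, rule all, intro allI impI, elim conjE)
      fix H c H' c' \<phi> assume "(H, c) \<in> ?K" "(H', c') \<in> ?K" and \<phi>: "wf_fm L \<phi>" "fv \<phi> = {}"
      then obtain B h B' h' where B: "copy_of B h H c" "copy_of B' h' H' c'" using K by metis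
      show "valid_in H \<phi> \<longleftrightarrow> valid_in H' \<phi>" 
        unfolding copy_sat_sentence[OF B(1) \<phi>, of undefined] copy_sat_sentence[OF B(2) \<phi>, of undefined] ..
    qed
  next
    show "\<forall>(H, c)\<in>?K. \<forall>(H', c')\<in>?K. \<forall>X y y' f.
        X \<subseteq> universe H \<and> y \<in> universe H \<and> partial_embedding L H H' f \<and>
        Domain f = insert y X \<and> (y, y') \<in> f \<longrightarrow> (y \<in> c X \<longleftrightarrow> y' \<in> c' (f `` X))"
    proof (rule all, rule all, intro allI impI, elim conjE)
      fix H c H' c' X y y' f assume "(H, c) \<in> ?K" "(H', c') \<in> ?K" and 
        *: "X \<subseteq> universe H" "partial_embedding L H H' f" "Domain f = insert y X" "(y, y') \<in> f"
      then obtain B h B' h' where B: "copy_of B h H c" "copy_of B' h' H' c'" using K by metis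
      show "y \<in> c X \<longleftrightarrow> y' \<in> c' (f `` X)" by (rule cl_invariant[OF B *(2,1,3,4)])
    qed
  next
    show "\<forall>(H, c)\<in>?K. \<forall>(H', c')\<in>?K. \<forall>G G' g x x'.
        empty_or_countable_closed (H, c) G \<and> empty_or_countable_closed (H', c') G' \<and>
        isom_of_subsets L g H G H' G' \<and> x \<in> universe H - c G \<and> x' \<in> universe H' - c' G' \<longrightarrow>
        partial_embedding L H H' (graph_on G g \<union> {(x, x')})"
    proof (rule all, rule all, intro allI impI, elim conjE)
      fix H c H' c' G G' g x x' assume "(H, c) \<in> ?K" "(H', c') \<in> ?K" and 
        *: "empty_or_countable_closed (H, c) G" "empty_or_countable_closed (H', c') G'"
        "isom_of_subsets L g H G H' G'" "x \<in> universe H - c G" "x' \<in> universe H' - c' G'"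
      then obtain B h B' h' where B: "copy_of B h H c" "copy_of B' h' H' c'" using K by metis
      show "partial_embedding L H H' (graph_on G g \<union> {(x, x')})" by (rule extend_generic[OF B *])
    qed
  next
    show "\<forall>(H, c)\<in>?K. \<forall>(H', c')\<in>?K. \<forall>G G' g f y.
        empty_or_countable_closed (H, c) G \<and> empty_or_countable_closed (H', c') G' \<and>
        isom_of_subsets L g H G H' G' \<and>
        partial_embedding L H H' (graph_on G g \<union> f) \<and> finite (Domain f) \<and> y \<in> c (Domain f \<union> G) \<longrightarrow>
        (\<exists>y'\<in>universe H'. partial_embedding L H H' (graph_on G g \<union> f \<union> {(y, y')}))"
    proof (rule all, rule all, intro allI impI, elim conjE)
      fix H c H' c' G G' g f y assume "(H, c) \<in> ?K" "(H', c') \<in> ?K" and 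
        *: "empty_or_countable_closed (H, c) G" "empty_or_countable_closed (H', c') G'"
        "isom_of_subsets L g H G H' G'" "partial_embedding L H H' (graph_on G g \<union> f)" "finite (Domain f)"
        "y \<in> c (Domain f \<union> G)"
      then obtain B h B' h' where B: "copy_of B h H c" "copy_of B' h' H' c'" using K by metis
      show "\<exists>y'\<in>universe H'. partial_embedding L H H' (graph_on G g \<union> f \<union> {(y, y')})" by (rule extend_closed[OF B *])
    qed
  qed
qed

end

theorem theorem6p7:
  fixes L :: "('f, 'r) lang"
    and T :: "('f, 'r) fm set"
    and \<kappa> :: "'k rel"
    and C :: "('f, 'r, 'm) struc"
    and p :: "('f + 'm, 'r) fm set"
  assumes "countable (funs L)" and "countable (rels L)"
    and "complete_theory TYPE('m) L T"
    and "quantifier_elimination TYPE('m) L T"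
    and "omega_stable TYPE('m) L T"
    and "monster L T \<kappa> C"
    and "strongly_regular L \<kappa> C p"
    and "\<And>A. A \<subseteq> universe C \<Longrightarrow> finite A \<Longrightarrow> \<not> isolated C (type_restr L p A)"
  shows "quasiminimal_excellent L
           (isomorphic_copies L (prime_class L \<kappa> C p) :: ('f, 'r, 'u) cl_struc set)"
proof -
  interpret monster_regular L T \<kappa> C p
    by unfold_locales (use assms in auto)
  show ?thesis by (rule quasiminimal_excellent_copies)
qed

end
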